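(* Let $\mathcal{T}$ be a Hom-finite triangulated category over a field $k$ which admits a Serre functor $\mathbb{S}$, and let $\mathcal{X}$ be a contravariantly finite subcategory of $\mathcal{T}$. If $\mathrm{gl.dim}\,\mathrm{mod}\text{-}\mathcal{X}<\infty$, then the following are equivalent: (i) $\mathcal{X}$ is a $2$-cluster tilting subcategory of $\mathcal{T}$. (ii) $\mathcal{X}$ is fully rigid, $\mathbb{S}(\mathcal{X})=\mathcal{X}[2]$, and the map $\Phi:\mathcal{Y}\mapsto\mathsf{H}(\mathcal{Y})$ gives a bijective correspondence between: (I) $2$-cluster tilting subcategories $\mathcal{Y}$ of $\mathcal{T}$ contained in $\mathcal{T}_{\mathcal{X}^{\bot}}$; (II) tilting subcategories $\mathcal{U}$ of $\mathrm{mod}\text{-}\mathcal{X}$ such that (a) $\mathsf{H}^{-1}(\mathcal{U})$ is contravariantly finite in $\mathcal{T}$, and (b) $\mathbb{S}\,\mathsf{H}^{-1}(\mathcal{U})=\mathsf{H}^{-1}(\mathcal{U})[2]$. When (i) and (ii) hold and $\mathcal{Y}$ as in (I) corresponds under $\Phi$ to $\mathcal{U}=\mathsf{H}(\mathcal{Y})$ as in (II), we have $\mathcal{U}\simeq\mathcal{Y}/\mathsf{Gh}_{\mathcal{X}}(\mathcal{Y})$. Moreover if $\mathcal{Y}=\mathrm{add}\,T$, so $\mathcal{U}=\mathrm{add}\,\mathsf{H}(T)$, then there is an algebra isomorphism $$\mathrm{End}_{\mathcal{T}}(T)/\mathsf{Gh}_{\mathcal{X}}(T)\cong\mathrm{End}_{\mathrm{mod}\text{-}\mathcal{X}}(\mathsf{H}(T)),$$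 where $\mathsf{Gh}_{\mathcal{X}}(T)$ is the ideal of $\mathrm{End}_{\mathcal{T}}(T)$ consisting of all maps $T\to T$ factorizing through an object from $\mathcal{X}[1]$.
   Context: $\mathcal{T}$ is $k$-linear with split idempotents and shift $[1]$; subcategories are full, additive, closed under isomorphisms and direct summands. $\mathcal{X}$ is contravariantly finite if every $A\in\mathcal{T}$ admits a map $X_A\to A$, $X_A\in\mathcal{X}$, with $\mathcal{T}(\mathcal{X},X_A)\to\mathcal{T}(\mathcal{X},A)$ surjective (same definition in any additive category); covariantly finite is dual; functorially finite means both. $\mathcal{X}$ is rigid if $\mathcal{T}(\mathcal{X},\mathcal{X}[1])=0$. $\mathcal{X}^{\bot}=\{A\mid\mathcal{T}(\mathcal{X},A)=0\}$. $\mathrm{mod}\text{-}\mathcal{X}$ is the (abelian) category of coherent functors $F:\mathcal{X}^{\mathrm{op}}\to\mathrm{Ab}$, i.e. those with an exact sequence $\mathcal{X}(-,X^1)\to\mathcal{X}(-,X^0)\to F\to0$, $X^i\in\mathcal{X}$. $\mathsf{H}:\mathcal{T}\to\mathrm{mod}\text{-}\mathcal{X}$, $\mathsf{H}(A)=\mathcal{T}(-,A)|_{\mathcal{X}}$. A contravariantly finite rigid $\mathcal{X}$ is fully rigid if $\mathsf{H}$ is full. $\mathcal{M}\subseteq\mathcal{T}$ is $2$-cluster tilting if it is functorially finite and $\{A\mid\mathcal{T}(\mathcal{M},A[1])=0\}=\mathcal{M}=\{A\mid\mathcal{T}(A,\mathcal{M}[1])=0\}$. $\mathcal{T}_{\mathcal{X}^{\bot}}$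 is the full subcategory of objects with no non-zero direct summand in $\mathcal{X}^{\bot}$. For $\mathcal{U}\subseteq\mathrm{mod}\text{-}\mathcal{X}$, $\mathsf{H}^{-1}(\mathcal{U})=\{Y\in\mathcal{T}_{\mathcal{X}^{\bot}}\mid\mathsf{H}(Y)\in\mathcal{U}\}$. A contravariantly finite subcategory $\mathcal{U}$ of an abelian category $\mathcal{A}$ is tilting if $\mathrm{Fac}(\mathcal{U})=\{A\in\mathcal{A}\mid\mathrm{Ext}^1(\mathcal{U},A)=0\}$, where $\mathrm{Fac}(\mathcal{U})$ is the full subcategory of quotients of objects of $\mathcal{U}$. A map $f$ in $\mathcal{T}$ is $\mathcal{X}$-ghost if $\mathcal{T}(\mathcal{X},f)=0$; $\mathcal{Y}/\mathsf{Gh}_{\mathcal{X}}(\mathcal{Y})$ is the quotient of $\mathcal{Y}$ by the ideal of $\mathcal{X}$-ghost maps between objects of $\mathcal{Y}$. $\mathrm{add}\,T$ consists of the direct summands of finite direct sums of copies of $T$. Hom-finite: all $\mathcal{T}(A,B)$ are finite-dimensional. A Serre functor is a triangulated equivalence $\mathbb{S}:\mathcal{T}\to\mathcal{T}$ with natural bifunctorial isomorphisms $\mathrm{Hom}_k(\mathcal{T}(A,B),k)\cong\mathcal{T}(B,\mathbb{S}(A))$. *)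

theory Defs
  imports "HOL-Library.Extended_Nat" "HOL-Algebra.QuotRing" "HOL-Algebra.Module"
begin

section \<open>Linear algebra over a field\<close>

definition linear_maps ::
  "('k, 'r) ring_scheme \<Rightarrow> ('k, 'a, 'v) module_scheme \<Rightarrow> ('k, 'b, 'w) module_scheme \<Rightarrow> ('a \<Rightarrow> 'b) set"
  where "linear_maps K V W =
    {f \<in> carrier V \<rightarrow> carrier W.
       (\<forall>x\<in>carrier V. \<forall>y\<in>carrier V. f (x \<oplus>\<^bsub>V\<^esub> y) = f x \<oplus>\<^bsub>W\<^esub> f y) \<and>
       (\<forall>c\<in>carrier K. \<forall>x\<in>carrier V. f (c \<odot>\<^bsub>V\<^esub> x) = c \<odot>\<^bsub>W\<^esub> f x)}"

definition linear_isos ::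
  "('k, 'r) ring_scheme \<Rightarrow> ('k, 'a, 'v) module_scheme \<Rightarrow> ('k, 'b, 'w) module_scheme \<Rightarrow> ('a \<Rightarrow> 'b) set"
  where "linear_isos K V W = {f \<in> linear_maps K V W. bij_betw f (carrier V) (carrier W)}"

definition finite_dimensional ::
  "('k, 'r) ring_scheme \<Rightarrow> ('k, 'a, 'v) module_scheme \<Rightarrow> bool"
  where "finite_dimensional K V \<longleftrightarrow>
    (\<exists>B. finite B \<and> B \<subseteq> carrier V \<and>
      (\<forall>v\<in>carrier V. \<exists>a\<in>B \<rightarrow> carrier K. v = (\<Oplus>\<^bsub>V\<^esub>b\<in>B. a b \<odot>\<^bsub>V\<^esub> b)))"

text \<open>The elements of the dual space are extensional functions, so that equality of functionals is
  equality on the carrier. A \<^typ>\<open>('k, 'v) module\<close> also has the fields \<^const>\<open>mult\<close> and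
  \<^const>\<open>one\<close>; for a module they carry no information.\<close>

definition dual_module ::
  "('k, 'r) ring_scheme \<Rightarrow> ('k, 'a, 'v) module_scheme \<Rightarrow> ('k, 'a \<Rightarrow> 'k) module"
  where "dual_module K V =
    \<lparr>carrier = {\<phi> \<in> carrier V \<rightarrow>\<^sub>E carrier K.
        (\<forall>x\<in>carrier V. \<forall>y\<in>carrier V. \<phi> (x \<oplus>\<^bsub>V\<^esub> y) = \<phi> x \<oplus>\<^bsub>K\<^esub> \<phi> y) \<and>
        (\<forall>c\<in>carrier K. \<forall>x\<in>carrier V. \<phi> (c \<odot>\<^bsub>V\<^esub> x) = c \<otimes>\<^bsub>K\<^esub> \<phi> x)},
     mult = undefined,
     one = undefined,
     zero = (\<lambda>x\<in>carrier V. \<zero>\<^bsub>K\<^esub>),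
     add = (\<lambda>\<phi> \<psi>. \<lambda>x\<in>carrier V. \<phi> x \<oplus>\<^bsub>K\<^esub> \<psi> x),
     smult = (\<lambda>c \<phi>. \<lambda>x\<in>carrier V. c \<otimes>\<^bsub>K\<^esub> \<phi> x)\<rparr>"

text \<open>An associative \<open>K\<close>-algebra is also a \<^typ>\<open>('k, 'a) module\<close> record, the multiplication now being
  meaningful; the quotient by an ideal inherits the scalar action. For a mere submodule \<open>I\<close> the same
  formula gives the quotient module.\<close>

definition quotient_algebra :: "('k, 'a, 'v) module_scheme \<Rightarrow> 'a set \<Rightarrow> ('k, 'a set) module"
  where "quotient_algebra A I =
    ring.extend (A Quot I) (module.fields (\<lambda>c W. \<Union>x\<in>W. I +>\<^bsub>A\<^esub> (c \<odot>\<^bsub>A\<^esub> x)))"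

definition algebra_isos ::
  "('k, 'r) ring_scheme \<Rightarrow> ('k, 'a, 'v) module_scheme \<Rightarrow> ('k, 'b, 'w) module_scheme \<Rightarrow> ('a \<Rightarrow> 'b) set"
  where "algebra_isos K A B = ring_iso A B \<inter> linear_maps K A B"

section \<open>Linear categories\<close>

text \<open>\<open>Hom C A B\<close> is a \<open>k\<close>-module whose carrier is the set of arrows \<open>A \<rightarrow> B\<close>. Arrows know their source
  and target, so hom-sets are disjoint. All fields are relevant only on objects and composable
  arrows of \<open>C\<close>.\<close>

record ('k, 'o, 'm) lcat =
  Obj :: "'o set"
  Src :: "'m \<Rightarrow> 'o"
  Tgt :: "'m \<Rightarrow> 'o"
  Hom :: "'o \<Rightarrow> 'o \<Rightarrow> ('k, 'm) module"
  Idt :: "'o \<Rightarrow> 'm"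
  Cmp :: "'m \<Rightarrow> 'm \<Rightarrow> 'm" (infixr \<open>\<cdot>\<index>\<close> 75)

abbreviation Arr :: "('k, 'o, 'm, 'z) lcat_scheme \<Rightarrow> 'o \<Rightarrow> 'o \<Rightarrow> 'm set"
  where "Arr C A B \<equiv> carrier (Hom C A B)"

locale linear_category =
  field K for K :: "('k, 'r) ring_scheme" +
  fixes C :: "('k, 'o, 'm, 'z) lcat_scheme"
  assumes Hom_module: "\<lbrakk>A \<in> Obj C; B \<in> Obj C\<rbrakk> \<Longrightarrow> Module.module K (Hom C A B)"
    and Src_Tgt: "\<lbrakk>A \<in> Obj C; B \<in> Obj C; f \<in> Arr C A B\<rbrakk> \<Longrightarrow> Src C f = A \<and> Tgt C f = B"
    and Idt_closed: "A \<in> Obj C \<Longrightarrow> Idt C A \<in> Arr C A A"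
    and Cmp_closed: "\<lbrakk>A \<in> Obj C; B \<in> Obj C; D \<in> Obj C; f \<in> Arr C A B; g \<in> Arr C B D\<rbrakk>
      \<Longrightarrow> g \<cdot>\<^bsub>C\<^esub> f \<in> Arr C A D"
    and Cmp_Idt: "\<lbrakk>A \<in> Obj C; B \<in> Obj C; f \<in> Arr C A B\<rbrakk> \<Longrightarrow> f \<cdot>\<^bsub>C\<^esub> Idt C A = f"
    and Idt_Cmp: "\<lbrakk>A \<in> Obj C; B \<in> Obj C; f \<in> Arr C A B\<rbrakk> \<Longrightarrow> Idt C B \<cdot>\<^bsub>C\<^esub> f = f"
    and Cmp_assoc: "\<lbrakk>A \<in> Obj C; B \<in> Obj C; D \<in> Obj C; E \<in> Obj C;
        f \<in> Arr C A B; g \<in> Arr C B D; h \<in> Arr C D E\<rbrakk>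
      \<Longrightarrow> (h \<cdot>\<^bsub>C\<^esub> g) \<cdot>\<^bsub>C\<^esub> f = h \<cdot>\<^bsub>C\<^esub> (g \<cdot>\<^bsub>C\<^esub> f)"
    and Cmp_linear_right: "\<lbrakk>A \<in> Obj C; B \<in> Obj C; D \<in> Obj C; g \<in> Arr C B D\<rbrakk>
      \<Longrightarrow> (\<lambda>f. g \<cdot>\<^bsub>C\<^esub> f) \<in> linear_maps K (Hom C A B) (Hom C A D)"
    and Cmp_linear_left: "\<lbrakk>A \<in> Obj C; B \<in> Obj C; D \<in> Obj C; f \<in> Arr C A B\<rbrakk>
      \<Longrightarrow> (\<lambda>g. g \<cdot>\<^bsub>C\<^esub> f) \<in> linear_maps K (Hom C B D) (Hom C A D)"

definition is_iso :: "('k, 'o, 'm, 'z) lcat_scheme \<Rightarrow> 'o \<Rightarrow> 'o \<Rightarrow> 'm \<Rightarrow> bool"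
  where "is_iso C A B f \<longleftrightarrow> f \<in> Arr C A B \<and>
    (\<exists>g\<in>Arr C B A. g \<cdot>\<^bsub>C\<^esub> f = Idt C A \<and> f \<cdot>\<^bsub>C\<^esub> g = Idt C B)"

definition isomorphic :: "('k, 'o, 'm, 'z) lcat_scheme \<Rightarrow> 'o \<Rightarrow> 'o \<Rightarrow> bool"
  where "isomorphic C A B \<longleftrightarrow> (\<exists>f. is_iso C A B f)"

definition is_zero_obj :: "('k, 'o, 'm, 'z) lcat_scheme \<Rightarrow> 'o \<Rightarrow> bool"
  where "is_zero_obj C Z \<longleftrightarrow> Z \<in> Obj C \<and>
    (\<forall>A\<in>Obj C. Arr C A Z = {\<zero>\<^bsub>Hom C A Z\<^esub>} \<and> Arr C Z A = {\<zero>\<^bsub>Hom C Z A\<^esub>})"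

definition is_direct_sum :: "('k, 'o, 'm, 'z) lcat_scheme \<Rightarrow> 'o \<Rightarrow> 'o \<Rightarrow> 'o \<Rightarrow> bool"
  where "is_direct_sum C A B S \<longleftrightarrow> A \<in> Obj C \<and> B \<in> Obj C \<and> S \<in> Obj C \<and>
    (\<exists>i\<in>Arr C A S. \<exists>j\<in>Arr C B S. \<exists>p\<in>Arr C S A. \<exists>q\<in>Arr C S B.
       p \<cdot>\<^bsub>C\<^esub> i = Idt C A \<and> q \<cdot>\<^bsub>C\<^esub> j = Idt C B \<and>
       p \<cdot>\<^bsub>C\<^esub> j = \<zero>\<^bsub>Hom C B A\<^esub> \<and> q \<cdot>\<^bsub>C\<^esub> i = \<zero>\<^bsub>Hom C A B\<^esub> \<and>
       (i \<cdot>\<^bsub>C\<^esub> p) \<oplus>\<^bsub>Hom C S S\<^esub> (j \<cdot>\<^bsub>C\<^esub> q) = Idt C S)"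

definition direct_summand :: "('k, 'o, 'm, 'z) lcat_scheme \<Rightarrow> 'o \<Rightarrow> 'o \<Rightarrow> bool"
  where "direct_summand C A S \<longleftrightarrow> (\<exists>B. is_direct_sum C A B S)"

locale additive_category = linear_category K C
  for K :: "('k, 'r) ring_scheme" and C :: "('k, 'o, 'm, 'z) lcat_scheme" +
  assumes zero_obj_exists: "\<exists>Z. is_zero_obj C Z"
    and direct_sum_exists: "\<lbrakk>A \<in> Obj C; B \<in> Obj C\<rbrakk> \<Longrightarrow> \<exists>S. is_direct_sum C A B S"

definition split_idempotents :: "('k, 'o, 'm, 'z) lcat_scheme \<Rightarrow> bool"
  where "split_idempotents C \<longleftrightarrow>
    (\<forall>A\<in>Obj C. \<forall>e\<in>Arr C A A. e \<cdot>\<^bsub>C\<^esub> e = e \<longrightarrow>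
      (\<exists>B\<in>Obj C. \<exists>p\<in>Arr C A B. \<exists>i\<in>Arr C B A. i \<cdot>\<^bsub>C\<^esub> p = e \<and> p \<cdot>\<^bsub>C\<^esub> i = Idt C B))"

definition hom_finite :: "('k, 'r) ring_scheme \<Rightarrow> ('k, 'o, 'm, 'z) lcat_scheme \<Rightarrow> bool"
  where "hom_finite K C \<longleftrightarrow> (\<forall>A\<in>Obj C. \<forall>B\<in>Obj C. finite_dimensional K (Hom C A B))"

definition End_algebra :: "('k, 'o, 'm, 'z) lcat_scheme \<Rightarrow> 'o \<Rightarrow> ('k, 'm) module"
  where "End_algebra C A = (Hom C A A)\<lparr>mult := Cmp C, one := Idt C A\<rparr>"

section \<open>Subcategories\<close>

text \<open>Full subcategories are given by their sets of objects.\<close>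

definition full_subcategory ::
  "('k, 'o, 'm, 'z) lcat_scheme \<Rightarrow> 'o set \<Rightarrow> ('k, 'o, 'm, 'z) lcat_scheme"
  where "full_subcategory C U = C\<lparr>Obj := U\<rparr>"

definition subcategory :: "('k, 'o, 'm, 'z) lcat_scheme \<Rightarrow> 'o set \<Rightarrow> bool"
  where "subcategory C U \<longleftrightarrow> U \<subseteq> Obj C \<and>
    (\<forall>Z. is_zero_obj C Z \<longrightarrow> Z \<in> U) \<and>
    (\<forall>A\<in>U. \<forall>B\<in>U. \<forall>S. is_direct_sum C A B S \<longrightarrow> S \<in> U) \<and>
    (\<forall>A\<in>U. \<forall>B\<in>Obj C. isomorphic C A B \<longrightarrow> B \<in> U) \<and>
    (\<forall>A\<in>U. \<forall>B. direct_summand C B A \<longrightarrow> B \<in> U)"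

definition contravariantly_finite :: "('k, 'o, 'm, 'z) lcat_scheme \<Rightarrow> 'o set \<Rightarrow> bool"
  where "contravariantly_finite C X \<longleftrightarrow>
    (\<forall>A\<in>Obj C. \<exists>XA\<in>X. \<exists>f\<in>Arr C XA A.
      \<forall>X'\<in>X. (\<lambda>h. f \<cdot>\<^bsub>C\<^esub> h) ` Arr C X' XA = Arr C X' A)"

definition covariantly_finite :: "('k, 'o, 'm, 'z) lcat_scheme \<Rightarrow> 'o set \<Rightarrow> bool"
  where "covariantly_finite C X \<longleftrightarrow>
    (\<forall>A\<in>Obj C. \<exists>XA\<in>X. \<exists>f\<in>Arr C A XA.
      \<forall>X'\<in>X. (\<lambda>h. h \<cdot>\<^bsub>C\<^esub> f) ` Arr C XA X' = Arr C A X')"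

definition functorially_finite :: "('k, 'o, 'm, 'z) lcat_scheme \<Rightarrow> 'o set \<Rightarrow> bool"
  where "functorially_finite C X \<longleftrightarrow> contravariantly_finite C X \<and> covariantly_finite C X"

primrec is_power :: "('k, 'o, 'm, 'z) lcat_scheme \<Rightarrow> 'o \<Rightarrow> nat \<Rightarrow> 'o \<Rightarrow> bool"
  where
    "is_power C A 0 S \<longleftrightarrow> is_zero_obj C S"
  | "is_power C A (Suc n) S \<longleftrightarrow> (\<exists>S'. is_power C A n S' \<and> is_direct_sum C S' A S)"

definition add_closure :: "('k, 'o, 'm, 'z) lcat_scheme \<Rightarrow> 'o \<Rightarrow> 'o set"
  where "add_closure C A = {B. \<exists>n S. is_power C A n S \<and> direct_summand C B S}"

section \<open>Functors\<close>

record ('o, 'm, 'p, 'n) funct =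
  fob :: "'o \<Rightarrow> 'p"
  far :: "'m \<Rightarrow> 'n"

definition linear_functor ::
  "('k, 'r) ring_scheme \<Rightarrow> ('k, 'o, 'm, 'y) lcat_scheme \<Rightarrow> ('k, 'p, 'n, 'z) lcat_scheme
    \<Rightarrow> ('o, 'm, 'p, 'n) funct \<Rightarrow> bool"
  where "linear_functor K C D F \<longleftrightarrow>
    (\<forall>A\<in>Obj C. fob F A \<in> Obj D) \<and>
    (\<forall>A\<in>Obj C. \<forall>B\<in>Obj C. far F \<in> linear_maps K (Hom C A B) (Hom D (fob F A) (fob F B))) \<and>
    (\<forall>A\<in>Obj C. far F (Idt C A) = Idt D (fob F A)) \<and>
    (\<forall>A\<in>Obj C. \<forall>B\<in>Obj C. \<forall>E\<in>Obj C. \<forall>f\<in>Arr C A B. \<forall>g\<in>Arr C B E.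
      far F (g \<cdot>\<^bsub>C\<^esub> f) = far F g \<cdot>\<^bsub>D\<^esub> far F f)"

definition full_functor ::
  "('k, 'o, 'm, 'y) lcat_scheme \<Rightarrow> ('k, 'p, 'n, 'z) lcat_scheme \<Rightarrow> ('o, 'm, 'p, 'n) funct \<Rightarrow> bool"
  where "full_functor C D F \<longleftrightarrow>
    (\<forall>A\<in>Obj C. \<forall>B\<in>Obj C. far F ` Arr C A B = Arr D (fob F A) (fob F B))"

definition faithful_functor ::
  "('k, 'o, 'm, 'y) lcat_scheme \<Rightarrow> ('o, 'm, 'p, 'n) funct \<Rightarrow> bool"
  where "faithful_functor C F \<longleftrightarrow> (\<forall>A\<in>Obj C. \<forall>B\<in>Obj C. inj_on (far F) (Arr C A B))"

text \<open>The image of a full subcategory, closed under isomorphisms.\<close>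

definition ess_image ::
  "('k, 'p, 'n, 'z) lcat_scheme \<Rightarrow> ('o, 'm, 'p, 'n) funct \<Rightarrow> 'o set \<Rightarrow> 'p set"
  where "ess_image D F U = {B \<in> Obj D. \<exists>A\<in>U. isomorphic D (fob F A) B}"

definition linear_equivalence ::
  "('k, 'r) ring_scheme \<Rightarrow> ('k, 'o, 'm, 'y) lcat_scheme \<Rightarrow> ('k, 'p, 'n, 'z) lcat_scheme
    \<Rightarrow> ('o, 'm, 'p, 'n) funct \<Rightarrow> bool"
  where "linear_equivalence K C D F \<longleftrightarrow> linear_functor K C D F \<and> full_functor C D F \<and>
    faithful_functor C F \<and> ess_image D F (Obj C) = Obj D"

definition equivalent_categories ::
  "('k, 'r) ring_scheme \<Rightarrow> ('k, 'o, 'm, 'y) lcat_scheme \<Rightarrow> ('k, 'p, 'n, 'z) lcat_scheme \<Rightarrow> bool"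
  where "equivalent_categories K C D \<longleftrightarrow> (\<exists>F. linear_equivalence K C D F)"

section \<open>Abelian notions\<close>

definition epi :: "('k, 'o, 'm, 'z) lcat_scheme \<Rightarrow> 'o \<Rightarrow> 'o \<Rightarrow> 'm \<Rightarrow> bool"
  where "epi C A B f \<longleftrightarrow> f \<in> Arr C A B \<and>
    (\<forall>D\<in>Obj C. \<forall>g\<in>Arr C B D. \<forall>h\<in>Arr C B D. g \<cdot>\<^bsub>C\<^esub> f = h \<cdot>\<^bsub>C\<^esub> f \<longrightarrow> g = h)"

definition is_kernel :: "('k, 'o, 'm, 'z) lcat_scheme \<Rightarrow> 'o \<Rightarrow> 'o \<Rightarrow> 'o \<Rightarrow> 'm \<Rightarrow> 'm \<Rightarrow> bool"
  where "is_kernel C A B D i p \<longleftrightarrow> i \<in> Arr C A B \<and> p \<in> Arr C B D \<and>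
    p \<cdot>\<^bsub>C\<^esub> i = \<zero>\<^bsub>Hom C A D\<^esub> \<and>
    (\<forall>E\<in>Obj C. \<forall>f\<in>Arr C E B. p \<cdot>\<^bsub>C\<^esub> f = \<zero>\<^bsub>Hom C E D\<^esub> \<longrightarrow> (\<exists>!g. g \<in> Arr C E A \<and> i \<cdot>\<^bsub>C\<^esub> g = f))"

definition is_cokernel :: "('k, 'o, 'm, 'z) lcat_scheme \<Rightarrow> 'o \<Rightarrow> 'o \<Rightarrow> 'o \<Rightarrow> 'm \<Rightarrow> 'm \<Rightarrow> bool"
  where "is_cokernel C A B D i p \<longleftrightarrow> i \<in> Arr C A B \<and> p \<in> Arr C B D \<and>
    p \<cdot>\<^bsub>C\<^esub> i = \<zero>\<^bsub>Hom C A D\<^esub> \<and>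
    (\<forall>E\<in>Obj C. \<forall>f\<in>Arr C B E. f \<cdot>\<^bsub>C\<^esub> i = \<zero>\<^bsub>Hom C A E\<^esub> \<longrightarrow> (\<exists>!g. g \<in> Arr C D E \<and> g \<cdot>\<^bsub>C\<^esub> p = f))"

definition short_exact :: "('k, 'o, 'm, 'z) lcat_scheme \<Rightarrow> 'o \<Rightarrow> 'o \<Rightarrow> 'o \<Rightarrow> 'm \<Rightarrow> 'm \<Rightarrow> bool"
  where "short_exact C A B D i p \<longleftrightarrow> is_kernel C A B D i p \<and> is_cokernel C A B D i p"

text \<open>Exactness of \<open>A \<rightarrow> B \<rightarrow> D\<close> at \<open>B\<close>: the first map is an epimorphism onto a kernel of the second.\<close>

definition exact_at :: "('k, 'o, 'm, 'z) lcat_scheme \<Rightarrow> 'o \<Rightarrow> 'o \<Rightarrow> 'o \<Rightarrow> 'm \<Rightarrow> 'm \<Rightarrow> bool"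
  where "exact_at C A B D f g \<longleftrightarrow>
    (\<exists>I\<in>Obj C. \<exists>e i. epi C A I e \<and> is_kernel C I B D i g \<and> f = i \<cdot>\<^bsub>C\<^esub> e)"

definition projective :: "('k, 'o, 'm, 'z) lcat_scheme \<Rightarrow> 'o \<Rightarrow> bool"
  where "projective C P \<longleftrightarrow> P \<in> Obj C \<and>
    (\<forall>A\<in>Obj C. \<forall>B\<in>Obj C. \<forall>e. epi C A B e \<longrightarrow>
      (\<forall>f\<in>Arr C P B. \<exists>g\<in>Arr C P A. e \<cdot>\<^bsub>C\<^esub> g = f))"

text \<open>A projective resolution \<open>\<dots> \<rightarrow> P 1 \<rightarrow> P 0 \<rightarrow> A \<rightarrow> 0\<close> with \<open>P i = 0\<close> for \<open>i > n\<close>.\<close>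

definition has_projective_resolution :: "('k, 'o, 'm, 'z) lcat_scheme \<Rightarrow> 'o \<Rightarrow> nat \<Rightarrow> bool"
  where "has_projective_resolution C A n \<longleftrightarrow>
    (\<exists>P d e. (\<forall>i. projective C (P i)) \<and> (\<forall>i>n. is_zero_obj C (P i)) \<and>
      (\<forall>i. d i \<in> Arr C (P (Suc i)) (P i)) \<and> epi C (P 0) A e \<and>
      exact_at C (P 1) (P 0) A (d 0) e \<and>
      (\<forall>i. exact_at C (P (Suc (Suc i))) (P (Suc i)) (P i) (d (Suc i)) (d i)))"

definition proj_dim :: "('k, 'o, 'm, 'z) lcat_scheme \<Rightarrow> 'o \<Rightarrow> enat"
  where "proj_dim C A = Inf {enat n | n. has_projective_resolution C A n}"

definition gl_dim :: "('k, 'o, 'm, 'z) lcat_scheme \<Rightarrow> enat"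
  where "gl_dim C = (SUP A\<in>Obj C. proj_dim C A)"

text \<open>Yoneda's \<open>Ext\<^sup>1(B, A)\<close>: classes of extensions \<open>0 \<rightarrow> A \<rightarrow> E \<rightarrow> B \<rightarrow> 0\<close>. Its zero element is the
  class of the split extensions.\<close>

definition extensions :: "('k, 'o, 'm, 'z) lcat_scheme \<Rightarrow> 'o \<Rightarrow> 'o \<Rightarrow> ('o \<times> 'm \<times> 'm) set"
  where "extensions C B A = {(E, i, p). E \<in> Obj C \<and> short_exact C A E B i p}"

definition extension_equiv ::
  "('k, 'o, 'm, 'z) lcat_scheme \<Rightarrow> 'o \<Rightarrow> 'o \<Rightarrow> (('o \<times> 'm \<times> 'm) \<times> ('o \<times> 'm \<times> 'm)) set"
  where "extension_equiv C B A =
    {((E, i, p), (E', i', p')). (E, i, p) \<in> extensions C B A \<and> (E', i', p') \<in> extensions C B A \<and>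
       (\<exists>u. is_iso C E E' u \<and> u \<cdot>\<^bsub>C\<^esub> i = i' \<and> p' \<cdot>\<^bsub>C\<^esub> u = p)}"

definition Ext1 :: "('k, 'o, 'm, 'z) lcat_scheme \<Rightarrow> 'o \<Rightarrow> 'o \<Rightarrow> ('o \<times> 'm \<times> 'm) set set"
  where "Ext1 C B A = extensions C B A // extension_equiv C B A"

definition Ext1_zero :: "('k, 'o, 'm, 'z) lcat_scheme \<Rightarrow> 'o \<Rightarrow> 'o \<Rightarrow> ('o \<times> 'm \<times> 'm) set"
  where "Ext1_zero C B A =
    {(E, i, p) \<in> extensions C B A. \<exists>s\<in>Arr C B E. p \<cdot>\<^bsub>C\<^esub> s = Idt C B}"

definition Fac :: "('k, 'o, 'm, 'z) lcat_scheme \<Rightarrow> 'o set \<Rightarrow> 'o set"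
  where "Fac C U = {A \<in> Obj C. \<exists>B\<in>U. \<exists>e. epi C B A e}"

definition tilting_subcategory :: "('k, 'o, 'm, 'z) lcat_scheme \<Rightarrow> 'o set \<Rightarrow> bool"
  where "tilting_subcategory C U \<longleftrightarrow> subcategory C U \<and> contravariantly_finite C U \<and>
    Fac C U = {A \<in> Obj C. \<forall>B\<in>U. Ext1 C B A = {Ext1_zero C B A}}"

section \<open>Triangulated categories\<close>

text \<open>A candidate triangle \<open>A \<rightarrow> B \<rightarrow> D \<rightarrow> A[1]\<close> with maps \<open>f, g, h\<close> is the tuple \<open>(A, B, D, f, g, h)\<close>.\<close>

record ('k, 'o, 'm) tcat = "('k, 'o, 'm) lcat" +
  Shift :: "('o, 'm, 'o, 'm) funct"
  Tri :: "('o \<times> 'o \<times> 'o \<times> 'm \<times> 'm \<times> 'm) set"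

abbreviation shob :: "('k, 'o, 'm, 'z) tcat_scheme \<Rightarrow> 'o \<Rightarrow> 'o"
  where "shob T A \<equiv> fob (Shift T) A"

abbreviation shar :: "('k, 'o, 'm, 'z) tcat_scheme \<Rightarrow> 'm \<Rightarrow> 'm"
  where "shar T f \<equiv> far (Shift T) f"

definition candidate_triangles ::
  "('k, 'o, 'm, 'z) tcat_scheme \<Rightarrow> ('o \<times> 'o \<times> 'o \<times> 'm \<times> 'm \<times> 'm) set"
  where "candidate_triangles T =
    {(A, B, D, f, g, h). A \<in> Obj T \<and> B \<in> Obj T \<and> D \<in> Obj T \<and>
       f \<in> Arr T A B \<and> g \<in> Arr T B D \<and> h \<in> Arr T D (shob T A)}"

locale triangulated_category = additive_category K T
  for K :: "('k, 'r) ring_scheme" and T :: "('k, 'o, 'm, 'z) tcat_scheme" +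
  assumes Shift_equivalence: "linear_equivalence K T T (Shift T)"
    and Tri_candidate: "Tri T \<subseteq> candidate_triangles T"
    and TR1_iso: "\<lbrakk>(A, B, D, f, g, h) \<in> Tri T; (A', B', D', f', g', h') \<in> candidate_triangles T;
        is_iso T A A' a; is_iso T B B' b; is_iso T D D' d;
        b \<cdot>\<^bsub>T\<^esub> f = f' \<cdot>\<^bsub>T\<^esub> a; d \<cdot>\<^bsub>T\<^esub> g = g' \<cdot>\<^bsub>T\<^esub> b; shar T a \<cdot>\<^bsub>T\<^esub> h = h' \<cdot>\<^bsub>T\<^esub> d\<rbrakk>
      \<Longrightarrow> (A', B', D', f', g', h') \<in> Tri T"
    and TR1_id: "\<lbrakk>A \<in> Obj T; is_zero_obj T Z\<rbrakk>
      \<Longrightarrow> (A, A, Z, Idt T A, \<zero>\<^bsub>Hom T A Z\<^esub>, \<zero>\<^bsub>Hom T Z (shob T A)\<^esub>) \<in> Tri T"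
    and TR1_cone: "\<lbrakk>A \<in> Obj T; B \<in> Obj T; f \<in> Arr T A B\<rbrakk>
      \<Longrightarrow> \<exists>D g h. (A, B, D, f, g, h) \<in> Tri T"
    and TR2: "(A, B, D, f, g, h) \<in> candidate_triangles T
      \<Longrightarrow> (A, B, D, f, g, h) \<in> Tri T \<longleftrightarrow>
        (B, D, shob T A, g, h, \<ominus>\<^bsub>Hom T (shob T A) (shob T B)\<^esub> shar T f) \<in> Tri T"
    and TR3: "\<lbrakk>(A, B, D, f, g, h) \<in> Tri T; (A', B', D', f', g', h') \<in> Tri T;
        a \<in> Arr T A A'; b \<in> Arr T B B'; b \<cdot>\<^bsub>T\<^esub> f = f' \<cdot>\<^bsub>T\<^esub> a\<rbrakk>
      \<Longrightarrow> \<exists>d\<in>Arr T D D'. d \<cdot>\<^bsub>T\<^esub> g = g' \<cdot>\<^bsub>T\<^esub> b \<and> shar T a \<cdot>\<^bsub>T\<^esub> h = h' \<cdot>\<^bsub>T\<^esub> d"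
    and TR4: "\<lbrakk>(A, B, D, f, u, u') \<in> Tri T; (B, C, E, g, v, v') \<in> Tri T;
        (A, C, F, g \<cdot>\<^bsub>T\<^esub> f, w, w') \<in> Tri T\<rbrakk>
      \<Longrightarrow> \<exists>p\<in>Arr T D F. \<exists>q\<in>Arr T F E.
        (D, F, E, p, q, shar T u \<cdot>\<^bsub>T\<^esub> v') \<in> Tri T \<and>
        p \<cdot>\<^bsub>T\<^esub> u = w \<cdot>\<^bsub>T\<^esub> g \<and> w' \<cdot>\<^bsub>T\<^esub> p = u' \<and>
        q \<cdot>\<^bsub>T\<^esub> w = v \<and> v' \<cdot>\<^bsub>T\<^esub> q = shar T f \<cdot>\<^bsub>T\<^esub> w'"

text \<open>\<open>\<theta>\<close> is the natural isomorphism \<open>S(A[1]) \<rightarrow> S(A)[1]\<close>.\<close>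

definition triangulated_equivalence ::
  "('k, 'r) ring_scheme \<Rightarrow> ('k, 'o, 'm, 'z) tcat_scheme \<Rightarrow> ('o, 'm, 'o, 'm) funct \<Rightarrow> bool"
  where "triangulated_equivalence K T S \<longleftrightarrow> linear_equivalence K T T S \<and>
    (\<exists>\<theta>. (\<forall>A\<in>Obj T. is_iso T (fob S (shob T A)) (shob T (fob S A)) (\<theta> A)) \<and>
      (\<forall>A\<in>Obj T. \<forall>B\<in>Obj T. \<forall>f\<in>Arr T A B.
        \<theta> B \<cdot>\<^bsub>T\<^esub> far S (shar T f) = shar T (far S f) \<cdot>\<^bsub>T\<^esub> \<theta> A) \<and>
      (\<forall>(A, B, D, f, g, h)\<in>Tri T.
        (fob S A, fob S B, fob S D, far S f, far S g, \<theta> A \<cdot>\<^bsub>T\<^esub> far S h) \<in> Tri T))"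

text \<open>Naturality of \<open>\<eta>\<close> is in both variables at once: the maps \<open>a : A \<rightarrow> A'\<close> and \<open>b : B' \<rightarrow> B\<close> induce
  \<open>\<phi> \<mapsto> \<phi>(b - a)\<close> on duals and \<open>y \<mapsto> S(a) y b\<close> on the right-hand sides.\<close>

definition serre_functor ::
  "('k, 'r) ring_scheme \<Rightarrow> ('k, 'o, 'm, 'z) tcat_scheme \<Rightarrow> ('o, 'm, 'o, 'm) funct \<Rightarrow> bool"
  where "serre_functor K T S \<longleftrightarrow> triangulated_equivalence K T S \<and>
    (\<exists>\<eta>. (\<forall>A\<in>Obj T. \<forall>B\<in>Obj T.
          \<eta> A B \<in> linear_isos K (dual_module K (Hom T A B)) (Hom T B (fob S A))) \<and>
      (\<forall>A\<in>Obj T. \<forall>A'\<in>Obj T. \<forall>B\<in>Obj T. \<forall>B'\<in>Obj T. \<forall>a\<in>Arr T A A'. \<forall>b\<in>Arr T B' B.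
        \<forall>\<phi>\<in>carrier (dual_module K (Hom T A B)).
          \<eta> A' B' (\<lambda>x\<in>Arr T A' B'. \<phi> (b \<cdot>\<^bsub>T\<^esub> x \<cdot>\<^bsub>T\<^esub> a)) = far S a \<cdot>\<^bsub>T\<^esub> \<eta> A B \<phi> \<cdot>\<^bsub>T\<^esub> b))"

definition shift_subcategory :: "('k, 'o, 'm, 'z) tcat_scheme \<Rightarrow> 'o set \<Rightarrow> 'o set"
  where "shift_subcategory T X = ess_image T (Shift T) X"

definition rigid :: "('k, 'o, 'm, 'z) tcat_scheme \<Rightarrow> 'o set \<Rightarrow> bool"
  where "rigid T X \<longleftrightarrow>
    (\<forall>A\<in>X. \<forall>B\<in>X. Arr T A (shob T B) = {\<zero>\<^bsub>Hom T A (shob T B)\<^esub>})"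

definition two_cluster_tilting :: "('k, 'o, 'm, 'z) tcat_scheme \<Rightarrow> 'o set \<Rightarrow> bool"
  where "two_cluster_tilting T M \<longleftrightarrow> subcategory T M \<and> functorially_finite T M \<and>
    {A \<in> Obj T. \<forall>B\<in>M. Arr T B (shob T A) = {\<zero>\<^bsub>Hom T B (shob T A)\<^esub>}} = M \<and>
    {A \<in> Obj T. \<forall>B\<in>M. Arr T A (shob T B) = {\<zero>\<^bsub>Hom T A (shob T B)\<^esub>}} = M"

definition right_perp :: "('k, 'o, 'm, 'z) lcat_scheme \<Rightarrow> 'o set \<Rightarrow> 'o set"
  where "right_perp T X = {A \<in> Obj T. \<forall>B\<in>X. Arr T B A = {\<zero>\<^bsub>Hom T B A\<^esub>}}"

definition without_perp_summands :: "('k, 'o, 'm, 'z) lcat_scheme \<Rightarrow> 'o set \<Rightarrow> 'o set"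
  where "without_perp_summands T X =
    {A \<in> Obj T. \<forall>B. direct_summand T B A \<and> B \<in> right_perp T X \<longrightarrow> is_zero_obj T B}"

section \<open>Coherent functors\<close>

text \<open>Contravariant functors from the full subcategory \<open>X\<close> to abelian groups. Groups are additive groups
  of \<^typ>\<open>'m ring\<close> records (\<^const>\<open>mult\<close> and \<^const>\<open>one\<close> are ignored) with elements in the type \<open>'m\<close> of arrows.
  This choice of universe loses nothing: the value at \<open>A\<close> of a coherent functor is a quotient
  of a group of arrows, so every coherent functor is isomorphic to one whose values have underlying
  sets in \<open>'m\<close>.\<close>

type_synonym ('o, 'm) presheaf = "('o, 'm, 'm ring, 'm \<Rightarrow> 'm) funct"

definition is_presheaf ::
  "('k, 'o, 'm, 'z) lcat_scheme \<Rightarrow> 'o set \<Rightarrow> ('o, 'm) presheaf \<Rightarrow> bool"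
  where "is_presheaf T X F \<longleftrightarrow>
    (\<forall>A\<in>X. abelian_group (fob F A)) \<and>
    (\<forall>A\<in>X. \<forall>B\<in>X. \<forall>f\<in>Arr T A B.
      far F f \<in> hom (add_monoid (fob F B)) (add_monoid (fob F A))) \<and>
    (\<forall>A\<in>X. \<forall>x\<in>carrier (fob F A). far F (Idt T A) x = x) \<and>
    (\<forall>A\<in>X. \<forall>B\<in>X. \<forall>D\<in>X. \<forall>f\<in>Arr T A B. \<forall>g\<in>Arr T B D. \<forall>x\<in>carrier (fob F D).
      far F (g \<cdot>\<^bsub>T\<^esub> f) x = far F f (far F g x))"

definition hom_presheaf :: "('k, 'o, 'm, 'z) lcat_scheme \<Rightarrow> 'o \<Rightarrow> ('o, 'm) presheaf"
  where "hom_presheaf T A =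
    \<lparr>fob = (\<lambda>B. ring.truncate (Hom T B A)), far = (\<lambda>f x. x \<cdot>\<^bsub>T\<^esub> f)\<rparr>"

definition nat_transformations ::
  "('k, 'o, 'm, 'z) lcat_scheme \<Rightarrow> 'o set \<Rightarrow> ('o, 'm) presheaf \<Rightarrow> ('o, 'm) presheaf
    \<Rightarrow> ('o \<Rightarrow> 'm \<Rightarrow> 'm) set"
  where "nat_transformations T X F G =
    {\<eta> \<in> (\<Pi>\<^sub>E A\<in>X. hom (add_monoid (fob F A)) (add_monoid (fob G A)) \<inter> extensional (carrier (fob F A))).
      \<forall>A\<in>X. \<forall>B\<in>X. \<forall>f\<in>Arr T A B. \<forall>x\<in>carrier (fob F B).
        \<eta> A (far F f x) = far G f (\<eta> B x)}"

definition coherent ::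
  "('k, 'o, 'm, 'z) lcat_scheme \<Rightarrow> 'o set \<Rightarrow> ('o, 'm) presheaf \<Rightarrow> bool"
  where "coherent T X F \<longleftrightarrow> is_presheaf T X F \<and>
    (\<exists>X1\<in>X. \<exists>X0\<in>X.
      \<exists>\<alpha>\<in>nat_transformations T X (hom_presheaf T X1) (hom_presheaf T X0).
      \<exists>\<beta>\<in>nat_transformations T X (hom_presheaf T X0) F.
        \<forall>A\<in>X. \<alpha> A ` Arr T A X1 = a_kernel (Hom T A X0) (fob F A) (\<beta> A) \<and>
          \<beta> A ` Arr T A X0 = carrier (fob F A))"

text \<open>The category \<open>mod-X\<close>. Arrows are natural transformations tagged with source and target. The
  scalar \<open>c\<close> acts on \<open>\<eta> : F \<rightarrow> G\<close> through \<open>G(c 1\<^sub>A)\<close>, the \<open>k\<close>-linear structure inherited from \<open>X\<close>.\<close>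

definition mod_category ::
  "('k, 'o, 'm, 'z) lcat_scheme \<Rightarrow> 'o set
    \<Rightarrow> ('k, ('o, 'm) presheaf, ('o, 'm) presheaf \<times> ('o, 'm) presheaf \<times> ('o \<Rightarrow> 'm \<Rightarrow> 'm)) lcat"
  where "mod_category T X =
    \<lparr>Obj = {F. coherent T X F},
     Src = (\<lambda>(F, G, \<eta>). F),
     Tgt = (\<lambda>(F, G, \<eta>). G),
     Hom = (\<lambda>F G.
       \<lparr>carrier = {(F, G, \<eta>) | \<eta>. \<eta> \<in> nat_transformations T X F G},
        mult = undefined,
        one = undefined,
        zero = (F, G, \<lambda>A\<in>X. \<lambda>x\<in>carrier (fob F A). \<zero>\<^bsub>fob G A\<^esub>),
        add = (\<lambda>(_, _, \<eta>) (_, _, \<theta>).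
          (F, G, \<lambda>A\<in>X. \<lambda>x\<in>carrier (fob F A). \<eta> A x \<oplus>\<^bsub>fob G A\<^esub> \<theta> A x)),
        smult = (\<lambda>c (_, _, \<eta>).
          (F, G, \<lambda>A\<in>X. \<lambda>x\<in>carrier (fob F A). far G (c \<odot>\<^bsub>Hom T A A\<^esub> Idt T A) (\<eta> A x)))\<rparr>),
     Idt = (\<lambda>F. (F, F, \<lambda>A\<in>X. \<lambda>x\<in>carrier (fob F A). x)),
     Cmp = (\<lambda>(_, H, \<theta>) (F, _, \<eta>). (F, H, \<lambda>A\<in>X. \<lambda>x\<in>carrier (fob F A). \<theta> A (\<eta> A x)))\<rparr>"

definition H_functor ::
  "('k, 'o, 'm, 'z) lcat_scheme \<Rightarrow> 'o set
    \<Rightarrow> ('o, 'm, ('o, 'm) presheaf, ('o, 'm) presheaf \<times> ('o, 'm) presheaf \<times> ('o \<Rightarrow> 'm \<Rightarrow> 'm)) funct"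
  where "H_functor T X =
    \<lparr>fob = hom_presheaf T,
     far = (\<lambda>f. (hom_presheaf T (Src T f), hom_presheaf T (Tgt T f),
       \<lambda>A\<in>X. \<lambda>x\<in>Arr T A (Src T f). f \<cdot>\<^bsub>T\<^esub> x))\<rparr>"

definition fully_rigid :: "('k, 'o, 'm, 'z) tcat_scheme \<Rightarrow> 'o set \<Rightarrow> bool"
  where "fully_rigid T X \<longleftrightarrow> subcategory T X \<and> contravariantly_finite T X \<and> rigid T X \<and>
    full_functor T (mod_category T X) (H_functor T X)"

definition H_preimage ::
  "('k, 'o, 'm, 'z) lcat_scheme \<Rightarrow> 'o set \<Rightarrow> ('o, 'm) presheaf set \<Rightarrow> 'o set"
  where "H_preimage T X U = {Y \<in> without_perp_summands T X. fob (H_functor T X) Y \<in> U}"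

definition H_image ::
  "('k, 'o, 'm, 'z) lcat_scheme \<Rightarrow> 'o set \<Rightarrow> 'o set \<Rightarrow> ('o, 'm) presheaf set"
  where "H_image T X Y = ess_image (mod_category T X) (H_functor T X) Y"

section \<open>Ghost maps\<close>

definition ghosts :: "('k, 'o, 'm, 'z) lcat_scheme \<Rightarrow> 'o set \<Rightarrow> 'o \<Rightarrow> 'o \<Rightarrow> 'm set"
  where "ghosts T X A B =
    {f \<in> Arr T A B. \<forall>D\<in>X. \<forall>x\<in>Arr T D A. f \<cdot>\<^bsub>T\<^esub> x = \<zero>\<^bsub>Hom T D B\<^esub>}"

text \<open>The quotient of the full subcategory \<open>Y\<close> by the \<open>X\<close>-ghost maps. Cosets are non-empty
  sets of parallel arrows, so source and target may be read off any representative.\<close>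

definition ghost_quotient ::
  "('k, 'o, 'm, 'z) lcat_scheme \<Rightarrow> 'o set \<Rightarrow> 'o set \<Rightarrow> ('k, 'o, 'm set) lcat"
  where "ghost_quotient T X Y =
    \<lparr>Obj = Y,
     Src = (\<lambda>W. Src T (SOME f. f \<in> W)),
     Tgt = (\<lambda>W. Tgt T (SOME f. f \<in> W)),
     Hom = (\<lambda>A B. quotient_algebra (Hom T A B) (ghosts T X A B)),
     Idt = (\<lambda>A. ghosts T X A A +>\<^bsub>Hom T A A\<^esub> Idt T A),
     Cmp = (\<lambda>V W. \<Union>g\<in>V. \<Union>f\<in>W.
       ghosts T X (Src T f) (Tgt T g) +>\<^bsub>Hom T (Src T f) (Tgt T g)\<^esub> (g \<cdot>\<^bsub>T\<^esub> f))\<rparr>"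

definition factoring_endos :: "('k, 'o, 'm, 'z) lcat_scheme \<Rightarrow> 'o set \<Rightarrow> 'o \<Rightarrow> 'm set"
  where "factoring_endos T Z A =
    {f \<in> Arr T A A. \<exists>D\<in>Z. \<exists>u\<in>Arr T A D. \<exists>v\<in>Arr T D A. f = v \<cdot>\<^bsub>T\<^esub> u}"

section \<open>The two sides of the correspondence\<close>

definition ct_subcategories_in_TXperp :: "('k, 'o, 'm, 'z) tcat_scheme \<Rightarrow> 'o set \<Rightarrow> 'o set set"
  where "ct_subcategories_in_TXperp T X =
    {Y. two_cluster_tilting T Y \<and> Y \<subseteq> without_perp_summands T X}"

definition serre_tilting_subcategories ::
  "('k, 'o, 'm, 'z) tcat_scheme \<Rightarrow> ('o, 'm, 'o, 'm) funct \<Rightarrow> 'o set \<Rightarrow> ('o, 'm) presheaf set set"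
  where "serre_tilting_subcategories T S X =
    {U. tilting_subcategory (mod_category T X) U \<and>
        contravariantly_finite T (H_preimage T X U) \<and>
        ess_image T S (H_preimage T X U) =
          shift_subcategory T (shift_subcategory T (H_preimage T X U))}"

end

theory Submission
  imports Defs
begin

text \<open>
  For rigid \<open>X\<close>, the functor \<open>H\<close> is dense, kills exactly the ghosts, and is full when \<open>X\<close> is cluster tilting,
  because then every object has a triangle \<open>X1 \<rightarrow> X0 \<rightarrow> A \<rightarrow> X1[1]\<close>. So \<open>mod-X\<close> is \<open>T\<close> modulo ghosts, and all its
  homological notions can be read in \<open>T\<close>; by Fitting's lemma an object without summands in \<open>X\<^sup>\<bottom>\<close> is
  determined by its image. Serre duality makes the objects \<open>H(S Z)\<close> relatively injective, and since \<open>S X = X[2]\<close> a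
  projective resolution with more than two terms can be shortened: finite global dimension is at most one, and
  every coherent functor is \<open>H(A)\<close> for the cone \<open>A\<close> of a map in \<open>X\<close> that \<open>H\<close> sends to a monomorphism.
  With this, \<open>Ext\<^sup>1(H Y, H A) = 0\<close> says that all composites \<open>Y \<rightarrow> Z[1] \<rightarrow> A[1]\<close> with \<open>Z \<in> X\<close> vanish, and if \<open>S Y = B[2]\<close>,
  then Serre duality turns this into the statement that all maps \<open>A \<rightarrow> B[1]\<close> are ghosts. This
  translates between the tilting and the cluster tilting conditions. Conversely, the projectives \<open>H(X)\<close> always form a
  tilting subcategory, and whatever corresponds to them under the bijection must be \<open>X\<close> itself.
\<close>

section \<open>Calculus in linear categories\<close>

text \<open>The abelian structure of mod-X is never developed. Exactness is tested on maps out of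
  objects of \<open>X\<close>, and cones in \<open>T\<close> stand in for kernels and cokernels. The
  price is that \<open>H\<close> forgets ghosts: a diagram lifted from mod-X commutes only modulo
  ghosts. It is repaired either on maps out of \<open>X\<close>, where \<open>H\<close> is faithful,
  or on objects of \<open>Tp\<close>, where an endomorphism congruent to the identity is invertible.
  The bound on the dimension is the Gorenstein property of mod-X for cluster tilting
  \<open>X\<close>: projectives have injective dimension at most one, so finite projective dimension
  is at most one. It serves to present every object of \<open>Tp\<close> by a triangle whose first
  map stays monic under \<open>H\<close>; this makes a non-zero composite Y -> Z[1] -> A[1] visible
  as a non-split extension. In place of a Calabi-Yau property, Serre duality pairs T(A, B[1]) with
  T(B', A[1]), where S B' = B[2]. An equation S Y = Y[2] keeps \<open>B'\<close> inside
  \<open>Y\<close>.\<close>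

definition Mor :: "('k, 'o, 'm, 'z) lcat_scheme \<Rightarrow> 'm set"
  where "Mor C = {f. \<exists>A\<in>Obj C. \<exists>B\<in>Obj C. f \<in> Arr C A B}"

text \<open>A conjunction rather than a new constant: as an assumption it supplies rewrite rules for source
  and target, so that the simplifier settles composability.\<close>

abbreviation arrow_from_to ::
  "('k, 'o, 'm, 'z) lcat_scheme \<Rightarrow> 'm \<Rightarrow> 'o \<Rightarrow> 'o \<Rightarrow> bool" (\<open>_ \<Colon>\<index> _ \<rightarrow> _\<close> [61, 61, 61] 50)
  where "f \<Colon>\<^bsub>C\<^esub> A \<rightarrow> B \<equiv> f \<in> Mor C \<and> Src C f = A \<and> Tgt C f = B \<and> A \<in> Obj C \<and> B \<in> Obj C"

abbreviation null_arrow :: "('k, 'o, 'm, 'z) lcat_scheme \<Rightarrow> 'o \<Rightarrow> 'o \<Rightarrow> 'm" (\<open>nul\<index>\<close>)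
  where "null_arrow C A B \<equiv> \<zero>\<^bsub>Hom C A B\<^esub>"

text \<open>The hom-set is read off the first argument, so that sums of composites can be rewritten
  without carrying objects along.\<close>

definition arrow_plus :: "('k, 'o, 'm, 'z) lcat_scheme \<Rightarrow> 'm \<Rightarrow> 'm \<Rightarrow> 'm" (infixl \<open>\<boxplus>\<index>\<close> 65)
  where "f \<boxplus>\<^bsub>C\<^esub> g = f \<oplus>\<^bsub>Hom C (Src C f) (Tgt C f)\<^esub> g"

definition arrow_minus :: "('k, 'o, 'm, 'z) lcat_scheme \<Rightarrow> 'm \<Rightarrow> 'm \<Rightarrow> 'm" (infixl \<open>\<boxminus>\<index>\<close> 65)
  where "f \<boxminus>\<^bsub>C\<^esub> g = f \<ominus>\<^bsub>Hom C (Src C f) (Tgt C f)\<^esub> g"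

definition arrow_smult :: "('k, 'o, 'm, 'z) lcat_scheme \<Rightarrow> 'k \<Rightarrow> 'm \<Rightarrow> 'm" (infixr \<open>\<star>\<index>\<close> 72)
  where "c \<star>\<^bsub>C\<^esub> f = c \<odot>\<^bsub>Hom C (Src C f) (Tgt C f)\<^esub> f"

locale lincat = linear_category K C for K :: "('k, 'r) ring_scheme" and C :: "('k, 'o, 'm, 'z) lcat_scheme" (structure)
begin

lemma Arr_iff: "A \<in> Obj C \<Longrightarrow> B \<in> Obj C \<Longrightarrow> f \<in> Arr C A B \<longleftrightarrow> f \<in> Mor C \<and> Src C f = A \<and> Tgt C f = B"
  unfolding Mor_def using Src_Tgt by blast

lemma ArrI: "f \<Colon> A \<rightarrow> B \<Longrightarrow> f \<in> Arr C A B"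
  by (simp add: Arr_iff)

lemma ArrD: "f \<in> Arr C A B \<Longrightarrow> A \<in> Obj C \<Longrightarrow> B \<in> Obj C \<Longrightarrow> f \<Colon> A \<rightarrow> B"
  by (simp add: Arr_iff)

lemma MorD [simp]: "f \<in> Mor C \<Longrightarrow> Src C f \<in> Obj C" "f \<in> Mor C \<Longrightarrow> Tgt C f \<in> Obj C"
  unfolding Mor_def using Src_Tgt by blast+

lemma Mor_Arr: "f \<in> Mor C \<Longrightarrow> f \<in> Arr C (Src C f) (Tgt C f)"
  by (simp add: Arr_iff)

lemma Hom_group: "A \<in> Obj C \<Longrightarrow> B \<in> Obj C \<Longrightarrow> abelian_group (Hom C A B)"
  using Hom_module module.axioms by blast

lemma in_Idt [simp]:
  assumes "A \<in> Obj C"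
  shows "Idt C A \<in> Mor C" "Src C (Idt C A) = A" "Tgt C (Idt C A) = A"
  using ArrD[OF Idt_closed[OF assms] assms assms] by auto

lemma in_Cmp [simp]:
  assumes "f \<in> Mor C" "g \<in> Mor C" "Src C g = Tgt C f"
  shows "g \<cdot> f \<in> Mor C" "Src C (g \<cdot> f) = Src C f" "Tgt C (g \<cdot> f) = Tgt C g"
  using ArrD[OF Cmp_closed[OF _ _ _ Mor_Arr[OF assms(1)], of "Tgt C g" g]] assms Mor_Arr[OF assms(2)]
  by auto

lemma in_nul [simp]:
  assumes "A \<in> Obj C" "B \<in> Obj C"
  shows "nul A B \<in> Mor C" "Src C (nul A B) = A" "Tgt C (nul A B) = B"
proof -
  interpret abelian_group "Hom C A B" by (rule Hom_group[OF assms])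
  show "nul A B \<in> Mor C" "Src C (nul A B) = A" "Tgt C (nul A B) = B"
    using ArrD[OF zero_closed assms] by auto
qed

lemma plus_Hom: "f \<Colon> A \<rightarrow> B \<Longrightarrow> f \<oplus>\<^bsub>Hom C A B\<^esub> g = f \<boxplus> g"
  unfolding arrow_plus_def by auto

lemma minus_Hom: "f \<Colon> A \<rightarrow> B \<Longrightarrow> f \<ominus>\<^bsub>Hom C A B\<^esub> g = f \<boxminus> g"
  unfolding arrow_minus_def by auto

lemma smult_Hom: "f \<Colon> A \<rightarrow> B \<Longrightarrow> c \<odot>\<^bsub>Hom C A B\<^esub> f = c \<star> f"
  unfolding arrow_smult_def by auto

lemma in_plus [simp]:
  assumes "f \<in> Mor C" "g \<in> Mor C" "Src C g = Src C f" "Tgt C g = Tgt C f"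
  shows "f \<boxplus> g \<in> Mor C" "Src C (f \<boxplus> g) = Src C f" "Tgt C (f \<boxplus> g) = Tgt C f"
proof -
  interpret abelian_group "Hom C (Src C f) (Tgt C f)" by (rule Hom_group) (use assms in auto)
  have "f \<boxplus> g \<in> Arr C (Src C f) (Tgt C f)" unfolding arrow_plus_def
    using assms by (intro add.m_closed) (auto simp: Arr_iff)
  then show "f \<boxplus> g \<in> Mor C" "Src C (f \<boxplus> g) = Src C f" "Tgt C (f \<boxplus> g) = Tgt C f"
    using assms by (auto simp: Arr_iff)
qed

lemma in_minus [simp]:
  assumes "f \<in> Mor C" "g \<in> Mor C" "Src C g = Src C f" "Tgt C g = Tgt C f"
  shows "f \<boxminus> g \<in> Mor C" "Src C (f \<boxminus> g) = Src C f" "Tgt C (f \<boxminus> g) = Tgt C f"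
proof -
  interpret abelian_group "Hom C (Src C f) (Tgt C f)" by (rule Hom_group) (use assms in auto)
  have "f \<boxminus> g \<in> Arr C (Src C f) (Tgt C f)" unfolding arrow_minus_def
    using assms by (intro minus_closed) (auto simp: Arr_iff)
  then show "f \<boxminus> g \<in> Mor C" "Src C (f \<boxminus> g) = Src C f" "Tgt C (f \<boxminus> g) = Tgt C f"
    using assms by (auto simp: Arr_iff)
qed

lemma in_smult [simp]:
  assumes "f \<in> Mor C" "c \<in> carrier K"
  shows "c \<star> f \<in> Mor C" "Src C (c \<star> f) = Src C f" "Tgt C (c \<star> f) = Tgt C f"
proof -
  interpret module K "Hom C (Src C f) (Tgt C f)" by (rule Hom_module) (use assms in auto)
  have "c \<star> f \<in> Arr C (Src C f) (Tgt C f)" unfolding arrow_smult_def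
    using assms by (intro smult_closed) (auto simp: Arr_iff)
  then show "c \<star> f \<in> Mor C" "Src C (c \<star> f) = Src C f" "Tgt C (c \<star> f) = Tgt C f"
    using assms by (auto simp: Arr_iff)
qed

lemma Cmp_Idt' [simp]: "f \<in> Mor C \<Longrightarrow> Src C f = A \<Longrightarrow> f \<cdot> Idt C A = f"
  using Cmp_Idt[OF _ _ Mor_Arr] by auto

lemma Idt_Cmp' [simp]: "f \<in> Mor C \<Longrightarrow> Tgt C f = B \<Longrightarrow> Idt C B \<cdot> f = f"
  using Idt_Cmp[OF _ _ Mor_Arr] by auto

lemma assoc [simp]: "f \<in> Mor C \<Longrightarrow> g \<in> Mor C \<Longrightarrow> h \<in> Mor C \<Longrightarrow> Src C g = Tgt C f \<Longrightarrow> Src C h = Tgt C g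
    \<Longrightarrow> (h \<cdot> g) \<cdot> f = h \<cdot> (g \<cdot> f)"
  by (rule Cmp_assoc[of "Src C f" "Src C g" "Src C h" "Tgt C h"]) (auto simp: Arr_iff)

text \<open>The simplifier nests composites to the right, which hides an inner product
  \<open>h \<cdot> g\<close>. This form applies a known equation for that product in front of a
  further factor.\<close>

lemma Cmp_eq_Cmp: "h \<cdot> g = k \<Longrightarrow> f \<in> Mor C \<Longrightarrow> g \<in> Mor C \<Longrightarrow> h \<in> Mor C \<Longrightarrow> Src C g = Tgt C f \<Longrightarrow> Src C h = Tgt C g
    \<Longrightarrow> h \<cdot> (g \<cdot> f) = k \<cdot> f"
  using assoc by metis

lemma Cmp_plus_right:
  assumes "f \<in> Mor C" "f' \<in> Mor C" "g \<in> Mor C" "Src C f' = Src C f" "Tgt C f' = Tgt C f" "Src C g = Tgt C f"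
  shows "g \<cdot> (f \<boxplus> f') = g \<cdot> f \<boxplus> g \<cdot> f'"
  using Cmp_linear_right[of "Src C f" "Tgt C f" "Tgt C g" g] assms
  unfolding linear_maps_def arrow_plus_def by (simp add: Arr_iff)

lemma Cmp_plus_left:
  assumes "g \<in> Mor C" "g' \<in> Mor C" "f \<in> Mor C" "Src C g' = Src C g" "Tgt C g' = Tgt C g" "Src C g = Tgt C f"
  shows "(g \<boxplus> g') \<cdot> f = g \<cdot> f \<boxplus> g' \<cdot> f"
  using Cmp_linear_left[of "Src C f" "Tgt C f" "Tgt C g" f] assms
  unfolding linear_maps_def arrow_plus_def by (simp add: Arr_iff)

lemma Cmp_smult_right:
  assumes "f \<in> Mor C" "g \<in> Mor C" "Src C g = Tgt C f" "c \<in> carrier K"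
  shows "g \<cdot> (c \<star> f) = c \<star> (g \<cdot> f)"
  using Cmp_linear_right[of "Src C f" "Tgt C f" "Tgt C g" g] assms
  unfolding linear_maps_def arrow_smult_def by (simp add: Arr_iff)

lemma Cmp_smult_left:
  assumes "f \<in> Mor C" "g \<in> Mor C" "Src C g = Tgt C f" "c \<in> carrier K"
  shows "(c \<star> g) \<cdot> f = c \<star> (g \<cdot> f)"
  using Cmp_linear_left[of "Src C f" "Tgt C f" "Tgt C g" f] assms
  unfolding linear_maps_def arrow_smult_def by (simp add: Arr_iff)

text \<open>Membership in \<open>linear_maps\<close> asserts additivity only; zero and differences
  follow by cancellation in the target group. Composition on either side and linear functors are all
  instances.\<close>

lemma linear_maps_add_hom:
  assumes "A \<in> Obj C" "B \<in> Obj C" "abelian_group N" "\<phi> \<in> linear_maps K (Hom C A B) N"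
  shows "\<phi> (nul A B) = \<zero>\<^bsub>N\<^esub>"
    and "f \<Colon> A \<rightarrow> B \<Longrightarrow> g \<Colon> A \<rightarrow> B \<Longrightarrow> \<phi> (f \<boxminus> g) = \<phi> f \<ominus>\<^bsub>N\<^esub> \<phi> g"
proof -
  interpret H: abelian_group "Hom C A B" by (rule Hom_group[OF assms(1,2)])
  interpret N: abelian_group N by fact
  have cl: "\<And>f. f \<in> Arr C A B \<Longrightarrow> \<phi> f \<in> carrier N"
    and ad: "\<And>f g. f \<in> Arr C A B \<Longrightarrow> g \<in> Arr C A B \<Longrightarrow> \<phi> (f \<oplus>\<^bsub>Hom C A B\<^esub> g) = \<phi> f \<oplus>\<^bsub>N\<^esub> \<phi> g"
    using assms(4) unfolding linear_maps_def by auto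
  show z: "\<phi> (nul A B) = \<zero>\<^bsub>N\<^esub>"
    using ad[OF H.zero_closed H.zero_closed] cl[OF H.zero_closed]
    by (metis H.l_zero H.zero_closed N.add.l_cancel_one')
  show "\<phi> (f \<boxminus> g) = \<phi> f \<ominus>\<^bsub>N\<^esub> \<phi> g" if "f \<Colon> A \<rightarrow> B" "g \<Colon> A \<rightarrow> B"
  proof -
    have fg: "f \<in> Arr C A B" "g \<in> Arr C A B" using ArrI[OF that(1)] ArrI[OF that(2)] .
    have "\<phi> (f \<ominus>\<^bsub>Hom C A B\<^esub> g) \<oplus>\<^bsub>N\<^esub> \<phi> g = \<phi> f"
      using fg ad[of "f \<ominus>\<^bsub>Hom C A B\<^esub> g" g, symmetric]
      by (simp add: H.minus_eq H.add.m_assoc H.l_neg)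
    then show ?thesis
      using fg that cl minus_Hom[of f A B g]
      by (metis H.minus_closed N.add.inv_solve_right' N.minus_eq)
  qed
qed

lemma Cmp_nul [simp]:
  assumes "g \<in> Mor C" "A \<in> Obj C" "Src C g = B"
  shows "g \<cdot> nul A B = nul A (Tgt C g)"
  using linear_maps_add_hom(1)[OF _ _ Hom_group Cmp_linear_right[of A B "Tgt C g" g]] assms
  by (auto simp: Arr_iff)

lemma nul_Cmp [simp]:
  assumes "f \<in> Mor C" "D \<in> Obj C" "Tgt C f = B"
  shows "nul B D \<cdot> f = nul (Src C f) D"
  using linear_maps_add_hom(1)[OF _ _ Hom_group Cmp_linear_left[of "Src C f" B D f]] assms
  by (auto simp: Arr_iff)

lemma Cmp_minus_right:
  assumes "f \<in> Mor C" "f' \<in> Mor C" "g \<in> Mor C" "Src C f' = Src C f" "Tgt C f' = Tgt C f" "Src C g = Tgt C f"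
  shows "g \<cdot> (f \<boxminus> f') = g \<cdot> f \<boxminus> g \<cdot> f'"
  using linear_maps_add_hom(2)[OF _ _ Hom_group Cmp_linear_right[of "Src C f" "Tgt C f" "Tgt C g" g], of f f'] assms
  by (simp add: Arr_iff minus_Hom)

lemma Cmp_minus_left:
  assumes "g \<in> Mor C" "g' \<in> Mor C" "f \<in> Mor C" "Src C g' = Src C g" "Tgt C g' = Tgt C g" "Src C g = Tgt C f"
  shows "(g \<boxminus> g') \<cdot> f = g \<cdot> f \<boxminus> g' \<cdot> f"
  using linear_maps_add_hom(2)[OF _ _ Hom_group Cmp_linear_left[of "Src C f" "Tgt C f" "Tgt C g" f], of g g'] assms
  by (simp add: Arr_iff minus_Hom)

lemmas Cmp_distrib = Cmp_plus_right Cmp_plus_left Cmp_minus_right Cmp_minus_left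

lemma minus_eq_nul:
  assumes "f \<Colon> A \<rightarrow> B" "g \<Colon> A \<rightarrow> B"
  shows "f \<boxminus> g = nul A B \<longleftrightarrow> f = g"
proof -
  interpret abelian_group "Hom C A B" by (rule Hom_group) (use assms in auto)
  have fg: "f \<in> Arr C A B" "g \<in> Arr C A B" using ArrI[OF assms(1)] ArrI[OF assms(2)] .
  have "f \<ominus>\<^bsub>Hom C A B\<^esub> g = nul A B \<longleftrightarrow> f \<oplus>\<^bsub>Hom C A B\<^esub> \<ominus>\<^bsub>Hom C A B\<^esub> g = g \<oplus>\<^bsub>Hom C A B\<^esub> \<ominus>\<^bsub>Hom C A B\<^esub> g"
    using fg by (simp add: minus_eq r_neg)
  also have "\<dots> \<longleftrightarrow> f = g"
    using fg by (simp add: add.right_cancel)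
  finally show ?thesis using assms minus_Hom by metis
qed

lemma minus_self [simp]: "f \<in> Mor C \<Longrightarrow> f \<boxminus> f = nul (Src C f) (Tgt C f)"
  by (simp add: minus_eq_nul)

lemma
  assumes "f \<Colon> A \<rightarrow> B"
  shows plus_nul [simp]: "f \<boxplus> nul A B = f" and nul_plus [simp]: "nul A B \<boxplus> f = f"
    and minus_nul [simp]: "f \<boxminus> nul A B = f"
proof -
  interpret abelian_group "Hom C A B" by (rule Hom_group) (use assms in auto)
  show "f \<boxplus> nul A B = f" "nul A B \<boxplus> f = f" "f \<boxminus> nul A B = f"
    unfolding arrow_minus_def arrow_plus_def using assms ArrI[OF assms(1)]
    by (simp_all add: minus_eq)
qed

lemma
  assumes "f \<Colon> A \<rightarrow> B" "g \<Colon> A \<rightarrow> B"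
  shows minus_plus_cancel: "(f \<boxminus> g) \<boxplus> g = f" and plus_minus_cancel: "(f \<boxplus> g) \<boxminus> g = f"
    and minus_minus_cancel: "f \<boxminus> (f \<boxminus> g) = g" and plus_commute: "f \<boxplus> g = g \<boxplus> f"
proof -
  interpret abelian_group "Hom C A B" by (rule Hom_group) (use assms in auto)
  have *: "f \<boxminus> g = f \<ominus>\<^bsub>Hom C A B\<^esub> g" "\<And>h. f \<boxminus> h = f \<ominus>\<^bsub>Hom C A B\<^esub> h" "f \<boxplus> g = f \<oplus>\<^bsub>Hom C A B\<^esub> g"
     "g \<boxplus> f = g \<oplus>\<^bsub>Hom C A B\<^esub> f" "\<And>h. (f \<boxminus> g) \<boxplus> h = (f \<boxminus> g) \<oplus>\<^bsub>Hom C A B\<^esub> h" "\<And>h. (f \<boxplus> g) \<boxminus> h = (f \<boxplus> g) \<ominus>\<^bsub>Hom C A B\<^esub> h"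
    using assms by (auto simp: plus_Hom minus_Hom)
  have fg: "f \<in> Arr C A B" "g \<in> Arr C A B" using ArrI[OF assms(1)] ArrI[OF assms(2)] .
  show "f \<boxplus> g = g \<boxplus> f"
    unfolding * using fg by (simp add: add.m_comm)
  show "(f \<boxminus> g) \<boxplus> g = f"
    unfolding *(5)[of g] unfolding *(1) using fg by (simp add: minus_eq add.m_assoc l_neg)
  show "(f \<boxplus> g) \<boxminus> g = f"
    unfolding *(6)[of g] unfolding *(3) using fg by (simp add: minus_eq add.m_assoc r_neg)
  show "f \<boxminus> (f \<boxminus> g) = g"
    unfolding *(2) using fg by (simp add: minus_eq minus_add add.m_assoc[symmetric] r_neg)
qed

lemma plus_eq_iff_minus:
  assumes "f \<Colon> A \<rightarrow> B" "g \<Colon> A \<rightarrow> B" "h \<Colon> A \<rightarrow> B"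
  shows "f \<boxplus> g = h \<longleftrightarrow> f = h \<boxminus> g"
  using minus_plus_cancel[OF assms(3,2)] plus_minus_cancel[OF assms(1,2)] by auto

lemma is_isoI: "f \<Colon> A \<rightarrow> B \<Longrightarrow> g \<Colon> B \<rightarrow> A \<Longrightarrow> g \<cdot> f = Idt C A \<Longrightarrow> f \<cdot> g = Idt C B \<Longrightarrow> is_iso C A B f"
  unfolding is_iso_def using ArrI by blast

lemma is_isoE:
  assumes "is_iso C A B f" "A \<in> Obj C" "B \<in> Obj C"
  obtains g where "f \<Colon> A \<rightarrow> B" "g \<Colon> B \<rightarrow> A" "g \<cdot> f = Idt C A" "f \<cdot> g = Idt C B"
  using assms ArrD unfolding is_iso_def by blast

lemma isomorphicE:
  assumes "isomorphic C A B" "A \<in> Obj C" "B \<in> Obj C"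
  obtains f g where "f \<Colon> A \<rightarrow> B" "g \<Colon> B \<rightarrow> A" "g \<cdot> f = Idt C A" "f \<cdot> g = Idt C B"
  using assms is_isoE unfolding isomorphic_def by metis

lemma isomorphicI: "f \<Colon> A \<rightarrow> B \<Longrightarrow> g \<Colon> B \<rightarrow> A \<Longrightarrow> g \<cdot> f = Idt C A \<Longrightarrow> f \<cdot> g = Idt C B \<Longrightarrow> isomorphic C A B"
  unfolding isomorphic_def using is_isoI by blast

lemma isomorphic_refl [simp]: "A \<in> Obj C \<Longrightarrow> isomorphic C A A"
  by (rule isomorphicI[of "Idt C A" _ _ "Idt C A"]) simp_all

lemma isomorphic_sym: "isomorphic C A B \<Longrightarrow> A \<in> Obj C \<Longrightarrow> B \<in> Obj C \<Longrightarrow> isomorphic C B A"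
  by (metis isomorphicE isomorphicI)

lemma isomorphic_trans:
  assumes "isomorphic C A B" "isomorphic C B D" "A \<in> Obj C" "B \<in> Obj C" "D \<in> Obj C"
  shows "isomorphic C A D"
proof -
  obtain f g where f: "f \<Colon> A \<rightarrow> B" "g \<Colon> B \<rightarrow> A" "g \<cdot> f = Idt C A" "f \<cdot> g = Idt C B"
    using isomorphicE[OF assms(1,3,4)] .
  obtain f' g' where f': "f' \<Colon> B \<rightarrow> D" "g' \<Colon> D \<rightarrow> B" "g' \<cdot> f' = Idt C B" "f' \<cdot> g' = Idt C D"
    using isomorphicE[OF assms(2,4,5)] .
  show ?thesis
    by (rule isomorphicI[of "f' \<cdot> f" _ _ "g \<cdot> g'"])
      (use f f' in \<open>simp_all add: Cmp_eq_Cmp[of g' f'] Cmp_eq_Cmp[of f g]\<close>)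
qed

lemma iso_left_cancel:
  assumes "is_iso C A B u" "A \<in> Obj C" "B \<in> Obj C" "f \<in> Mor C" "g \<in> Mor C" "Tgt C f = A" "Tgt C g = A"
    "u \<cdot> f = u \<cdot> g"
  shows "f = g"
proof -
  obtain v where v: "u \<Colon> A \<rightarrow> B" "v \<Colon> B \<rightarrow> A" "v \<cdot> u = Idt C A" using is_isoE assms by metis
  have "v \<cdot> (u \<cdot> f) = f" "v \<cdot> (u \<cdot> g) = g"
    using v(1,2) assms(4-7) by (simp_all add: Cmp_eq_Cmp[OF v(3)])
  then show ?thesis using assms(8) by metis
qed

lemma is_zero_obj_iff: "is_zero_obj C Z \<longleftrightarrow> Z \<in> Obj C \<and> Idt C Z = nul Z Z"
proof
  assume "is_zero_obj C Z"
  then show "Z \<in> Obj C \<and> Idt C Z = nul Z Z"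
    unfolding is_zero_obj_def using Idt_closed[of Z] by auto
next
  assume Z: "Z \<in> Obj C \<and> Idt C Z = nul Z Z"
  have "f = nul A Z" if "f \<Colon> A \<rightarrow> Z" for f A
    using that Z Idt_Cmp'[of f Z] nul_Cmp[of f Z Z] by simp
  moreover have "f = nul Z A" if "f \<Colon> Z \<rightarrow> A" for f A
    using that Z Cmp_Idt'[of f Z] Cmp_nul[of f Z Z] by simp
  ultimately show "is_zero_obj C Z" unfolding is_zero_obj_def using Z by (auto simp: Arr_iff)
qed

lemma zero_obj_to: "is_zero_obj C Z \<Longrightarrow> f \<Colon> A \<rightarrow> Z \<Longrightarrow> f = nul A Z"
  and zero_obj_from: "is_zero_obj C Z \<Longrightarrow> f \<Colon> Z \<rightarrow> A \<Longrightarrow> f = nul Z A"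
  unfolding is_zero_obj_def using ArrI by blast+

section \<open>Vanishing hom-sets, direct sums and summands\<close>

lemma Arr_null_iff: "A \<in> Obj C \<Longrightarrow> B \<in> Obj C \<Longrightarrow> Arr C A B = {nul A B} \<longleftrightarrow> (\<forall>f. f \<Colon> A \<rightarrow> B \<longrightarrow> f = nul A B)"
  using in_nul[of A B] by (auto simp: Arr_iff set_eq_iff)

definition hom_null :: "'o \<Rightarrow> 'o \<Rightarrow> bool"
  where "hom_null A B \<longleftrightarrow> (\<forall>f. f \<Colon> A \<rightarrow> B \<longrightarrow> f = nul A B)"

lemma hom_nullD: "hom_null A B \<Longrightarrow> f \<Colon> A \<rightarrow> B \<Longrightarrow> f = nul A B"
  unfolding hom_null_def by blast

lemma hom_null_iso:
  assumes "isomorphic C A A'" "isomorphic C B B'" "A \<in> Obj C" "B \<in> Obj C" "A' \<in> Obj C" "B' \<in> Obj C" "hom_null A B"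
  shows "hom_null A' B'"
  unfolding hom_null_def
proof (intro allI impI)
  fix f assume f: "f \<Colon> A' \<rightarrow> B'"
  obtain a a' where a: "a \<Colon> A \<rightarrow> A'" "a' \<Colon> A' \<rightarrow> A" "a' \<cdot> a = Idt C A" "a \<cdot> a' = Idt C A'"
    using isomorphicE[OF assms(1,3,5)] .
  obtain b b' where b: "b \<Colon> B \<rightarrow> B'" "b' \<Colon> B' \<rightarrow> B" "b' \<cdot> b = Idt C B" "b \<cdot> b' = Idt C B'"
    using isomorphicE[OF assms(2,4,6)] .
  have "b' \<cdot> f \<cdot> a = nul A B" using hom_nullD[OF assms(7)] a b f by simp
  then have "b \<cdot> (b' \<cdot> f \<cdot> a) \<cdot> a' = nul A' B'" using a b f by simp
  then show "f = nul A' B'" using a b f by (simp add: Cmp_eq_Cmp[OF b(4)])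
qed

lemma is_direct_sumE:
  assumes "is_direct_sum C A B S"
  obtains i j p q where "i \<Colon> A \<rightarrow> S" "j \<Colon> B \<rightarrow> S" "p \<Colon> S \<rightarrow> A" "q \<Colon> S \<rightarrow> B"
    "p \<cdot> i = Idt C A" "q \<cdot> j = Idt C B" "p \<cdot> j = nul B A" "q \<cdot> i = nul A B" "i \<cdot> p \<boxplus> j \<cdot> q = Idt C S"
proof -
  obtain i j p q where *: "A \<in> Obj C" "B \<in> Obj C" "S \<in> Obj C" "i \<in> Arr C A S" "j \<in> Arr C B S" "p \<in> Arr C S A" "q \<in> Arr C S B"
    "p \<cdot> i = Idt C A" "q \<cdot> j = Idt C B" "p \<cdot> j = nul B A" "q \<cdot> i = nul A B" "(i \<cdot> p) \<oplus>\<^bsub>Hom C S S\<^esub> (j \<cdot> q) = Idt C S"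
    using assms unfolding is_direct_sum_def by blast
  then have t: "i \<Colon> A \<rightarrow> S" "j \<Colon> B \<rightarrow> S" "p \<Colon> S \<rightarrow> A" "q \<Colon> S \<rightarrow> B" by (auto simp: Arr_iff)
  then have "i \<cdot> p \<boxplus> j \<cdot> q = Idt C S" using *(12) plus_Hom[of "i \<cdot> p" S S "j \<cdot> q"] by simp
  then show thesis using that t * by blast
qed

lemma is_direct_sumI:
  assumes "i \<Colon> A \<rightarrow> S" "j \<Colon> B \<rightarrow> S" "p \<Colon> S \<rightarrow> A" "q \<Colon> S \<rightarrow> B"
    "p \<cdot> i = Idt C A" "q \<cdot> j = Idt C B" "p \<cdot> j = nul B A" "q \<cdot> i = nul A B" "i \<cdot> p \<boxplus> j \<cdot> q = Idt C S"
  shows "is_direct_sum C A B S"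
proof -
  have "(i \<cdot> p) \<oplus>\<^bsub>Hom C S S\<^esub> (j \<cdot> q) = Idt C S"
    using assms plus_Hom[of "i \<cdot> p" S S "j \<cdot> q"] by simp
  then have "\<exists>i\<in>Arr C A S. \<exists>j\<in>Arr C B S. \<exists>p\<in>Arr C S A. \<exists>q\<in>Arr C S B.
       p \<cdot> i = Idt C A \<and> q \<cdot> j = Idt C B \<and> p \<cdot> j = nul B A \<and> q \<cdot> i = nul A B \<and>
       (i \<cdot> p) \<oplus>\<^bsub>Hom C S S\<^esub> (j \<cdot> q) = Idt C S"
    by (intro bexI[OF _ ArrI[OF assms(1)]] bexI[OF _ ArrI[OF assms(2)]] bexI[OF _ ArrI[OF assms(3)]]
        bexI[OF _ ArrI[OF assms(4)]] conjI assms)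
  then show ?thesis unfolding is_direct_sum_def using assms(1,2) by simp
qed

lemma direct_summandE:
  assumes "direct_summand C A S"
  obtains i p where "i \<Colon> A \<rightarrow> S" "p \<Colon> S \<rightarrow> A" "p \<cdot> i = Idt C A"
  using assms is_direct_sumE unfolding direct_summand_def by metis

text \<open>The complement is the object that splits the idempotent
  \<open>Idt C S \<boxminus> i \<cdot> p\<close>. The two mixed composites vanish because this
  idempotent annihilates \<open>i\<close> and is annihilated by \<open>p\<close>.\<close>

lemma direct_summandI:
  assumes "split_idempotents C" "i \<Colon> A \<rightarrow> S" "p \<Colon> S \<rightarrow> A" "p \<cdot> i = Idt C A"
  shows "direct_summand C A S"
proof -
  define e where "e = Idt C S \<boxminus> i \<cdot> p"
  have e: "e \<Colon> S \<rightarrow> S" unfolding e_def using assms by simp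
  have pe: "p \<cdot> e = nul S A" unfolding e_def using assms
    by (simp add: Cmp_distrib Cmp_eq_Cmp[OF assms(4)])
  have ei: "e \<cdot> i = nul A S" unfolding e_def using assms by (simp add: Cmp_distrib)
  have "e \<cdot> e = e"
    using assms e pe by (subst (1) e_def) (simp add: Cmp_distrib)
  then obtain B q j where B: "B \<in> Obj C" "q \<in> Arr C S B" "j \<in> Arr C B S" "j \<cdot> q = e" "q \<cdot> j = Idt C B"
    using assms(1,2) e ArrI[OF e] unfolding split_idempotents_def by blast
  then have t: "q \<Colon> S \<rightarrow> B" "j \<Colon> B \<rightarrow> S" using assms by (auto simp: Arr_iff)
  have "j \<cdot> (q \<cdot> i) = nul A S" using B(4) ei t assms Cmp_eq_Cmp[of j q e i] by simp
  then have "q \<cdot> (j \<cdot> (q \<cdot> i)) = nul A B" using t assms by simp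
  then have qi: "q \<cdot> i = nul A B" using t assms Cmp_eq_Cmp[OF B(5), of "q \<cdot> i"] by simp
  have "(p \<cdot> j) \<cdot> q = nul S A" using B(4) pe t assms by simp
  then have "((p \<cdot> j) \<cdot> q) \<cdot> j = nul B A" using t assms by simp
  then have pj: "p \<cdot> j = nul B A" using t assms B(5) by simp
  have "i \<cdot> p \<boxplus> j \<cdot> q = Idt C S" unfolding B(4) e_def
    using assms plus_commute[of "i \<cdot> p" S S] minus_plus_cancel[of "Idt C S" S S] by simp
  then have "is_direct_sum C A B S" using is_direct_sumI[of i A S j B p q] t assms qi pj B(5) by simp
  then show ?thesis unfolding direct_summand_def by blast
qed

section \<open>Epimorphisms in a linear category\<close>

lemma epi_iff:
  assumes "f \<Colon> A \<rightarrow> B"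
  shows "epi C A B f \<longleftrightarrow> (\<forall>D g. g \<Colon> B \<rightarrow> D \<longrightarrow> g \<cdot> f = nul A D \<longrightarrow> g = nul B D)"
proof
  assume l: "epi C A B f"
  show "\<forall>D g. g \<Colon> B \<rightarrow> D \<longrightarrow> g \<cdot> f = nul A D \<longrightarrow> g = nul B D"
  proof (intro allI impI)
    fix D g assume g: "g \<Colon> B \<rightarrow> D" "g \<cdot> f = nul A D"
    then have "g \<cdot> f = nul B D \<cdot> f" using assms by simp
    then show "g = nul B D" using l g unfolding epi_def by (auto simp: Arr_iff)
  qed
next
  assume r: "\<forall>D g. g \<Colon> B \<rightarrow> D \<longrightarrow> g \<cdot> f = nul A D \<longrightarrow> g = nul B D"
  show "epi C A B f" unfolding epi_def
  proof (intro conjI ballI impI)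
    show "f \<in> Arr C A B" using ArrI[OF assms] .
    fix D g h assume *: "D \<in> Obj C" "g \<in> Arr C B D" "h \<in> Arr C B D" "g \<cdot> f = h \<cdot> f"
    then have t: "g \<Colon> B \<rightarrow> D" "h \<Colon> B \<rightarrow> D" using assms by (auto simp: Arr_iff)
    have "(g \<boxminus> h) \<cdot> f = nul A D" using t * assms by (simp add: Cmp_distrib)
    then have "g \<boxminus> h = nul B D" using r[THEN spec, THEN spec, of "g \<boxminus> h" D] t by simp
    then show "g = h" using minus_eq_nul t by blast
  qed
qed

lemma epiD:
  assumes "epi C A B f" "f \<Colon> A \<rightarrow> B" "g \<Colon> B \<rightarrow> D" "g \<cdot> f = nul A D"
  shows "g = nul B D"
proof -
  have 1: "\<forall>D g. g \<Colon> B \<rightarrow> D \<longrightarrow> g \<cdot> f = nul A D \<longrightarrow> g = nul B D" by (rule epi_iff[OF assms(2), THEN iffD1, OF assms(1)])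
  show ?thesis by (rule 1[THEN spec, THEN spec, THEN mp, THEN mp, OF assms(3,4)])
qed

lemma epi_cancel:
  assumes "epi C A B f" "g \<Colon> B \<rightarrow> D" "h \<Colon> B \<rightarrow> D" "g \<cdot> f = h \<cdot> f"
  shows "g = h"
proof -
  have 1: "\<forall>D\<in>Obj C. \<forall>g\<in>Arr C B D. \<forall>h\<in>Arr C B D. g \<cdot> f = h \<cdot> f \<longrightarrow> g = h" by (rule assms(1)[unfolded epi_def, THEN conjunct2])
  have D: "D \<in> Obj C" using assms(2) by simp
  show ?thesis by (rule 1[THEN bspec, OF D, THEN bspec, OF ArrI[OF assms(2)], THEN bspec, OF ArrI[OF assms(3)], THEN mp, OF assms(4)])
qed

end

section \<open>Finite-dimensional linear algebra\<close>

locale vector_space_over = module K V + field K for K :: "('k, 'r) ring_scheme" and V :: "('k, 'a, 'v) module_scheme"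
begin

definition subsp :: "'a set \<Rightarrow> bool"
  where "subsp W \<longleftrightarrow> W \<subseteq> carrier V \<and> \<zero>\<^bsub>V\<^esub> \<in> W \<and> (\<forall>x\<in>W. \<forall>y\<in>W. x \<oplus>\<^bsub>V\<^esub> y \<in> W) \<and>
    (\<forall>c\<in>carrier K. \<forall>x\<in>W. c \<odot>\<^bsub>V\<^esub> x \<in> W)"

definition adjoin :: "'a set \<Rightarrow> 'a \<Rightarrow> 'a set"
  where "adjoin W v = {w \<oplus>\<^bsub>V\<^esub> c \<odot>\<^bsub>V\<^esub> v | w c. w \<in> W \<and> c \<in> carrier K}"

lemma subspD:
  assumes "subsp W"
  shows "x \<in> W \<Longrightarrow> x \<in> carrier V" "\<zero>\<^bsub>V\<^esub> \<in> W" "x \<in> W \<Longrightarrow> y \<in> W \<Longrightarrow> x \<oplus>\<^bsub>V\<^esub> y \<in> W"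
    "c \<in> carrier K \<Longrightarrow> x \<in> W \<Longrightarrow> c \<odot>\<^bsub>V\<^esub> x \<in> W"
  using assms unfolding subsp_def by blast+

lemma subsp_neg: "subsp W \<Longrightarrow> x \<in> W \<Longrightarrow> \<ominus>\<^bsub>V\<^esub> x \<in> W"
  using subspD(4)[of W "\<ominus>\<^bsub>K\<^esub> \<one>\<^bsub>K\<^esub>" x] subspD(1)[of W x] smult_l_minus[of "\<one>\<^bsub>K\<^esub>" x] by simp

lemma subsp_minus: "subsp W \<Longrightarrow> x \<in> W \<Longrightarrow> y \<in> W \<Longrightarrow> x \<ominus>\<^bsub>V\<^esub> y \<in> W"
  using subsp_neg subspD(3) by (simp add: M.minus_eq)

lemma subsp_inter: "subsp W \<Longrightarrow> subsp U \<Longrightarrow> subsp (W \<inter> U)"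
  unfolding subsp_def by blast

lemma smult_unit_cancel:
  assumes "c \<in> carrier K" "c \<noteq> \<zero>\<^bsub>K\<^esub>" "v \<in> carrier V" "subsp W" "c \<odot>\<^bsub>V\<^esub> v \<in> W"
  shows "v \<in> W"
proof -
  have c: "inv\<^bsub>K\<^esub> c \<in> carrier K" "inv\<^bsub>K\<^esub> c \<otimes>\<^bsub>K\<^esub> c = \<one>\<^bsub>K\<^esub>" using assms field_Units by auto
  then have "inv\<^bsub>K\<^esub> c \<odot>\<^bsub>V\<^esub> (c \<odot>\<^bsub>V\<^esub> v) = v" using assms smult_assoc1[of "inv\<^bsub>K\<^esub> c" c v] by simp
  then show ?thesis using subspD(4)[OF assms(4) c(1) assms(5)] by simp
qed

lemma add_swap:
  assumes "a \<in> carrier V" "b \<in> carrier V" "c \<in> carrier V" "d \<in> carrier V"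
  shows "(a \<oplus>\<^bsub>V\<^esub> b) \<oplus>\<^bsub>V\<^esub> (c \<oplus>\<^bsub>V\<^esub> d) = (a \<oplus>\<^bsub>V\<^esub> c) \<oplus>\<^bsub>V\<^esub> (b \<oplus>\<^bsub>V\<^esub> d)"
  using assms by (simp add: M.add.m_ac)

lemma adjoin_add:
  assumes "subsp W" "v \<in> carrier V" "w \<in> W" "w' \<in> W" "c \<in> carrier K" "c' \<in> carrier K"
  shows "(w \<oplus>\<^bsub>V\<^esub> c \<odot>\<^bsub>V\<^esub> v) \<oplus>\<^bsub>V\<^esub> (w' \<oplus>\<^bsub>V\<^esub> c' \<odot>\<^bsub>V\<^esub> v) = (w \<oplus>\<^bsub>V\<^esub> w') \<oplus>\<^bsub>V\<^esub> (c \<oplus>\<^bsub>K\<^esub> c') \<odot>\<^bsub>V\<^esub> v"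
  using assms subspD(1)[OF assms(1)] by (simp add: add_swap smult_l_distr)

lemma adjoin_smult:
  assumes "subsp W" "v \<in> carrier V" "w \<in> W" "c \<in> carrier K" "d \<in> carrier K"
  shows "d \<odot>\<^bsub>V\<^esub> (w \<oplus>\<^bsub>V\<^esub> c \<odot>\<^bsub>V\<^esub> v) = d \<odot>\<^bsub>V\<^esub> w \<oplus>\<^bsub>V\<^esub> (d \<otimes>\<^bsub>K\<^esub> c) \<odot>\<^bsub>V\<^esub> v"
  using assms subspD(1)[OF assms(1)] by (simp add: smult_r_distr smult_assoc1)

lemma adjoin_mem: "w \<in> W \<Longrightarrow> c \<in> carrier K \<Longrightarrow> w \<oplus>\<^bsub>V\<^esub> c \<odot>\<^bsub>V\<^esub> v \<in> adjoin W v"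
  unfolding adjoin_def by blast

lemma adjoinE:
  assumes "x \<in> adjoin W v"
  obtains w c where "w \<in> W" "c \<in> carrier K" "x = w \<oplus>\<^bsub>V\<^esub> c \<odot>\<^bsub>V\<^esub> v"
  using assms unfolding adjoin_def by blast

lemma subset_adjoin:
  assumes "subsp W" "v \<in> carrier V"
  shows "W \<subseteq> adjoin W v" "v \<in> adjoin W v"
proof -
  show "W \<subseteq> adjoin W v"
  proof
    fix w assume "w \<in> W"
    then show "w \<in> adjoin W v" using adjoin_mem[of w W "\<zero>\<^bsub>K\<^esub>" v] subspD(1)[OF assms(1)] assms(2) by simp
  qed
  show "v \<in> adjoin W v"
    using adjoin_mem[OF subspD(2)[OF assms(1)], of "\<one>\<^bsub>K\<^esub>" v] assms(2) by simp
qed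

lemma subsp_adjoin:
  assumes "subsp W" "v \<in> carrier V"
  shows "subsp (adjoin W v)"
  unfolding subsp_def
proof (intro conjI ballI)
  show "adjoin W v \<subseteq> carrier V" using subspD(1)[OF assms(1)] assms(2) by (auto elim!: adjoinE)
  show "\<zero>\<^bsub>V\<^esub> \<in> adjoin W v" using subset_adjoin[OF assms] subspD(2)[OF assms(1)] by blast
next
  fix x y assume "x \<in> adjoin W v" "y \<in> adjoin W v"
  then show "x \<oplus>\<^bsub>V\<^esub> y \<in> adjoin W v"
    by (auto elim!: adjoinE simp: adjoin_add[OF assms] intro!: adjoin_mem subspD(3)[OF assms(1)])
next
  fix c x assume "c \<in> carrier K" "x \<in> adjoin W v"
  then show "c \<odot>\<^bsub>V\<^esub> x \<in> adjoin W v"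
    by (auto elim!: adjoinE simp: adjoin_smult[OF assms] intro!: adjoin_mem subspD(4)[OF assms(1)])
qed

lemma minus_zero_eq:
  assumes "c \<in> carrier K" "d \<in> carrier K" "c \<ominus>\<^bsub>K\<^esub> d = \<zero>\<^bsub>K\<^esub>"
  shows "c = d"
proof -
  have "c \<oplus>\<^bsub>K\<^esub> \<ominus>\<^bsub>K\<^esub> d = d \<oplus>\<^bsub>K\<^esub> \<ominus>\<^bsub>K\<^esub> d" using assms by (simp add: R.minus_eq R.r_neg)
  then show ?thesis using assms(1,2) by (simp add: R.add.right_cancel)
qed

text \<open>If the coefficients of \<open>v\<close> differed, their difference would be a unit that
  moves \<open>v\<close> into \<open>W\<close>. Hence the coefficients agree, and then so do the
  components in \<open>W\<close>.\<close>

lemma adjoin_unique: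
  assumes "subsp W" "v \<in> carrier V" "v \<notin> W" "w \<in> W" "w' \<in> W" "c \<in> carrier K" "c' \<in> carrier K"
    "w \<oplus>\<^bsub>V\<^esub> c \<odot>\<^bsub>V\<^esub> v = w' \<oplus>\<^bsub>V\<^esub> c' \<odot>\<^bsub>V\<^esub> v"
  shows "w = w'"
proof -
  have cl: "w \<in> carrier V" "w' \<in> carrier V" using assms subspD by blast+
  have "(c \<ominus>\<^bsub>K\<^esub> c') \<odot>\<^bsub>V\<^esub> v = c \<odot>\<^bsub>V\<^esub> v \<ominus>\<^bsub>V\<^esub> c' \<odot>\<^bsub>V\<^esub> v"
    using assms by (simp add: R.minus_eq M.minus_eq smult_l_distr smult_l_minus)
  also have "c \<odot>\<^bsub>V\<^esub> v = (w' \<oplus>\<^bsub>V\<^esub> c' \<odot>\<^bsub>V\<^esub> v) \<ominus>\<^bsub>V\<^esub> w"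
    using assms(2,6) cl by (simp add: assms(8)[symmetric] M.minus_eq M.add.m_ac M.r_neg1 M.r_neg2)
  also have "\<dots> \<ominus>\<^bsub>V\<^esub> c' \<odot>\<^bsub>V\<^esub> v = w' \<ominus>\<^bsub>V\<^esub> w"
  proof -
    have "\<dots> \<ominus>\<^bsub>V\<^esub> c' \<odot>\<^bsub>V\<^esub> v = (w' \<ominus>\<^bsub>V\<^esub> w) \<oplus>\<^bsub>V\<^esub> (c' \<odot>\<^bsub>V\<^esub> v \<oplus>\<^bsub>V\<^esub> \<ominus>\<^bsub>V\<^esub> (c' \<odot>\<^bsub>V\<^esub> v))"
      using assms(2,7) cl by (simp only: M.minus_eq M.add.m_ac smult_closed M.a_inv_closed M.a_closed)
    then show ?thesis using assms(2,7) cl by (simp add: M.r_neg M.minus_eq)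
  qed
  finally have "(c \<ominus>\<^bsub>K\<^esub> c') \<odot>\<^bsub>V\<^esub> v \<in> W" using subsp_minus[OF assms(1) assms(5,4)] by simp
  then have "c \<ominus>\<^bsub>K\<^esub> c' = \<zero>\<^bsub>K\<^esub>" using smult_unit_cancel[of "c \<ominus>\<^bsub>K\<^esub> c'" v W] assms by auto
  then have "c = c'" using assms minus_zero_eq by auto
  then show ?thesis using assms(2,6,8) cl by simp
qed

lemma subsp_finsum: "finite B \<Longrightarrow> subsp W \<Longrightarrow> B \<subseteq> W \<Longrightarrow> a \<in> B \<rightarrow> carrier K \<Longrightarrow> (\<Oplus>\<^bsub>V\<^esub>b\<in>B. a b \<odot>\<^bsub>V\<^esub> b) \<in> W"
proof (induction B rule: finite_induct)
  case (insert b B)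
  have "(\<lambda>b. a b \<odot>\<^bsub>V\<^esub> b) \<in> B \<rightarrow> carrier V" "a b \<odot>\<^bsub>V\<^esub> b \<in> W" using insert subspD(1,4) by (auto simp: Pi_iff)
  then show ?case using insert subspD(1,3)[OF insert(4)] by (auto simp: Pi_iff)
qed (use subspD in simp)

text \<open>Finite-dimensionality enters through this statement: both the extension of functionals
  and the chain condition below adjoin the spanning vectors one at a time and end with the whole
  space.\<close>

lemma spanning_subsp:
  assumes "finite B" "\<forall>v\<in>carrier V. \<exists>a\<in>B \<rightarrow> carrier K. v = (\<Oplus>\<^bsub>V\<^esub>b\<in>B. a b \<odot>\<^bsub>V\<^esub> b)" "subsp W" "B \<subseteq> W"
  shows "W = carrier V"
proof
  show "W \<subseteq> carrier V" using subspD(1)[OF assms(3)] by blast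
  show "carrier V \<subseteq> W"
  proof
    fix v assume "v \<in> carrier V"
    then obtain a where "a \<in> B \<rightarrow> carrier K" "v = (\<Oplus>\<^bsub>V\<^esub>b\<in>B. a b \<odot>\<^bsub>V\<^esub> b)" using assms(2) by blast
    then show "v \<in> W" using subsp_finsum[OF assms(1,3,4)] by simp
  qed
qed

section \<open>Extension of linear functionals\<close>

definition functional_on :: "'a set \<Rightarrow> ('a \<Rightarrow> 'k) \<Rightarrow> bool"
  where "functional_on W \<phi> \<longleftrightarrow> subsp W \<and> (\<forall>x\<in>W. \<phi> x \<in> carrier K) \<and>
    (\<forall>x\<in>W. \<forall>y\<in>W. \<phi> (x \<oplus>\<^bsub>V\<^esub> y) = \<phi> x \<oplus>\<^bsub>K\<^esub> \<phi> y) \<and> (\<forall>c\<in>carrier K. \<forall>x\<in>W. \<phi> (c \<odot>\<^bsub>V\<^esub> x) = c \<otimes>\<^bsub>K\<^esub> \<phi> x)"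

lemma functional_extend_one:
  assumes f: "functional_on W \<phi>" and v: "v \<in> carrier V"
  shows "\<exists>W' \<psi>. functional_on W' \<psi> \<and> W \<subseteq> W' \<and> v \<in> W' \<and> (\<forall>x\<in>W. \<psi> x = \<phi> x)"
proof (cases "v \<in> W")
  case True then show ?thesis using f by blast
next
  case False
  have s: "subsp W" using f unfolding functional_on_def by simp
  \<comment> \<open>The extension is zero on \<open>v\<close>: it evaluates \<open>\<phi>\<close> at
    the component in \<open>W\<close>, which is unique because \<open>v\<close> lies outside
    \<open>W\<close>.\<close>
  define \<psi> where "\<psi> x = \<phi> (SOME w. w \<in> W \<and> (\<exists>c\<in>carrier K. x = w \<oplus>\<^bsub>V\<^esub> c \<odot>\<^bsub>V\<^esub> v))" for x
  have \<psi>: "\<psi> (w \<oplus>\<^bsub>V\<^esub> c \<odot>\<^bsub>V\<^esub> v) = \<phi> w" if "w \<in> W" "c \<in> carrier K" for w c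
  proof -
    have "(SOME w'. w' \<in> W \<and> (\<exists>c'\<in>carrier K. w \<oplus>\<^bsub>V\<^esub> c \<odot>\<^bsub>V\<^esub> v = w' \<oplus>\<^bsub>V\<^esub> c' \<odot>\<^bsub>V\<^esub> v)) = w"
      using that adjoin_unique[OF s v False] by (intro some_equality) blast+
    then show ?thesis unfolding \<psi>_def by simp
  qed
  have "functional_on (adjoin W v) \<psi>"
    unfolding functional_on_def using subsp_adjoin[OF s v] f subspD[OF s]
    by (auto elim!: adjoinE simp: adjoin_add[OF s v] adjoin_smult[OF s v] \<psi> functional_on_def)
  moreover have "\<forall>x\<in>W. \<psi> x = \<phi> x"
  proof
    fix x assume "x \<in> W"
    then show "\<psi> x = \<phi> x" using \<psi>[of x "\<zero>\<^bsub>K\<^esub>"] subspD(1)[OF s] v by simp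
  qed
  ultimately show ?thesis using subset_adjoin[OF s v] by blast
qed

text \<open>Exactness of vector space duality in the form that Serre duality uses: restriction of
  functionals to a subspace is onto.\<close>

lemma functional_extend:
  assumes "finite_dimensional K V" "functional_on W \<phi>"
  shows "\<exists>\<psi>\<in>carrier (dual_module K V). \<forall>x\<in>W. \<psi> x = \<phi> x"
proof -
  obtain B where B: "finite B" "B \<subseteq> carrier V" "\<forall>v\<in>carrier V. \<exists>a\<in>B \<rightarrow> carrier K. v = (\<Oplus>\<^bsub>V\<^esub>b\<in>B. a b \<odot>\<^bsub>V\<^esub> b)"
    using assms(1) unfolding finite_dimensional_def by blast
  from B(1,2) have "\<exists>W' \<psi>. functional_on W' \<psi> \<and> W \<subseteq> W' \<and> B \<subseteq> W' \<and> (\<forall>x\<in>W. \<psi> x = \<phi> x)"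
  proof (induction B rule: finite_induct)
    case empty then show ?case using assms(2) by blast
  next
    case (insert b B)
    then obtain W1 \<psi>1 where 1: "functional_on W1 \<psi>1" "W \<subseteq> W1" "B \<subseteq> W1" "\<forall>x\<in>W. \<psi>1 x = \<phi> x" by blast
    then show ?case using functional_extend_one[OF 1(1), of b] insert by (metis insert_subset subsetD subset_trans)
  qed
  then obtain W' \<psi> where \<psi>: "functional_on W' \<psi>" "W \<subseteq> W'" "B \<subseteq> W'" "\<forall>x\<in>W. \<psi> x = \<phi> x" by blast
  then have W': "W' = carrier V" using spanning_subsp[OF B(1,3)] unfolding functional_on_def by blast
  have "(\<lambda>x\<in>carrier V. \<psi> x) \<in> carrier (dual_module K V)"
    using \<psi>(1) unfolding W' functional_on_def dual_module_def by auto
  then show ?thesis using \<psi>(2,4) W' by (intro bexI[of _ "\<lambda>x\<in>carrier V. \<psi> x"]) auto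
qed

lemma functional_nonzero:
  assumes "finite_dimensional K V" "v \<in> carrier V" "v \<noteq> \<zero>\<^bsub>V\<^esub>"
  shows "\<exists>\<psi>\<in>carrier (dual_module K V). \<psi> v \<noteq> \<zero>\<^bsub>K\<^esub>"
proof -
  \<comment> \<open>The coordinate on the line through \<open>v\<close>, which takes the value one
    at \<open>v\<close>; it is then extended to the whole space.\<close>
  define \<phi> where "\<phi> x = (THE c. c \<in> carrier K \<and> x = c \<odot>\<^bsub>V\<^esub> v)" for x
  have z: "subsp {\<zero>\<^bsub>V\<^esub>}" unfolding subsp_def by auto
  have uni: "c = d" if "c \<in> carrier K" "d \<in> carrier K" "c \<odot>\<^bsub>V\<^esub> v = d \<odot>\<^bsub>V\<^esub> v" for c d
  proof -
    have "(c \<ominus>\<^bsub>K\<^esub> d) \<odot>\<^bsub>V\<^esub> v = \<zero>\<^bsub>V\<^esub>"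
      using that assms(2) by (simp add: R.minus_eq smult_l_distr smult_l_minus M.r_neg)
    then have "(c \<ominus>\<^bsub>K\<^esub> d) \<odot>\<^bsub>V\<^esub> v \<in> {\<zero>\<^bsub>V\<^esub>}" by simp
    then have "c \<ominus>\<^bsub>K\<^esub> d = \<zero>\<^bsub>K\<^esub>"
      using smult_unit_cancel[of "c \<ominus>\<^bsub>K\<^esub> d" v "{\<zero>\<^bsub>V\<^esub>}", OF R.minus_closed[OF that(1,2)] _ assms(2) z] assms(3) by blast
    then show ?thesis using minus_zero_eq that by blast
  qed
  have \<phi>: "\<phi> (c \<odot>\<^bsub>V\<^esub> v) = c" if "c \<in> carrier K" for c
    unfolding \<phi>_def using that uni by (intro the_equality) auto
  have e: "x \<in> adjoin {\<zero>\<^bsub>V\<^esub>} v \<Longrightarrow> \<exists>c\<in>carrier K. x = c \<odot>\<^bsub>V\<^esub> v" for x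
    using assms(2) by (auto elim!: adjoinE)
  have "functional_on (adjoin {\<zero>\<^bsub>V\<^esub>} v) \<phi>"
    unfolding functional_on_def
  proof (intro conjI ballI subsp_adjoin[OF z assms(2)])
    fix x y assume "x \<in> adjoin {\<zero>\<^bsub>V\<^esub>} v" "y \<in> adjoin {\<zero>\<^bsub>V\<^esub>} v"
    then obtain c d where "c \<in> carrier K" "x = c \<odot>\<^bsub>V\<^esub> v" "d \<in> carrier K" "y = d \<odot>\<^bsub>V\<^esub> v" using e by meson
    then show "\<phi> (x \<oplus>\<^bsub>V\<^esub> y) = \<phi> x \<oplus>\<^bsub>K\<^esub> \<phi> y" using assms(2) by (simp add: smult_l_distr[symmetric] \<phi>)
  next
    fix x c assume "x \<in> adjoin {\<zero>\<^bsub>V\<^esub>} v" "c \<in> carrier K"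
    then obtain d where "c \<in> carrier K" "d \<in> carrier K" "x = d \<odot>\<^bsub>V\<^esub> v" using e by meson
    then show "\<phi> (c \<odot>\<^bsub>V\<^esub> x) = c \<otimes>\<^bsub>K\<^esub> \<phi> x" using assms(2) by (simp add: smult_assoc1[symmetric] \<phi>)
  qed (use e \<phi> in force)
  from functional_extend[OF assms(1) this] subset_adjoin(2)[OF z assms(2)] \<phi>[of "\<one>\<^bsub>K\<^esub>"] assms(2)
  show ?thesis by force
qed

section \<open>Descending chains of subspaces\<close>

definition artinian :: "'a set \<Rightarrow> bool"
  where "artinian U \<longleftrightarrow> (\<forall>W :: nat \<Rightarrow> 'a set. (\<forall>i. subsp (W i) \<and> W i \<subseteq> U) \<and> antimono W \<longrightarrow> (\<exists>n. \<forall>m\<ge>n. W m = W n))"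

text \<open>The intersections of the chain with \<open>U\<close> become stationary. Either some
  member of the chain has no component along \<open>b\<close>, and from there on the chain lies in
  \<open>U\<close>; or every member has one, and it can be used to correct an element of an earlier
  member by an element of a later member to an element of \<open>U\<close>.\<close>

lemma artinian_adjoin:
  assumes U: "subsp U" "artinian U" and b: "b \<in> carrier V"
  shows "artinian (adjoin U b)"
  unfolding artinian_def
proof (intro allI impI)
  fix W :: "nat \<Rightarrow> 'a set" assume W: "(\<forall>i. subsp (W i) \<and> W i \<subseteq> adjoin U b) \<and> antimono W"
  have dec: "m \<ge> n \<Longrightarrow> W m \<subseteq> W n" for m n using W antimonoD by metis
  have "(\<forall>i. subsp (W i \<inter> U) \<and> W i \<inter> U \<subseteq> U) \<and> antimono (\<lambda>i. W i \<inter> U)"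
    using W U(1) subsp_inter dec by (intro conjI allI antimonoI Int_mono) auto
  then obtain n1 where n1: "\<forall>m\<ge>n1. W m \<inter> U = W n1 \<inter> U"
    using U(2)[unfolded artinian_def, rule_format, of "\<lambda>i. W i \<inter> U"] by auto
  \<comment> \<open>\<open>J i\<close>: some element of \<open>W i\<close> has a non-zero
    coefficient at \<open>b\<close>.\<close>
  define J where "J i \<longleftrightarrow> (\<exists>c\<in>carrier K. c \<noteq> \<zero>\<^bsub>K\<^esub> \<and> (\<exists>u\<in>U. u \<oplus>\<^bsub>V\<^esub> c \<odot>\<^bsub>V\<^esub> b \<in> W i))" for i
  show "\<exists>n. \<forall>m\<ge>n. W m = W n"
  proof (cases "\<forall>i. J i")
    case False
    then obtain n2 where n2: "\<not> J n2" by blast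
    have sub: "W m \<subseteq> U" if "m \<ge> n2" for m
    proof
      fix x assume x: "x \<in> W m"
      then obtain u c where u: "u \<in> U" "c \<in> carrier K" "x = u \<oplus>\<^bsub>V\<^esub> c \<odot>\<^bsub>V\<^esub> b" using W adjoinE by (metis subsetD)
      then have "c = \<zero>\<^bsub>K\<^esub>" using n2 x dec[OF that] unfolding J_def by blast
      then show "x \<in> U" using u b subspD(1)[OF U(1)] by simp
    qed
    show ?thesis
    proof (intro exI[of _ "max n1 n2"] allI impI)
      fix m assume "m \<ge> max n1 n2"
      then show "W m = W (max n1 n2)" using sub[of m] sub[of "max n1 n2"] n1
        by (metis inf.absorb1 max.bounded_iff max.cobounded1 max.cobounded2)
    qed
  next
    case True
    show ?thesis
    proof (intro exI[of _ n1] allI impI subset_antisym)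
      fix m assume m: "m \<ge> n1"
      show "W m \<subseteq> W n1" using dec[OF m] .
      show "W n1 \<subseteq> W m"
      proof
        fix x assume x: "x \<in> W n1"
        then obtain u c where u: "u \<in> U" "c \<in> carrier K" "x = u \<oplus>\<^bsub>V\<^esub> c \<odot>\<^bsub>V\<^esub> b" using W adjoinE by (metis subsetD)
        obtain d t where d: "d \<in> carrier K" "d \<noteq> \<zero>\<^bsub>K\<^esub>" "t \<in> U" "t \<oplus>\<^bsub>V\<^esub> d \<odot>\<^bsub>V\<^esub> b \<in> W m" using True unfolding J_def by blast
        have di: "inv\<^bsub>K\<^esub> d \<in> carrier K" "inv\<^bsub>K\<^esub> d \<otimes>\<^bsub>K\<^esub> d = \<one>\<^bsub>K\<^esub>" using d field_Units by auto
        define r where "r = c \<otimes>\<^bsub>K\<^esub> inv\<^bsub>K\<^esub> d"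
        have r: "r \<in> carrier K" "r \<otimes>\<^bsub>K\<^esub> d = c" unfolding r_def using di u d by (simp_all add: R.m_assoc)
        \<comment> \<open>The scalar \<open>r\<close> is chosen such that \<open>y\<close>, an
          element of the smaller \<open>W m\<close>, has the same coefficient at \<open>b\<close> as
          \<open>x\<close>. Their difference then lies in \<open>U\<close>, where the two members of
          the chain already agree.\<close>
        define y where "y = r \<odot>\<^bsub>V\<^esub> (t \<oplus>\<^bsub>V\<^esub> d \<odot>\<^bsub>V\<^esub> b)"
        have y: "y \<in> W m" unfolding y_def using W d(4) r(1) subspD(4) by blast
        have cl: "u \<in> carrier V" "t \<in> carrier V" using u d subspD(1)[OF U(1)] by auto
        have y2: "y = r \<odot>\<^bsub>V\<^esub> t \<oplus>\<^bsub>V\<^esub> c \<odot>\<^bsub>V\<^esub> b" unfolding y_def using adjoin_smult[OF U(1) b d(3,1) r(1)] r(2) by simp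
        have "x \<ominus>\<^bsub>V\<^esub> y = (u \<ominus>\<^bsub>V\<^esub> r \<odot>\<^bsub>V\<^esub> t) \<oplus>\<^bsub>V\<^esub> (c \<odot>\<^bsub>V\<^esub> b \<oplus>\<^bsub>V\<^esub> \<ominus>\<^bsub>V\<^esub> (c \<odot>\<^bsub>V\<^esub> b))"
          unfolding u(3) y2 using cl r u(2) b
          by (simp only: M.minus_eq M.minus_add M.add.m_ac smult_closed M.a_inv_closed M.a_closed)
        also have "\<dots> = u \<ominus>\<^bsub>V\<^esub> r \<odot>\<^bsub>V\<^esub> t" using cl r u(2) b by (simp add: M.r_neg)
        finally have "x \<ominus>\<^bsub>V\<^esub> y \<in> U" using subsp_minus[OF U(1) u(1)] subspD(4)[OF U(1) r(1) d(3)] by simp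
        moreover have "x \<ominus>\<^bsub>V\<^esub> y \<in> W n1" using subsp_minus[of "W n1"] W x y dec[OF m] by blast
        ultimately have xy: "x \<ominus>\<^bsub>V\<^esub> y \<in> W m" using n1 m by blast
        have cl2: "x \<in> carrier V" "y \<in> carrier V" using x y W subspD(1) by blast+
        have "(x \<ominus>\<^bsub>V\<^esub> y) \<oplus>\<^bsub>V\<^esub> y = x" using cl2 by (simp add: M.minus_eq M.add.m_assoc M.l_neg)
        then show "x \<in> W m" using subspD(3)[of "W m", OF _ xy y] W by simp
      qed
    qed
  qed
qed

lemma artinian_carrier:
  assumes "finite_dimensional K V"
  shows "artinian (carrier V)"
proof -
  obtain B where B: "finite B" "B \<subseteq> carrier V" "\<forall>v\<in>carrier V. \<exists>a\<in>B \<rightarrow> carrier K. v = (\<Oplus>\<^bsub>V\<^esub>b\<in>B. a b \<odot>\<^bsub>V\<^esub> b)"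
    using assms(1) unfolding finite_dimensional_def by blast
  from B(1,2) have "\<exists>U. subsp U \<and> B \<subseteq> U \<and> artinian U"
  proof (induction B rule: finite_induct)
    case empty
    have "subsp {\<zero>\<^bsub>V\<^esub>}" unfolding subsp_def by auto
    moreover have "artinian {\<zero>\<^bsub>V\<^esub>}" unfolding artinian_def subsp_def by (metis subset_singletonD empty_iff)
    ultimately show ?case by blast
  next
    case (insert b B)
    then obtain U where "subsp U" "B \<subseteq> U" "artinian U" by blast
    then show ?case using insert artinian_adjoin[of U b] subset_adjoin[of U b] subsp_adjoin[of U b]
      by (intro exI[of _ "adjoin U b"]) auto
  qed
  then show ?thesis using spanning_subsp[OF B(1,3)] by metis
qed

end

section \<open>Powers of an endomorphism and Fitting's lemma\<close>

context lincat begin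

primrec pw :: "'m \<Rightarrow> nat \<Rightarrow> 'm" where
  "pw f 0 = Idt C (Src C f)"
| "pw f (Suc n) = f \<cdot> pw f n"

lemma in_pw:
  assumes "f \<Colon> A \<rightarrow> A"
  shows "pw f n \<Colon> A \<rightarrow> A"
  using assms by (induction n) auto

lemma pw_add:
  assumes "f \<Colon> A \<rightarrow> A"
  shows "pw f (m + n) = pw f m \<cdot> pw f n"
  using assms in_pw[OF assms] by (induction m) auto

lemma Hom_vector_space: "A \<in> Obj C \<Longrightarrow> B \<in> Obj C \<Longrightarrow> vector_space_over K (Hom C A B)"
  using Hom_module unfolding vector_space_over_def by (auto intro: field_axioms)

text \<open>Fitting's lemma: both chains of one-sided ideals generated by the powers of \<open>f\<close> stabilize.\<close>

lemma fitting:
  assumes "hom_finite K C" and f: "f \<Colon> A \<rightarrow> A"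
  obtains n x y where "x \<Colon> A \<rightarrow> A" "y \<Colon> A \<rightarrow> A"
    "pw f (Suc n) \<cdot> (pw f (Suc n) \<cdot> x) = pw f (Suc n)" "y \<cdot> (pw f (Suc n) \<cdot> pw f (Suc n)) = pw f (Suc n)"
proof -
  interpret V: vector_space_over K "Hom C A A" using f by (auto intro: Hom_vector_space)
  have art: "V.artinian (Arr C A A)" using assms unfolding hom_finite_def by (intro V.artinian_carrier) auto
  have p: "pw f n \<Colon> A \<rightarrow> A" for n using in_pw[OF f] .
  define E where "E = Arr C A A"
  have E: "x \<Colon> A \<rightarrow> A" if "x \<in> E" for x using that f unfolding E_def by (simp add: Arr_iff)
  have EI: "x \<in> E" if "x \<Colon> A \<rightarrow> A" for x unfolding E_def by (rule ArrI[OF that])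
  define R where "R n = (\<lambda>x. pw f n \<cdot> x) ` E" for n
  define L where "L n = (\<lambda>x. x \<cdot> pw f n) ` E" for n
  have addf: "g \<oplus>\<^bsub>Hom C A A\<^esub> h = g \<boxplus> h" if "g \<Colon> A \<rightarrow> A" for g h by (rule plus_Hom[OF that])
  have smf: "c \<odot>\<^bsub>Hom C A A\<^esub> g = c \<star> g" if "g \<Colon> A \<rightarrow> A" for g c by (rule smult_Hom[OF that])
  have nE: "nul A A \<in> E" using f by (intro EI) simp
  have R: "V.subsp (R n)" for n
    unfolding V.subsp_def
  proof (intro conjI ballI)
    show "R n \<subseteq> Arr C A A" unfolding R_def E_def[symmetric] using p[of n] by (auto dest!: E intro!: EI)
    have "nul A A = pw f n \<cdot> nul A A" using p[of n] f by simp
    then show "nul A A \<in> R n" unfolding R_def using nE by (rule image_eqI)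
  next
    fix g h assume "g \<in> R n" "h \<in> R n"
    then obtain x y where x: "x \<in> E" "g = pw f n \<cdot> x" "y \<in> E" "h = pw f n \<cdot> y" unfolding R_def by blast
    have "g \<oplus>\<^bsub>Hom C A A\<^esub> h = pw f n \<cdot> (x \<boxplus> y)"
      unfolding x using E[OF x(1)] E[OF x(3)] p[of n] by (simp add: addf Cmp_plus_right)
    moreover have "x \<boxplus> y \<in> E" using E[OF x(1)] E[OF x(3)] by (intro EI) simp
    ultimately show "g \<oplus>\<^bsub>Hom C A A\<^esub> h \<in> R n" unfolding R_def by (rule image_eqI)
  next
    fix c g assume c: "c \<in> carrier K" and "g \<in> R n"
    then obtain x where x: "x \<in> E" "g = pw f n \<cdot> x" unfolding R_def by blast
    have "c \<odot>\<^bsub>Hom C A A\<^esub> g = pw f n \<cdot> (c \<star> x)"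
      unfolding x using E[OF x(1)] p[of n] c by (simp add: smf Cmp_smult_right)
    moreover have "c \<star> x \<in> E" using E[OF x(1)] c by (intro EI) simp
    ultimately show "c \<odot>\<^bsub>Hom C A A\<^esub> g \<in> R n" unfolding R_def by (rule image_eqI)
  qed
  have L: "V.subsp (L n)" for n
    unfolding V.subsp_def
  proof (intro conjI ballI)
    show "L n \<subseteq> Arr C A A" unfolding L_def E_def[symmetric] using p[of n] by (auto dest!: E intro!: EI)
    have "nul A A = nul A A \<cdot> pw f n" using p[of n] f by simp
    then show "nul A A \<in> L n" unfolding L_def using nE by (rule image_eqI)
  next
    fix g h assume "g \<in> L n" "h \<in> L n"
    then obtain x y where x: "x \<in> E" "g = x \<cdot> pw f n" "y \<in> E" "h = y \<cdot> pw f n" unfolding L_def by blast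
    have "g \<oplus>\<^bsub>Hom C A A\<^esub> h = (x \<boxplus> y) \<cdot> pw f n"
      unfolding x using E[OF x(1)] E[OF x(3)] p[of n] by (simp add: addf Cmp_plus_left)
    moreover have "x \<boxplus> y \<in> E" using E[OF x(1)] E[OF x(3)] by (intro EI) simp
    ultimately show "g \<oplus>\<^bsub>Hom C A A\<^esub> h \<in> L n" unfolding L_def by (rule image_eqI)
  next
    fix c g assume c: "c \<in> carrier K" and "g \<in> L n"
    then obtain x where x: "x \<in> E" "g = x \<cdot> pw f n" unfolding L_def by blast
    have "c \<odot>\<^bsub>Hom C A A\<^esub> g = (c \<star> x) \<cdot> pw f n"
      unfolding x using E[OF x(1)] p[of n] c by (simp add: smf Cmp_smult_left)
    moreover have "c \<star> x \<in> E" using E[OF x(1)] c by (intro EI) simp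
    ultimately show "c \<odot>\<^bsub>Hom C A A\<^esub> g \<in> L n" unfolding L_def by (rule image_eqI)
  qed
  have decR: "R n \<subseteq> R m" and decL: "L n \<subseteq> L m" if "m \<le> n" for m n
  proof -
    obtain k where k: "n = m + k" "n = k + m" using \<open>m \<le> n\<close> le_Suc_ex add.commute by metis
    have q: "pw f n = pw f m \<cdot> pw f k" "pw f n = pw f k \<cdot> pw f m" using k pw_add[OF f] by metis+
    have 1: "pw f n \<cdot> x = pw f m \<cdot> (pw f k \<cdot> x)" "x \<cdot> pw f n = (x \<cdot> pw f k) \<cdot> pw f m" if "x \<in> E" for x
      using p[of m] p[of k] E[OF that] unfolding q(1) by (simp, unfold q(1)[symmetric] q(2), simp)
    have 2: "pw f k \<cdot> x \<in> E" "x \<cdot> pw f k \<in> E" if "x \<in> E" for x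
      using p[of k] E[OF that] by (simp_all add: EI)
    show "R n \<subseteq> R m" unfolding R_def using 1(1) 2(1) by auto
    show "L n \<subseteq> L m" unfolding L_def using 1(2) 2(2) by auto
  qed
  have stab: "\<exists>n. \<forall>m\<ge>n. W m = W n" if "\<And>i. V.subsp (W i)" "\<And>m n. m \<le> n \<Longrightarrow> W n \<subseteq> W m" for W :: "nat \<Rightarrow> 'm set"
  proof -
    have "W i \<subseteq> Arr C A A" for i using that(1)[of i] unfolding V.subsp_def by (rule conjunct1)
    then have "(\<forall>i. V.subsp (W i) \<and> W i \<subseteq> Arr C A A) \<and> antimono W"
      using that by (intro conjI allI antimonoI) simp_all
    then show ?thesis by (rule art[unfolded V.artinian_def, THEN spec, THEN mp])
  qed
  obtain n1 where n1: "\<forall>m\<ge>n1. R m = R n1" using stab[of R, OF R decR] by blast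
  obtain n2 where n2: "\<forall>m\<ge>n2. L m = L n2" using stab[of L, OF L decL] by blast
  \<comment> \<open>Both chains are constant from here on. The exponent used is
    \<open>Suc n\<close>, so that a factor \<open>f\<close> can later be split off the power on
    either side.\<close>
  define n where "n = max n1 n2"
  define a where "a = pw f (Suc n)"
  have a: "a \<Colon> A \<rightarrow> A" unfolding a_def by (rule p)
  have aa: "pw f (Suc n + Suc n) = a \<cdot> a" unfolding a_def by (rule pw_add[OF f])
  have i: "Idt C A \<in> E" using f by (intro EI) simp
  have "a = a \<cdot> Idt C A" "a = Idt C A \<cdot> a" using a by simp_all
  then have "a \<in> R (Suc n)" "a \<in> L (Suc n)" unfolding R_def L_def a_def[symmetric] using i by (auto intro: image_eqI)
  moreover have "R (Suc n) = R (Suc n + Suc n)" "L (Suc n) = L (Suc n + Suc n)"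
    using n1[rule_format, of "Suc n"] n1[rule_format, of "Suc n + Suc n"]
      n2[rule_format, of "Suc n"] n2[rule_format, of "Suc n + Suc n"] unfolding n_def by auto
  ultimately obtain x y where x: "x \<in> E" "a = (a \<cdot> a) \<cdot> x" and y: "y \<in> E" "a = y \<cdot> (a \<cdot> a)"
    unfolding R_def L_def aa by blast
  have "a \<cdot> (a \<cdot> x) = a" using x(2) assoc[of x a a] a E[OF x(1)] by metis
  then show thesis
    using that[OF E[OF x(1)] E[OF y(1)], of n] y(2)[symmetric] unfolding a_def[symmetric] by blast
qed

end

section \<open>Linear functors and triangulated categories\<close>

locale linfun = C: lincat K C + D: lincat K D
  for K :: "('k, 'r) ring_scheme" and C :: "('k, 'o, 'm, 'y) lcat_scheme" and D :: "('k, 'p, 'n, 'z) lcat_scheme" +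
  fixes F :: "('o, 'm, 'p, 'n) funct"
  assumes linear: "linear_functor K C D F"
begin

lemma fob_Obj [simp]: "A \<in> Obj C \<Longrightarrow> fob F A \<in> Obj D"
  using linear unfolding linear_functor_def by blast

lemma far_linear: "A \<in> Obj C \<Longrightarrow> B \<in> Obj C \<Longrightarrow> far F \<in> linear_maps K (Hom C A B) (Hom D (fob F A) (fob F B))"
  using linear unfolding linear_functor_def by blast

lemma far_in [simp]:
  assumes "f \<in> Mor C"
  shows "far F f \<in> Mor D" "Src D (far F f) = fob F (Src C f)" "Tgt D (far F f) = fob F (Tgt C f)"
proof -
  have "far F f \<in> Arr D (fob F (Src C f)) (fob F (Tgt C f))"
    using far_linear[of "Src C f" "Tgt C f"] C.Mor_Arr[OF assms] assms unfolding linear_maps_def by auto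
  from D.ArrD[OF this] assms
  show "far F f \<in> Mor D" "Src D (far F f) = fob F (Src C f)" "Tgt D (far F f) = fob F (Tgt C f)" by simp_all
qed

lemma far_Idt [simp]: "A \<in> Obj C \<Longrightarrow> far F (Idt C A) = Idt D (fob F A)"
  using linear unfolding linear_functor_def by blast

lemma far_Cmp [simp]:
  assumes "f \<in> Mor C" "g \<in> Mor C" "Src C g = Tgt C f"
  shows "far F (g \<cdot>\<^bsub>C\<^esub> f) = far F g \<cdot>\<^bsub>D\<^esub> far F f"
proof -
  have *: "\<forall>A\<in>Obj C. \<forall>B\<in>Obj C. \<forall>E\<in>Obj C. \<forall>f\<in>Arr C A B. \<forall>g\<in>Arr C B E.
      far F (g \<cdot>\<^bsub>C\<^esub> f) = far F g \<cdot>\<^bsub>D\<^esub> far F f" using linear unfolding linear_functor_def by blast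
  show ?thesis using C.Mor_Arr[OF assms(1)] C.Mor_Arr[OF assms(2)] assms
    by (intro *[rule_format, of "Src C f" "Tgt C f" "Tgt C g"]) auto
qed

lemma far_nul [simp]: "A \<in> Obj C \<Longrightarrow> B \<in> Obj C \<Longrightarrow> far F (nul\<^bsub>C\<^esub> A B) = nul\<^bsub>D\<^esub> (fob F A) (fob F B)"
  using C.linear_maps_add_hom(1)[OF _ _ D.Hom_group far_linear] by simp

lemma far_minus:
  assumes "f \<in> Mor C" "g \<in> Mor C" "Src C g = Src C f" "Tgt C g = Tgt C f"
  shows "far F (f \<boxminus>\<^bsub>C\<^esub> g) = far F f \<boxminus>\<^bsub>D\<^esub> far F g"
  using C.linear_maps_add_hom(2)[OF _ _ D.Hom_group far_linear, of "Src C f" "Tgt C f" f g] assms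
    D.minus_Hom[of "far F f" "fob F (Src C f)" "fob F (Tgt C f)"] by simp

lemma far_plus:
  assumes "f \<in> Mor C" "g \<in> Mor C" "Src C g = Src C f" "Tgt C g = Tgt C f"
  shows "far F (f \<boxplus>\<^bsub>C\<^esub> g) = far F f \<boxplus>\<^bsub>D\<^esub> far F g"
  using far_linear[of "Src C f" "Tgt C f"] C.Mor_Arr[OF assms(1)] C.Mor_Arr[OF assms(2)] assms
    D.plus_Hom[of "far F f" "fob F (Src C f)" "fob F (Tgt C f)"]
  unfolding linear_maps_def by (simp add: arrow_plus_def[of C])

lemma far_smult:
  assumes "f \<in> Mor C" "c \<in> carrier K"
  shows "far F (c \<star>\<^bsub>C\<^esub> f) = c \<star>\<^bsub>D\<^esub> far F f"
  using far_linear[of "Src C f" "Tgt C f"] C.Mor_Arr[OF assms(1)] assms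
    D.smult_Hom[of "far F f" "fob F (Src C f)" "fob F (Tgt C f)"]
  unfolding linear_maps_def by (simp add: arrow_smult_def[of C])

lemma isomorphic_fob: "isomorphic C A B \<Longrightarrow> A \<in> Obj C \<Longrightarrow> B \<in> Obj C \<Longrightarrow> isomorphic D (fob F A) (fob F B)"
proof -
  assume AB: "isomorphic C A B" "A \<in> Obj C" "B \<in> Obj C"
  obtain f g where f: "f \<Colon>\<^bsub>C\<^esub> A \<rightarrow> B" "g \<Colon>\<^bsub>C\<^esub> B \<rightarrow> A" "g \<cdot>\<^bsub>C\<^esub> f = Idt C A" "f \<cdot>\<^bsub>C\<^esub> g = Idt C B"
    using C.isomorphicE[OF AB] .
  have "far F g \<cdot>\<^bsub>D\<^esub> far F f = Idt D (fob F A)" "far F f \<cdot>\<^bsub>D\<^esub> far F g = Idt D (fob F B)"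
    using f(1,2) far_Cmp[of f g] far_Cmp[of g f] unfolding f(3,4) by simp_all
  then show ?thesis using f(1,2) by (intro D.isomorphicI[of "far F f" _ _ "far F g"]) simp_all
qed

lemma is_direct_sum_fob:
  assumes "is_direct_sum C A B S"
  shows "is_direct_sum D (fob F A) (fob F B) (fob F S)"
proof -
  obtain i j p q where t: "i \<Colon>\<^bsub>C\<^esub> A \<rightarrow> S" "j \<Colon>\<^bsub>C\<^esub> B \<rightarrow> S" "p \<Colon>\<^bsub>C\<^esub> S \<rightarrow> A" "q \<Colon>\<^bsub>C\<^esub> S \<rightarrow> B" and
    e: "p \<cdot>\<^bsub>C\<^esub> i = Idt C A" "q \<cdot>\<^bsub>C\<^esub> j = Idt C B" "p \<cdot>\<^bsub>C\<^esub> j = nul\<^bsub>C\<^esub> B A" "q \<cdot>\<^bsub>C\<^esub> i = nul\<^bsub>C\<^esub> A B"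
      "i \<cdot>\<^bsub>C\<^esub> p \<boxplus>\<^bsub>C\<^esub> j \<cdot>\<^bsub>C\<^esub> q = Idt C S"
    using C.is_direct_sumE[OF assms] .
  have "far F p \<cdot>\<^bsub>D\<^esub> far F i = Idt D (fob F A)" "far F q \<cdot>\<^bsub>D\<^esub> far F j = Idt D (fob F B)"
    "far F p \<cdot>\<^bsub>D\<^esub> far F j = nul\<^bsub>D\<^esub> (fob F B) (fob F A)" "far F q \<cdot>\<^bsub>D\<^esub> far F i = nul\<^bsub>D\<^esub> (fob F A) (fob F B)"
    using t far_Cmp[of i p] far_Cmp[of j q] far_Cmp[of j p] far_Cmp[of i q] unfolding e by simp_all
  moreover have "far F i \<cdot>\<^bsub>D\<^esub> far F p \<boxplus>\<^bsub>D\<^esub> far F j \<cdot>\<^bsub>D\<^esub> far F q = Idt D (fob F S)"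
    using t far_plus[of "i \<cdot>\<^bsub>C\<^esub> p" "j \<cdot>\<^bsub>C\<^esub> q"] unfolding e by simp
  ultimately show ?thesis using t
    by (intro D.is_direct_sumI[of "far F i" _ _ "far F j" _ "far F p" "far F q"]) simp_all
qed

lemma is_zero_obj_fob: "is_zero_obj C Z \<Longrightarrow> is_zero_obj D (fob F Z)"
  unfolding C.is_zero_obj_iff D.is_zero_obj_iff by (metis fob_Obj far_Idt far_nul)

lemma full_lift:
  assumes "full_functor C D F" "A \<in> Obj C" "B \<in> Obj C" "\<phi> \<Colon>\<^bsub>D\<^esub> fob F A \<rightarrow> fob F B"
  obtains f where "f \<Colon>\<^bsub>C\<^esub> A \<rightarrow> B" "far F f = \<phi>"
proof -
  have "\<phi> \<in> far F ` Arr C A B" using assms D.ArrI[OF assms(4)] unfolding full_functor_def by simp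
  then show thesis using that C.ArrD[OF _ assms(2,3)] by blast
qed

lemma faithful_eq:
  assumes "faithful_functor C F" "f \<Colon>\<^bsub>C\<^esub> A \<rightarrow> B" "g \<Colon>\<^bsub>C\<^esub> A \<rightarrow> B" "far F f = far F g"
  shows "f = g"
proof -
  have "inj_on (far F) (Arr C A B)" using assms(1-3) unfolding faithful_functor_def by simp
  then show ?thesis using C.ArrI[OF assms(2)] C.ArrI[OF assms(3)] assms(4) by (meson inj_onD)
qed

end

context lincat begin

lemma neg_Hom:
  assumes "f \<Colon> A \<rightarrow> B"
  shows "\<ominus>\<^bsub>Hom C A B\<^esub> f = nul A B \<boxminus> f"
proof -
  interpret abelian_group "Hom C A B" by (rule Hom_group) (use assms in auto)
  show ?thesis using minus_Hom[of "nul A B" A B f] assms ArrI[OF assms] by (simp add: minus_eq)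
qed

lemma nul_minus_inject:
  assumes "f \<Colon> A \<rightarrow> B" "g \<Colon> A \<rightarrow> B" "nul A B \<boxminus> f = nul A B \<boxminus> g"
  shows "f = g"
proof -
  have "nul A B \<boxminus> (nul A B \<boxminus> f) = f" by (rule minus_minus_cancel[of _ A B]) (use assms(1) in simp_all)
  moreover have "nul A B \<boxminus> (nul A B \<boxminus> g) = g" by (rule minus_minus_cancel[of _ A B]) (use assms(2) in simp_all)
  ultimately show ?thesis using assms(3) by metis
qed

lemma nul_minus_eq_nul:
  assumes "f \<Colon> A \<rightarrow> B"
  shows "nul A B \<boxminus> f = nul A B \<longleftrightarrow> f = nul A B"
  using minus_eq_nul[of "nul A B" A B f] assms by (metis in_nul)

end

section \<open>Long exact hom-sequences of a triangle\<close>

locale triang = triangulated_category K T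
  for K :: "('k, 'r) ring_scheme" and T :: "('k, 'o, 'm, 'z) tcat_scheme" (structure)
begin

sublocale lincat K T ..

sublocale Sh: linfun K T T "Shift T"
  using Shift_equivalence unfolding linear_equivalence_def by unfold_locales simp

lemma Shift_full: "full_functor T T (Shift T)" and Shift_faithful: "faithful_functor T (Shift T)"
  using Shift_equivalence unfolding linear_equivalence_def by simp_all

lemma shift_lift:
  assumes "A \<in> Obj T" "B \<in> Obj T" "\<phi> \<Colon> shob T A \<rightarrow> shob T B"
  obtains f where "f \<Colon> A \<rightarrow> B" "shar T f = \<phi>"
  using Sh.full_lift[OF Shift_full assms] .

lemma shift_eq:
  assumes "f \<Colon> A \<rightarrow> B" "g \<Colon> A \<rightarrow> B" "shar T f = shar T g"
  shows "f = g"
  by (rule Sh.faithful_eq[OF Shift_faithful assms])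

lemma shift_eq_nul:
  assumes "f \<Colon> A \<rightarrow> B" "shar T f = nul (shob T A) (shob T B)"
  shows "f = nul A B"
  by (rule shift_eq[of f A B]) (use assms in simp_all)

lemma shift_surj:
  assumes "A \<in> Obj T"
  obtains B where "B \<in> Obj T" "isomorphic T (shob T B) A"
proof -
  have "A \<in> ess_image T (Shift T) (Obj T)" using Shift_equivalence assms unfolding linear_equivalence_def by simp
  then show thesis using that unfolding ess_image_def by blast
qed

lemma hom_null_shift: "A \<in> Obj T \<Longrightarrow> B \<in> Obj T \<Longrightarrow> hom_null (shob T A) (shob T B) \<longleftrightarrow> hom_null A B"
proof
  assume A: "A \<in> Obj T" "B \<in> Obj T" and h: "hom_null (shob T A) (shob T B)"
  show "hom_null A B" unfolding hom_null_def
  proof (intro allI impI)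
    fix f assume f: "f \<Colon> A \<rightarrow> B"
    have "shar T f = nul (shob T A) (shob T B)" by (rule hom_nullD[OF h]) (use f in simp)
    then show "f = nul A B" by (rule shift_eq_nul[OF f])
  qed
next
  assume A: "A \<in> Obj T" "B \<in> Obj T" and h: "hom_null A B"
  show "hom_null (shob T A) (shob T B)" unfolding hom_null_def
  proof (intro allI impI)
    fix f assume f: "f \<Colon> shob T A \<rightarrow> shob T B"
    obtain g where g: "g \<Colon> A \<rightarrow> B" "shar T g = f" using shift_lift[OF A f] .
    show "f = nul (shob T A) (shob T B)" unfolding g(2)[symmetric] hom_nullD[OF h g(1)] using A by simp
  qed
qed

lemma triD:
  assumes "(A, B, D, f, g, h) \<in> Tri T"
  shows "f \<Colon> A \<rightarrow> B" "g \<Colon> B \<rightarrow> D" "h \<Colon> D \<rightarrow> shob T A"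
  using subsetD[OF Tri_candidate assms] unfolding candidate_triangles_def by (auto simp: Arr_iff)

lemma candI:
  assumes "f \<Colon> A \<rightarrow> B" "g \<Colon> B \<rightarrow> D" "h \<Colon> D \<rightarrow> shob T A"
  shows "(A, B, D, f, g, h) \<in> candidate_triangles T"
  unfolding candidate_triangles_def using assms by (simp add: Arr_iff)

text \<open>The arrow calculus has differences but no negation, so the sign in the rotation axiom is
  written as a difference from the null arrow.\<close>

lemma tri_rot:
  assumes "(A, B, D, f, g, h) \<in> Tri T"
  shows "(B, D, shob T A, g, h, nul (shob T A) (shob T B) \<boxminus> shar T f) \<in> Tri T"
proof -
  note t = triD[OF assms]
  have "(B, D, shob T A, g, h, \<ominus>\<^bsub>Hom T (shob T A) (shob T B)\<^esub> shar T f) \<in> Tri T"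
    by (rule TR2[OF subsetD[OF Tri_candidate assms], THEN iffD1, OF assms])
  then show ?thesis using neg_Hom[of "shar T f" "shob T A" "shob T B"] t by simp
qed

lemma tri_rot_back:
  assumes "f \<Colon> A \<rightarrow> B" "g \<Colon> B \<rightarrow> D" "h \<Colon> D \<rightarrow> shob T A"
    "(B, D, shob T A, g, h, nul (shob T A) (shob T B) \<boxminus> shar T f) \<in> Tri T"
  shows "(A, B, D, f, g, h) \<in> Tri T"
  using TR2[OF candI[OF assms(1-3)]] assms neg_Hom[of "shar T f" "shob T A" "shob T B"] by simp

lemma obtain_zero:
  obtains Z where "Z \<in> Obj T" "is_zero_obj T Z"
  using zero_obj_exists is_zero_obj_iff by blast

text \<open>Exactness of T(W, -) at \<open>B\<close>. The axiom TR3 produces only the third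
  component of a morphism of triangles. Mapping the rotation of the trivial triangle on
  \<open>W\<close> into the rotation of the given one makes the wanted lift that third component up
  to a shift, and the shift is full and faithful.\<close>

lemma tri_ex1:
  assumes tr: "(A, B, D, f, g, h) \<in> Tri T" and x: "x \<Colon> W \<rightarrow> B" "g \<cdot> x = nul W D"
  obtains y where "y \<Colon> W \<rightarrow> A" "f \<cdot> y = x"
proof -
  note t = triD[OF tr]
  obtain Z where Z: "Z \<in> Obj T" "is_zero_obj T Z" using obtain_zero .
  have "W \<in> Obj T" using x by simp
  from tri_rot[OF TR1_id[OF this Z(2)]]
  have t1: "(W, Z, shob T W, nul W Z, nul Z (shob T W), nul (shob T W) (shob T W) \<boxminus> shar T (Idt T W)) \<in> Tri T" .
  have "x \<in> Arr T W B" "nul Z D \<in> Arr T Z D" "nul Z D \<cdot> nul W Z = g \<cdot> x" using x t Z by (simp_all add: Arr_iff)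
  from TR3[OF t1 tri_rot[OF tr] this]
  obtain d where d: "d \<in> Arr T (shob T W) (shob T A)" and
    e: "shar T x \<cdot> (nul (shob T W) (shob T W) \<boxminus> shar T (Idt T W)) = (nul (shob T A) (shob T B) \<boxminus> shar T f) \<cdot> d"
    by blast
  have d': "d \<Colon> shob T W \<rightarrow> shob T A" using d x t by (simp add: Arr_iff)
  then obtain y where y: "y \<Colon> W \<rightarrow> A" "shar T y = d" using shift_lift[of W A d] x t by blast
  have "nul (shob T W) (shob T B) \<boxminus> shar T x = nul (shob T W) (shob T B) \<boxminus> shar T (f \<cdot> y)"
    using e y x t d' by (simp add: Cmp_distrib)
  then have "shar T x = shar T (f \<cdot> y)" by (intro nul_minus_inject[of "shar T x" "shob T W" "shob T B" "shar T (f \<cdot> y)"]) (use x y(1) t in simp_all)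
  then have "f \<cdot> y = x" by (intro shift_eq[of "f \<cdot> y" W B x]) (use x y(1) t in simp_all)
  then show thesis using that y by blast
qed

text \<open>TR3, applied to the trivial triangle A = A -> 0 and the identity of \<open>A\<close>,
  factors \<open>g \<cdot> f\<close> through a zero object.\<close>

lemma tri_zero1:
  assumes tr: "(A, B, D, f, g, h) \<in> Tri T"
  shows "g \<cdot> f = nul A D"
proof -
  note t = triD[OF tr]
  obtain Z where Z: "Z \<in> Obj T" "is_zero_obj T Z" using obtain_zero .
  have A: "A \<in> Obj T" using t by simp
  have "Idt T A \<in> Arr T A A" "f \<in> Arr T A B" "f \<cdot> Idt T A = f \<cdot> Idt T A" using t by (simp_all add: Arr_iff)
  from TR3[OF TR1_id[OF A Z(2)] tr this] obtain d where d: "d \<in> Arr T Z D" "d \<cdot> nul A Z = g \<cdot> f" by blast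
  then have "d \<Colon> Z \<rightarrow> D" using Z t by (simp add: Arr_iff)
  then show ?thesis using d(2) t by simp
qed

lemma tri_zero2: "(A, B, D, f, g, h) \<in> Tri T \<Longrightarrow> h \<cdot> g = nul B (shob T A)"
  using tri_zero1[OF tri_rot] .

lemma tri_zero3:
  assumes "(A, B, D, f, g, h) \<in> Tri T"
  shows "shar T f \<cdot> h = nul D (shob T B)"
proof -
  note t = triD[OF assms]
  have "(nul (shob T A) (shob T B) \<boxminus> shar T f) \<cdot> h = nul D (shob T B)" using tri_zero2[OF tri_rot[OF assms]] .
  then have "nul D (shob T B) \<boxminus> shar T f \<cdot> h = nul D (shob T B)" using t by (simp add: Cmp_distrib)
  then show ?thesis using t nul_minus_eq_nul[of "shar T f \<cdot> h" D "shob T B"] by simp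
qed

lemma tri_ex2:
  assumes tr: "(A, B, D, f, g, h) \<in> Tri T" and x: "x \<Colon> W \<rightarrow> D" "h \<cdot> x = nul W (shob T A)"
  obtains y where "y \<Colon> W \<rightarrow> B" "g \<cdot> y = x"
  using tri_ex1[OF tri_rot[OF tr] x] .

lemma tri_ex3:
  assumes tr: "(A, B, D, f, g, h) \<in> Tri T" and x: "x \<Colon> W \<rightarrow> A" "f \<cdot> x = nul W B"
  obtains y where "y \<Colon> shob T W \<rightarrow> D" "h \<cdot> y = shar T x"
proof -
  note t = triD[OF tr]
  have "shar T f \<cdot> shar T x = nul (shob T W) (shob T B)" using Sh.far_Cmp[of x f] x t by simp
  then have "(nul (shob T A) (shob T B) \<boxminus> shar T f) \<cdot> shar T x = nul (shob T W) (shob T B)" "shar T x \<Colon> shob T W \<rightarrow> shob T A"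
    using x t by (simp_all add: Cmp_distrib)
  from tri_ex2[OF tri_rot[OF tr] this(2,1)] show thesis using that .
qed

text \<open>Exactness of T(-, W) at \<open>B\<close>. The triangle is mapped into 0 -> W = W, itself
  a trivial triangle rotated back; the third component of the morphism from TR3 is the
  factorization.\<close>

lemma tri_co1:
  assumes tr: "(A, B, D, f, g, h) \<in> Tri T" and x: "x \<Colon> B \<rightarrow> W" "x \<cdot> f = nul A W"
  obtains y where "y \<Colon> D \<rightarrow> W" "y \<cdot> g = x"
proof -
  note t = triD[OF tr]
  obtain Z where Z: "Z \<in> Obj T" "is_zero_obj T Z" using obtain_zero .
  have W: "W \<in> Obj T" using x by simp
  have "nul (shob T Z) (shob T W) \<boxminus> shar T (nul Z W) = nul (shob T Z) (shob T W)" using Z W by simp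
  then have t1: "(Z, W, W, nul Z W, Idt T W, nul W (shob T Z)) \<in> Tri T"
    by (intro tri_rot_back[of "nul Z W" Z W]) (use TR1_id[OF W Sh.is_zero_obj_fob[OF Z(2)]] Z W in simp_all)
  have "nul A Z \<in> Arr T A Z" "x \<in> Arr T B W" "x \<cdot> f = nul Z W \<cdot> nul A Z" using x t Z by (simp_all add: Arr_iff)
  from TR3[OF tr t1 this] obtain d where d: "d \<in> Arr T D W" "d \<cdot> g = Idt T W \<cdot> x" by blast
  then show thesis using that[of d] x t by (simp add: Arr_iff)
qed

lemma tri_co2:
  assumes tr: "(A, B, D, f, g, h) \<in> Tri T" and x: "x \<Colon> D \<rightarrow> W" "x \<cdot> g = nul B W"
  obtains y where "y \<Colon> shob T A \<rightarrow> W" "y \<cdot> h = x"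
  using tri_co1[OF tri_rot[OF tr] x] .

lemma tri_co3:
  assumes tr: "(A, B, D, f, g, h) \<in> Tri T" and x: "x \<Colon> A \<rightarrow> W" "shar T x \<cdot> h = nul D (shob T W)"
  obtains y where "y \<Colon> B \<rightarrow> W" "y \<cdot> f = x"
proof -
  note t = triD[OF tr]
  have "shar T x \<Colon> shob T A \<rightarrow> shob T W" using x by simp
  from tri_co2[OF tri_rot[OF tr] this x(2)]
  obtain z where z: "z \<Colon> shob T B \<rightarrow> shob T W" "z \<cdot> (nul (shob T A) (shob T B) \<boxminus> shar T f) = shar T x" .
  obtain w where w: "w \<Colon> B \<rightarrow> W" "shar T w = z" using shift_lift[of B W z] z x t by blast
  \<comment> \<open>The rotated triangle carries the negative of the shift of \<open>f\<close>, so
    the map found here is the negative of the wanted factor.\<close>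
  have "nul (shob T A) (shob T W) \<boxminus> shar T (w \<cdot> f) = shar T x" using z w t x by (simp add: Cmp_distrib)
  moreover have "shar T (nul A W \<boxminus> w \<cdot> f) = nul (shob T A) (shob T W) \<boxminus> shar T (w \<cdot> f)" using w t x by (simp add: Sh.far_minus)
  ultimately have "nul A W \<boxminus> w \<cdot> f = x" by (intro shift_eq[of "nul A W \<boxminus> w \<cdot> f" A W x]) (use w(1) t x in simp_all)
  then have "(nul B W \<boxminus> w) \<cdot> f = x" using w t x by (simp add: Cmp_distrib)
  then show thesis using that[of "nul B W \<boxminus> w"] w t x by simp
qed

text \<open>TR1 completes a map only as the first of a triangle. The shift is an equivalence and not
  necessarily an automorphism, so the cone of \<open>p\<close> is first replaced by an isomorphic
  object A[1]; only then can the triangle be rotated back.\<close>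

lemma tri_complete_mid:
  assumes p: "p \<Colon> B \<rightarrow> D"
  obtains A f h where "(A, B, D, f, p, h) \<in> Tri T"
proof -
  have "p \<in> Arr T B D" by (rule ArrI[OF p])
  then obtain E g h where tr: "(B, D, E, p, g, h) \<in> Tri T" using TR1_cone p by blast
  note t = triD[OF tr]
  obtain A where A: "A \<in> Obj T" "isomorphic T (shob T A) E" using shift_surj[of E] t by auto
  have AE: "shob T A \<in> Obj T" "E \<in> Obj T" using A t by simp_all
  obtain u v where uv: "u \<Colon> shob T A \<rightarrow> E" "v \<Colon> E \<rightarrow> shob T A" "v \<cdot> u = Idt T (shob T A)" "u \<cdot> v = Idt T E"
    using isomorphicE[OF A(2) AE] .
  have iso: "is_iso T E (shob T A) v" by (rule is_isoI[OF uv(2,1,4,3)])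
  have iso_id: "is_iso T Q Q (Idt T Q)" if "Q \<in> Obj T" for Q
    by (rule is_isoI[of _ _ _ "Idt T Q"]) (use that in simp_all)
  have tr2: "(B, D, shob T A, p, v \<cdot> g, h \<cdot> u) \<in> Tri T"
  proof (rule TR1_iso[OF tr _ iso_id iso_id iso])
    show "(B, D, shob T A, p, v \<cdot> g, h \<cdot> u) \<in> candidate_triangles T" using uv t by (intro candI) simp_all
    show "shar T (Idt T B) \<cdot> h = (h \<cdot> u) \<cdot> v" using uv t by simp
  qed (use uv t in simp_all)
  have hu: "nul (shob T A) (shob T B) \<boxminus> h \<cdot> u \<Colon> shob T A \<rightarrow> shob T B" using uv t by simp
  obtain f where f: "f \<Colon> A \<rightarrow> B" "shar T f = nul (shob T A) (shob T B) \<boxminus> h \<cdot> u"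
    using shift_lift[OF A(1) _ hu] p by blast
  have "nul (shob T A) (shob T B) \<boxminus> shar T f = h \<cdot> u"
    unfolding f(2) by (rule minus_minus_cancel[of _ "shob T A" "shob T B"]) (use uv t A in simp_all)
  then have "(A, B, D, f, p, v \<cdot> g) \<in> Tri T" 
    by (intro tri_rot_back[OF f(1)]) (use tr2 uv(1,2) t p in simp_all)
  then show thesis using that by blast
qed

lemma tri_complete_last:
  assumes w: "w \<Colon> D \<rightarrow> shob T A" and A: "A \<in> Obj T"
  obtains B f g where "(A, B, D, f, g, w) \<in> Tri T"
proof -
  obtain B g k where tr: "(B, D, shob T A, g, w, k) \<in> Tri T" using tri_complete_mid[OF w] .
  note t = triD[OF tr]
  have hu: "nul (shob T A) (shob T B) \<boxminus> k \<Colon> shob T A \<rightarrow> shob T B" using t by simp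
  obtain f where f: "f \<Colon> A \<rightarrow> B" "shar T f = nul (shob T A) (shob T B) \<boxminus> k"
    using shift_lift[OF A _ hu] t by blast
  have "nul (shob T A) (shob T B) \<boxminus> shar T f = k"
    unfolding f(2) by (rule minus_minus_cancel[of _ "shob T A" "shob T B"]) (use t A in simp_all)
  then have "(A, B, D, f, g, w) \<in> Tri T" by (intro tri_rot_back[OF f(1)]) (use tr t in simp_all)
  then show thesis using that by blast
qed

lemma tri_cone:
  assumes f: "f \<Colon> A \<rightarrow> B"
  obtains D g h where "(A, B, D, f, g, h) \<in> Tri T"
  using TR1_cone[OF _ _ ArrI[OF f]] f by blast

end

section \<open>The category modulo ghosts\<close>

context lincat begin

text \<open>A composite of epimorphisms, the outer two of which are split. It moves an epimorphism
  of \<open>D\<close> to one between objects in the image of \<open>H\<close> and back.\<close>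

lemma epi_iso:
  assumes e: "epi C A B f" "f \<Colon> A \<rightarrow> B" and u: "u \<Colon> A' \<rightarrow> A" "u' \<Colon> A \<rightarrow> A'" "u \<cdot> u' = Idt C A"
    and v: "v \<Colon> B \<rightarrow> B'" "v' \<Colon> B' \<rightarrow> B" "v \<cdot> v' = Idt C B'"
  shows "epi C A' B' (v \<cdot> (f \<cdot> u))"
proof -
  have t: "v \<cdot> (f \<cdot> u) \<Colon> A' \<rightarrow> B'" using assms by simp
  show ?thesis unfolding epi_iff[OF t]
  proof (intro allI impI)
    fix E g assume g: "g \<Colon> B' \<rightarrow> E" "g \<cdot> (v \<cdot> (f \<cdot> u)) = nul A' E"
    have "(g \<cdot> v) \<cdot> f = (g \<cdot> (v \<cdot> (f \<cdot> u))) \<cdot> u'" using e(2) u v g(1) by simp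
    also have "\<dots> = nul A E" unfolding g(2) using u g(1) by simp
    finally have *: "(g \<cdot> v) \<cdot> f = nul A E" .
    have "g \<cdot> v \<Colon> B \<rightarrow> E" using g(1) v by simp
    from epiD[OF e this *] have "g \<cdot> v = nul B E" .
    then have "(g \<cdot> v) \<cdot> v' = nul B' E" using v g(1) by simp
    then show "g = nul B' E" using v g(1) by simp
  qed
qed

end

text \<open>mod-X is replaced by an arbitrary linear category \<open>D\<close> with a full and dense
  functor \<open>H\<close> that kills exactly the ghosts. This keeps the record encoding of functors
  out of the argument; \<open>mod_category\<close> and \<open>H_functor\<close> are substituted at
  the end.\<close>

locale ghost_setting = triang K T + H: linfun K T D H
  for K :: "('k, 'r) ring_scheme" and T :: "('k, 'o, 'm, 'z) tcat_scheme" (structure)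
    and D :: "('k, 'p, 'n, 'y) lcat_scheme" and H :: "('o, 'm, 'p, 'n) funct" +
  fixes X :: "'o set"
  assumes X_subcat: "subcategory T X" and X_cf: "contravariantly_finite T X" and X_rigid: "rigid T X"
    and split: "split_idempotents T" and hom_fin: "hom_finite K T"
    and H_ghost: "f \<Colon> A \<rightarrow> B \<Longrightarrow> far H f = nul\<^bsub>D\<^esub> (fob H A) (fob H B) \<longleftrightarrow> f \<in> ghosts T X A B"
    and H_ess: "ess_image D H (Obj T) = Obj D"
    and H_full: "full_functor T D H"
begin

abbreviation arrow_D (\<open>_ \<Colon>\<^sub>D _ \<rightarrow> _\<close> [61, 61, 61] 50)
  where "\<phi> \<Colon>\<^sub>D F \<rightarrow> G \<equiv> \<phi> \<Colon>\<^bsub>D\<^esub> F \<rightarrow> G"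

abbreviation Cmp_D (infixr \<open>\<cdot>\<^sub>D\<close> 75)
  where "\<psi> \<cdot>\<^sub>D \<phi> \<equiv> \<psi> \<cdot>\<^bsub>D\<^esub> \<phi>"

abbreviation nul_D (\<open>nul\<^sub>D\<close>)
  where "nul\<^sub>D \<equiv> null_arrow D"

abbreviation plus_D (infixl \<open>\<boxplus>\<^sub>D\<close> 65)
  where "\<phi> \<boxplus>\<^sub>D \<psi> \<equiv> \<phi> \<boxplus>\<^bsub>D\<^esub> \<psi>"

abbreviation minus_D (infixl \<open>\<boxminus>\<^sub>D\<close> 65)
  where "\<phi> \<boxminus>\<^sub>D \<psi> \<equiv> \<phi> \<boxminus>\<^bsub>D\<^esub> \<psi>"

abbreviation smult_D (infixr \<open>\<star>\<^sub>D\<close> 72)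
  where "c \<star>\<^sub>D \<phi> \<equiv> c \<star>\<^bsub>D\<^esub> \<phi>"

lemma X_Obj [simp]: "Z \<in> X \<Longrightarrow> Z \<in> Obj T"
  using X_subcat unfolding subcategory_def by blast

lemma X_summand:
  assumes "i \<Colon> A \<rightarrow> Z" "p \<Colon> Z \<rightarrow> A" "p \<cdot> i = Idt T A" "Z \<in> X"
  shows "A \<in> X"
proof -
  have "direct_summand T A Z" by (rule direct_summandI[OF split assms(1-3)])
  then show ?thesis using X_subcat assms(4) unfolding subcategory_def by blast
qed

lemma H_eq:
  assumes "f \<Colon> A \<rightarrow> B" "g \<Colon> A \<rightarrow> B"
  shows "far H f = far H g \<longleftrightarrow> (\<forall>Z\<in>X. \<forall>z\<in>Arr T Z A. f \<cdot> z = g \<cdot> z)"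
proof -
  have t: "f \<boxminus> g \<Colon> A \<rightarrow> B" using assms by simp
  have "far H f = far H g \<longleftrightarrow> far H f \<boxminus>\<^sub>D far H g = nul\<^sub>D (fob H A) (fob H B)"
    using assms H.D.minus_eq_nul[of "far H f" "fob H A" "fob H B" "far H g"] by simp
  also have "\<dots> \<longleftrightarrow> far H (f \<boxminus> g) = nul\<^sub>D (fob H A) (fob H B)"
    using assms H.far_minus[of f g] by simp
  also have "\<dots> \<longleftrightarrow> f \<boxminus> g \<in> ghosts T X A B" using H_ghost[OF t] .
  also have "\<dots> \<longleftrightarrow> (\<forall>Z\<in>X. \<forall>z\<in>Arr T Z A. (f \<boxminus> g) \<cdot> z = nul Z B)"
    unfolding ghosts_def using ArrI[OF t] by simp
  also have "\<dots> \<longleftrightarrow> (\<forall>Z\<in>X. \<forall>z\<in>Arr T Z A. f \<cdot> z = g \<cdot> z)"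
  proof (intro ball_cong refl)
    fix Z z assume "Z \<in> X" "z \<in> Arr T Z A"
    then have z: "z \<Colon> Z \<rightarrow> A" using ArrD[of z Z A] assms by simp
    have "(f \<boxminus> g) \<cdot> z = f \<cdot> z \<boxminus> g \<cdot> z" using z assms by (simp add: Cmp_distrib)
    then show "(f \<boxminus> g) \<cdot> z = nul Z B \<longleftrightarrow> f \<cdot> z = g \<cdot> z"
      using z assms minus_eq_nul[of "f \<cdot> z" Z B "g \<cdot> z"] by simp
  qed
  finally show ?thesis .
qed

lemma H_eqI:
  assumes "f \<Colon> A \<rightarrow> B" "g \<Colon> A \<rightarrow> B" "\<And>Z z. Z \<in> X \<Longrightarrow> z \<Colon> Z \<rightarrow> A \<Longrightarrow> f \<cdot> z = g \<cdot> z"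
  shows "far H f = far H g"
proof -
  have A: "A \<in> Obj T" using assms(1) by simp
  show ?thesis unfolding H_eq[OF assms(1,2)] by (intro ballI assms(3) ArrD X_Obj A)
qed

lemma H_eqD:
  assumes "far H f = far H g" "f \<Colon> A \<rightarrow> B" "g \<Colon> A \<rightarrow> B" "Z \<in> X" "z \<Colon> Z \<rightarrow> A"
  shows "f \<cdot> z = g \<cdot> z"
  using H_eq[OF assms(2,3), THEN iffD1, OF assms(1)] assms(4) ArrI[OF assms(5)] by blast

text \<open>Equality modulo ghosts, tested on the identity of \<open>Z\<close>, is equality:
  \<open>H\<close> is faithful on maps out of \<open>X\<close>.\<close>

lemma H_eq_X:
  assumes "far H f = far H g" "f \<Colon> Z \<rightarrow> B" "g \<Colon> Z \<rightarrow> B" "Z \<in> X"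
  shows "f = g"
  using H_eqD[OF assms, of "Idt T Z"] assms(2,3) by simp

definition ghost :: "'m \<Rightarrow> bool"
  where "ghost f \<longleftrightarrow> (\<forall>Z\<in>X. \<forall>z\<in>Arr T Z (Src T f). f \<cdot> z = nul Z (Tgt T f))"

lemma ghostD:
  assumes "ghost f" "f \<Colon> A \<rightarrow> B" "Z \<in> X" "z \<Colon> Z \<rightarrow> A"
  shows "f \<cdot> z = nul Z B"
  using assms(1)[unfolded ghost_def, THEN bspec, OF assms(3)] ArrI[OF assms(4)] assms(2) by simp

lemma ghostI:
  assumes f: "f \<Colon> A \<rightarrow> B" and "\<And>Z z. Z \<in> X \<Longrightarrow> z \<Colon> Z \<rightarrow> A \<Longrightarrow> f \<cdot> z = nul Z B"
  shows "ghost f"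
  unfolding ghost_def
proof (intro ballI)
  fix Z z assume Z: "Z \<in> X" and "z \<in> Arr T Z (Src T f)"
  then have "z \<Colon> Z \<rightarrow> A" using ArrD[of z Z A] f by simp
  from assms(2)[OF Z this] show "f \<cdot> z = nul Z (Tgt T f)" using f by simp
qed

lemma H_nul_iff:
  assumes f: "f \<Colon> A \<rightarrow> B"
  shows "far H f = nul\<^sub>D (fob H A) (fob H B) \<longleftrightarrow> ghost f"
  unfolding H_ghost[OF f] ghosts_def ghost_def using ArrI[OF f] f by simp

lemma H_lift:
  assumes "A \<in> Obj T" "B \<in> Obj T" "\<phi> \<Colon>\<^sub>D fob H A \<rightarrow> fob H B"
  obtains f where "f \<Colon> A \<rightarrow> B" "far H f = \<phi>"
  using H.full_lift[OF H_full assms] .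

lemma H_obj:
  assumes "F \<in> Obj D"
  obtains A a a' where "A \<in> Obj T" "a \<Colon>\<^sub>D fob H A \<rightarrow> F" "a' \<Colon>\<^sub>D F \<rightarrow> fob H A"
    "a' \<cdot>\<^sub>D a = Idt D (fob H A)" "a \<cdot>\<^sub>D a' = Idt D F"
proof -
  have "F \<in> ess_image D H (Obj T)" using H_ess assms by simp
  then obtain A where A: "A \<in> Obj T" "isomorphic D (fob H A) F" unfolding ess_image_def by blast
  from H.D.isomorphicE[OF A(2) _ assms] A(1) show thesis using that by (metis H.fob_Obj)
qed

text \<open>Objectwise surjectivity of \<open>H f\<close>. The lemmas \<open>surjX_epi\<close> and
  \<open>epi_surjX\<close> identify it with being an epimorphism in \<open>D\<close>.\<close>

definition surjX :: "'m \<Rightarrow> bool"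
  where "surjX f \<longleftrightarrow> (\<forall>Z\<in>X. \<forall>z\<in>Arr T Z (Tgt T f). \<exists>y\<in>Arr T Z (Src T f). f \<cdot> y = z)"

lemma surjXD:
  assumes "surjX f" "f \<Colon> A \<rightarrow> B" "Z \<in> X" "z \<Colon> Z \<rightarrow> B"
  obtains y where "y \<Colon> Z \<rightarrow> A" "f \<cdot> y = z"
proof -
  have "z \<in> Arr T Z (Tgt T f)" and A: "Src T f = A" using ArrI[OF assms(4)] assms(2) by simp_all
  then obtain y where y: "y \<in> Arr T Z A" "f \<cdot> y = z"
    using assms(1)[unfolded surjX_def, THEN bspec, OF assms(3)] unfolding A by blast
  show thesis by (rule that[OF ArrD[OF y(1)] y(2)]) (use assms in simp_all)
qed

lemma surjXI:
  assumes f: "f \<Colon> A \<rightarrow> B" and "\<And>Z z. Z \<in> X \<Longrightarrow> z \<Colon> Z \<rightarrow> B \<Longrightarrow> \<exists>y. y \<Colon> Z \<rightarrow> A \<and> f \<cdot> y = z"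
  shows "surjX f"
  unfolding surjX_def
proof (intro ballI)
  fix Z z assume Z: "Z \<in> X" and "z \<in> Arr T Z (Tgt T f)"
  then have "z \<Colon> Z \<rightarrow> B" using ArrD[of z Z B] f by simp
  from assms(2)[OF Z this] obtain y where y: "y \<Colon> Z \<rightarrow> A" "f \<cdot> y = z" by blast
  show "\<exists>y\<in>Arr T Z (Src T f). f \<cdot> y = z" using ArrI[OF y(1)] y(2) f by (intro bexI[of _ y]) simp_all
qed

text \<open>A map that annihilates \<open>H f\<close> lifts, after identifying its target with some
  \<open>H W\<close>, to an arrow \<open>u\<close> with \<open>u \<cdot> f\<close> a ghost. Every
  map from \<open>X\<close> to \<open>B\<close> factors through \<open>f\<close>, so
  \<open>u\<close> is itself a ghost.\<close>

lemma surjX_epi: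
  assumes f: "f \<Colon> A \<rightarrow> B" and s: "surjX f"
  shows "epi D (fob H A) (fob H B) (far H f)"
proof -
  have t: "far H f \<Colon>\<^sub>D fob H A \<rightarrow> fob H B" using f by simp
  show ?thesis unfolding H.D.epi_iff[OF t]
  proof (intro allI impI)
    fix E g assume g: "g \<Colon>\<^sub>D fob H B \<rightarrow> E" "g \<cdot>\<^sub>D far H f = nul\<^sub>D (fob H A) E"
    obtain W a a' where W: "W \<in> Obj T" "a \<Colon>\<^sub>D fob H W \<rightarrow> E" "a' \<Colon>\<^sub>D E \<rightarrow> fob H W"
      "a' \<cdot>\<^sub>D a = Idt D (fob H W)" "a \<cdot>\<^sub>D a' = Idt D E" using H_obj[of E] g by blast
    have B: "B \<in> Obj T" using f by simp
    have "a' \<cdot>\<^sub>D g \<Colon>\<^sub>D fob H B \<rightarrow> fob H W" using W(3) g(1) by simp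
    then obtain u where u: "u \<Colon> B \<rightarrow> W" "far H u = a' \<cdot>\<^sub>D g" using H_lift[OF B W(1)] by blast
    have uf: "u \<cdot> f \<Colon> A \<rightarrow> W" using u(1) f by simp
    have "far H (u \<cdot> f) = (a' \<cdot>\<^sub>D g) \<cdot>\<^sub>D far H f" using u f by simp
    also have "\<dots> = nul\<^sub>D (fob H A) (fob H W)" using f g W(3) by simp
    finally have gh: "ghost (u \<cdot> f)" using H_nul_iff[OF uf] by simp
    have "ghost u"
    proof (rule ghostI[OF u(1)])
      fix Z z assume z: "Z \<in> X" "z \<Colon> Z \<rightarrow> B"
      obtain y where y: "y \<Colon> Z \<rightarrow> A" "f \<cdot> y = z" using surjXD[OF s f z] .
      have "u \<cdot> (f \<cdot> y) = (u \<cdot> f) \<cdot> y" using u(1) f y(1) by simp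
      then show "u \<cdot> z = nul Z W" unfolding y(2) using ghostD[OF gh uf z(1) y(1)] by simp
    qed
    then have "a' \<cdot>\<^sub>D g = nul\<^sub>D (fob H B) (fob H W)" using H_nul_iff[OF u(1)] u(2) by simp
    then have "a \<cdot>\<^sub>D (a' \<cdot>\<^sub>D g) = nul\<^sub>D (fob H B) E" using W(2) B by simp
    then show "g = nul\<^sub>D (fob H B) E" using H.D.Cmp_eq_Cmp[OF W(5), of g] W(2,3) g(1) by simp
  qed
qed

text \<open>The map \<open>c\<close> into the cone satisfies \<open>c \<cdot> f = 0\<close>, so the
  epimorphism forces \<open>H c = 0\<close>. Thus \<open>c\<close> annihilates every map from
  \<open>X\<close> to \<open>B\<close>, and each of these lifts through \<open>f\<close>.\<close>

lemma epi_surjX: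
  assumes f: "f \<Colon> A \<rightarrow> B" and e: "epi D (fob H A) (fob H B) (far H f)"
  shows "surjX f"
proof (rule surjXI[OF f])
  fix Z z assume z: "Z \<in> X" "z \<Colon> Z \<rightarrow> B"
  obtain E c d where tr: "(A, B, E, f, c, d) \<in> Tri T" using tri_cone[OF f] .
  note t = triD[OF tr]
  have hf: "far H f \<Colon>\<^sub>D fob H A \<rightarrow> fob H B" and hc: "far H c \<Colon>\<^sub>D fob H B \<rightarrow> fob H E" using t by simp_all
  have "far H c \<cdot>\<^sub>D far H f = nul\<^sub>D (fob H A) (fob H E)"
    using H.far_Cmp[of f c] t tri_zero1[OF tr] by simp
  from H.D.epiD[OF e hf hc this] have "ghost c" using H_nul_iff[OF t(2)] by simp
  from ghostD[OF this t(2) z] obtain y where "y \<Colon> Z \<rightarrow> A" "f \<cdot> y = z" using tri_ex1[OF tr z(2)] by blast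
  then show "\<exists>y. y \<Colon> Z \<rightarrow> A \<and> f \<cdot> y = z" by blast
qed

section \<open>Approximations and projective objects\<close>

lemma approx:
  assumes "A \<in> Obj T"
  obtains X0 p where "X0 \<in> X" "p \<Colon> X0 \<rightarrow> A" "surjX p"
proof -
  obtain X0 p where p: "X0 \<in> X" "p \<in> Arr T X0 A" "\<forall>X'\<in>X. (\<lambda>h. p \<cdot> h) ` Arr T X' X0 = Arr T X' A"
    using X_cf assms unfolding contravariantly_finite_def by blast
  have t: "p \<Colon> X0 \<rightarrow> A" using ArrD[OF p(2)] p(1) assms by simp
  have "surjX p"
  proof (rule surjXI[OF t])
    fix Z z assume z: "Z \<in> X" "z \<Colon> Z \<rightarrow> A"
    have "z \<in> (\<lambda>h. p \<cdot> h) ` Arr T Z X0" using p(3) z(1) ArrI[OF z(2)] by simp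
    then obtain y where "y \<in> Arr T Z X0" "z = p \<cdot> y" by (elim imageE)
    then show "\<exists>y. y \<Colon> Z \<rightarrow> X0 \<and> p \<cdot> y = z" using ArrD[of y Z X0] z(1) p(1) by (intro exI[of _ y]) simp
  qed
  then show thesis using that p(1) t by blast
qed

text \<open>Objects \<open>H Z\<close> with \<open>Z\<close> in \<open>X\<close> are projective:
  transported to \<open>T\<close>, the epimorphism is onto on maps out of \<open>Z\<close>.\<close>

lemma projective_lift:
  assumes e: "epi D F G e" "e \<Colon>\<^sub>D F \<rightarrow> G" and Z: "Z \<in> X" and \<phi>: "\<phi> \<Colon>\<^sub>D fob H Z \<rightarrow> G"
  obtains \<psi> where "\<psi> \<Colon>\<^sub>D fob H Z \<rightarrow> F" "e \<cdot>\<^sub>D \<psi> = \<phi>"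
proof -
  obtain A a a' where A: "A \<in> Obj T" "a \<Colon>\<^sub>D fob H A \<rightarrow> F" "a' \<Colon>\<^sub>D F \<rightarrow> fob H A"
    "a' \<cdot>\<^sub>D a = Idt D (fob H A)" "a \<cdot>\<^sub>D a' = Idt D F" using H_obj[of F] e by blast
  obtain B b b' where B: "B \<in> Obj T" "b \<Colon>\<^sub>D fob H B \<rightarrow> G" "b' \<Colon>\<^sub>D G \<rightarrow> fob H B"
    "b' \<cdot>\<^sub>D b = Idt D (fob H B)" "b \<cdot>\<^sub>D b' = Idt D G" using H_obj[of G] e by blast
  have ep: "epi D (fob H A) (fob H B) (b' \<cdot>\<^sub>D (e \<cdot>\<^sub>D a))"
    by (rule H.D.epi_iso[OF e A(2,3,5) B(3,2,4)])
  have "b' \<cdot>\<^sub>D (e \<cdot>\<^sub>D a) \<Colon>\<^sub>D fob H A \<rightarrow> fob H B" using e(2) A(2) B(3) by simp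
  then obtain f where f: "f \<Colon> A \<rightarrow> B" "far H f = b' \<cdot>\<^sub>D (e \<cdot>\<^sub>D a)" using H_lift[OF A(1) B(1)] by blast
  have s: "surjX f" using epi_surjX[OF f(1)] ep f(2) by simp
  have "b' \<cdot>\<^sub>D \<phi> \<Colon>\<^sub>D fob H Z \<rightarrow> fob H B" using \<phi> B(3) by simp
  then obtain z where z: "z \<Colon> Z \<rightarrow> B" "far H z = b' \<cdot>\<^sub>D \<phi>" using H_lift[OF X_Obj[OF Z] B(1)] by blast
  obtain y where y: "y \<Colon> Z \<rightarrow> A" "f \<cdot> y = z" using surjXD[OF s f(1) Z z(1)] .
  define \<psi> where "\<psi> = a \<cdot>\<^sub>D far H y"
  have t: "\<psi> \<Colon>\<^sub>D fob H Z \<rightarrow> F" unfolding \<psi>_def using y(1) A(2) by simp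
  have "far H (f \<cdot> y) = b' \<cdot>\<^sub>D (e \<cdot>\<^sub>D \<psi>)" unfolding \<psi>_def using H.far_Cmp[of y f] f y(1) A(2) B(3) e(2) by simp
  then have *: "b' \<cdot>\<^sub>D (e \<cdot>\<^sub>D \<psi>) = b' \<cdot>\<^sub>D \<phi>" unfolding y(2) z(2) by simp
  have "is_iso D G (fob H B) b'" by (rule H.D.is_isoI[OF B(3,2,5,4)])
  then have "e \<cdot>\<^sub>D \<psi> = \<phi>" by (rule H.D.iso_left_cancel[OF _ _ _ _ _ _ _ *]) (use t e(2) \<phi> B in simp_all)
  then show thesis using that t by blast
qed

text \<open>The idempotent of \<open>H Z\<close> that belongs to the retract lifts to an
  endomorphism of \<open>Z\<close>. Since \<open>H\<close> is faithful on maps out of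
  \<open>X\<close>, the lift is an idempotent on the nose; it splits in \<open>T\<close>, and its
  image is a summand of \<open>Z\<close>.\<close>

lemma retract_of_X:
  assumes Z: "Z \<in> X" and s: "s \<Colon>\<^sub>D F \<rightarrow> fob H Z" "r \<Colon>\<^sub>D fob H Z \<rightarrow> F" "r \<cdot>\<^sub>D s = Idt D F"
  shows "\<exists>Z'\<in>X. isomorphic D (fob H Z') F"
proof -
  obtain A a a' where A: "A \<in> Obj T" "a \<Colon>\<^sub>D fob H A \<rightarrow> F" "a' \<Colon>\<^sub>D F \<rightarrow> fob H A"
    "a' \<cdot>\<^sub>D a = Idt D (fob H A)" "a \<cdot>\<^sub>D a' = Idt D F" using H_obj[of F] s by blast
  have ZO: "Z \<in> Obj T" using Z by simp
  have "s \<cdot>\<^sub>D a \<Colon>\<^sub>D fob H A \<rightarrow> fob H Z" "a' \<cdot>\<^sub>D r \<Colon>\<^sub>D fob H Z \<rightarrow> fob H A" using s A by simp_all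
  then obtain m n where m: "m \<Colon> A \<rightarrow> Z" "far H m = s \<cdot>\<^sub>D a" and n: "n \<Colon> Z \<rightarrow> A" "far H n = a' \<cdot>\<^sub>D r"
    using H_lift[OF A(1) ZO] H_lift[OF ZO A(1)] by metis
  have nm: "far H n \<cdot>\<^sub>D far H m = Idt D (fob H A)"
    unfolding m(2) n(2) using s(1,2) A(2,3,4) H.D.Cmp_eq_Cmp[OF s(3), of a] by simp
  have nm': "far H n \<cdot>\<^sub>D (far H m \<cdot>\<^sub>D u) = u" if "u \<Colon>\<^sub>D E \<rightarrow> fob H A" for u E
    using H.D.Cmp_eq_Cmp[OF nm, of u] that m(1) n(1) by simp
  define e where "e = m \<cdot> n"
  have e: "e \<Colon> Z \<rightarrow> Z" unfolding e_def using m n by simp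
  have "far H (e \<cdot> e) = far H e" unfolding e_def using m(1) n(1) nm'[of "far H n" "fob H Z"] by simp
  then have ee: "e \<cdot> e = e" by (rule H_eq_X[of _ _ Z Z]) (use e Z in simp_all)
  then obtain Z' p i where "Z' \<in> Obj T" "p \<in> Arr T Z Z'" "i \<in> Arr T Z' Z" and ip: "i \<cdot> p = e" "p \<cdot> i = Idt T Z'"
    using split ZO ArrI[OF e] unfolding split_idempotents_def by blast
  then have t: "p \<Colon> Z \<rightarrow> Z'" "i \<Colon> Z' \<rightarrow> Z" using ArrD ZO by blast+
  have Z': "Z' \<in> X" by (rule X_summand[OF t(2,1) ip(2) Z])
  have hp: "far H p \<cdot>\<^sub>D far H i = Idt D (fob H Z')" using H.far_Cmp[of i p] t ip(2) by simp
  have hm: "far H m \<cdot>\<^sub>D far H n = far H i \<cdot>\<^sub>D far H p"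
    using H.far_Cmp[of n m] H.far_Cmp[of p i] m(1) n(1) t ip(1) unfolding e_def by simp
  have hm': "far H m \<cdot>\<^sub>D (far H n \<cdot>\<^sub>D far H i) = far H i"
    using H.D.Cmp_eq_Cmp[OF hm, of "far H i"] m(1) n(1) t hp by simp
  define u where "u = a \<cdot>\<^sub>D (far H n \<cdot>\<^sub>D far H i)"
  define v where "v = far H p \<cdot>\<^sub>D (far H m \<cdot>\<^sub>D a')"
  have uv: "u \<Colon>\<^sub>D fob H Z' \<rightarrow> F" "v \<Colon>\<^sub>D F \<rightarrow> fob H Z'" unfolding u_def v_def using A(2,3) m(1) n(1) t by simp_all
  have "v \<cdot>\<^sub>D u = far H p \<cdot>\<^sub>D (far H m \<cdot>\<^sub>D (far H n \<cdot>\<^sub>D far H i))"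
    unfolding u_def v_def using A(2,3) m(1) n(1) t H.D.Cmp_eq_Cmp[OF A(4), of "far H n \<cdot>\<^sub>D far H i"] by simp
  then have vu: "v \<cdot>\<^sub>D u = Idt D (fob H Z')" unfolding hm' hp .
  have "far H i \<cdot>\<^sub>D (far H p \<cdot>\<^sub>D (far H m \<cdot>\<^sub>D a')) = far H m \<cdot>\<^sub>D (far H n \<cdot>\<^sub>D (far H m \<cdot>\<^sub>D a'))"
    using H.D.Cmp_eq_Cmp[OF hm, of "far H m \<cdot>\<^sub>D a'"] A(3) m(1) n(1) t by simp
  also have "\<dots> = far H m \<cdot>\<^sub>D a'" using nm'[of a' F] A(3) by simp
  finally have "u \<cdot>\<^sub>D v = a \<cdot>\<^sub>D (far H n \<cdot>\<^sub>D (far H m \<cdot>\<^sub>D a'))"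
    unfolding u_def v_def using A(2,3) m(1) n(1) t by simp
  then have "u \<cdot>\<^sub>D v = Idt D F" using nm'[of a' F] A(3,5) by simp
  from H.D.isomorphicI[OF uv vu this] Z' show ?thesis by blast
qed

text \<open>An approximation of a lift of \<open>P\<close> becomes an epimorphism onto
  \<open>P\<close>, which splits; so \<open>P\<close> is a retract of some
  \<open>H Z\<close>.\<close>

lemma projective_in_X:
  assumes "projective D P"
  shows "\<exists>Z\<in>X. isomorphic D (fob H Z) P"
proof -
  have P: "P \<in> Obj D" using assms unfolding projective_def by simp
  obtain A a a' where A: "A \<in> Obj T" "a \<Colon>\<^sub>D fob H A \<rightarrow> P" "a' \<Colon>\<^sub>D P \<rightarrow> fob H A"
    "a' \<cdot>\<^sub>D a = Idt D (fob H A)" "a \<cdot>\<^sub>D a' = Idt D P" using H_obj[OF P] .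
  obtain Z p where Z: "Z \<in> X" "p \<Colon> Z \<rightarrow> A" "surjX p" using approx[OF A(1)] .
  have hp: "far H p \<Colon>\<^sub>D fob H Z \<rightarrow> fob H A" "fob H Z \<in> Obj D" using Z by simp_all
  have id: "Idt D (fob H Z) \<Colon>\<^sub>D fob H Z \<rightarrow> fob H Z" "Idt D (fob H Z) \<cdot>\<^sub>D Idt D (fob H Z) = Idt D (fob H Z)"
    using hp(2) by simp_all
  have ep: "epi D (fob H Z) P (a \<cdot>\<^sub>D (far H p \<cdot>\<^sub>D Idt D (fob H Z)))"
    by (rule H.D.epi_iso[OF surjX_epi[OF Z(2,3)] hp(1) id(1,1,2) A(2,3,5)])
  define e where "e = a \<cdot>\<^sub>D (far H p \<cdot>\<^sub>D Idt D (fob H Z))"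
  have e: "e \<Colon>\<^sub>D fob H Z \<rightarrow> P" unfolding e_def using A(2) hp by simp
  have "Idt D P \<in> Arr D P P" using P by (simp add: H.D.Arr_iff)
  then obtain s where s: "s \<in> Arr D P (fob H Z)" "e \<cdot>\<^sub>D s = Idt D P"
    using assms ep P hp(2) unfolding projective_def e_def[symmetric] by meson
  from H.D.ArrD[OF s(1) P hp(2)] show ?thesis by (rule retract_of_X[OF Z(1) _ e s(2)])
qed

end

section \<open>Objects without summands in the perpendicular category\<close>

context ghost_setting begin

abbreviation "Tp \<equiv> without_perp_summands T X"
abbreviation "Pp \<equiv> right_perp T X"

lemma Pp_iff: "B \<in> Pp \<longleftrightarrow> B \<in> Obj T \<and> (\<forall>Z\<in>X. hom_null Z B)"
proof -
  have "(\<forall>Z\<in>X. Arr T Z B = {nul Z B}) \<longleftrightarrow> (\<forall>Z\<in>X. hom_null Z B)" if "B \<in> Obj T"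
    by (intro ball_cong refl) (rule Arr_null_iff[folded hom_null_def, OF X_Obj that])
  then show ?thesis unfolding right_perp_def by blast
qed

lemma Tp_Obj [simp]: "A \<in> Tp \<Longrightarrow> A \<in> Obj T"
  unfolding without_perp_summands_def by (drule CollectD) (rule conjunct1)

lemma TpD:
  assumes "A \<in> Tp" "i \<Colon> B \<rightarrow> A" "p \<Colon> A \<rightarrow> B" "p \<cdot> i = Idt T B" "B \<in> Pp"
  shows "Idt T B = nul B B"
proof -
  have "direct_summand T B A" by (rule direct_summandI[OF split assms(2-4)])
  then have "is_zero_obj T B" using assms(1,5) unfolding without_perp_summands_def by blast
  then show ?thesis using is_zero_obj_iff by simp
qed

lemma TpI:
  assumes "A \<in> Obj T" "\<And>B i p. i \<Colon> B \<rightarrow> A \<Longrightarrow> p \<Colon> A \<rightarrow> B \<Longrightarrow> p \<cdot> i = Idt T B \<Longrightarrow> B \<in> Pp \<Longrightarrow> Idt T B = nul B B"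
  shows "A \<in> Tp"
  unfolding without_perp_summands_def
proof (intro CollectI conjI allI impI assms(1))
  fix B assume B: "direct_summand T B A \<and> B \<in> Pp"
  then obtain i p where "i \<Colon> B \<rightarrow> A" "p \<Colon> A \<rightarrow> B" "p \<cdot> i = Idt T B" using direct_summandE by blast
  then show "is_zero_obj T B" using assms(2) B is_zero_obj_iff by blast
qed

lemma X_Tp: "X \<subseteq> Tp"
proof
  fix Z assume Z: "Z \<in> X"
  show "Z \<in> Tp"
  proof (rule TpI)
    fix B i p assume *: "i \<Colon> B \<rightarrow> Z" "p \<Colon> Z \<rightarrow> B" "p \<cdot> i = Idt T B" "B \<in> Pp"
    then have "B \<in> X" using X_summand Z by blast
    then have "hom_null B B" using *(4) Pp_iff by blast
    then show "Idt T B = nul B B" using *(1) by (intro hom_nullD) simp_all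
  qed (use Z in simp)
qed

text \<open>The image \<open>B\<close> of the idempotent receives no non-zero map from
  \<open>X\<close>, since such a map would survive composition with the ghost \<open>e\<close>.
  Hence \<open>B\<close> is a summand of \<open>A\<close> in \<open>Pp\<close>, and it
  vanishes.\<close>

lemma ghost_idempotent:
  assumes A: "A \<in> Tp" and e: "e \<Colon> A \<rightarrow> A" "e \<cdot> e = e" "ghost e"
  shows "e = nul A A"
proof -
  have AO: "A \<in> Obj T" using A by simp
  obtain B p i where "B \<in> Obj T" "p \<in> Arr T A B" "i \<in> Arr T B A" and ip: "i \<cdot> p = e" "p \<cdot> i = Idt T B"
    using split AO ArrI[OF e(1)] e(2) unfolding split_idempotents_def by blast
  then have t: "p \<Colon> A \<rightarrow> B" "i \<Colon> B \<rightarrow> A" using ArrD AO by blast+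
  have "hom_null Z B" if Z: "Z \<in> X" for Z unfolding hom_null_def
  proof (intro allI impI)
    fix z assume z: "z \<Colon> Z \<rightarrow> B"
    have iz: "i \<cdot> z \<Colon> Z \<rightarrow> A" using z t by simp
    have "p \<cdot> (e \<cdot> (i \<cdot> z)) = nul Z B" using ghostD[OF e(3,1) Z iz] t Z by simp
    moreover have "p \<cdot> (e \<cdot> (i \<cdot> z)) = z"
      unfolding ip(1)[symmetric] using t z Cmp_eq_Cmp[OF ip(2), of z] by simp
    ultimately show "z = nul Z B" by simp
  qed
  then have "B \<in> Pp" using Pp_iff t by blast
  from TpD[OF A t(2,1) ip(2) this] have "i \<cdot> (Idt T B \<cdot> p) = nul A A" using t by simp
  then show ?thesis using t ip(1) by simp
qed

text \<open>On objects of \<open>Tp\<close> the ghosts behave like a radical. Fitting's lemma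
  attaches to a power \<open>a\<close> of \<open>f\<close> an idempotent \<open>a \<cdot> x\<close>
  that is congruent to the identity modulo ghosts; its complement is a ghost idempotent, hence zero,
  so \<open>a\<close> is invertible and with it \<open>f\<close>.\<close>

lemma Tp_iso:
  assumes A: "A \<in> Tp" and f: "f \<Colon> A \<rightarrow> A" "far H f = Idt D (fob H A)"
  obtains g where "g \<Colon> A \<rightarrow> A" "g \<cdot> f = Idt T A" "f \<cdot> g = Idt T A"
proof -
  obtain n x y where x: "x \<Colon> A \<rightarrow> A" and y: "y \<Colon> A \<rightarrow> A" and
    ax: "pw f (Suc n) \<cdot> (pw f (Suc n) \<cdot> x) = pw f (Suc n)" and ya: "y \<cdot> (pw f (Suc n) \<cdot> pw f (Suc n)) = pw f (Suc n)"
    using fitting[OF hom_fin f(1)] .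
  define a where "a = pw f (Suc n)"
  note p = in_pw[OF f(1)]
  have a: "a \<Colon> A \<rightarrow> A" unfolding a_def by (rule p)
  have hpw: "far H (pw f m) = Idt D (fob H A)" for m
    using f p[of m] A by (induction m) (simp_all add: in_pw[OF f(1)])
  have ha: "far H a = Idt D (fob H A)" unfolding a_def by (rule hpw)
  have ax': "a \<cdot> (a \<cdot> x) = a" using ax unfolding a_def .
  have ya': "y \<cdot> (a \<cdot> a) = a" using ya unfolding a_def .
  define e where "e = a \<cdot> x"
  have e: "e \<Colon> A \<rightarrow> A" unfolding e_def using a x by simp
  \<comment> \<open>Both \<open>a \<cdot> x\<close> and \<open>y \<cdot> a\<close> equal
    \<open>y \<cdot> a \<cdot> a \<cdot> x\<close>. This makes \<open>e\<close> an idempotent and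
    gives at once a right and a left inverse of \<open>a\<close>.\<close>
  have e2: "e = y \<cdot> a"
  proof -
    have "e = (y \<cdot> (a \<cdot> a)) \<cdot> x" unfolding e_def ya' by simp
    also have "\<dots> = y \<cdot> (a \<cdot> (a \<cdot> x))" using a x y by simp
    finally show ?thesis unfolding ax' .
  qed
  have "e \<cdot> e = (y \<cdot> a) \<cdot> (a \<cdot> x)" using e2 unfolding e_def[symmetric] by simp
  also have "\<dots> = y \<cdot> (a \<cdot> (a \<cdot> x))" using a x y by simp
  finally have ee: "e \<cdot> e = e" unfolding ax' e2[symmetric] .
  have "far H (a \<cdot> (a \<cdot> x)) = far H x" using ha a x by simp
  then have "far H x = Idt D (fob H A)" unfolding ax' ha by simp
  then have he: "far H e = Idt D (fob H A)" unfolding e_def using ha a x by simp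
  define c where "c = Idt T A \<boxminus> e"
  have AO: "A \<in> Obj T" using f by simp
  have c: "c \<Colon> A \<rightarrow> A" unfolding c_def using e by simp
  have "ec = nul A A" if "ec = e \<cdot> c" for ec unfolding that c_def using e ee by (simp add: Cmp_distrib)
  then have ec: "e \<cdot> c = nul A A" by simp
  have "c \<cdot> c = Idt T A \<cdot> c \<boxminus> e \<cdot> c" using c e by (subst (1) c_def) (simp add: Cmp_distrib)
  then have cc: "c \<cdot> c = c" using ec c by simp
  have "far H c = nul\<^sub>D (fob H A) (fob H A)" unfolding c_def using e he AO by (simp add: H.far_minus)
  then have "ghost c" using H_nul_iff[OF c] by simp
  from ghost_idempotent[OF A c cc this] have "Idt T A = e" unfolding c_def using minus_eq_nul[of "Idt T A" A A e] e AO by simp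
  then have e1: "a \<cdot> x = Idt T A" "y \<cdot> a = Idt T A" using e2 unfolding e_def by simp_all
  define q where "q = pw f n"
  have q: "q \<Colon> A \<rightarrow> A" "a = f \<cdot> q" "a = q \<cdot> f"
    unfolding a_def q_def using p[of n] pw_add[OF f(1), of n "Suc 0"] f by simp_all
  have r: "f \<cdot> (q \<cdot> x) = Idt T A" using e1(1) q f(1) x by simp
  have l: "(y \<cdot> q) \<cdot> f = Idt T A" using e1(2) q(1,3) f(1) y by simp
  have "y \<cdot> q = (y \<cdot> q) \<cdot> (f \<cdot> (q \<cdot> x))" unfolding r using q y by simp
  also have "\<dots> = ((y \<cdot> q) \<cdot> f) \<cdot> (q \<cdot> x)" using q(1) y x f(1) by simp
  also have "\<dots> = q \<cdot> x" unfolding l using q(1) x by simp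
  finally have lr: "y \<cdot> q = q \<cdot> x" .
  have "q \<cdot> x \<Colon> A \<rightarrow> A" using q(1) x by simp
  then show thesis using that r l unfolding lr by blast
qed

text \<open>A retraction modulo ghosts is corrected to a true one. The inverse \<open>g\<close> of
  \<open>v \<cdot> u\<close> is exported with both of its equations because some uses correct on the
  left and others on the right.\<close>

lemma Tp_retract:
  assumes A: "A \<in> Tp" and u: "u \<Colon> A \<rightarrow> B" and v: "v \<Colon> B \<rightarrow> A" and h: "far H v \<cdot>\<^sub>D far H u = Idt D (fob H A)"
  obtains v' g where "v' \<Colon> B \<rightarrow> A" "v' \<cdot> u = Idt T A" "g \<Colon> A \<rightarrow> A" "v' = g \<cdot> v"
    "g \<cdot> (v \<cdot> u) = Idt T A" "(v \<cdot> u) \<cdot> g = Idt T A"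
proof -
  have t: "v \<cdot> u \<Colon> A \<rightarrow> A" using u v by simp
  have "far H (v \<cdot> u) = Idt D (fob H A)" using h u v by simp
  from Tp_iso[OF A t this] obtain g where g: "g \<Colon> A \<rightarrow> A" "g \<cdot> (v \<cdot> u) = Idt T A" "(v \<cdot> u) \<cdot> g = Idt T A" .
  show thesis by (rule that[of "g \<cdot> v" g]) (use g u v in simp_all)
qed

text \<open>Lifts of two inverse isomorphisms are inverse only modulo ghosts. Correcting them in
  \<open>A\<close> gives a left inverse of \<open>u\<close>, correcting them in \<open>B\<close> a
  right inverse, and the two coincide.\<close>

lemma Tp_reflect:
  assumes A: "A \<in> Tp" and B: "B \<in> Tp" and i: "isomorphic D (fob H A) (fob H B)"
  shows "isomorphic T A B"
proof -
  have O: "A \<in> Obj T" "B \<in> Obj T" using A B by simp_all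
  obtain \<phi> \<psi> where f: "\<phi> \<Colon>\<^sub>D fob H A \<rightarrow> fob H B" "\<psi> \<Colon>\<^sub>D fob H B \<rightarrow> fob H A"
    "\<psi> \<cdot>\<^sub>D \<phi> = Idt D (fob H A)" "\<phi> \<cdot>\<^sub>D \<psi> = Idt D (fob H B)" using H.D.isomorphicE[OF i] O by auto
  obtain u where u: "u \<Colon> A \<rightarrow> B" "far H u = \<phi>" using H_lift[OF O f(1)] .
  obtain v where v: "v \<Colon> B \<rightarrow> A" "far H v = \<psi>" using H_lift[OF O(2,1) f(2)] .
  obtain v' where v': "v' \<Colon> B \<rightarrow> A" "v' \<cdot> u = Idt T A"
    using Tp_retract[OF A u(1) v(1)] f(3) unfolding u(2) v(2) by blast
  obtain g where g: "g \<Colon> B \<rightarrow> B" "(u \<cdot> v) \<cdot> g = Idt T B"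
    using Tp_retract[OF B v(1) u(1)] f(4) unfolding u(2) v(2) by blast
  have r: "u \<cdot> (v \<cdot> g) = Idt T B" using g u(1) v(1) by simp
  have "v' = v' \<cdot> (u \<cdot> (v \<cdot> g))" unfolding r using v' by simp
  also have "\<dots> = (v' \<cdot> u) \<cdot> (v \<cdot> g)" using v'(1) u(1) v(1) g(1) by simp
  also have "\<dots> = v \<cdot> g" unfolding v'(2) using v(1) g(1) by simp
  finally have "u \<cdot> v' = Idt T B" using r by simp
  from isomorphicI[OF u(1) v' this] show ?thesis .
qed

lemma Tp_summand:
  assumes A: "A \<in> Tp" and i: "i \<Colon> B \<rightarrow> A" "p \<Colon> A \<rightarrow> B" "p \<cdot> i = Idt T B"
  shows "B \<in> Tp"
proof (rule TpI)
  fix E j q assume *: "j \<Colon> E \<rightarrow> B" "q \<Colon> B \<rightarrow> E" "q \<cdot> j = Idt T E" "E \<in> Pp"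
  have "(q \<cdot> p) \<cdot> (i \<cdot> j) = q \<cdot> ((p \<cdot> i) \<cdot> j)" using i(1,2) *(1,2) by simp
  also have "\<dots> = Idt T E" unfolding i(3) using * by simp
  finally show "Idt T E = nul E E" using i(1,2) *(1,2,4) by (intro TpD[OF A, of "i \<cdot> j" E "q \<cdot> p"]) simp_all
qed (use i in simp)

lemma Tp_isomorphic:
  assumes "A \<in> Tp" "isomorphic T A B" "B \<in> Obj T"
  shows "B \<in> Tp"
proof -
  have "A \<in> Obj T" using assms by simp
  from isomorphicE[OF assms(2) this assms(3)] obtain f g where "f \<Colon> A \<rightarrow> B" "g \<Colon> B \<rightarrow> A" "g \<cdot> f = Idt T A" "f \<cdot> g = Idt T B" .
  then show ?thesis using Tp_summand[OF assms(1)] by blast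
qed

lemma ghost_from_Pp: "C \<in> Pp \<Longrightarrow> f \<Colon> A \<rightarrow> C \<Longrightarrow> ghost f"
proof (rule ghostI)
  fix Z z assume "C \<in> Pp" "f \<Colon> A \<rightarrow> C" "Z \<in> X" "z \<Colon> Z \<rightarrow> A"
  moreover from this have "f \<cdot> z \<Colon> Z \<rightarrow> C" "hom_null Z C" using Pp_iff by simp_all
  ultimately show "f \<cdot> z = nul Z C" using hom_nullD by blast
qed

text \<open>The identity of a summand \<open>C\<close> in \<open>Pp\<close> is the sum of its parts
  through \<open>A\<close> and through \<open>B\<close>. The part \<open>v\<close> from
  \<open>B\<close> to \<open>C\<close> is a ghost, so \<open>1 - u v\<close> is invertible on
  \<open>B\<close> by \<open>Tp_iso\<close>. Then \<open>1 - v u\<close>, which is the part through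
  \<open>A\<close>, has a left inverse, and \<open>C\<close> is already a retract of
  \<open>A\<close>.\<close>

lemma Tp_direct_sum:
  assumes A: "A \<in> Tp" and B: "B \<in> Tp" and S: "is_direct_sum T A B S"
  shows "S \<in> Tp"
proof (rule TpI)
  obtain i j p q where t: "i \<Colon> A \<rightarrow> S" "j \<Colon> B \<rightarrow> S" "p \<Colon> S \<rightarrow> A" "q \<Colon> S \<rightarrow> B" and
    e: "p \<cdot> i = Idt T A" "q \<cdot> j = Idt T B" "p \<cdot> j = nul B A" "q \<cdot> i = nul A B" "i \<cdot> p \<boxplus> j \<cdot> q = Idt T S"
    using is_direct_sumE[OF S] .
  show "S \<in> Obj T" using t by simp
  fix C k r assume c: "k \<Colon> C \<rightarrow> S" "r \<Colon> S \<rightarrow> C" "r \<cdot> k = Idt T C" "C \<in> Pp"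
  have pk: "p \<cdot> k \<Colon> C \<rightarrow> A" and ri: "r \<cdot> i \<Colon> A \<rightarrow> C" and qk: "q \<cdot> k \<Colon> C \<rightarrow> B" and rj: "r \<cdot> j \<Colon> B \<rightarrow> C"
    using t c(1,2) by simp_all
  have "Idt T C = r \<cdot> ((i \<cdot> p \<boxplus> j \<cdot> q) \<cdot> k)" unfolding e(5) using t c by simp
  also have "\<dots> = (r \<cdot> i) \<cdot> (p \<cdot> k) \<boxplus> (r \<cdot> j) \<cdot> (q \<cdot> k)" using t c(1,2) by (simp add: Cmp_distrib)
  finally have id: "(r \<cdot> i) \<cdot> (p \<cdot> k) \<boxplus> (r \<cdot> j) \<cdot> (q \<cdot> k) = Idt T C" by simp
  define u where "u = q \<cdot> k"
  define v where "v = r \<cdot> j"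
  have uv: "u \<Colon> C \<rightarrow> B" "v \<Colon> B \<rightarrow> C" unfolding u_def v_def using qk rj by simp_all
  define w where "w = Idt T B \<boxminus> u \<cdot> v"
  have w: "w \<Colon> B \<rightarrow> B" unfolding w_def using uv by simp
  have "ghost v" by (rule ghost_from_Pp[OF c(4) uv(2)])
  then have "far H v = nul\<^sub>D (fob H B) (fob H C)" using H_nul_iff[OF uv(2)] by simp
  then have hw: "far H w = Idt D (fob H B)" unfolding w_def using uv by (simp add: H.far_minus)
  obtain g where g: "g \<Colon> B \<rightarrow> B" "g \<cdot> w = Idt T B" "w \<cdot> g = Idt T B" using Tp_iso[OF B w hw] .
  define s where "s = Idt T C \<boxminus> v \<cdot> u"
  have s: "s \<Colon> C \<rightarrow> C" unfolding s_def using uv by simp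
  have sr: "s = (r \<cdot> i) \<cdot> (p \<cdot> k)" unfolding s_def u_def v_def
    using plus_eq_iff_minus[of "(r \<cdot> i) \<cdot> (p \<cdot> k)" C C "(r \<cdot> j) \<cdot> (q \<cdot> k)" "Idt T C"] id t c(1,2) by simp
  \<comment> \<open>The familiar formula: an inverse of 1 - vu is 1 + v g u, with \<open>g\<close>
    an inverse of 1 - uv.\<close>
  define s' where "s' = Idt T C \<boxplus> v \<cdot> (g \<cdot> u)"
  have s': "s' \<Colon> C \<rightarrow> C" unfolding s'_def using uv g by simp
  have us: "u \<cdot> s = w \<cdot> u" unfolding s_def w_def using uv by (simp add: Cmp_distrib)
  have "s' \<cdot> s = s \<boxplus> v \<cdot> (g \<cdot> (u \<cdot> s))" unfolding s'_def using uv g(1) s by (simp add: Cmp_distrib)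
  also have "g \<cdot> (u \<cdot> s) = u" unfolding us using Cmp_eq_Cmp[OF g(2), of u] g(1) w uv by simp
  also have "s \<boxplus> v \<cdot> u = Idt T C" unfolding s_def using minus_plus_cancel[of "Idt T C" C C "v \<cdot> u"] uv by simp
  finally have "(s' \<cdot> (r \<cdot> i)) \<cdot> (p \<cdot> k) = Idt T C" unfolding sr using s' pk ri by simp
  moreover have "s' \<cdot> (r \<cdot> i) \<Colon> A \<rightarrow> C" using s' ri by simp
  ultimately show "Idt T C = nul C C" using TpD[OF A pk _ _ c(4)] by blast
qed

lemma Tp_zero: "is_zero_obj T Z \<Longrightarrow> Z \<in> Tp"
proof (rule TpI)
  assume Z: "is_zero_obj T Z"
  then show "Z \<in> Obj T" using is_zero_obj_iff by blast
  fix B i p assume *: "i \<Colon> B \<rightarrow> Z" "p \<Colon> Z \<rightarrow> B" "p \<cdot> i = Idt T B"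
  then show "Idt T B = nul B B" using zero_obj_to[OF Z *(1)] by simp
qed

end

section \<open>Serre duality\<close>

locale serre_cat = triang K T
  for K :: "('k, 'r) ring_scheme" and T :: "('k, 'o, 'm, 'z) tcat_scheme" (structure) +
  fixes S :: "('o, 'm, 'o, 'm) funct"
  assumes serre: "serre_functor K T S" and hom_fin': "hom_finite K T"
begin

lemma S_equiv: "linear_equivalence K T T S"
  using serre unfolding serre_functor_def triangulated_equivalence_def by blast

sublocale S: linfun K T T S
  using S_equiv unfolding linear_equivalence_def by unfold_locales simp

lemma S_full: "full_functor T T S" and S_faithful: "faithful_functor T S"
  using S_equiv unfolding linear_equivalence_def by simp_all

lemma S_surj:
  assumes "A \<in> Obj T"
  obtains B where "B \<in> Obj T" "isomorphic T (fob S B) A"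
proof -
  have "A \<in> ess_image T S (Obj T)" using S_equiv assms unfolding linear_equivalence_def by simp
  then show thesis using that unfolding ess_image_def by blast
qed

definition \<theta> :: "'o \<Rightarrow> 'm"
  where "\<theta> = (SOME \<theta>. (\<forall>A\<in>Obj T. is_iso T (fob S (shob T A)) (shob T (fob S A)) (\<theta> A)) \<and>
      (\<forall>A\<in>Obj T. \<forall>B\<in>Obj T. \<forall>f\<in>Arr T A B.
        \<theta> B \<cdot> far S (shar T f) = shar T (far S f) \<cdot> \<theta> A) \<and>
      (\<forall>(A, B, D, f, g, h)\<in>Tri T.
        (fob S A, fob S B, fob S D, far S f, far S g, \<theta> A \<cdot> far S h) \<in> Tri T))"

lemma \<theta>_props:
  "(\<forall>A\<in>Obj T. is_iso T (fob S (shob T A)) (shob T (fob S A)) (\<theta> A)) \<and>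
      (\<forall>A\<in>Obj T. \<forall>B\<in>Obj T. \<forall>f\<in>Arr T A B.
        \<theta> B \<cdot> far S (shar T f) = shar T (far S f) \<cdot> \<theta> A) \<and>
      (\<forall>(A, B, D, f, g, h)\<in>Tri T.
        (fob S A, fob S B, fob S D, far S f, far S g, \<theta> A \<cdot> far S h) \<in> Tri T)"
  unfolding \<theta>_def by (rule someI_ex[OF serre[unfolded serre_functor_def triangulated_equivalence_def, THEN conjunct1, THEN conjunct2]])

lemma \<theta>_iso: "A \<in> Obj T \<Longrightarrow> is_iso T (fob S (shob T A)) (shob T (fob S A)) (\<theta> A)"
  using \<theta>_props by blast

lemma \<theta>_in [simp]:
  assumes "A \<in> Obj T"
  shows "\<theta> A \<in> Mor T" "Src T (\<theta> A) = fob S (shob T A)" "Tgt T (\<theta> A) = shob T (fob S A)"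
  using is_isoE[OF \<theta>_iso[OF assms]] assms by (metis S.fob_Obj Sh.fob_Obj)+

lemma \<theta>_nat: "f \<Colon> A \<rightarrow> B \<Longrightarrow> \<theta> B \<cdot> far S (shar T f) = shar T (far S f) \<cdot> \<theta> A"
  using \<theta>_props[THEN conjunct2, THEN conjunct1] ArrI[of f A B] by simp

lemma S_tri:
  assumes "(A, B, D, f, g, h) \<in> Tri T"
  shows "(fob S A, fob S B, fob S D, far S f, far S g, \<theta> A \<cdot> far S h) \<in> Tri T"
  using \<theta>_props[THEN conjunct2, THEN conjunct2] assms by fastforce

definition \<eta> :: "'o \<Rightarrow> 'o \<Rightarrow> ('m \<Rightarrow> 'k) \<Rightarrow> 'm"
  where "\<eta> = (SOME \<eta>. (\<forall>A\<in>Obj T. \<forall>B\<in>Obj T.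
          \<eta> A B \<in> linear_isos K (dual_module K (Hom T A B)) (Hom T B (fob S A))) \<and>
      (\<forall>A\<in>Obj T. \<forall>A'\<in>Obj T. \<forall>B\<in>Obj T. \<forall>B'\<in>Obj T. \<forall>a\<in>Arr T A A'. \<forall>b\<in>Arr T B' B.
        \<forall>\<phi>\<in>carrier (dual_module K (Hom T A B)).
          \<eta> A' B' (\<lambda>x\<in>Arr T A' B'. \<phi> (b \<cdot> x \<cdot> a)) = far S a \<cdot> \<eta> A B \<phi> \<cdot> b))"

lemma \<eta>_props: "(\<forall>A\<in>Obj T. \<forall>B\<in>Obj T.
          \<eta> A B \<in> linear_isos K (dual_module K (Hom T A B)) (Hom T B (fob S A))) \<and>
      (\<forall>A\<in>Obj T. \<forall>A'\<in>Obj T. \<forall>B\<in>Obj T. \<forall>B'\<in>Obj T. \<forall>a\<in>Arr T A A'. \<forall>b\<in>Arr T B' B.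
        \<forall>\<phi>\<in>carrier (dual_module K (Hom T A B)).
          \<eta> A' B' (\<lambda>x\<in>Arr T A' B'. \<phi> (b \<cdot> x \<cdot> a)) = far S a \<cdot> \<eta> A B \<phi> \<cdot> b)"
  unfolding \<eta>_def by (rule someI_ex[OF serre[unfolded serre_functor_def, THEN conjunct2]])

abbreviation dual :: "'o \<Rightarrow> 'o \<Rightarrow> ('m \<Rightarrow> 'k) set"
  where "dual A B \<equiv> carrier (dual_module K (Hom T A B))"

lemma dual_iff:
  "\<phi> \<in> dual A B \<longleftrightarrow> \<phi> \<in> Arr T A B \<rightarrow>\<^sub>E carrier K \<and>
     (\<forall>x\<in>Arr T A B. \<forall>y\<in>Arr T A B. \<phi> (x \<oplus>\<^bsub>Hom T A B\<^esub> y) = \<phi> x \<oplus>\<^bsub>K\<^esub> \<phi> y) \<and>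
     (\<forall>c\<in>carrier K. \<forall>x\<in>Arr T A B. \<phi> (c \<odot>\<^bsub>Hom T A B\<^esub> x) = c \<otimes>\<^bsub>K\<^esub> \<phi> x)"
  unfolding dual_module_def by simp

lemma \<eta>_linear_iso:
  assumes "A \<in> Obj T" "B \<in> Obj T"
  shows "bij_betw (\<eta> A B) (dual A B) (Arr T B (fob S A))"
    "\<phi> \<in> dual A B \<Longrightarrow> \<psi> \<in> dual A B \<Longrightarrow>
      \<eta> A B (\<phi> \<oplus>\<^bsub>dual_module K (Hom T A B)\<^esub> \<psi>) = \<eta> A B \<phi> \<oplus>\<^bsub>Hom T B (fob S A)\<^esub> \<eta> A B \<psi>"
  using \<eta>_props[THEN conjunct1, THEN bspec, OF assms(1), THEN bspec, OF assms(2)]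
  unfolding linear_isos_def linear_maps_def by blast+

lemma \<eta>_in:
  assumes "A \<in> Obj T" "B \<in> Obj T" "\<phi> \<in> dual A B"
  shows "\<eta> A B \<phi> \<Colon> B \<rightarrow> fob S A"
  using \<eta>_linear_iso(1)[OF assms(1,2)] assms by (intro ArrD) (auto simp: bij_betw_def)

lemma \<eta>_surj:
  assumes "u \<Colon> B \<rightarrow> fob S A" "A \<in> Obj T"
  obtains \<phi> where "\<phi> \<in> dual A B" "\<eta> A B \<phi> = u"
proof -
  have "u \<in> \<eta> A B ` dual A B" using \<eta>_linear_iso(1)[OF assms(2), of B] ArrI[OF assms(1)] assms unfolding bij_betw_def by blast
  then show thesis using that by blast
qed

lemma functional_zero:
  assumes "A \<in> Obj T" "B \<in> Obj T"
  shows "(\<lambda>x\<in>Arr T A B. \<zero>\<^bsub>K\<^esub>) \<in> dual A B"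
proof -
  interpret V: vector_space_over K "Hom T A B" by (rule Hom_vector_space[OF assms])
  show ?thesis unfolding dual_iff by auto
qed

lemma functional_at_nul:
  assumes "\<phi> \<in> dual A B" "A \<in> Obj T" "B \<in> Obj T"
  shows "\<phi> (nul A B) = \<zero>\<^bsub>K\<^esub>"
proof -
  interpret V: vector_space_over K "Hom T A B" by (rule Hom_vector_space[OF assms(2,3)])
  have "\<phi> (\<zero>\<^bsub>K\<^esub> \<odot>\<^bsub>Hom T A B\<^esub> nul A B) = \<zero>\<^bsub>K\<^esub> \<otimes>\<^bsub>K\<^esub> \<phi> (nul A B)" "\<phi> (nul A B) \<in> carrier K"
    using assms(1) V.M.zero_closed zero_closed unfolding dual_iff by blast+
  then show ?thesis by simp
qed

lemma \<eta>_zero: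
  assumes "A \<in> Obj T" "B \<in> Obj T"
  shows "\<eta> A B (\<lambda>x\<in>Arr T A B. \<zero>\<^bsub>K\<^esub>) = nul B (fob S A)"
proof -
  let ?z = "\<lambda>x\<in>Arr T A B. \<zero>\<^bsub>K\<^esub>"
  interpret V: vector_space_over K "Hom T A B" by (rule Hom_vector_space[OF assms])
  interpret W: vector_space_over K "Hom T B (fob S A)" by (rule Hom_vector_space) (use assms in simp_all)
  have "?z \<oplus>\<^bsub>dual_module K (Hom T A B)\<^esub> ?z = ?z"
    unfolding dual_module_def by (auto simp: restrict_def fun_eq_iff)
  then have "\<eta> A B ?z \<oplus>\<^bsub>Hom T B (fob S A)\<^esub> \<eta> A B ?z = \<eta> A B ?z"
    using \<eta>_linear_iso(2)[OF assms functional_zero[OF assms] functional_zero[OF assms]] by metis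
  moreover have "\<eta> A B ?z \<in> Arr T B (fob S A)"
    by (rule ArrI[OF \<eta>_in[OF assms functional_zero[OF assms]]])
  ultimately show ?thesis by (metis W.M.add.l_cancel_one')
qed

lemma \<eta>_eq_nul:
  assumes "\<phi> \<in> dual A B" "\<eta> A B \<phi> = nul B (fob S A)" "x \<Colon> A \<rightarrow> B"
  shows "\<phi> x = \<zero>\<^bsub>K\<^esub>"
proof -
  have AB: "A \<in> Obj T" "B \<in> Obj T" using assms(3) by simp_all
  have "\<eta> A B \<phi> = \<eta> A B (\<lambda>x\<in>Arr T A B. \<zero>\<^bsub>K\<^esub>)" using assms(2) \<eta>_zero[OF AB] by metis
  then have "\<phi> = (\<lambda>x\<in>Arr T A B. \<zero>\<^bsub>K\<^esub>)"
    using \<eta>_linear_iso(1)[OF AB] assms(1) functional_zero[OF AB] unfolding bij_betw_def by (metis inj_onD)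
  then show ?thesis using ArrI[OF assms(3)] by simp
qed

lemma \<eta>_nat:
  assumes "a \<Colon> A \<rightarrow> A'" "b \<Colon> B' \<rightarrow> B" "\<phi> \<in> dual A B"
  shows "\<eta> A' B' (\<lambda>x\<in>Arr T A' B'. \<phi> (b \<cdot> x \<cdot> a)) = far S a \<cdot> \<eta> A B \<phi> \<cdot> b"
proof -
  have O: "A \<in> Obj T" "A' \<in> Obj T" "B \<in> Obj T" "B' \<in> Obj T" using assms by simp_all
  show ?thesis
    using \<eta>_props[THEN conjunct2, THEN bspec, OF O(1), THEN bspec, OF O(2), THEN bspec, OF O(3), THEN bspec, OF O(4),
        THEN bspec, OF ArrI[OF assms(1)], THEN bspec, OF ArrI[OF assms(2)], THEN bspec, OF assms(3)] .
qed

lemma \<eta>_precomp: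
  assumes "b \<Colon> B' \<rightarrow> B" "\<phi> \<in> dual A B" "A \<in> Obj T"
  shows "\<eta> A B' (\<lambda>x\<in>Arr T A B'. \<phi> (b \<cdot> x)) = \<eta> A B \<phi> \<cdot> b"
proof -
  have id: "Idt T A \<Colon> A \<rightarrow> A" using assms by simp
  have e: "\<eta> A B \<phi> \<Colon> B \<rightarrow> fob S A" by (rule \<eta>_in) (use assms in simp_all)
  have *: "\<phi> (b \<cdot> x \<cdot> Idt T A) = \<phi> (b \<cdot> x)" if "x \<in> Arr T A B'" for x
    using ArrD[OF that] assms(1,3) by simp
  have "(\<lambda>x\<in>Arr T A B'. \<phi> (b \<cdot> x \<cdot> Idt T A)) = (\<lambda>x\<in>Arr T A B'. \<phi> (b \<cdot> x))"
    by (rule restrict_ext) (rule *)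
  then show ?thesis using \<eta>_nat[OF id assms(1,2)] assms(1,3) e by simp
qed

lemma \<eta>_postcomp:
  assumes "a \<Colon> A \<rightarrow> A'" "\<phi> \<in> dual A B" "B \<in> Obj T"
  shows "\<eta> A' B (\<lambda>x\<in>Arr T A' B. \<phi> (x \<cdot> a)) = far S a \<cdot> \<eta> A B \<phi>"
proof -
  have id: "Idt T B \<Colon> B \<rightarrow> B" using assms by simp
  have e: "\<eta> A B \<phi> \<Colon> B \<rightarrow> fob S A" by (rule \<eta>_in) (use assms in simp_all)
  have *: "\<phi> (Idt T B \<cdot> x \<cdot> a) = \<phi> (x \<cdot> a)" if "x \<in> Arr T A' B" for x
    using ArrD[OF that] assms(1,3) by simp
  have "(\<lambda>x\<in>Arr T A' B. \<phi> (Idt T B \<cdot> x \<cdot> a)) = (\<lambda>x\<in>Arr T A' B. \<phi> (x \<cdot> a))"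
    by (rule restrict_ext) (rule *)
  then show ?thesis using \<eta>_nat[OF assms(1) id assms(2)] assms(1,3) e by simp
qed

lemma dual_precomp:
  assumes "b \<Colon> B' \<rightarrow> B" "\<phi> \<in> dual A B" "A \<in> Obj T"
  shows "(\<lambda>x\<in>Arr T A B'. \<phi> (b \<cdot> x)) \<in> dual A B'"
proof -
  have O: "B \<in> Obj T" "B' \<in> Obj T" using assms by simp_all
  interpret V: vector_space_over K "Hom T A B'" by (rule Hom_vector_space[OF assms(3) O(2)])
  have l: "(\<lambda>x. b \<cdot> x) \<in> linear_maps K (Hom T A B') (Hom T A B)"
    by (rule Cmp_linear_right[OF assms(3) O(2,1) ArrI[OF assms(1)]])
  have c: "b \<cdot> x \<in> Arr T A B" if "x \<in> Arr T A B'" for x using l that unfolding linear_maps_def by blast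
  show ?thesis using assms(2) l c unfolding dual_iff linear_maps_def by (auto simp: PiE_iff)
qed

lemma dual_postcomp:
  assumes "a \<Colon> A \<rightarrow> A'" "\<phi> \<in> dual A B" "B \<in> Obj T"
  shows "(\<lambda>x\<in>Arr T A' B. \<phi> (x \<cdot> a)) \<in> dual A' B"
proof -
  have O: "A \<in> Obj T" "A' \<in> Obj T" using assms by simp_all
  interpret V: vector_space_over K "Hom T A' B" by (rule Hom_vector_space[OF O(2) assms(3)])
  have l: "(\<lambda>x. x \<cdot> a) \<in> linear_maps K (Hom T A' B) (Hom T A B)"
    by (rule Cmp_linear_left[OF O assms(3) ArrI[OF assms(1)]])
  have c: "x \<cdot> a \<in> Arr T A B" if "x \<in> Arr T A' B" for x using l that unfolding linear_maps_def by blast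
  show ?thesis using assms(2) l c unfolding dual_iff linear_maps_def by (auto simp: PiE_iff)
qed

text \<open>T(B, S A) is the dual space of T(A, B), and by \<open>functional_nonzero\<close> a
  finite-dimensional space with zero dual is zero.\<close>

lemma serre_null:
  assumes "A \<in> Obj T" "B \<in> Obj T"
  shows "hom_null A B \<longleftrightarrow> hom_null B (fob S A)"
proof
  assume h: "hom_null A B"
  show "hom_null B (fob S A)" unfolding hom_null_def
  proof (intro allI impI)
    fix u assume u: "u \<Colon> B \<rightarrow> fob S A"
    obtain \<phi> where \<phi>: "\<phi> \<in> dual A B" "\<eta> A B \<phi> = u" using \<eta>_surj[OF u assms(1)] .
    have "Arr T A B = {nul A B}" using h Arr_null_iff[folded hom_null_def, OF assms] by blast
    then have "\<phi> = (\<lambda>x\<in>Arr T A B. \<zero>\<^bsub>K\<^esub>)"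
      using \<phi>(1) functional_at_nul[OF \<phi>(1) assms] unfolding dual_iff
      by (intro ext) (auto simp: PiE_iff extensional_def)
    then show "u = nul B (fob S A)" using \<eta>_zero[OF assms] \<phi>(2) by metis
  qed
next
  assume h: "hom_null B (fob S A)"
  show "hom_null A B" unfolding hom_null_def
  proof (intro allI impI, rule ccontr)
    fix f assume f: "f \<Colon> A \<rightarrow> B" and nz: "f \<noteq> nul A B"
    interpret V: vector_space_over K "Hom T A B" by (rule Hom_vector_space[OF assms])
    have fd: "finite_dimensional K (Hom T A B)" using hom_fin' assms unfolding hom_finite_def by blast
    obtain \<phi> where \<phi>: "\<phi> \<in> dual A B" "\<phi> f \<noteq> \<zero>\<^bsub>K\<^esub>" using V.functional_nonzero[OF fd ArrI[OF f] nz] by blast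
    have "\<eta> A B \<phi> = nul B (fob S A)" by (rule hom_nullD[OF h \<eta>_in[OF assms \<phi>(1)]])
    from \<eta>_eq_nul[OF \<phi>(1) this f] show False using \<phi>(2) by blast
  qed
qed

text \<open>\<open>T(-, S Z)\<close> is the dual of \<open>T(Z, -)\<close>, so \<open>S Z\<close> is injective relative to sequences that
  \<open>T(Z, -)\<close> turns into exact ones.\<close>

lemma serre_injective:
  assumes l: "l \<Colon> Q \<rightarrow> R" and u: "u \<Colon> Q \<rightarrow> fob S Z" and Z: "Z \<in> Obj T"
    and k: "\<And>z. z \<Colon> Z \<rightarrow> Q \<Longrightarrow> l \<cdot> z = nul Z R \<Longrightarrow> u \<cdot> z = nul Z (fob S Z)"
  obtains t where "t \<Colon> R \<rightarrow> fob S Z" "t \<cdot> l = u"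
proof -
  have O: "Q \<in> Obj T" "R \<in> Obj T" using l by simp_all
  obtain \<phi> where \<phi>: "\<phi> \<in> dual Z Q" "\<eta> Z Q \<phi> = u" using \<eta>_surj[OF u Z] .
  interpret V: vector_space_over K "Hom T Z Q" by (rule Hom_vector_space[OF Z O(1)])
  interpret W: vector_space_over K "Hom T Z R" by (rule Hom_vector_space[OF Z O(2)])
  have lin: "(\<lambda>x. l \<cdot> x) \<in> linear_maps K (Hom T Z Q) (Hom T Z R)"
    by (rule Cmp_linear_right[OF Z O ArrI[OF l]])
  have ld: "l \<cdot> x \<in> Arr T Z R" "l \<cdot> (x \<oplus>\<^bsub>Hom T Z Q\<^esub> y) = l \<cdot> x \<oplus>\<^bsub>Hom T Z R\<^esub> l \<cdot> y"
    "c \<in> carrier K \<Longrightarrow> l \<cdot> (c \<odot>\<^bsub>Hom T Z Q\<^esub> x) = c \<odot>\<^bsub>Hom T Z R\<^esub> l \<cdot> x"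
    if "x \<in> Arr T Z Q" "y \<in> Arr T Z Q" for x y c
    using lin that unfolding linear_maps_def by blast+
  have \<phi>d: "\<phi> x \<in> carrier K" "\<phi> (x \<oplus>\<^bsub>Hom T Z Q\<^esub> y) = \<phi> x \<oplus>\<^bsub>K\<^esub> \<phi> y"
    "c \<in> carrier K \<Longrightarrow> \<phi> (c \<odot>\<^bsub>Hom T Z Q\<^esub> x) = c \<otimes>\<^bsub>K\<^esub> \<phi> x"
    if "x \<in> Arr T Z Q" "y \<in> Arr T Z Q" for x y c
    using \<phi>(1) that unfolding dual_iff by blast+
  \<comment> \<open>Precomposition with \<open>z\<close> turns \<open>u\<close> into the arrow that
    corresponds to the functional sending \<open>x\<close> to \<open>\<phi> (z \<cdot> x)\<close>.
    That arrow is null by hypothesis, and the functional is evaluated at the identity of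
    \<open>Z\<close>.\<close>
  have ker: "\<phi> z = \<zero>\<^bsub>K\<^esub>" if z: "z \<Colon> Z \<rightarrow> Q" "l \<cdot> z = nul Z R" for z
  proof -
    have "\<eta> Z Z (\<lambda>x\<in>Arr T Z Z. \<phi> (z \<cdot> x)) = nul Z (fob S Z)"
      using \<eta>_precomp[OF z(1) \<phi>(1) Z] k[OF z] \<phi>(2) by metis
    from \<eta>_eq_nul[OF dual_precomp[OF z(1) \<phi>(1) Z] this, of "Idt T Z"]
    show ?thesis using Z z(1) ArrI[of "Idt T Z" Z Z] by simp
  qed
  have wd: "\<phi> x = \<phi> y" if "x \<in> Arr T Z Q" "y \<in> Arr T Z Q" "l \<cdot> x = l \<cdot> y" for x y
  proof -
    have t: "x \<Colon> Z \<rightarrow> Q" "y \<Colon> Z \<rightarrow> Q" using ArrD that(1,2) Z O by blast+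
    have "l \<cdot> (x \<boxminus> y) = l \<cdot> x \<boxminus> l \<cdot> y" using t l by (simp add: Cmp_distrib)
    also have "\<dots> = nul Z R" using t l unfolding that(3) by simp
    finally have 0: "\<phi> (x \<boxminus> y) = \<zero>\<^bsub>K\<^esub>" using t by (intro ker) simp_all
    have d: "x \<boxminus> y \<Colon> Z \<rightarrow> Q" using t by simp
    have "\<phi> x = \<phi> ((x \<boxminus> y) \<oplus>\<^bsub>Hom T Z Q\<^esub> y)" using minus_plus_cancel[OF t] plus_Hom[OF d, of y] by simp
    also have "\<dots> = \<phi> (x \<boxminus> y) \<oplus>\<^bsub>K\<^esub> \<phi> y" using \<phi>d(2)[OF ArrI[OF d] that(2)] .
    finally show ?thesis unfolding 0 using \<phi>d(1)[OF that(2,2)] by simp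
  qed
  define I where "I = (\<lambda>x. l \<cdot> x) ` Arr T Z Q"
  \<comment> \<open>\<open>\<phi>\<close> descends to the image of T(Z, l), because it vanishes on
    the kernel. An extension of it to all of T(Z, R) corresponds to the wanted arrow from
    \<open>R\<close> to S Z.\<close>
  define \<phi>' where "\<phi>' w = \<phi> (SOME x. x \<in> Arr T Z Q \<and> l \<cdot> x = w)" for w
  have \<phi>': "\<phi>' (l \<cdot> x) = \<phi> x" if "x \<in> Arr T Z Q" for x
  proof -
    have "(SOME y. y \<in> Arr T Z Q \<and> l \<cdot> y = l \<cdot> x) \<in> Arr T Z Q \<and> l \<cdot> (SOME y. y \<in> Arr T Z Q \<and> l \<cdot> y = l \<cdot> x) = l \<cdot> x"
      by (rule someI[of "\<lambda>y. y \<in> Arr T Z Q \<and> l \<cdot> y = l \<cdot> x" x]) (use that in simp)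
    then show ?thesis unfolding \<phi>'_def using wd that by blast
  qed
  have "W.functional_on I \<phi>'"
    unfolding W.functional_on_def W.subsp_def
  proof (intro conjI ballI)
    show "I \<subseteq> Arr T Z R" unfolding I_def using ld(1) by blast
    have "nul Z R = l \<cdot> nul Z Q" using l Z by simp
    then show "nul Z R \<in> I" unfolding I_def by (rule image_eqI) simp
    fix x y assume "x \<in> I" "y \<in> I"
    then obtain x' y' where e: "x' \<in> Arr T Z Q" "x = l \<cdot> x'" "y' \<in> Arr T Z Q" "y = l \<cdot> y'" unfolding I_def by blast
    have c: "x' \<oplus>\<^bsub>Hom T Z Q\<^esub> y' \<in> Arr T Z Q" using e by simp
    have eq: "x \<oplus>\<^bsub>Hom T Z R\<^esub> y = l \<cdot> (x' \<oplus>\<^bsub>Hom T Z Q\<^esub> y')" unfolding e using ld(2) e by simp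
    show "x \<oplus>\<^bsub>Hom T Z R\<^esub> y \<in> I" unfolding eq I_def using c by blast
    show "\<phi>' (x \<oplus>\<^bsub>Hom T Z R\<^esub> y) = \<phi>' x \<oplus>\<^bsub>K\<^esub> \<phi>' y"
      unfolding eq unfolding e using \<phi>'[OF c] \<phi>'[OF e(1)] \<phi>'[OF e(3)] \<phi>d(2)[OF e(1,3)] by simp
  next
    fix c x assume c: "c \<in> carrier K" and "x \<in> I"
    then obtain x' where e: "x' \<in> Arr T Z Q" "x = l \<cdot> x'" unfolding I_def by blast
    have m: "c \<odot>\<^bsub>Hom T Z Q\<^esub> x' \<in> Arr T Z Q" using e c by simp
    have eq: "c \<odot>\<^bsub>Hom T Z R\<^esub> x = l \<cdot> (c \<odot>\<^bsub>Hom T Z Q\<^esub> x')" unfolding e using ld(3) e c by simp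
    show "c \<odot>\<^bsub>Hom T Z R\<^esub> x \<in> I" unfolding eq I_def using m by blast
    show "\<phi>' (c \<odot>\<^bsub>Hom T Z R\<^esub> x) = c \<otimes>\<^bsub>K\<^esub> \<phi>' x"
      unfolding eq unfolding e using \<phi>'[OF m] \<phi>'[OF e(1)] \<phi>d(3)[OF e(1,1) c] by simp
  next
    fix x assume "x \<in> I"
    then obtain x' where e: "x' \<in> Arr T Z Q" "x = l \<cdot> x'" unfolding I_def by blast
    then show "\<phi>' x \<in> carrier K" using \<phi>' \<phi>d(1) by simp
  qed
  moreover have "finite_dimensional K (Hom T Z R)" using hom_fin' Z O unfolding hom_finite_def by blast
  ultimately obtain \<psi> where \<psi>: "\<psi> \<in> dual Z R" "\<forall>x\<in>I. \<psi> x = \<phi>' x" using W.functional_extend by blast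
  have *: "\<psi> (l \<cdot> x) = \<phi> x" if "x \<in> Arr T Z Q" for x using \<psi>(2) \<phi>' that unfolding I_def by simp
  have "(\<lambda>x\<in>Arr T Z Q. \<psi> (l \<cdot> x)) = (\<lambda>x\<in>Arr T Z Q. \<phi> x)" by (rule restrict_ext) (rule *)
  also have "\<dots> = \<phi>" using \<phi>(1) unfolding dual_iff by (meson PiE_restrict)
  finally have "\<eta> Z R \<psi> \<cdot> l = u" using \<eta>_precomp[OF l \<psi>(1) Z] \<phi>(2) by simp
  then show thesis using that[OF \<eta>_in[OF Z O(2) \<psi>(1)]] by simp
qed

lemma S_lift:
  assumes "A \<in> Obj T" "B \<in> Obj T" "\<phi> \<Colon> fob S A \<rightarrow> fob S B"
  obtains f where "f \<Colon> A \<rightarrow> B" "far S f = \<phi>"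
  using S.full_lift[OF S_full assms] .

lemma hom_null_S:
  assumes "A \<in> Obj T" "B \<in> Obj T" "hom_null A B"
  shows "hom_null (fob S A) (fob S B)"
  unfolding hom_null_def
proof (intro allI impI)
  fix f assume f: "f \<Colon> fob S A \<rightarrow> fob S B"
  obtain g where g: "g \<Colon> A \<rightarrow> B" "far S g = f" using S_lift[OF assms(1,2) f] .
  show "f = nul (fob S A) (fob S B)" unfolding g(2)[symmetric] hom_nullD[OF assms(3) g(1)] using assms by simp
qed

lemma hom_null_S':
  assumes "A \<in> Obj T" "B \<in> Obj T" "hom_null (fob S A) (fob S B)"
  shows "hom_null A B"
  unfolding hom_null_def
proof (intro allI impI)
  fix f assume f: "f \<Colon> A \<rightarrow> B"
  have "far S f = nul (fob S A) (fob S B)" by (rule hom_nullD[OF assms(3)]) (use f in simp)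
  also have "\<dots> = far S (nul A B)" using assms by simp
  finally show "f = nul A B" by (rule S.faithful_eq[OF S_faithful f, rotated]) (use assms in simp)
qed

text \<open>T(A, B[1]) is dual to T(B[1], S A), which the shift identifies with T(B[2], (S A)[1]),
  hence with T(S B', S(A[1])) and so with T(B', A[1]). For a 2-Calabi-Yau category, where S = [2],
  one may take B' = B; in general the passage from \<open>B\<close> to \<open>B'\<close> replaces
  that symmetry.\<close>

lemma serre_shift_null:
  assumes "A \<in> Obj T" "B \<in> Obj T" "B' \<in> Obj T" and i: "isomorphic T (fob S B') (shob T (shob T B))"
  shows "hom_null A (shob T B) \<longleftrightarrow> hom_null B' (shob T A)"
proof -
  have O: "fob S B' \<in> Obj T" "shob T (shob T B) \<in> Obj T" "shob T (fob S A) \<in> Obj T" "fob S (shob T A) \<in> Obj T"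
    using assms by simp_all
  have j: "isomorphic T (fob S (shob T A)) (shob T (fob S A))"
    using \<theta>_iso[OF assms(1)] unfolding isomorphic_def by blast
  have "hom_null A (shob T B) \<longleftrightarrow> hom_null (shob T B) (fob S A)" using assms by (intro serre_null) simp_all
  also have "\<dots> \<longleftrightarrow> hom_null (shob T (shob T B)) (shob T (fob S A))" using assms by (simp add: hom_null_shift)
  also have "\<dots> \<longleftrightarrow> hom_null (fob S B') (fob S (shob T A))"
    using hom_null_iso[OF i isomorphic_sym[OF isomorphic_sym[OF j O(4,3)] O(3,4)] O(1,4,2,3)]
      hom_null_iso[OF isomorphic_sym[OF i O(1,2)] isomorphic_sym[OF j O(4,3)] O(2,3,1,4)] by blast
  also have "\<dots> \<longleftrightarrow> hom_null B' (shob T A)" using hom_null_S hom_null_S' assms by (metis Sh.fob_Obj)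
  finally show ?thesis .
qed

text \<open>If \<open>f z \<noteq> 0\<close>, some functional pairs to a nonzero value with it, which yields a nonzero map
  \<open>B[1] \<rightarrow> S Z \<rightarrow> S A\<close>; shifted once and read through \<open>S\<close>, it is a map \<open>B' \<rightarrow> Z[1] \<rightarrow> A[1]\<close>.\<close>

lemma serre_ghost:
  assumes f: "f \<Colon> A \<rightarrow> shob T B" and z: "z \<Colon> Z \<rightarrow> A" and B: "B \<in> Obj T" "B' \<in> Obj T"
    and i: "isomorphic T (fob S B') (shob T (shob T B))"
    and n: "\<And>u. u \<Colon> B' \<rightarrow> shob T Z \<Longrightarrow> shar T z \<cdot> u = nul B' (shob T A)"
  shows "f \<cdot> z = nul Z (shob T B)"
proof (rule ccontr)
  assume nz: "f \<cdot> z \<noteq> nul Z (shob T B)"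
  have O: "A \<in> Obj T" "Z \<in> Obj T" "shob T B \<in> Obj T" using f z by simp_all
  interpret V: vector_space_over K "Hom T Z (shob T B)" by (rule Hom_vector_space[OF O(2,3)])
  have fd: "finite_dimensional K (Hom T Z (shob T B))" using hom_fin' O unfolding hom_finite_def by blast
  have fz: "f \<cdot> z \<Colon> Z \<rightarrow> shob T B" using f z by simp
  obtain \<phi> where \<phi>: "\<phi> \<in> dual Z (shob T B)" "\<phi> (f \<cdot> z) \<noteq> \<zero>\<^bsub>K\<^esub>" using V.functional_nonzero[OF fd ArrI[OF fz] nz] by blast
  define m where "m = \<eta> Z (shob T B) \<phi>"
  have m: "m \<Colon> shob T B \<rightarrow> fob S Z" unfolding m_def by (rule \<eta>_in[OF O(2,3) \<phi>(1)])
  have pc: "\<eta> A (shob T B) (\<lambda>x\<in>Arr T A (shob T B). \<phi> (x \<cdot> z)) = far S z \<cdot> m"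
    unfolding m_def by (rule \<eta>_postcomp[OF z \<phi>(1) O(3)])
  obtain \<iota> \<iota>' where \<iota>: "\<iota> \<Colon> fob S B' \<rightarrow> shob T (shob T B)" "\<iota>' \<Colon> shob T (shob T B) \<rightarrow> fob S B'"
    "\<iota>' \<cdot> \<iota> = Idt T (fob S B')" "\<iota> \<cdot> \<iota>' = Idt T (shob T (shob T B))" using isomorphicE[OF i] B by auto
  obtain k where k: "k \<Colon> shob T (fob S Z) \<rightarrow> fob S (shob T Z)" "\<theta> Z \<cdot> k = Idt T (shob T (fob S Z))"
    using is_isoE[OF \<theta>_iso[OF O(2)]] O(2) by auto
  \<comment> \<open>The inverse \<open>k\<close> of \<open>\<theta> Z\<close> turns (S Z)[1] into
    S(Z[1]), so that the shifted map becomes the image under \<open>S\<close> of an arrow from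
    \<open>B'\<close> to Z[1]; to this arrow the hypothesis \<open>n\<close> applies.\<close>
  have "k \<cdot> shar T m \<cdot> \<iota> \<Colon> fob S B' \<rightarrow> fob S (shob T Z)" using k(1) m \<iota>(1) by simp
  then obtain u where u: "u \<Colon> B' \<rightarrow> shob T Z" "far S u = k \<cdot> shar T m \<cdot> \<iota>" using S_lift[OF B(2), of "shob T Z"] O by auto
  have nat: "\<theta> A \<cdot> far S (shar T z) = shar T (far S z) \<cdot> \<theta> Z" by (rule \<theta>_nat[OF z])
  have "shar T (far S z) \<cdot> shar T m \<cdot> \<iota> = shar T (far S z) \<cdot> (\<theta> Z \<cdot> k) \<cdot> shar T m \<cdot> \<iota>"
    unfolding k(2) using z m \<iota>(1) O by simp
  also have "\<dots> = (shar T (far S z) \<cdot> \<theta> Z) \<cdot> far S u" unfolding u(2) using z m \<iota>(1) k(1) O by simp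
  also have "\<dots> = \<theta> A \<cdot> far S (shar T z \<cdot> u)" unfolding nat[symmetric] using z u(1) O by simp
  also have "\<dots> = nul (fob S B') (shob T (fob S A))" unfolding n[OF u(1)] using B(2) O by simp
  finally have "(shar T (far S z) \<cdot> shar T m \<cdot> \<iota>) \<cdot> \<iota>' = nul (shob T (shob T B)) (shob T (fob S A))"
    using \<iota>(2) O by simp
  moreover have "(shar T (far S z) \<cdot> shar T m \<cdot> \<iota>) \<cdot> \<iota>' = shar T (far S z \<cdot> m)" using \<iota> z m O by simp
  ultimately have "far S z \<cdot> m = nul (shob T B) (fob S A)" using z m by (intro shift_eq_nul[of "far S z \<cdot> m" "shob T B" "fob S A"]) simp_all
  then have "(\<lambda>x\<in>Arr T A (shob T B). \<phi> (x \<cdot> z)) f = \<zero>\<^bsub>K\<^esub>"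
    by (intro \<eta>_eq_nul[OF dual_postcomp[OF z \<phi>(1) O(3)] _ f]) (simp only: pc)
  then show False using \<phi>(2) ArrI[OF f] by simp
qed

end

section \<open>Extensions, factors and direct sums\<close>

context lincat begin

lemma is_kernelI:
  assumes "i \<Colon> A \<rightarrow> B" "p \<Colon> B \<rightarrow> D" "p \<cdot> i = nul A D"
    and "\<And>E f. f \<Colon> E \<rightarrow> B \<Longrightarrow> p \<cdot> f = nul E D \<Longrightarrow> \<exists>g. g \<Colon> E \<rightarrow> A \<and> i \<cdot> g = f"
    and "\<And>E g g'. g \<Colon> E \<rightarrow> A \<Longrightarrow> g' \<Colon> E \<rightarrow> A \<Longrightarrow> i \<cdot> g = i \<cdot> g' \<Longrightarrow> g = g'"
  shows "is_kernel C A B D i p"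
  unfolding is_kernel_def
proof (intro conjI ballI impI ArrI[OF assms(1)] ArrI[OF assms(2)] assms(3))
  fix E f assume E: "E \<in> Obj C" and "f \<in> Arr C E B" and pf: "p \<cdot> f = nul E D"
  then have f: "f \<Colon> E \<rightarrow> B" using ArrD assms(1) by blast
  obtain g where g: "g \<Colon> E \<rightarrow> A" "i \<cdot> g = f" using assms(4)[OF f pf] by blast
  show "\<exists>!g. g \<in> Arr C E A \<and> i \<cdot> g = f"
  proof (rule ex1I[of _ g])
    show "g \<in> Arr C E A \<and> i \<cdot> g = f" using ArrI[OF g(1)] g(2) by blast
    fix g' assume "g' \<in> Arr C E A \<and> i \<cdot> g' = f"
    then have g': "g' \<Colon> E \<rightarrow> A" "i \<cdot> g' = i \<cdot> g" using ArrD[of g' E A] g by auto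
    show "g' = g" by (rule assms(5)[OF g'(1) g(1) g'(2)])
  qed
qed

lemma is_cokernelI:
  assumes "i \<Colon> A \<rightarrow> B" "p \<Colon> B \<rightarrow> D" "p \<cdot> i = nul A D"
    and "\<And>E f. f \<Colon> B \<rightarrow> E \<Longrightarrow> f \<cdot> i = nul A E \<Longrightarrow> \<exists>g. g \<Colon> D \<rightarrow> E \<and> g \<cdot> p = f"
    and "\<And>E g g'. g \<Colon> D \<rightarrow> E \<Longrightarrow> g' \<Colon> D \<rightarrow> E \<Longrightarrow> g \<cdot> p = g' \<cdot> p \<Longrightarrow> g = g'"
  shows "is_cokernel C A B D i p"
  unfolding is_cokernel_def
proof (intro conjI ballI impI ArrI[OF assms(1)] ArrI[OF assms(2)] assms(3))
  fix E f assume E: "E \<in> Obj C" and "f \<in> Arr C B E" and pf: "f \<cdot> i = nul A E"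
  then have f: "f \<Colon> B \<rightarrow> E" using ArrD assms(1) by blast
  obtain g where g: "g \<Colon> D \<rightarrow> E" "g \<cdot> p = f" using assms(4)[OF f pf] by blast
  show "\<exists>!g. g \<in> Arr C D E \<and> g \<cdot> p = f"
  proof (rule ex1I[of _ g])
    show "g \<in> Arr C D E \<and> g \<cdot> p = f" using ArrI[OF g(1)] g(2) by blast
    fix g' assume "g' \<in> Arr C D E \<and> g' \<cdot> p = f"
    then have g': "g' \<Colon> D \<rightarrow> E" "g' \<cdot> p = g \<cdot> p" using ArrD[of g' D E] g by auto
    show "g' = g" by (rule assms(5)[OF g'(1) g(1) g'(2)])
  qed
qed

lemma kernelD:
  assumes k: "is_kernel C A B D i p" and O: "A \<in> Obj C" "B \<in> Obj C" "D \<in> Obj C"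
  shows "i \<Colon> A \<rightarrow> B" "p \<Colon> B \<rightarrow> D" "p \<cdot> i = nul A D"
    and "f \<Colon> E \<rightarrow> B \<Longrightarrow> p \<cdot> f = nul E D \<Longrightarrow> \<exists>g. g \<Colon> E \<rightarrow> A \<and> i \<cdot> g = f"
    and "g \<Colon> E \<rightarrow> A \<Longrightarrow> g' \<Colon> E \<rightarrow> A \<Longrightarrow> i \<cdot> g = i \<cdot> g' \<Longrightarrow> g = g'"
proof -
  show t: "i \<Colon> A \<rightarrow> B" "p \<Colon> B \<rightarrow> D" "p \<cdot> i = nul A D" using k O ArrD unfolding is_kernel_def by blast+
  have u: "\<exists>!g. g \<in> Arr C E A \<and> i \<cdot> g = f" if "E \<in> Obj C" "f \<in> Arr C E B" "p \<cdot> f = nul E D" for E f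
    using k that unfolding is_kernel_def by simp
  show "\<exists>g. g \<Colon> E \<rightarrow> A \<and> i \<cdot> g = f" if f: "f \<Colon> E \<rightarrow> B" "p \<cdot> f = nul E D"
  proof -
    have "E \<in> Obj C" using f by simp
    from ex1_implies_ex[OF u[OF this ArrI[OF f(1)] f(2)]] obtain g where g: "g \<in> Arr C E A" "i \<cdot> g = f" by blast
    show ?thesis by (rule exI[of _ g]) (use ArrD[OF g(1)] g(2) O f in simp)
  qed
  show "g = g'" if g: "g \<Colon> E \<rightarrow> A" "g' \<Colon> E \<rightarrow> A" "i \<cdot> g = i \<cdot> g'"
  proof -
    have E: "E \<in> Obj C" and ig: "i \<cdot> g \<Colon> E \<rightarrow> B" using g t by simp_all
    have "p \<cdot> i \<cdot> g = nul E D" using Cmp_eq_Cmp[OF t(3), of g] t g(1) by simp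
    from u[OF E ArrI[OF ig] this] show ?thesis using ArrI[OF g(1)] ArrI[OF g(2)] g(3) by metis
  qed
qed

lemma cokernelD:
  assumes k: "is_cokernel C A B D i p" and O: "A \<in> Obj C" "B \<in> Obj C" "D \<in> Obj C"
  shows "f \<Colon> B \<rightarrow> E \<Longrightarrow> f \<cdot> i = nul A E \<Longrightarrow> \<exists>g. g \<Colon> D \<rightarrow> E \<and> g \<cdot> p = f"
    and "epi C B D p"
proof -
  have t: "i \<Colon> A \<rightarrow> B" "p \<Colon> B \<rightarrow> D" "p \<cdot> i = nul A D" using k O ArrD unfolding is_cokernel_def by blast+
  have u: "\<exists>!g. g \<in> Arr C D E \<and> g \<cdot> p = f" if "E \<in> Obj C" "f \<in> Arr C B E" "f \<cdot> i = nul A E" for E f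
    using k that unfolding is_cokernel_def by simp
  show "\<exists>g. g \<Colon> D \<rightarrow> E \<and> g \<cdot> p = f" if f: "f \<Colon> B \<rightarrow> E" "f \<cdot> i = nul A E"
  proof -
    have "E \<in> Obj C" using f by simp
    from ex1_implies_ex[OF u[OF this ArrI[OF f(1)] f(2)]] obtain g where g: "g \<in> Arr C D E" "g \<cdot> p = f" by blast
    show ?thesis by (rule exI[of _ g]) (use ArrD[OF g(1)] g(2) O f in simp)
  qed
  show "epi C B D p" unfolding epi_iff[OF t(2)]
  proof (intro allI impI)
    fix E g assume g: "g \<Colon> D \<rightarrow> E" "g \<cdot> p = nul B E"
    have E: "E \<in> Obj C" "nul B E \<Colon> B \<rightarrow> E" "nul D E \<Colon> D \<rightarrow> E" using g O by simp_all
    have "nul B E \<cdot> i = nul A E" "nul D E \<cdot> p = nul B E" using t E by simp_all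
    then show "g = nul D E" using u[OF E(1) ArrI[OF E(2)]] ArrI[OF g(1)] ArrI[OF E(3)] g(2) by metis
  qed
qed

lemma is_direct_sum_iso:
  assumes ds: "is_direct_sum C A B S" and "isomorphic C A A'" "isomorphic C B B'" "isomorphic C S S'"
    and O: "A' \<in> Obj C" "B' \<in> Obj C" "S' \<in> Obj C"
  shows "is_direct_sum C A' B' S'"
proof -
  obtain i j p q where t: "i \<Colon> A \<rightarrow> S" "j \<Colon> B \<rightarrow> S" "p \<Colon> S \<rightarrow> A" "q \<Colon> S \<rightarrow> B" and
    e: "p \<cdot> i = Idt C A" "q \<cdot> j = Idt C B" "p \<cdot> j = nul B A" "q \<cdot> i = nul A B" "i \<cdot> p \<boxplus> j \<cdot> q = Idt C S"
    using is_direct_sumE[OF ds] .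
  have O': "A \<in> Obj C" "B \<in> Obj C" "S \<in> Obj C" using t by simp_all
  obtain a a' where a: "a \<Colon> A \<rightarrow> A'" "a' \<Colon> A' \<rightarrow> A" "a' \<cdot> a = Idt C A" "a \<cdot> a' = Idt C A'"
    using isomorphicE[OF assms(2) O'(1) O(1)] .
  obtain b b' where b: "b \<Colon> B \<rightarrow> B'" "b' \<Colon> B' \<rightarrow> B" "b' \<cdot> b = Idt C B" "b \<cdot> b' = Idt C B'"
    using isomorphicE[OF assms(3) O'(2) O(2)] .
  obtain s s' where s: "s \<Colon> S \<rightarrow> S'" "s' \<Colon> S' \<rightarrow> S" "s' \<cdot> s = Idt C S" "s \<cdot> s' = Idt C S'"
    using isomorphicE[OF assms(4) O'(3) O(3)] .
  note r = Cmp_eq_Cmp[OF s(3)] Cmp_eq_Cmp[OF a(3)] Cmp_eq_Cmp[OF b(3)] Cmp_eq_Cmp[OF e(1)] Cmp_eq_Cmp[OF e(2)]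
    Cmp_eq_Cmp[OF e(3)] Cmp_eq_Cmp[OF e(4)]
  have 5: "(s \<cdot> i \<cdot> a') \<cdot> (a \<cdot> p \<cdot> s') \<boxplus> (s \<cdot> j \<cdot> b') \<cdot> (b \<cdot> q \<cdot> s') = Idt C S'"
  proof -
    have "(s \<cdot> i \<cdot> a') \<cdot> (a \<cdot> p \<cdot> s') \<boxplus> (s \<cdot> j \<cdot> b') \<cdot> (b \<cdot> q \<cdot> s') = s \<cdot> (i \<cdot> p \<boxplus> j \<cdot> q) \<cdot> s'"
      using t a(1,2) b(1,2) s(1,2) by (simp add: r Cmp_distrib)
    then show ?thesis unfolding e(5) using s O by simp
  qed
  show ?thesis
    by (rule is_direct_sumI[of "s \<cdot> i \<cdot> a'" _ _ "s \<cdot> j \<cdot> b'" _ "a \<cdot> p \<cdot> s'" "b \<cdot> q \<cdot> s'"])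
      (use t a b s O 5 in \<open>simp_all add: r\<close>)
qed

lemma direct_sum_unique:
  assumes ds: "is_direct_sum C A B S" "is_direct_sum C A B S'"
  shows "isomorphic C S S'"
proof -
  obtain i j p q where t: "i \<Colon> A \<rightarrow> S" "j \<Colon> B \<rightarrow> S" "p \<Colon> S \<rightarrow> A" "q \<Colon> S \<rightarrow> B" and
    e: "p \<cdot> i = Idt C A" "q \<cdot> j = Idt C B" "p \<cdot> j = nul B A" "q \<cdot> i = nul A B" "i \<cdot> p \<boxplus> j \<cdot> q = Idt C S"
    using is_direct_sumE[OF ds(1)] .
  obtain i' j' p' q' where t': "i' \<Colon> A \<rightarrow> S'" "j' \<Colon> B \<rightarrow> S'" "p' \<Colon> S' \<rightarrow> A" "q' \<Colon> S' \<rightarrow> B" and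
    e': "p' \<cdot> i' = Idt C A" "q' \<cdot> j' = Idt C B" "p' \<cdot> j' = nul B A" "q' \<cdot> i' = nul A B" "i' \<cdot> p' \<boxplus> j' \<cdot> q' = Idt C S'"
    using is_direct_sumE[OF ds(2)] .
  note r = Cmp_eq_Cmp[OF e(1)] Cmp_eq_Cmp[OF e(2)] Cmp_eq_Cmp[OF e(3)] Cmp_eq_Cmp[OF e(4)]
    Cmp_eq_Cmp[OF e'(1)] Cmp_eq_Cmp[OF e'(2)] Cmp_eq_Cmp[OF e'(3)] Cmp_eq_Cmp[OF e'(4)]
  have 1: "(i \<cdot> p' \<boxplus> j \<cdot> q') \<cdot> (i' \<cdot> p \<boxplus> j' \<cdot> q) = i \<cdot> p \<boxplus> j \<cdot> q"
    using t t' by (simp add: Cmp_distrib r)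
  have 2: "(i' \<cdot> p \<boxplus> j' \<cdot> q) \<cdot> (i \<cdot> p' \<boxplus> j \<cdot> q') = i' \<cdot> p' \<boxplus> j' \<cdot> q'"
    using t t' by (simp add: Cmp_distrib r)
  show ?thesis
    by (rule isomorphicI[of "i' \<cdot> p \<boxplus> j' \<cdot> q" _ _ "i \<cdot> p' \<boxplus> j \<cdot> q'"])
      (use t t' in simp, use t t' in simp, (rule trans[OF 1 e(5)] trans[OF 2 e'(5)])+)
qed

lemma zero_obj_unique: "is_zero_obj C Z \<Longrightarrow> is_zero_obj C Z' \<Longrightarrow> isomorphic C Z Z'"
  by (rule isomorphicI[of "nul Z Z'" _ _ "nul Z' Z"]) (simp_all add: is_zero_obj_iff)

section \<open>Split extensions and the vanishing of Ext\<close>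

definition ext_split :: "'o \<Rightarrow> 'o \<Rightarrow> bool"
  where "ext_split B A \<longleftrightarrow> (\<forall>E\<in>Obj C. \<forall>i p. short_exact C A E B i p \<longrightarrow> (\<exists>s\<in>Arr C B E. p \<cdot> s = Idt C B))"

text \<open>A section \<open>s\<close> of \<open>p\<close> yields a retraction \<open>r\<close> of
  \<open>i\<close>, determined by \<open>i \<cdot> r = 1 - s \<cdot> p\<close>. The comparison
  isomorphism is then \<open>i' \<cdot> r + s' \<cdot> p\<close>, and its inverse is built in the
  same way.\<close>

lemma split_extensions_equivalent:
  assumes O: "A \<in> Obj C" "B \<in> Obj C" "E \<in> Obj C" "E' \<in> Obj C"
    and x: "short_exact C A E B i p" "s \<in> Arr C B E" "p \<cdot> s = Idt C B"
    and x': "short_exact C A E' B i' p'" "s' \<in> Arr C B E'" "p' \<cdot> s' = Idt C B"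
  obtains u where "is_iso C E E' u" "u \<cdot> i = i'" "p' \<cdot> u = p"
proof -
  have k: "is_kernel C A E B i p" "is_kernel C A E' B i' p'" using x x' unfolding short_exact_def by simp_all
  note K = kernelD[OF k(1) O(1,3,2)] and K' = kernelD[OF k(2) O(1,4,2)]
  have s: "s \<Colon> B \<rightarrow> E" "s' \<Colon> B \<rightarrow> E'" using ArrD x(2) x'(2) O by blast+
  have w: "Idt C E \<boxminus> s \<cdot> p \<Colon> E \<rightarrow> E" "p \<cdot> (Idt C E \<boxminus> s \<cdot> p) = nul E B"
    using K(1,2) s by (simp_all add: Cmp_distrib Cmp_eq_Cmp[OF x(3)])
  have w': "Idt C E' \<boxminus> s' \<cdot> p' \<Colon> E' \<rightarrow> E'" "p' \<cdot> (Idt C E' \<boxminus> s' \<cdot> p') = nul E' B"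
    using K'(1,2) s by (simp_all add: Cmp_distrib Cmp_eq_Cmp[OF x'(3)])
  obtain r where r: "r \<Colon> E \<rightarrow> A" "i \<cdot> r = Idt C E \<boxminus> s \<cdot> p" using K(4)[OF w] by blast
  obtain r' where r': "r' \<Colon> E' \<rightarrow> A" "i' \<cdot> r' = Idt C E' \<boxminus> s' \<cdot> p'" using K'(4)[OF w'] by blast
  have ri: "r \<cdot> i = Idt C A"
  proof (rule K(5))
    show "i \<cdot> r \<cdot> i = i \<cdot> Idt C A" using Cmp_eq_Cmp[OF r(2), of i] K(1,2,3) r(1) s by (simp add: Cmp_distrib)
  qed (use r K(1) O in simp_all)
  have ri': "r' \<cdot> i' = Idt C A"
  proof (rule K'(5))
    show "i' \<cdot> r' \<cdot> i' = i' \<cdot> Idt C A" using Cmp_eq_Cmp[OF r'(2), of i'] K'(1,2,3) r'(1) s by (simp add: Cmp_distrib)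
  qed (use r' K'(1) O in simp_all)
  have rs: "r \<cdot> s = nul B A"
  proof (rule K(5))
    show "i \<cdot> r \<cdot> s = i \<cdot> nul B A" using Cmp_eq_Cmp[OF r(2), of s] K(1,2) x(3) r(1) s O by (simp add: Cmp_distrib)
  qed (use r s K(1) O in simp_all)
  have rs': "r' \<cdot> s' = nul B A"
  proof (rule K'(5))
    show "i' \<cdot> r' \<cdot> s' = i' \<cdot> nul B A" using Cmp_eq_Cmp[OF r'(2), of s'] K'(1,2) x'(3) r'(1) s O by (simp add: Cmp_distrib)
  qed (use r' s K'(1) O in simp_all)
  define u where "u = i' \<cdot> r \<boxplus> s' \<cdot> p"
  define v where "v = i \<cdot> r' \<boxplus> s \<cdot> p'"
  have u: "u \<Colon> E \<rightarrow> E'" and v: "v \<Colon> E' \<rightarrow> E" unfolding u_def v_def using K(1,2) K'(1,2) r(1) r'(1) s by simp_all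
  note c = Cmp_eq_Cmp[OF ri] Cmp_eq_Cmp[OF ri'] Cmp_eq_Cmp[OF rs] Cmp_eq_Cmp[OF rs'] Cmp_eq_Cmp[OF K(3)] Cmp_eq_Cmp[OF K'(3)]
    Cmp_eq_Cmp[OF x(3)] Cmp_eq_Cmp[OF x'(3)]
  have "v \<cdot> u = i \<cdot> r \<boxplus> s \<cdot> p" unfolding u_def v_def using K(1,2) K'(1,2) r(1) r'(1) s by (simp add: Cmp_distrib c)
  then have vu: "v \<cdot> u = Idt C E" using r(2) minus_plus_cancel[of "Idt C E" E E "s \<cdot> p"] K(2) s O by simp
  have "u \<cdot> v = i' \<cdot> r' \<boxplus> s' \<cdot> p'" unfolding u_def v_def using K(1,2) K'(1,2) r(1) r'(1) s by (simp add: Cmp_distrib c)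
  then have uv: "u \<cdot> v = Idt C E'" using r'(2) minus_plus_cancel[of "Idt C E'" E' E' "s' \<cdot> p'"] K'(2) s O by simp
  have "u \<cdot> i = i'" unfolding u_def using K(1-3) K'(1) r(1) s by (simp add: Cmp_distrib ri)
  moreover have "p' \<cdot> u = p" unfolding u_def using K(1,2) K'(1,2,3) r(1) s by (simp add: Cmp_distrib c)
  ultimately show thesis using that is_isoI[OF u v vu uv] by blast
qed

lemma direct_sum_short_exact:
  assumes t: "i \<Colon> A \<rightarrow> S" "j \<Colon> B \<rightarrow> S" "p \<Colon> S \<rightarrow> A" "q \<Colon> S \<rightarrow> B" and
    e: "p \<cdot> i = Idt C A" "q \<cdot> j = Idt C B" "p \<cdot> j = nul B A" "q \<cdot> i = nul A B" "i \<cdot> p \<boxplus> j \<cdot> q = Idt C S"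
  shows "short_exact C A S B i q"
  unfolding short_exact_def
proof
  show "is_kernel C A S B i q"
  proof (rule is_kernelI[OF t(1,4) e(4)])
    fix E f assume f: "f \<Colon> E \<rightarrow> S" "q \<cdot> f = nul E B"
    have "f = (i \<cdot> p \<boxplus> j \<cdot> q) \<cdot> f" unfolding e(5) using f by simp
    also have "\<dots> = i \<cdot> (p \<cdot> f)" using f t by (simp add: Cmp_distrib)
    finally show "\<exists>g. g \<Colon> E \<rightarrow> A \<and> i \<cdot> g = f" using f t by (intro exI[of _ "p \<cdot> f"]) simp
  next
    fix E g g' assume g: "g \<Colon> E \<rightarrow> A" "g' \<Colon> E \<rightarrow> A" "i \<cdot> g = i \<cdot> g'"
    have "p \<cdot> (i \<cdot> g) = g" "p \<cdot> (i \<cdot> g') = g'" using g(1,2) t by (simp_all add: Cmp_eq_Cmp[OF e(1)])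
    then show "g = g'" using g(3) by metis
  qed
  show "is_cokernel C A S B i q"
  proof (rule is_cokernelI[OF t(1,4) e(4)])
    fix E f assume f: "f \<Colon> S \<rightarrow> E" "f \<cdot> i = nul A E"
    have "f = f \<cdot> (i \<cdot> p \<boxplus> j \<cdot> q)" unfolding e(5) using f by simp
    also have "\<dots> = (f \<cdot> j) \<cdot> q" using f t Cmp_eq_Cmp[OF f(2), of p] by (simp add: Cmp_distrib)
    finally show "\<exists>g. g \<Colon> B \<rightarrow> E \<and> g \<cdot> q = f" using f t by (intro exI[of _ "f \<cdot> j"]) simp
  next
    fix E g g' assume g: "g \<Colon> B \<rightarrow> E" "g' \<Colon> B \<rightarrow> E" "g \<cdot> q = g' \<cdot> q"
    have "(g \<cdot> q) \<cdot> j = g" "(g' \<cdot> q) \<cdot> j = g'" using g(1,2) t by (simp_all add: e(2))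
    then show "g = g'" using g(3) by metis
  qed
qed

text \<open>The class of split extensions has to occur among the equivalence classes, so some
  extension must exist; the direct sum provides it. All split extensions form a single class by the
  preceding lemma.\<close>

lemma Ext1_zero_iff:
  assumes ds: "is_direct_sum C A B S"
  shows "Ext1 C B A = {Ext1_zero C B A} \<longleftrightarrow> ext_split B A"
proof -
  have O: "A \<in> Obj C" "B \<in> Obj C" "S \<in> Obj C" using ds unfolding is_direct_sum_def by simp_all
  have refl: "(x, x) \<in> extension_equiv C B A" if x: "x \<in> extensions C B A" for x
  proof -
    obtain E i p where e: "x = (E, i, p)" by (cases x)
    have E: "E \<in> Obj C" "short_exact C A E B i p" using x e unfolding extensions_def by simp_all
    then have K: "is_kernel C A E B i p" unfolding short_exact_def by simp
    note K' = kernelD[OF K O(1) E(1) O(2)]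
    have "is_iso C E E (Idt C E)" by (rule is_isoI[of _ _ _ "Idt C E"]) (use E in simp_all)
    moreover have "Idt C E \<cdot> i = i" "p \<cdot> Idt C E = p" using K'(1,2) by simp_all
    ultimately show ?thesis using x unfolding e extension_equiv_def by blast
  qed
  show ?thesis
  proof
    assume z: "Ext1 C B A = {Ext1_zero C B A}"
    show "ext_split B A" unfolding ext_split_def
    proof (intro ballI allI impI)
      fix E i p assume E: "E \<in> Obj C" "short_exact C A E B i p"
      then have x: "(E, i, p) \<in> extensions C B A" unfolding extensions_def by simp
      have "extension_equiv C B A `` {(E, i, p)} \<in> Ext1 C B A" unfolding Ext1_def by (rule quotientI[OF x])
      then have "extension_equiv C B A `` {(E, i, p)} = Ext1_zero C B A" unfolding z by (rule singletonD)
      moreover have "(E, i, p) \<in> extension_equiv C B A `` {(E, i, p)}" by (rule ImageI[OF refl[OF x]]) simp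
      ultimately have "(E, i, p) \<in> Ext1_zero C B A" by (rule subst)
      then show "\<exists>s\<in>Arr C B E. p \<cdot> s = Idt C B" unfolding Ext1_zero_def by simp
    qed
  next
    assume s: "ext_split B A"
    have all: "Ext1_zero C B A = extensions C B A"
    proof
      show "Ext1_zero C B A \<subseteq> extensions C B A" unfolding Ext1_zero_def by blast
      show "extensions C B A \<subseteq> Ext1_zero C B A"
      proof
        fix x assume x: "x \<in> extensions C B A"
        obtain E i p where e: "x = (E, i, p)" by (cases x)
        have E: "E \<in> Obj C" "short_exact C A E B i p" using x unfolding e extensions_def by simp_all
        then have "\<exists>s\<in>Arr C B E. p \<cdot> s = Idt C B" using s unfolding ext_split_def by blast
        then show "x \<in> Ext1_zero C B A" using x unfolding e Ext1_zero_def by simp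
      qed
    qed
    have sb: "extension_equiv C B A \<subseteq> extensions C B A \<times> extensions C B A"
      unfolding extension_equiv_def by auto
    have eq: "(x, y) \<in> extension_equiv C B A" if "x \<in> extensions C B A" "y \<in> extensions C B A" for x y
    proof -
      obtain E i p E' i' p' where e: "x = (E, i, p)" "y = (E', i', p')" by (cases x, cases y)
      have E: "E \<in> Obj C" "short_exact C A E B i p" "E' \<in> Obj C" "short_exact C A E' B i' p'"
        using that e unfolding extensions_def by simp_all
      obtain \<sigma> \<sigma>' where sg: "\<sigma> \<in> Arr C B E" "p \<cdot> \<sigma> = Idt C B" "\<sigma>' \<in> Arr C B E'" "p' \<cdot> \<sigma>' = Idt C B"
        using s E unfolding ext_split_def by meson
      obtain u where "is_iso C E E' u" "u \<cdot> i = i'" "p' \<cdot> u = p"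
        using split_extensions_equivalent[OF O(1,2) E(1,3,2) sg(1,2) E(4) sg(3,4)] .
      then show ?thesis using that unfolding e extension_equiv_def by blast
    qed
    have sub: "extension_equiv C B A `` {x} = extensions C B A" if "x \<in> extensions C B A" for x
      using eq[OF that] sb by blast
    obtain i j p q where "i \<Colon> A \<rightarrow> S" "j \<Colon> B \<rightarrow> S" "p \<Colon> S \<rightarrow> A" "q \<Colon> S \<rightarrow> B"
      "p \<cdot> i = Idt C A" "q \<cdot> j = Idt C B" "p \<cdot> j = nul B A" "q \<cdot> i = nul A B" "i \<cdot> p \<boxplus> j \<cdot> q = Idt C S"
      using is_direct_sumE[OF ds] .
    from direct_sum_short_exact[OF this] have ne: "(S, i, q) \<in> extensions C B A" unfolding extensions_def using O by simp
    show "Ext1 C B A = {Ext1_zero C B A}" unfolding Ext1_def all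
    proof (intro equalityI subsetI)
      fix W assume "W \<in> extensions C B A // extension_equiv C B A"
      then obtain x where "x \<in> extensions C B A" "W = extension_equiv C B A `` {x}" by (rule quotientE)
      then show "W \<in> {extensions C B A}" using sub by simp
    next
      fix W assume "W \<in> {extensions C B A}"
      then have "W = extension_equiv C B A `` {(S, i, q)}" using sub[OF ne] by simp
      then show "W \<in> extensions C B A // extension_equiv C B A" using quotientI[OF ne] by simp
    qed
  qed
qed

lemma ext_split_iso:
  assumes s: "ext_split B A" and a: "isomorphic C A A'" and b: "isomorphic C B B'"
    and O: "A \<in> Obj C" "A' \<in> Obj C" "B \<in> Obj C" "B' \<in> Obj C"
  shows "ext_split B' A'"
  unfolding ext_split_def
proof (intro ballI allI impI)
  fix E i p assume E: "E \<in> Obj C" "short_exact C A' E B' i p"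
  obtain a a' where a: "a \<Colon> A \<rightarrow> A'" "a' \<Colon> A' \<rightarrow> A" "a' \<cdot> a = Idt C A" "a \<cdot> a' = Idt C A'"
    using isomorphicE[OF a O(1,2)] .
  obtain b b' where b: "b \<Colon> B \<rightarrow> B'" "b' \<Colon> B' \<rightarrow> B" "b' \<cdot> b = Idt C B" "b \<cdot> b' = Idt C B'"
    using isomorphicE[OF b O(3,4)] .
  have k: "is_kernel C A' E B' i p" "is_cokernel C A' E B' i p" using E unfolding short_exact_def by simp_all
  note K = kernelD[OF k(1) O(2) E(1) O(4)] and L = cokernelD[OF k(2) O(2) E(1) O(4)]
  have z: "(b' \<cdot> p) \<cdot> (i \<cdot> a) = nul A B" using K(1,2) a(1) b(2) by (simp add: Cmp_eq_Cmp[OF K(3)])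
  have bp: "b' \<cdot> p \<Colon> E \<rightarrow> B" and ia: "i \<cdot> a \<Colon> A \<rightarrow> E" using K a b by simp_all
  have "is_kernel C A E B (i \<cdot> a) (b' \<cdot> p)"
  proof (rule is_kernelI[OF ia bp z])
    fix W f assume f: "f \<Colon> W \<rightarrow> E" "(b' \<cdot> p) \<cdot> f = nul W B"
    have "b \<cdot> (b' \<cdot> p) \<cdot> f = nul W B'" unfolding f(2) using b f(1) by simp
    then have "p \<cdot> f = nul W B'" using f(1) b K(2) by (simp add: Cmp_eq_Cmp[OF b(4)])
    then obtain g where g: "g \<Colon> W \<rightarrow> A'" "i \<cdot> g = f" using K(4)[OF f(1)] by blast
    have "(i \<cdot> a) \<cdot> (a' \<cdot> g) = f" using g a(1,2) K(1) by (simp add: Cmp_eq_Cmp[OF a(4)])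
    then show "\<exists>g. g \<Colon> W \<rightarrow> A \<and> (i \<cdot> a) \<cdot> g = f" using g(1) a(2) by (intro exI[of _ "a' \<cdot> g"]) simp
  next
    fix W g g' assume g: "g \<Colon> W \<rightarrow> A" "g' \<Colon> W \<rightarrow> A" "(i \<cdot> a) \<cdot> g = (i \<cdot> a) \<cdot> g'"
    have "i \<cdot> (a \<cdot> g) = i \<cdot> (a \<cdot> g')" using g a(1) K(1) by simp
    then have "a \<cdot> g = a \<cdot> g'" by (intro K(5)[of "a \<cdot> g" W "a \<cdot> g'"]) (use g(1,2) a(1) in simp_all)
    then have "a' \<cdot> (a \<cdot> g) = a' \<cdot> (a \<cdot> g')" by simp
    moreover have "a' \<cdot> (a \<cdot> g) = g" "a' \<cdot> (a \<cdot> g') = g'" using g(1,2) a(1,2) by (simp_all add: Cmp_eq_Cmp[OF a(3)])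
    ultimately show "g = g'" by metis
  qed
  moreover have "is_cokernel C A E B (i \<cdot> a) (b' \<cdot> p)"
  proof (rule is_cokernelI[OF ia bp z])
    fix W f assume f: "f \<Colon> E \<rightarrow> W" "f \<cdot> (i \<cdot> a) = nul A W"
    have "(f \<cdot> (i \<cdot> a)) \<cdot> a' = nul A' W" unfolding f(2) using a f(1) by simp
    then have "f \<cdot> i = nul A' W" using f(1) a K(1) by simp
    then obtain g where g: "g \<Colon> B' \<rightarrow> W" "g \<cdot> p = f" using L(1)[OF f(1)] by blast
    have "(g \<cdot> b) \<cdot> (b' \<cdot> p) = f" using g b(1,2) K(2) by (simp add: Cmp_eq_Cmp[OF b(4)])
    then show "\<exists>g. g \<Colon> B \<rightarrow> W \<and> g \<cdot> (b' \<cdot> p) = f" using g(1) b(1) by (intro exI[of _ "g \<cdot> b"]) simp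
  next
    fix W g g' assume g: "g \<Colon> B \<rightarrow> W" "g' \<Colon> B \<rightarrow> W" "g \<cdot> (b' \<cdot> p) = g' \<cdot> (b' \<cdot> p)"
    have "(g \<cdot> b') \<cdot> p = (g' \<cdot> b') \<cdot> p" using g b(2) K(2) by simp
    then have "g \<cdot> b' = g' \<cdot> b'" by (intro epi_cancel[OF L(2), of "g \<cdot> b'" W "g' \<cdot> b'"]) (use g(1,2) b(2) in simp_all)
    then have "(g \<cdot> b') \<cdot> b = (g' \<cdot> b') \<cdot> b" by simp
    moreover have "(g \<cdot> b') \<cdot> b = g" "(g' \<cdot> b') \<cdot> b = g'" using g(1,2) b(1,2,3) by simp_all
    ultimately show "g = g'" by metis
  qed
  ultimately have "short_exact C A E B (i \<cdot> a) (b' \<cdot> p)" unfolding short_exact_def by blast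
  then obtain s where s: "s \<in> Arr C B E" "(b' \<cdot> p) \<cdot> s = Idt C B" using s E(1) unfolding ext_split_def by blast
  have s': "s \<Colon> B \<rightarrow> E" using ArrD[OF s(1)] O E by blast
  have sb: "s \<cdot> b' \<Colon> B' \<rightarrow> E" using s' b(2) by simp
  have "b \<cdot> ((b' \<cdot> p) \<cdot> s) \<cdot> b' = Idt C B'" unfolding s(2) using b by simp
  then have "p \<cdot> (s \<cdot> b') = Idt C B'" using s' b(1,2) K(2) by (simp add: Cmp_eq_Cmp[OF b(4)])
  then show "\<exists>s\<in>Arr C B' E. p \<cdot> s = Idt C B'" using ArrI[OF sb] by blast
qed

end

section \<open>Subcategories of \<open>T\<close> and their images under \<open>H\<close>\<close>

context ghost_setting begin

lemma D_direct_sum: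
  assumes "F \<in> Obj D" "G \<in> Obj D"
  obtains W where "is_direct_sum D F G W"
proof -
  obtain A a a' where A: "A \<in> Obj T" "a \<Colon>\<^sub>D fob H A \<rightarrow> F" "a' \<Colon>\<^sub>D F \<rightarrow> fob H A"
    "a' \<cdot>\<^sub>D a = Idt D (fob H A)" "a \<cdot>\<^sub>D a' = Idt D F" using H_obj[OF assms(1)] .
  obtain B b b' where B: "B \<in> Obj T" "b \<Colon>\<^sub>D fob H B \<rightarrow> G" "b' \<Colon>\<^sub>D G \<rightarrow> fob H B"
    "b' \<cdot>\<^sub>D b = Idt D (fob H B)" "b \<cdot>\<^sub>D b' = Idt D G" using H_obj[OF assms(2)] .
  obtain W where W: "is_direct_sum T A B W" using direct_sum_exists A(1) B(1) by blast
  have "W \<in> Obj T" using W unfolding is_direct_sum_def by simp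
  then have "is_direct_sum D F G (fob H W)"
    by (intro H.D.is_direct_sum_iso[OF H.is_direct_sum_fob[OF W] H.D.isomorphicI[OF A(2-5)] H.D.isomorphicI[OF B(2-5)]])
      (use assms in simp_all)
  then show thesis using that by blast
qed

lemma Ext1_iff: "F \<in> Obj D \<Longrightarrow> G \<in> Obj D \<Longrightarrow> Ext1 D G F = {Ext1_zero D G F} \<longleftrightarrow> H.D.ext_split G F"
  using D_direct_sum H.D.Ext1_zero_iff by metis

abbreviation H_img :: "'o set \<Rightarrow> 'p set"
  where "H_img Y \<equiv> ess_image D H Y"

lemma H_imgI: "A \<in> Y \<Longrightarrow> A \<in> Obj T \<Longrightarrow> fob H A \<in> H_img Y"
  unfolding ess_image_def using H.D.isomorphic_refl[of "fob H A"] by (intro CollectI conjI bexI[of _ A]) simp_all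

lemma H_img_iso: "F \<in> H_img Y \<Longrightarrow> isomorphic D F G \<Longrightarrow> G \<in> Obj D \<Longrightarrow> Y \<subseteq> Obj T \<Longrightarrow> G \<in> H_img Y"
proof -
  assume *: "F \<in> H_img Y" "isomorphic D F G" "G \<in> Obj D" "Y \<subseteq> Obj T"
  then obtain A where A: "A \<in> Y" "isomorphic D (fob H A) F" "F \<in> Obj D" unfolding ess_image_def by blast
  have "fob H A \<in> Obj D" using A *(4) by auto
  then have "isomorphic D (fob H A) G" using H.D.isomorphic_trans[OF A(2) *(2)] A(3) *(3) by blast
  then show ?thesis using A(1) *(3) unfolding ess_image_def by blast
qed

text \<open>Zero objects and sums are images of those in \<open>T\<close>. Closure under summands
  does not come for free, because a retraction in \<open>D\<close> lifts only modulo ghosts; it is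
  left to the caller as the hypothesis \<open>r\<close>, discharged once for \<open>X\<close> and
  once for cluster tilting subcategories of \<open>Tp\<close>.\<close>

lemma H_img_subcategory:
  assumes Y: "subcategory T Y"
    and r: "\<And>F A s r. A \<in> Y \<Longrightarrow> s \<Colon>\<^sub>D F \<rightarrow> fob H A \<Longrightarrow> r \<Colon>\<^sub>D fob H A \<rightarrow> F \<Longrightarrow> r \<cdot>\<^sub>D s = Idt D F
      \<Longrightarrow> \<exists>A'\<in>Y. isomorphic D (fob H A') F"
  shows "subcategory D (H_img Y)"
proof -
  have YO: "A \<in> Y \<Longrightarrow> A \<in> Obj T" for A using Y unfolding subcategory_def by blast
  have sub: "Y \<subseteq> Obj T" using YO by blast
  have 1: "H_img Y \<subseteq> Obj D" unfolding ess_image_def by blast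
  have 2: "Z \<in> H_img Y" if Z: "is_zero_obj D Z" for Z
  proof -
    obtain Z0 where Z0: "Z0 \<in> Obj T" "is_zero_obj T Z0" using obtain_zero .
    then have "Z0 \<in> Y" using Y unfolding subcategory_def by blast
    moreover have "isomorphic D (fob H Z0) Z" by (rule H.D.zero_obj_unique[OF H.is_zero_obj_fob[OF Z0(2)] Z])
    moreover have "Z \<in> Obj D" using Z H.D.is_zero_obj_iff by blast
    ultimately show ?thesis unfolding ess_image_def by blast
  qed
  have 3: "W \<in> H_img Y" if FG: "F \<in> H_img Y" "G \<in> H_img Y" and W: "is_direct_sum D F G W" for F G W
  proof -
    obtain A where A: "A \<in> Y" "isomorphic D (fob H A) F" "F \<in> Obj D" using FG(1) unfolding ess_image_def by blast
    obtain B where B: "B \<in> Y" "isomorphic D (fob H B) G" "G \<in> Obj D" using FG(2) unfolding ess_image_def by blast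
    obtain V where V: "is_direct_sum T A B V" using direct_sum_exists YO A(1) B(1) by blast
    then have VY: "V \<in> Y" using Y A(1) B(1) unfolding subcategory_def by blast
    have WO: "W \<in> Obj D" using W unfolding is_direct_sum_def by simp
    have "is_direct_sum D F G (fob H V)"
      by (rule H.D.is_direct_sum_iso[OF H.is_direct_sum_fob[OF V] A(2) B(2)]) (use A B YO[OF VY] in simp_all)
    from H.D.direct_sum_unique[OF this W] show ?thesis using VY WO unfolding ess_image_def by blast
  qed
  have 4: "\<And>F G. F \<in> H_img Y \<Longrightarrow> G \<in> Obj D \<Longrightarrow> isomorphic D F G \<Longrightarrow> G \<in> H_img Y"
    using H_img_iso[OF _ _ _ sub] by blast
  have 5: "F \<in> H_img Y" if G: "G \<in> H_img Y" and F: "direct_summand D F G" for F G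
  proof -
    obtain A where A: "A \<in> Y" "isomorphic D (fob H A) G" "G \<in> Obj D" using G unfolding ess_image_def by blast
    obtain i p where i: "i \<Colon>\<^sub>D F \<rightarrow> G" "p \<Colon>\<^sub>D G \<rightarrow> F" "p \<cdot>\<^sub>D i = Idt D F" using H.D.direct_summandE[OF F] .
    have "fob H A \<in> Obj D" using YO[OF A(1)] by simp
    from H.D.isomorphicE[OF A(2) this A(3)] obtain a a' where a: "a \<Colon>\<^sub>D fob H A \<rightarrow> G" "a' \<Colon>\<^sub>D G \<rightarrow> fob H A"
      "a' \<cdot>\<^sub>D a = Idt D (fob H A)" "a \<cdot>\<^sub>D a' = Idt D G" .
    have ai: "a' \<cdot>\<^sub>D i \<Colon>\<^sub>D F \<rightarrow> fob H A" and pa: "p \<cdot>\<^sub>D a \<Colon>\<^sub>D fob H A \<rightarrow> F" using i a by simp_all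
    have "(p \<cdot>\<^sub>D a) \<cdot>\<^sub>D (a' \<cdot>\<^sub>D i) = Idt D F" using i a(1,2) by (simp add: H.D.Cmp_eq_Cmp[OF a(4)])
    from r[OF A(1) ai pa this] show ?thesis using i unfolding ess_image_def by blast
  qed
  show ?thesis unfolding subcategory_def using 1 2 3 4 5 by blast
qed

text \<open>Since \<open>H\<close> is full, a map from some \<open>H E\<close> into \<open>F\<close>
  is lifted to \<open>T\<close>, where the given approximation applies.\<close>

lemma H_img_contravariantly_finite:
  assumes Y: "contravariantly_finite T Y" and sub: "Y \<subseteq> Obj T"
  shows "contravariantly_finite D (H_img Y)"
  unfolding contravariantly_finite_def
proof (intro ballI)
  fix F assume F: "F \<in> Obj D"
  obtain A a a' where A: "A \<in> Obj T" "a \<Colon>\<^sub>D fob H A \<rightarrow> F" "a' \<Colon>\<^sub>D F \<rightarrow> fob H A"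
    "a' \<cdot>\<^sub>D a = Idt D (fob H A)" "a \<cdot>\<^sub>D a' = Idt D F" using H_obj[OF F] .
  obtain B y where B: "B \<in> Y" "y \<in> Arr T B A" and ap: "\<forall>Y'\<in>Y. (\<lambda>h. y \<cdot> h) ` Arr T Y' B = Arr T Y' A"
    using Y A(1) unfolding contravariantly_finite_def by blast
  have BO: "B \<in> Obj T" using B sub by blast
  have y: "y \<Colon> B \<rightarrow> A" using ArrD[OF B(2) BO A(1)] .
  define f where "f = a \<cdot>\<^sub>D far H y"
  have f: "f \<Colon>\<^sub>D fob H B \<rightarrow> F" unfolding f_def using A y by simp
  have "(\<lambda>h. f \<cdot>\<^sub>D h) ` Arr D G (fob H B) = Arr D G F" if G: "G \<in> H_img Y" for G
  proof
    have GO: "G \<in> Obj D" using G unfolding ess_image_def by blast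
    show "(\<lambda>h. f \<cdot>\<^sub>D h) ` Arr D G (fob H B) \<subseteq> Arr D G F"
      using H.D.ArrI[OF f] H.D.Cmp_closed[OF GO _ F] f by blast
    show "Arr D G F \<subseteq> (\<lambda>h. f \<cdot>\<^sub>D h) ` Arr D G (fob H B)"
    proof
      fix g assume "g \<in> Arr D G F"
      then have g: "g \<Colon>\<^sub>D G \<rightarrow> F" using H.D.ArrD GO F by blast
      obtain E where E: "E \<in> Y" "isomorphic D (fob H E) G" using G unfolding ess_image_def by blast
      have EO: "E \<in> Obj T" "fob H E \<in> Obj D" using E sub by auto
      obtain c c' where c: "c \<Colon>\<^sub>D fob H E \<rightarrow> G" "c' \<Colon>\<^sub>D G \<rightarrow> fob H E"
        "c' \<cdot>\<^sub>D c = Idt D (fob H E)" "c \<cdot>\<^sub>D c' = Idt D G" using H.D.isomorphicE[OF E(2) EO(2) GO] .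
      have "a' \<cdot>\<^sub>D (g \<cdot>\<^sub>D c) \<Colon>\<^sub>D fob H E \<rightarrow> fob H A" using A(3) g c(1) by simp
      then obtain h where h: "h \<Colon> E \<rightarrow> A" "far H h = a' \<cdot>\<^sub>D (g \<cdot>\<^sub>D c)" using H_lift[OF EO(1) A(1)] by blast
      have "h \<in> (\<lambda>h. y \<cdot> h) ` Arr T E B" using ap E(1) ArrI[OF h(1)] by simp
      then obtain k where k: "k \<in> Arr T E B" "h = y \<cdot> k" by blast
      have k': "k \<Colon> E \<rightarrow> B" using ArrD[OF k(1) EO(1) BO] .
      have "f \<cdot>\<^sub>D (far H k \<cdot>\<^sub>D c') = a \<cdot>\<^sub>D (far H h \<cdot>\<^sub>D c')"
        unfolding f_def k(2) using A(2) y k' c(2) by simp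
      also have "\<dots> = g" unfolding h(2) using A(2,3) g c(1,2,4) by (simp add: H.D.Cmp_eq_Cmp[OF A(5)])
      finally have e: "g = f \<cdot>\<^sub>D (far H k \<cdot>\<^sub>D c')" ..
      have t: "far H k \<cdot>\<^sub>D c' \<Colon>\<^sub>D G \<rightarrow> fob H B" using k' c(2) by simp
      show "g \<in> (\<lambda>h. f \<cdot>\<^sub>D h) ` Arr D G (fob H B)" using e H.D.ArrI[OF t] by blast
    qed
  qed
  then show "\<exists>XA\<in>H_img Y. \<exists>f\<in>Arr D XA F. \<forall>X'\<in>H_img Y. (\<lambda>h. f \<cdot>\<^sub>D h) ` Arr D X' XA = Arr D X' F"
    by (intro bexI[OF _ H_imgI[OF B(1) BO]] bexI[OF _ H.D.ArrI[OF f]] ballI) blast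
qed

lemma Fac_iff:
  assumes sub: "Y \<subseteq> Obj T" and F: "F \<in> Obj D" and A: "A \<in> Obj T" "isomorphic D (fob H A) F"
  shows "F \<in> Fac D (H_img Y) \<longleftrightarrow> (\<exists>B\<in>Y. \<exists>y. y \<Colon> B \<rightarrow> A \<and> surjX y)"
proof
  have HA: "fob H A \<in> Obj D" using A by simp
  obtain a a' where a: "a \<Colon>\<^sub>D fob H A \<rightarrow> F" "a' \<Colon>\<^sub>D F \<rightarrow> fob H A"
    "a' \<cdot>\<^sub>D a = Idt D (fob H A)" "a \<cdot>\<^sub>D a' = Idt D F" using H.D.isomorphicE[OF A(2) HA F] .
  {
    assume "F \<in> Fac D (H_img Y)"
    then obtain G e where G: "G \<in> H_img Y" "epi D G F e" unfolding Fac_def by blast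
    obtain B where B: "B \<in> Y" "isomorphic D (fob H B) G" "G \<in> Obj D" using G(1) unfolding ess_image_def by blast
    have e: "e \<Colon>\<^sub>D G \<rightarrow> F" using G(2) H.D.ArrD[OF _ B(3) F] unfolding epi_def by blast
    have BO: "B \<in> Obj T" "fob H B \<in> Obj D" using B sub by auto
    obtain c c' where c: "c \<Colon>\<^sub>D fob H B \<rightarrow> G" "c' \<Colon>\<^sub>D G \<rightarrow> fob H B"
      "c' \<cdot>\<^sub>D c = Idt D (fob H B)" "c \<cdot>\<^sub>D c' = Idt D G" using H.D.isomorphicE[OF B(2) BO(2) B(3)] .
    have "a' \<cdot>\<^sub>D (e \<cdot>\<^sub>D c) \<Colon>\<^sub>D fob H B \<rightarrow> fob H A" using a e c by simp
    then obtain y where y: "y \<Colon> B \<rightarrow> A" "far H y = a' \<cdot>\<^sub>D (e \<cdot>\<^sub>D c)" using H_lift[OF BO(1) A(1)] by blast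
    have "epi D (fob H B) (fob H A) (far H y)" unfolding y(2)
      by (rule H.D.epi_iso[OF G(2) e c(1,2,4) a(2,1,3)])
    then have "surjX y" by (rule epi_surjX[OF y(1)])
    then show "\<exists>B\<in>Y. \<exists>y. y \<Colon> B \<rightarrow> A \<and> surjX y" using B(1) y(1) by blast
  }
  {
    assume "\<exists>B\<in>Y. \<exists>y. y \<Colon> B \<rightarrow> A \<and> surjX y"
    then obtain B y where B: "B \<in> Y" "y \<Colon> B \<rightarrow> A" "surjX y" by blast
    have BO: "B \<in> Obj T" "fob H B \<in> Obj D" using B by simp_all
    have id: "Idt D (fob H B) \<Colon>\<^sub>D fob H B \<rightarrow> fob H B" "Idt D (fob H B) \<cdot>\<^sub>D Idt D (fob H B) = Idt D (fob H B)"
      using BO(2) by simp_all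
    have hy: "far H y \<Colon>\<^sub>D fob H B \<rightarrow> fob H A" using B(2) by simp
    have "epi D (fob H B) F (a \<cdot>\<^sub>D (far H y \<cdot>\<^sub>D Idt D (fob H B)))"
      by (rule H.D.epi_iso[OF surjX_epi[OF B(2,3)] hy id(1,1,2) a(1,2,4)])
    then show "F \<in> Fac D (H_img Y)" using H_imgI[OF B(1) BO(1)] F unfolding Fac_def by blast
  }
qed

text \<open>By density both sides of the equation that defines tilting need to be compared only on
  objects \<open>H A\<close>, which turns the condition into one on the objects of
  \<open>T\<close>.\<close>

lemma tilting_iff:
  assumes sub: "Y \<subseteq> Obj T" "subcategory D (H_img Y)" "contravariantly_finite D (H_img Y)"
  shows "tilting_subcategory D (H_img Y) \<longleftrightarrow>
    (\<forall>A\<in>Obj T. (\<exists>B\<in>Y. \<exists>y. y \<Colon> B \<rightarrow> A \<and> surjX y) \<longleftrightarrow> (\<forall>B\<in>Y. H.D.ext_split (fob H B) (fob H A)))"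
proof -
  have ext: "(\<forall>G\<in>H_img Y. Ext1 D G F = {Ext1_zero D G F}) \<longleftrightarrow> (\<forall>B\<in>Y. H.D.ext_split (fob H B) (fob H A))"
    if F: "F \<in> Obj D" and A: "A \<in> Obj T" "isomorphic D (fob H A) F" for F A
  proof
    have HA: "fob H A \<in> Obj D" using A by simp
    have AF: "isomorphic D F (fob H A)" by (rule H.D.isomorphic_sym[OF A(2) HA F])
    {
      assume l: "\<forall>G\<in>H_img Y. Ext1 D G F = {Ext1_zero D G F}"
      show "\<forall>B\<in>Y. H.D.ext_split (fob H B) (fob H A)"
      proof
        fix B assume B: "B \<in> Y"
        then have HB: "fob H B \<in> Obj D" "fob H B \<in> H_img Y" using sub(1) H_imgI by auto
        then have "H.D.ext_split (fob H B) F" using l Ext1_iff[OF F HB(1)] by blast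
        then show "H.D.ext_split (fob H B) (fob H A)"
          by (rule H.D.ext_split_iso[OF _ AF H.D.isomorphic_refl[OF HB(1)] F HA HB(1,1)])
      qed
    }
    {
      assume r: "\<forall>B\<in>Y. H.D.ext_split (fob H B) (fob H A)"
      show "\<forall>G\<in>H_img Y. Ext1 D G F = {Ext1_zero D G F}"
      proof
        fix G assume "G \<in> H_img Y"
        then obtain B where B: "B \<in> Y" "isomorphic D (fob H B) G" "G \<in> Obj D" unfolding ess_image_def by blast
        then have HB: "fob H B \<in> Obj D" using sub(1) by auto
        have "H.D.ext_split G F" using r B(1) by (intro H.D.ext_split_iso[OF _ A(2) B(2) HA F HB B(3)]) blast
        then show "Ext1 D G F = {Ext1_zero D G F}" using Ext1_iff[OF F B(3)] by blast
      qed
    }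
  qed
  have gen: "U = {A \<in> V. P A} \<longleftrightarrow> (\<forall>F\<in>V. F \<in> U \<longleftrightarrow> P F)" if "U \<subseteq> V" for U V :: "'p set" and P
    using that by blast
  have s1: "tilting_subcategory D (H_img Y) \<longleftrightarrow>
      (\<forall>F\<in>Obj D. F \<in> Fac D (H_img Y) \<longleftrightarrow> (\<forall>G\<in>H_img Y. Ext1 D G F = {Ext1_zero D G F}))"
  proof -
    have "Fac D (H_img Y) \<subseteq> Obj D" unfolding Fac_def by blast
    from gen[OF this, of "\<lambda>F. \<forall>G\<in>H_img Y. Ext1 D G F = {Ext1_zero D G F}"] sub(2,3)
    show ?thesis unfolding tilting_subcategory_def by blast
  qed
  have s2: "(\<forall>F\<in>Obj D. F \<in> Fac D (H_img Y) \<longleftrightarrow> (\<forall>G\<in>H_img Y. Ext1 D G F = {Ext1_zero D G F})) \<longleftrightarrow> (\<forall>A\<in>Obj T. (\<exists>B\<in>Y. \<exists>y. y \<Colon> B \<rightarrow> A \<and> surjX y) \<longleftrightarrow> (\<forall>B\<in>Y. H.D.ext_split (fob H B) (fob H A)))"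
  proof
    assume l: "\<forall>F\<in>Obj D. F \<in> Fac D (H_img Y) \<longleftrightarrow> (\<forall>G\<in>H_img Y. Ext1 D G F = {Ext1_zero D G F})"
    show "\<forall>A\<in>Obj T. (\<exists>B\<in>Y. \<exists>y. y \<Colon> B \<rightarrow> A \<and> surjX y) \<longleftrightarrow> (\<forall>B\<in>Y. H.D.ext_split (fob H B) (fob H A))"
    proof
      fix A assume A: "A \<in> Obj T"
      then have HA: "fob H A \<in> Obj D" "isomorphic D (fob H A) (fob H A)" by simp_all
      show "(\<exists>B\<in>Y. \<exists>y. y \<Colon> B \<rightarrow> A \<and> surjX y) \<longleftrightarrow> (\<forall>B\<in>Y. H.D.ext_split (fob H B) (fob H A))"
        by (rule trans[OF Fac_iff[OF sub(1) HA(1) A HA(2), symmetric] trans[OF bspec[OF l HA(1)] ext[OF HA(1) A HA(2)]]])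
    qed
  next
    assume r: "\<forall>A\<in>Obj T. (\<exists>B\<in>Y. \<exists>y. y \<Colon> B \<rightarrow> A \<and> surjX y) \<longleftrightarrow> (\<forall>B\<in>Y. H.D.ext_split (fob H B) (fob H A))"
    show "\<forall>F\<in>Obj D. F \<in> Fac D (H_img Y) \<longleftrightarrow> (\<forall>G\<in>H_img Y. Ext1 D G F = {Ext1_zero D G F})"
    proof
      fix F assume F: "F \<in> Obj D"
      obtain A where A: "A \<in> Obj T" "isomorphic D (fob H A) F" using H_ess F unfolding ess_image_def by blast
      show "F \<in> Fac D (H_img Y) \<longleftrightarrow> (\<forall>G\<in>H_img Y. Ext1 D G F = {Ext1_zero D G F})"
        by (rule trans[OF Fac_iff[OF sub(1) F A] trans[OF bspec[OF r A(1)] ext[OF F A, symmetric]]])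
    qed
  qed
  show ?thesis by (rule trans[OF s1 s2])
qed

definition H_pre :: "'p set \<Rightarrow> 'o set"
  where "H_pre U = {Y \<in> Tp. fob H Y \<in> U}"

text \<open>An object of \<open>Tp\<close> with the same image as an object of \<open>Y\<close> is
  isomorphic to it by \<open>Tp_reflect\<close>.\<close>

lemma H_pre_img:
  assumes Y: "Y \<subseteq> Tp" "\<And>A B. A \<in> Y \<Longrightarrow> B \<in> Obj T \<Longrightarrow> isomorphic T A B \<Longrightarrow> B \<in> Y"
  shows "H_pre (H_img Y) = Y"
proof
  show "Y \<subseteq> H_pre (H_img Y)" unfolding H_pre_def using Y(1) H_imgI by auto
  show "H_pre (H_img Y) \<subseteq> Y"
  proof
    fix A assume "A \<in> H_pre (H_img Y)"
    then obtain B where A: "A \<in> Tp" and B: "B \<in> Y" "isomorphic D (fob H B) (fob H A)"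
      unfolding H_pre_def ess_image_def by blast
    then have "isomorphic T B A" using Tp_reflect Y(1) by blast
    then show "A \<in> Y" using Y(2)[OF B(1)] A by simp
  qed
qed

text \<open>Both sides of the tilting equation are all of \<open>D\<close>: every object is a
  quotient of some \<open>H Z\<close> by an approximation, and extensions of the projective
  \<open>H Z\<close> split.\<close>

lemma projectives_tilting: "tilting_subcategory D (H_img X)"
proof -
  have sub: "X \<subseteq> Obj T" using X_Obj by blast
  have 1: "subcategory D (H_img X)" by (rule H_img_subcategory[OF X_subcat]) (rule retract_of_X)
  have 2: "contravariantly_finite D (H_img X)" by (rule H_img_contravariantly_finite[OF X_cf sub])
  have "H.D.ext_split (fob H Z) (fob H A)" if Z: "Z \<in> X" and A: "A \<in> Obj T" for Z A
    unfolding H.D.ext_split_def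
  proof (intro ballI allI impI)
    fix E i p assume E: "E \<in> Obj D" "short_exact D (fob H A) E (fob H Z) i p"
    have O: "fob H A \<in> Obj D" "fob H Z \<in> Obj D" using A Z by simp_all
    have c: "is_kernel D (fob H A) E (fob H Z) i p" "is_cokernel D (fob H A) E (fob H Z) i p"
      using E unfolding short_exact_def by simp_all
    have p: "p \<Colon>\<^sub>D E \<rightarrow> fob H Z" using H.D.kernelD(2)[OF c(1) O(1) E(1) O(2)] .
    have e: "epi D E (fob H Z) p" using H.D.cokernelD(2)[OF c(2) O(1) E(1) O(2)] .
    have "Idt D (fob H Z) \<Colon>\<^sub>D fob H Z \<rightarrow> fob H Z" using O by simp
    from projective_lift[OF e p Z this] obtain s where "s \<Colon>\<^sub>D fob H Z \<rightarrow> E" "p \<cdot>\<^sub>D s = Idt D (fob H Z)" .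
    then show "\<exists>s\<in>Arr D (fob H Z) E. p \<cdot>\<^sub>D s = Idt D (fob H Z)" using H.D.ArrI by blast
  qed
  moreover have "\<exists>B\<in>X. \<exists>y. y \<Colon> B \<rightarrow> A \<and> surjX y" if "A \<in> Obj T" for A using approx[OF that] by blast
  ultimately show ?thesis using tilting_iff[OF sub 1 2] by blast
qed

end

section \<open>Cluster tilting subcategories\<close>

context triang begin

lemma tri_ex4:
  assumes tr: "(A, B, D, f, g, h) \<in> Tri T" and x: "x \<Colon> W \<rightarrow> shob T A" "shar T f \<cdot> x = nul W (shob T B)"
  obtains y where "y \<Colon> W \<rightarrow> D" "h \<cdot> y = x"
proof -
  note t = triD[OF tr]
  have "(nul (shob T A) (shob T B) \<boxminus> shar T f) \<cdot> x = nul W (shob T B)"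
    using x t by (simp add: Cmp_distrib)
  from tri_ex2[OF tri_rot[OF tr] x(1) this] show thesis using that .
qed

text \<open>The argument of Wakamatsu's lemma. A map from \<open>V\<close> to W[1] dies in Y[1], so
  it comes from a map into \<open>A\<close>; that map lifts to \<open>Y\<close>, and the composite
  of \<open>p\<close> with the connecting map is zero.\<close>

lemma approx_kernel_null:
  assumes tr: "(W, Y, A, b, p, d) \<in> Tri T" and Y: "hom_null V (shob T Y)"
    and ap: "\<And>v. v \<Colon> V \<rightarrow> A \<Longrightarrow> \<exists>y. y \<Colon> V \<rightarrow> Y \<and> p \<cdot> y = v"
  shows "hom_null V (shob T W)"
  unfolding hom_null_def
proof (intro allI impI)
  fix x assume x: "x \<Colon> V \<rightarrow> shob T W"
  note t = triD[OF tr]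
  have bx: "shar T b \<cdot> x \<Colon> V \<rightarrow> shob T Y" using x t by simp
  obtain v where v: "v \<Colon> V \<rightarrow> A" "d \<cdot> v = x" using tri_ex4[OF tr x hom_nullD[OF Y bx]] .
  obtain y where y: "y \<Colon> V \<rightarrow> Y" "p \<cdot> y = v" using ap[OF v(1)] by blast
  have "d \<cdot> (p \<cdot> y) = nul V (shob T W)" using t y(1) by (simp add: Cmp_eq_Cmp[OF tri_zero2[OF tr]])
  then show "x = nul V (shob T W)" unfolding y(2) v(2) .
qed

lemma two_cluster_tilting_iff:
  "two_cluster_tilting T M \<longleftrightarrow> subcategory T M \<and> functorially_finite T M \<and>
    (\<forall>A\<in>Obj T. A \<in> M \<longleftrightarrow> (\<forall>B\<in>M. hom_null B (shob T A))) \<and>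
    (\<forall>A\<in>Obj T. A \<in> M \<longleftrightarrow> (\<forall>B\<in>M. hom_null A (shob T B)))"
proof (cases "subcategory T M")
  case True
  then have M: "M \<subseteq> Obj T" unfolding subcategory_def by (rule conjunct1)
  have gen: "{A \<in> V. P A} = M \<longleftrightarrow> (\<forall>A\<in>V. A \<in> M \<longleftrightarrow> Q A)" if "M \<subseteq> V" "\<And>A. A \<in> V \<Longrightarrow> P A \<longleftrightarrow> Q A" for V P Q
    using that by blast
  have "(\<forall>B\<in>M. Arr T B (shob T A) = {nul B (shob T A)}) \<longleftrightarrow> (\<forall>B\<in>M. hom_null B (shob T A))" if "A \<in> Obj T" for A
    by (intro ball_cong refl) (rule Arr_null_iff[folded hom_null_def], use M that in auto)
  note 1 = gen[OF M this]
  have "(\<forall>B\<in>M. Arr T A (shob T B) = {nul A (shob T B)}) \<longleftrightarrow> (\<forall>B\<in>M. hom_null A (shob T B))" if "A \<in> Obj T" for A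
    by (intro ball_cong refl) (rule Arr_null_iff[folded hom_null_def], use M that in auto)
  note 2 = gen[OF M this]
  show ?thesis unfolding two_cluster_tilting_def by (intro conj_cong refl 1 2)
next
  case False
  then show ?thesis unfolding two_cluster_tilting_def by blast
qed

lemma ctD:
  assumes "two_cluster_tilting T M"
  shows "subcategory T M" "contravariantly_finite T M" "covariantly_finite T M" "M \<subseteq> Obj T"
    and "A \<in> M \<Longrightarrow> B \<in> M \<Longrightarrow> hom_null A (shob T B)"
    and "A \<in> Obj T \<Longrightarrow> (\<And>B. B \<in> M \<Longrightarrow> hom_null B (shob T A)) \<Longrightarrow> A \<in> M"
    and "A \<in> Obj T \<Longrightarrow> (\<And>B. B \<in> M \<Longrightarrow> hom_null A (shob T B)) \<Longrightarrow> A \<in> M"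
proof -
  note c = assms[unfolded two_cluster_tilting_iff]
  show "subcategory T M" "contravariantly_finite T M" "covariantly_finite T M" 
    using c unfolding functorially_finite_def by blast+
  then show M: "M \<subseteq> Obj T" unfolding subcategory_def by blast
  show "A \<in> M \<Longrightarrow> B \<in> M \<Longrightarrow> hom_null A (shob T B)" using c M by blast
  show "A \<in> Obj T \<Longrightarrow> (\<And>B. B \<in> M \<Longrightarrow> hom_null B (shob T A)) \<Longrightarrow> A \<in> M" using c by blast
  show "A \<in> Obj T \<Longrightarrow> (\<And>B. B \<in> M \<Longrightarrow> hom_null A (shob T B)) \<Longrightarrow> A \<in> M" using c by blast
qed

lemma shift2_surj:
  assumes "A \<in> Obj T"
  obtains B where "B \<in> Obj T" "isomorphic T (shob T (shob T B)) A"
proof -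
  obtain C where C: "C \<in> Obj T" "isomorphic T (shob T C) A" using shift_surj[OF assms] .
  obtain B where B: "B \<in> Obj T" "isomorphic T (shob T B) C" using shift_surj[OF C(1)] .
  have "isomorphic T (shob T (shob T B)) (shob T C)" using Sh.isomorphic_fob[OF B(2)] B(1) C(1) by simp
  then have "isomorphic T (shob T (shob T B)) A" using isomorphic_trans[OF _ C(2)] B(1) C(1) assms by simp
  then show thesis using that B(1) by blast
qed

lemma shift2_mem:
  assumes "Y \<subseteq> Obj T"
  shows "B \<in> shift_subcategory T (shift_subcategory T Y) \<longleftrightarrow> B \<in> Obj T \<and> (\<exists>A\<in>Y. isomorphic T (shob T (shob T A)) B)"
proof
  assume "B \<in> shift_subcategory T (shift_subcategory T Y)"
  then obtain C A where C: "B \<in> Obj T" "C \<in> Obj T" "isomorphic T (shob T C) B" and A: "A \<in> Y" "isomorphic T (shob T A) C"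
    unfolding shift_subcategory_def ess_image_def by blast
  have AO: "A \<in> Obj T" using A(1) assms by blast
  have "isomorphic T (shob T (shob T A)) (shob T C)" using Sh.isomorphic_fob[OF A(2)] AO C(2) by simp
  then have "isomorphic T (shob T (shob T A)) B" using isomorphic_trans[OF _ C(3)] AO C by simp
  then show "B \<in> Obj T \<and> (\<exists>A\<in>Y. isomorphic T (shob T (shob T A)) B)" using A(1) C(1) by blast
next
  assume "B \<in> Obj T \<and> (\<exists>A\<in>Y. isomorphic T (shob T (shob T A)) B)"
  then obtain A where A: "B \<in> Obj T" "A \<in> Y" "isomorphic T (shob T (shob T A)) B" by blast
  have AO: "shob T A \<in> Obj T" using A(2) assms by auto
  then have "shob T A \<in> shift_subcategory T Y"
    unfolding shift_subcategory_def ess_image_def using A(2) isomorphic_refl[OF AO] by blast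
  then show "B \<in> shift_subcategory T (shift_subcategory T Y)"
    using A(1,3) unfolding shift_subcategory_def[of _ "shift_subcategory T Y"] ess_image_def by blast
qed

end

section \<open>The equation S Y = Y[2] for cluster tilting subcategories\<close>

context serre_cat begin

lemma serre_shift_eq_iff:
  assumes Y: "Y \<subseteq> Obj T"
  shows "ess_image T S Y = shift_subcategory T (shift_subcategory T Y) \<longleftrightarrow>
    (\<forall>A\<in>Y. \<exists>B\<in>Y. isomorphic T (fob S A) (shob T (shob T B))) \<and>
    (\<forall>A\<in>Y. \<exists>B\<in>Y. isomorphic T (fob S B) (shob T (shob T A)))"
    (is "?l \<longleftrightarrow> ?r1 \<and> ?r2")
proof -
  have YO: "A \<in> Y \<Longrightarrow> A \<in> Obj T" for A using Y by blast
  have im: "B \<in> ess_image T S Y \<longleftrightarrow> B \<in> Obj T \<and> (\<exists>A\<in>Y. isomorphic T (fob S A) B)" for B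
    unfolding ess_image_def by blast
  show ?thesis
  proof
    assume l: ?l
    show "?r1 \<and> ?r2"
    proof (intro conjI ballI)
      fix A assume A: "A \<in> Y"
      have SA: "fob S A \<in> Obj T" "shob T (shob T A) \<in> Obj T" using YO[OF A] by simp_all
      have "fob S A \<in> ess_image T S Y" unfolding im using A SA isomorphic_refl[OF SA(1)] by blast
      then obtain B where B: "B \<in> Y" "isomorphic T (shob T (shob T B)) (fob S A)" unfolding l shift2_mem[OF Y] by blast
      have "shob T (shob T B) \<in> Obj T" using YO[OF B(1)] by simp
      then show "\<exists>B\<in>Y. isomorphic T (fob S A) (shob T (shob T B))" using isomorphic_sym[OF B(2) _ SA(1)] B(1) by blast
      have "shob T (shob T A) \<in> shift_subcategory T (shift_subcategory T Y)"
        unfolding shift2_mem[OF Y] using A SA isomorphic_refl[OF SA(2)] by blast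
      then show "\<exists>B\<in>Y. isomorphic T (fob S B) (shob T (shob T A))" unfolding l[symmetric] im by blast
    qed
  next
    assume r: "?r1 \<and> ?r2"
    show ?l
    proof (intro equalityI subsetI)
      fix B assume "B \<in> ess_image T S Y"
      then obtain A where A: "B \<in> Obj T" "A \<in> Y" "isomorphic T (fob S A) B" unfolding im by blast
      obtain E where E: "E \<in> Y" "isomorphic T (fob S A) (shob T (shob T E))" using r A(2) by blast
      have O: "fob S A \<in> Obj T" "shob T (shob T E) \<in> Obj T" using YO[OF A(2)] YO[OF E(1)] by simp_all
      have "isomorphic T (shob T (shob T E)) B"
        by (rule isomorphic_trans[OF isomorphic_sym[OF E(2) O] A(3) O(2,1) A(1)])
      then show "B \<in> shift_subcategory T (shift_subcategory T Y)" unfolding shift2_mem[OF Y] using A(1) E(1) by blast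
    next
      fix B assume "B \<in> shift_subcategory T (shift_subcategory T Y)"
      then obtain A where A: "B \<in> Obj T" "A \<in> Y" "isomorphic T (shob T (shob T A)) B" unfolding shift2_mem[OF Y] by blast
      obtain E where E: "E \<in> Y" "isomorphic T (fob S E) (shob T (shob T A))" using r A(2) by blast
      have O: "shob T (shob T A) \<in> Obj T" "fob S E \<in> Obj T" using YO[OF A(2)] YO[OF E(1)] by simp_all
      have "isomorphic T (fob S E) B" by (rule isomorphic_trans[OF E(2) A(3) O(2,1) A(1)])
      then show "B \<in> ess_image T S Y" unfolding im using A(1) E(1) by blast
    qed
  qed
qed

text \<open>For \<open>A\<close> in \<open>Y\<close> choose \<open>B\<close> with B[2] = S A,
  respectively \<open>B'\<close> with S B' = A[2]. By \<open>serre_shift_null\<close> the rigidity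
  of \<open>Y\<close> becomes the orthogonality condition for \<open>B\<close>, respectively
  \<open>B'\<close>, and maximality of \<open>Y\<close> puts these objects into
  \<open>Y\<close>.\<close>

lemma ct_serre:
  assumes Y: "two_cluster_tilting T Y"
  shows "ess_image T S Y = shift_subcategory T (shift_subcategory T Y)"
  unfolding serre_shift_eq_iff[OF ctD(4)[OF Y]]
proof (intro conjI ballI)
  note c = ctD[OF Y]
  fix A assume A: "A \<in> Y"
  then have AO: "A \<in> Obj T" using c(4) by blast
  then have SA: "fob S A \<in> Obj T" by simp
  obtain B where B: "B \<in> Obj T" "isomorphic T (shob T (shob T B)) (fob S A)" using shift2_surj[OF SA] .
  have B2: "shob T (shob T B) \<in> Obj T" using B(1) by simp
  have i: "isomorphic T (fob S A) (shob T (shob T B))" by (rule isomorphic_sym[OF B(2) B2 SA])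
  have "B \<in> Y"
  proof (rule c(6)[OF B(1)])
    fix E assume E: "E \<in> Y"
    then have "E \<in> Obj T" using c(4) by blast
    from serre_shift_null[OF this B(1) AO i] show "hom_null E (shob T B)" using c(5)[OF A E] by blast
  qed
  then show "\<exists>B\<in>Y. isomorphic T (fob S A) (shob T (shob T B))" using i by blast
  have A2: "shob T (shob T A) \<in> Obj T" using AO by simp
  obtain B' where B': "B' \<in> Obj T" "isomorphic T (fob S B') (shob T (shob T A))" using S_surj[OF A2] .
  have "B' \<in> Y"
  proof (rule c(7)[OF B'(1)])
    fix E assume E: "E \<in> Y"
    then have "E \<in> Obj T" using c(4) by blast
    from serre_shift_null[OF this AO B'] show "hom_null B' (shob T E)" using c(5)[OF E A] by blast
  qed
  then show "\<exists>B\<in>Y. isomorphic T (fob S B) (shob T (shob T A))" using B'(2) by blast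
qed

end

section \<open>Consequences of \<open>X\<close> being cluster tilting\<close>

locale ct_setting = ghost_setting K T D H X + serre_cat K T S
  for K :: "('k, 'r) ring_scheme" and T :: "('k, 'o, 'm, 'z) tcat_scheme" (structure)
    and D :: "('k, 'p, 'n, 'y) lcat_scheme" and H :: "('o, 'm, 'p, 'n) funct" and X :: "'o set"
    and S :: "('o, 'm, 'o, 'm) funct" +
  assumes X_ct: "two_cluster_tilting T X"
    and finite_res: "F \<in> Obj D \<Longrightarrow> \<exists>n. has_projective_resolution D F n"
begin

lemma X_null: "Z \<in> X \<Longrightarrow> Z' \<in> X \<Longrightarrow> f \<Colon> Z \<rightarrow> shob T Z' \<Longrightarrow> f = nul Z (shob T Z')"
  using ctD(5)[OF X_ct] hom_nullD by blast

text \<open>The cocone of an approximation has no maps from \<open>X\<close> to its shift by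
  \<open>approx_kernel_null\<close>, so it lies in \<open>X\<close> by maximality.\<close>

lemma presentation:
  assumes A: "A \<in> Obj T"
  obtains X0 X1 b p d where "X0 \<in> X" "X1 \<in> X" "(X1, X0, A, b, p, d) \<in> Tri T" "surjX p"
proof -
  obtain X0 p where p: "X0 \<in> X" "p \<Colon> X0 \<rightarrow> A" "surjX p" using approx[OF A] .
  obtain X1 b d where tr: "(X1, X0, A, b, p, d) \<in> Tri T" using tri_complete_mid[OF p(2)] .
  have "X1 \<in> Obj T" using triD[OF tr] by simp
  then have "X1 \<in> X"
  proof (rule ctD(6)[OF X_ct])
    fix V assume V: "V \<in> X"
    show "hom_null V (shob T X1)"
    proof (rule approx_kernel_null[OF tr ctD(5)[OF X_ct V p(1)]])
      fix v assume "v \<Colon> V \<rightarrow> A"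
      then show "\<exists>y. y \<Colon> V \<rightarrow> X0 \<and> p \<cdot> y = v" using surjXD[OF p(3,2) V] by metis
    qed
  qed
  then show thesis using that p(1,3) tr by blast
qed

text \<open>Starts from a left approximation \<open>f\<close> of \<open>W\<close>. A map from
  \<open>X1\<close> to V[1] vanishes on \<open>X0\<close> by rigidity and therefore factors through
  W[1]; there it extends along the shift of \<open>f\<close>, whose composite with \<open>h\<close>
  is zero. Applying \<open>S\<close> to this triangle will yield relatively injective
  copresentations.\<close>

lemma copresentation:
  assumes W: "W \<in> Obj T"
  obtains X0 X1 f g h where "X0 \<in> X" "X1 \<in> X" "(W, X0, X1, f, g, h) \<in> Tri T"
proof -
  obtain X0 f where f: "X0 \<in> X" "f \<in> Arr T W X0" and ap: "\<forall>X'\<in>X. (\<lambda>h. h \<cdot> f) ` Arr T X0 X' = Arr T W X'"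
    using ctD(3)[OF X_ct] W unfolding covariantly_finite_def by blast
  have f': "f \<Colon> W \<rightarrow> X0" using ArrD[OF f(2) W] f(1) by simp
  obtain X1 g h where tr: "(W, X0, X1, f, g, h) \<in> Tri T" using tri_cone[OF f'] .
  note t = triD[OF tr]
  have O: "X1 \<in> Obj T" using t by simp
  have "X1 \<in> X"
  proof (rule ctD(7)[OF X_ct O])
    fix V assume V: "V \<in> X"
    show "hom_null X1 (shob T V)" unfolding hom_null_def
    proof (intro allI impI)
      fix x assume x: "x \<Colon> X1 \<rightarrow> shob T V"
      have "x \<cdot> g \<Colon> X0 \<rightarrow> shob T V" using x t by simp
      from tri_co2[OF tr x X_null[OF f(1) V this]] obtain y where y: "y \<Colon> shob T W \<rightarrow> shob T V" "y \<cdot> h = x" .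
      obtain y' where y': "y' \<Colon> W \<rightarrow> V" "shar T y' = y" using shift_lift[OF W X_Obj[OF V] y(1)] .
      have "y' \<in> (\<lambda>h. h \<cdot> f) ` Arr T X0 V" using ap V ArrI[OF y'(1)] by simp
      then obtain k where k: "k \<in> Arr T X0 V" "y' = k \<cdot> f" by blast
      have k': "k \<Colon> X0 \<rightarrow> V" using ArrD[OF k(1)] f(1) V by simp
      have "x = shar T k \<cdot> (shar T f \<cdot> h)" unfolding y(2)[symmetric] y'(2)[symmetric] k(2) using k' t by simp
      then show "x = nul X1 (shob T V)" unfolding tri_zero3[OF tr] using k' t by simp
    qed
  qed
  then show thesis using that f(1) tr by blast
qed

lemma Pp_shift:
  assumes B: "B \<in> Pp"
  obtains B' where "B' \<in> X" "isomorphic T (shob T B') B"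
proof -
  have BO: "B \<in> Obj T" using B Pp_iff by blast
  obtain B' where B': "B' \<in> Obj T" "isomorphic T (shob T B') B" using shift_surj[OF BO] .
  have sB: "shob T B' \<in> Obj T" using B'(1) by simp
  have "B' \<in> X"
  proof (rule ctD(6)[OF X_ct B'(1)])
    fix Z assume Z: "Z \<in> X"
    then have "hom_null Z B" using B Pp_iff by blast
    then show "hom_null Z (shob T B')"
      by (rule hom_null_iso[OF isomorphic_refl isomorphic_sym[OF B'(2) sB BO] _ BO _ sB, rotated 3]) (use Z in simp_all)
  qed
  then show thesis using that B'(2) by blast
qed

text \<open>A ghost annihilates the approximation in a presentation of \<open>A\<close>, so it
  factors through the connecting map into X1[1].\<close>

lemma ghost_factor:
  assumes f: "f \<Colon> A \<rightarrow> B" "ghost f"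
  obtains Z u v where "Z \<in> X" "u \<Colon> A \<rightarrow> shob T Z" "v \<Colon> shob T Z \<rightarrow> B" "f = v \<cdot> u"
proof -
  have A: "A \<in> Obj T" using f by simp
  obtain X0 X1 b p d where P: "X0 \<in> X" "X1 \<in> X" "(X1, X0, A, b, p, d) \<in> Tri T" using presentation[OF A] .
  note t = triD[OF P(3)]
  have "f \<cdot> p = nul X0 B" by (rule ghostD[OF f(2,1) P(1) t(2)])
  from tri_co2[OF P(3) f(1) this] obtain v where "v \<Colon> shob T X1 \<rightarrow> B" "v \<cdot> d = f" .
  then show thesis using that[OF P(2) t(3)] by blast
qed

lemma factor_ghost:
  assumes "Z \<in> X" "u \<Colon> A \<rightarrow> shob T Z" "v \<Colon> shob T Z \<rightarrow> B"
  shows "ghost (v \<cdot> u)"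
proof (rule ghostI[of _ A B])
  fix V z assume z: "V \<in> X" "z \<Colon> V \<rightarrow> A"
  have uz: "u \<cdot> z \<Colon> V \<rightarrow> shob T Z" using z assms by simp
  have "u \<cdot> z = nul V (shob T Z)" by (rule X_null[OF z(1) assms(1) uz])
  then show "(v \<cdot> u) \<cdot> z = nul V B" using assms z by simp
qed (use assms in simp)

subsection \<open>Finite projective dimension forces projective dimension at most one\<close>

text \<open>Objectwise injectivity of \<open>H f\<close> on \<open>X\<close>, the counterpart of
  \<open>surjX\<close>.\<close>

definition injX :: "'m \<Rightarrow> bool"
  where "injX f \<longleftrightarrow> (\<forall>Z\<in>X. \<forall>z\<in>Arr T Z (Src T f). f \<cdot> z = nul Z (Tgt T f) \<longrightarrow> z = nul Z (Src T f))"

lemma injXD: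
  assumes "injX f" "f \<Colon> A \<rightarrow> B" "Z \<in> X" "z \<Colon> Z \<rightarrow> A" "f \<cdot> z = nul Z B"
  shows "z = nul Z A"
  using assms(1)[unfolded injX_def, THEN bspec, OF assms(3)] assms(2,5) ArrI[OF assms(4)] by simp

lemma injXI:
  assumes f: "f \<Colon> A \<rightarrow> B" and "\<And>Z z. Z \<in> X \<Longrightarrow> z \<Colon> Z \<rightarrow> A \<Longrightarrow> f \<cdot> z = nul Z B \<Longrightarrow> z = nul Z A"
  shows "injX f"
  unfolding injX_def
proof (intro ballI impI)
  fix Z z assume Z: "Z \<in> X" and z: "z \<in> Arr T Z (Src T f)" "f \<cdot> z = nul Z (Tgt T f)"
  then have "z \<Colon> Z \<rightarrow> A" "f \<cdot> z = nul Z B" using ArrD[of z Z A] f by simp_all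
  from assms(2)[OF Z this] show "z = nul Z (Src T f)" using f by simp
qed

lemma injX_eq:
  assumes "injX f" "f \<Colon> A \<rightarrow> B" "Z \<in> X" "z \<Colon> Z \<rightarrow> A" "z' \<Colon> Z \<rightarrow> A" "f \<cdot> z = f \<cdot> z'"
  shows "z = z'"
proof -
  have "f \<cdot> (z \<boxminus> z') = f \<cdot> z \<boxminus> f \<cdot> z'" using assms(2,4,5) by (simp add: Cmp_distrib)
  also have "\<dots> = nul Z B" unfolding assms(6) using assms(2,5) by simp
  finally have "z \<boxminus> z' = nul Z A" by (intro injXD[OF assms(1-3)]) (use assms(4,5) in simp_all)
  then show ?thesis using minus_eq_nul[OF assms(4,5)] by simp
qed

text \<open>Exactness of the sequence \<open>H f\<close>, \<open>H g\<close> in the middle, again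
  tested objectwise on \<open>X\<close>; it makes no reference to kernels in
  \<open>D\<close>.\<close>

definition exX :: "'m \<Rightarrow> 'm \<Rightarrow> bool"
  where "exX f g \<longleftrightarrow> ghost (g \<cdot> f) \<and>
    (\<forall>Z\<in>X. \<forall>z\<in>Arr T Z (Src T g). g \<cdot> z = nul Z (Tgt T g) \<longrightarrow> (\<exists>y\<in>Arr T Z (Src T f). f \<cdot> y = z))"

lemma exXD:
  assumes "exX f g" "f \<Colon> A \<rightarrow> B" "g \<Colon> B \<rightarrow> E" "Z \<in> X" "z \<Colon> Z \<rightarrow> B" "g \<cdot> z = nul Z E"
  obtains y where "y \<Colon> Z \<rightarrow> A" "f \<cdot> y = z"
proof -
  have e: "\<forall>z\<in>Arr T Z (Src T g). g \<cdot> z = nul Z (Tgt T g) \<longrightarrow> (\<exists>y\<in>Arr T Z (Src T f). f \<cdot> y = z)"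
    using assms(1,4) unfolding exX_def by blast
  have s: "Src T g = B" "Tgt T g = E" "Src T f = A" "A \<in> Obj T" "Z \<in> Obj T" using assms(2,3,5) by simp_all
  obtain y where y: "y \<in> Arr T Z A" "f \<cdot> y = z" using e ArrI[OF assms(5)] assms(6) unfolding s by blast
  show thesis by (rule that[OF ArrD[OF y(1) s(5,4)] y(2)])
qed

lemma exX_zero:
  assumes "exX f g" "f \<Colon> A \<rightarrow> B" "g \<Colon> B \<rightarrow> E" "Z \<in> X" "z \<Colon> Z \<rightarrow> A"
  shows "g \<cdot> (f \<cdot> z) = nul Z E"
proof -
  have "g \<cdot> f \<Colon> A \<rightarrow> E" "ghost (g \<cdot> f)" using assms(1-3) unfolding exX_def by simp_all
  from ghostD[OF this(2,1) assms(4,5)] show ?thesis using assms by simp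
qed

lemma exXI:
  assumes f: "f \<Colon> A \<rightarrow> B" "g \<Colon> B \<rightarrow> E" and 1: "\<And>Z z. Z \<in> X \<Longrightarrow> z \<Colon> Z \<rightarrow> A \<Longrightarrow> g \<cdot> (f \<cdot> z) = nul Z E"
    and 2: "\<And>Z z. Z \<in> X \<Longrightarrow> z \<Colon> Z \<rightarrow> B \<Longrightarrow> g \<cdot> z = nul Z E \<Longrightarrow> \<exists>y. y \<Colon> Z \<rightarrow> A \<and> f \<cdot> y = z"
  shows "exX f g"
  unfolding exX_def
proof (intro conjI ballI impI)
  show "ghost (g \<cdot> f)"
  proof (rule ghostI[of _ A E])
    fix Z z assume z: "Z \<in> X" "z \<Colon> Z \<rightarrow> A"
    show "(g \<cdot> f) \<cdot> z = nul Z E" using 1[OF z] f z(2) by simp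
  qed (use f in simp)
  fix Z z assume Z: "Z \<in> X" and "z \<in> Arr T Z (Src T g)" "g \<cdot> z = nul Z (Tgt T g)"
  then have "z \<Colon> Z \<rightarrow> B" "g \<cdot> z = nul Z E" using ArrD[of z Z B] f by simp_all
  from 2[OF Z this] obtain y where y: "y \<Colon> Z \<rightarrow> A" "f \<cdot> y = z" by blast
  then show "\<exists>y\<in>Arr T Z (Src T f). f \<cdot> y = z" using ArrI[OF y(1)] f by (intro bexI[of _ y]) simp_all
qed

text \<open>\<open>res n A\<close>: \<open>H A\<close> has a resolution by objects \<open>H Z\<close>, \<open>Z \<in> X\<close>, with \<open>n\<close> nonzero terms.\<close>

primrec res :: "nat \<Rightarrow> 'o \<Rightarrow> bool" where
  "res 0 A \<longleftrightarrow> A \<in> Pp"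
| "res (Suc n) A \<longleftrightarrow> (\<exists>X0\<in>X. \<exists>B\<in>Obj T. \<exists>b\<in>Arr T B X0. \<exists>p\<in>Arr T X0 A. injX b \<and> exX b p \<and> surjX p \<and> res n B)"

lemma res_SucE:
  assumes "res (Suc n) A" "A \<in> Obj T"
  obtains X0 B b p where "X0 \<in> X" "b \<Colon> B \<rightarrow> X0" "p \<Colon> X0 \<rightarrow> A" "injX b" "exX b p" "surjX p" "res n B"
proof -
  obtain X0 B b p where *: "X0 \<in> X" "B \<in> Obj T" "b \<in> Arr T B X0" "p \<in> Arr T X0 A" "injX b" "exX b p" "surjX p" "res n B"
    using assms(1) unfolding res.simps by blast
  show thesis by (rule that[OF *(1) ArrD[OF *(3)] ArrD[OF *(4)] *(5-8)]) (use * assms(2) in simp_all)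
qed

lemma res_SucI:
  assumes "X0 \<in> X" "b \<Colon> B \<rightarrow> X0" "p \<Colon> X0 \<rightarrow> A" "injX b" "exX b p" "surjX p" "res n B"
  shows "res (Suc n) A"
proof -
  have "B \<in> Obj T" using assms(2) by simp
  then show ?thesis unfolding res.simps using assms(1,4-7) ArrI[OF assms(2)] ArrI[OF assms(3)] by blast
qed

text \<open>With \<open>X2 = S W\<close>, applying \<open>S\<close> to a copresentation of \<open>W\<close> embeds \<open>X2\<close> into a two-term complex
  of relatively injective objects; a monomorphism out of \<open>X2\<close> whose cokernel embeds in a
  projective therefore splits.\<close>

lemma split_mono:
  assumes XX: "X2 \<in> X" "X1 \<in> X" "X0 \<in> X" and m: "m \<Colon> X2 \<rightarrow> X1" and l: "l \<Colon> X1 \<rightarrow> X0"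
    and inj: "injX m" and ex: "exX m l"
  obtains s where "s \<Colon> X1 \<rightarrow> X2" "s \<cdot> m = Idt T X2"
proof -
  have XO: "X2 \<in> Obj T" "X1 \<in> Obj T" "X0 \<in> Obj T" using XX by simp_all
  obtain W where W: "W \<in> Obj T" "isomorphic T (fob S W) X2" using S_surj[OF XO(1)] .
  have SW: "fob S W \<in> Obj T" using W by simp
  obtain \<kappa> \<iota> where io: "\<kappa> \<Colon> fob S W \<rightarrow> X2" "\<iota> \<Colon> X2 \<rightarrow> fob S W" "\<iota> \<cdot> \<kappa> = Idt T (fob S W)" "\<kappa> \<cdot> \<iota> = Idt T X2"
    using isomorphicE[OF W(2) SW XO(1)] .
  obtain Y0 Y1 f g h where Y: "Y0 \<in> X" "Y1 \<in> X" and tr0: "(W, Y0, Y1, f, g, h) \<in> Tri T" using copresentation[OF W(1)] .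
  note t0 = triD[OF tr0]
  define j where "j = far S f"
  define q where "q = far S g"
  define r where "r = \<theta> W \<cdot> far S h"
  have tr: "(fob S W, fob S Y0, fob S Y1, j, q, r) \<in> Tri T" unfolding j_def q_def r_def by (rule S_tri[OF tr0])
  note t = triD[OF tr]
  have lm: "l \<cdot> m = nul X2 X0"
    using exX_zero[OF ex m l XX(1), of "Idt T X2"] m XO by simp
  have ji: "j \<cdot> \<iota> \<Colon> X2 \<rightarrow> fob S Y0" using t io by simp
  \<comment> \<open>No non-zero map from \<open>Y0\<close> to \<open>X2\<close> is annihilated by
    the monic \<open>m\<close>, so the relative injectivity of S Y0 extends
    \<open>j \<cdot> \<iota>\<close> along \<open>m\<close>.\<close>
  have "j \<cdot> \<iota> \<cdot> z = nul Y0 (fob S Y0)" if "z \<Colon> Y0 \<rightarrow> X2" "m \<cdot> z = nul Y0 X1" for z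
    using injXD[OF inj m Y(1) that] t io that(1) by simp
  then obtain j' where j': "j' \<Colon> X1 \<rightarrow> fob S Y0" "j' \<cdot> m = j \<cdot> \<iota>"
    using serre_injective[OF m ji X_Obj[OF Y(1)]] io t by (metis assoc)
  have qj: "q \<cdot> j' \<Colon> X1 \<rightarrow> fob S Y1" using t j' by simp
  have qjm: "q \<cdot> (j' \<cdot> m) = nul X2 (fob S Y1)"
    unfolding j'(2) using Cmp_eq_Cmp[OF tri_zero1[OF tr], of \<iota>] t io by simp
  \<comment> \<open>By exactness a map from \<open>Y1\<close> annihilated by \<open>l\<close>
    factors through \<open>m\<close>, and \<open>q \<cdot> j' \<cdot> m\<close> is zero. So
    \<open>q \<cdot> j'\<close> extends along \<open>l\<close>, by the relative injectivity of S
    Y1.\<close>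
  have "(q \<cdot> j') \<cdot> z = nul Y1 (fob S Y1)" if z: "z \<Colon> Y1 \<rightarrow> X1" "l \<cdot> z = nul Y1 X0" for z
  proof -
    obtain y where y: "y \<Colon> Y1 \<rightarrow> X2" "m \<cdot> y = z" using exXD[OF ex m l Y(2) z] .
    have "(q \<cdot> j') \<cdot> (m \<cdot> y) = (q \<cdot> (j' \<cdot> m)) \<cdot> y" using y(1) m j'(1) t by simp
    also have "\<dots> = nul Y1 (fob S Y1)" unfolding qjm using y(1) t by simp
    finally show ?thesis unfolding y(2) .
  qed
  then obtain u where u: "u \<Colon> X0 \<rightarrow> fob S Y1" "u \<cdot> l = q \<cdot> j'"
    using serre_injective[OF l qj X_Obj[OF Y(2)]] by blast
  \<comment> \<open>The obstruction to lifting \<open>u\<close> through \<open>q\<close> is a map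
    from \<open>X0\<close> to (S W)[1], that is to X2[1]; rigidity removes it.\<close>
  have "hom_null X0 (shob T (fob S W))"
    by (rule hom_null_iso[OF isomorphic_refl[OF XO(3)] Sh.isomorphic_fob[OF isomorphic_sym[OF W(2) SW XO(1)]] XO(3) _ XO(3) _
          ctD(5)[OF X_ct XX(3,1)]]) (use XO SW in simp_all)
  moreover have "r \<cdot> u \<Colon> X0 \<rightarrow> shob T (fob S W)" using t u by simp
  ultimately have "r \<cdot> u = nul X0 (shob T (fob S W))" using hom_nullD by blast
  from tri_ex2[OF tr u(1) this] obtain u' where u': "u' \<Colon> X0 \<rightarrow> fob S Y0" "q \<cdot> u' = u" .
  \<comment> \<open>Subtracting \<open>u' \<cdot> l\<close> moves \<open>j'\<close> into the kernel
    of \<open>q\<close> and does not change \<open>j' \<cdot> m\<close>, because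
    \<open>l \<cdot> m\<close> is zero. The corrected map therefore factors through
    \<open>j\<close>.\<close>
  define j2 where "j2 = j' \<boxminus> u' \<cdot> l"
  have j2: "j2 \<Colon> X1 \<rightarrow> fob S Y0" unfolding j2_def using j' u' l by simp
  have "q \<cdot> j2 = q \<cdot> j' \<boxminus> u \<cdot> l"
    unfolding j2_def using t j'(1) u'(1) l Cmp_eq_Cmp[OF u'(2), of l] by (simp add: Cmp_distrib)
  also have "\<dots> = nul X1 (fob S Y1)" unfolding u(2) using qj by simp
  finally obtain s' where s': "s' \<Colon> X1 \<rightarrow> fob S W" "j \<cdot> s' = j2" using tri_ex1[OF tr j2] by blast
  define w where "w = s' \<cdot> m \<boxminus> \<iota>"
  have w: "w \<Colon> X2 \<rightarrow> fob S W" unfolding w_def using s' m io by simp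
  have "j \<cdot> s' \<cdot> m = j2 \<cdot> m" using Cmp_eq_Cmp[OF s'(2), of m] s'(1) m t by simp
  also have "\<dots> = j \<cdot> \<iota>" unfolding j2_def using j' u'(1) l m lm ji by (simp add: Cmp_distrib)
  finally have "j \<cdot> w = nul X2 (fob S Y0)" unfolding w_def using t s'(1) m io by (simp add: Cmp_distrib)
  from tri_ex3[OF tr w this] obtain y where y: "y \<Colon> shob T X2 \<rightarrow> fob S Y1" "r \<cdot> y = shar T w" .
  \<comment> \<open>The arrows \<open>s' \<cdot> m\<close> and \<open>\<iota>\<close> agree after
    composition with \<open>j\<close>. Their difference is measured by a map from X2[1] to S Y1, and
    such maps are dual to T(Y1, X2[1]), which vanishes.\<close>
  have "hom_null Y1 (shob T X2)" by (rule ctD(5)[OF X_ct Y(2) XX(1)])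
  then have "hom_null (shob T X2) (fob S Y1)" using serre_null[of Y1 "shob T X2"] Y XO by simp
  then have "y = nul (shob T X2) (fob S Y1)" using hom_nullD y(1) by blast
  then have "shar T w = nul (shob T X2) (shob T (fob S W))" unfolding y(2)[symmetric] using t y(1) by simp
  from shift_eq_nul[OF w this] have "s' \<cdot> m = \<iota>"
    unfolding w_def using minus_eq_nul[of "s' \<cdot> m" X2 "fob S W" \<iota>] s'(1) m io by simp
  then have "\<kappa> \<cdot> s' \<cdot> m = Idt T X2" using io(4) by simp
  moreover have "\<kappa> \<cdot> s' \<Colon> X1 \<rightarrow> X2" using s' io by simp
  ultimately show thesis using that[of "\<kappa> \<cdot> s'"] s'(1) io(1) m by simp
qed

text \<open>A resolution is padded with a zero term at its far end.\<close>

lemma res_mono: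
  assumes "A \<in> Obj T" "res n A"
  shows "res (Suc n) A"
  using assms
proof (induction n arbitrary: A)
  case 0
  obtain Z where Z: "Z \<in> Obj T" "is_zero_obj T Z" using obtain_zero .
  have ZX: "Z \<in> X" using X_subcat Z unfolding subcategory_def by blast
  have ZP: "Z \<in> Pp"
  proof -
    have "hom_null V Z" for V unfolding hom_null_def using zero_obj_to[OF Z(2)] by blast
    then show ?thesis using Z(1) Pp_iff by blast
  qed
  have AP: "A \<in> Pp" using 0(2) by simp
  have i: "Idt T Z \<Colon> Z \<rightarrow> Z" and n: "nul Z A \<Colon> Z \<rightarrow> A" using Z 0(1) by simp_all
  show ?case
  proof (rule res_SucI[OF ZX i n])
    show "injX (Idt T Z)"
    proof (rule injXI[OF i])
      fix V z assume "V \<in> X" "z \<Colon> V \<rightarrow> Z"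
      then show "z = nul V Z" using zero_obj_to[OF Z(2)] by blast
    qed
    show "exX (Idt T Z) (nul Z A)"
    proof (rule exXI[OF i n])
      fix V z assume z: "V \<in> X" "z \<Colon> V \<rightarrow> Z"
      show "nul Z A \<cdot> (Idt T Z \<cdot> z) = nul V A" using z(2) 0(1) by simp
      show "\<exists>y. y \<Colon> V \<rightarrow> Z \<and> Idt T Z \<cdot> y = z" using z(2) by (intro exI[of _ z]) simp
    qed
    show "surjX (nul Z A)"
    proof (rule surjXI[OF n])
      fix V z assume z: "V \<in> X" "z \<Colon> V \<rightarrow> A"
      have "hom_null V A" using AP Pp_iff z(1) by blast
      then have "z = nul V A" using hom_nullD z(2) by blast
      then show "\<exists>y. y \<Colon> V \<rightarrow> Z \<and> nul Z A \<cdot> y = z" using z(2) Z(1) 0(1) by (intro exI[of _ "nul V Z"]) simp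
    qed
    show "res 0 Z" using ZP by simp
  qed
next
  case (Suc n)
  obtain X0 B b p where *: "X0 \<in> X" "b \<Colon> B \<rightarrow> X0" "p \<Colon> X0 \<rightarrow> A" "injX b" "exX b p" "surjX p" "res n B"
    using res_SucE[OF Suc.prems(2,1)] .
  have "B \<in> Obj T" using *(2) by simp
  from Suc.IH[OF this *(7)] show ?case by (rule res_SucI[OF *(1-6)])
qed

text \<open>The last map \<open>m\<close> of the resolution is monic and its cokernel
  \<open>B\<close> embeds in \<open>X0\<close>, so \<open>split_mono\<close> splits it. The
  complement of \<open>X2\<close> in \<open>X1\<close> then resolves \<open>B\<close> by
  itself.\<close>

lemma res_drop:
  assumes A: "A \<in> Obj T" and r: "res (Suc (Suc (Suc 0))) A"
  shows "res (Suc (Suc 0)) A"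
proof -
  obtain X0 B b p where 1: "X0 \<in> X" "b \<Colon> B \<rightarrow> X0" "p \<Colon> X0 \<rightarrow> A" "injX b" "exX b p" "surjX p" "res (Suc (Suc 0)) B"
    using res_SucE[OF r A] .
  have BO: "B \<in> Obj T" using 1(2) by simp
  obtain X1 E c q where 2: "X1 \<in> X" "c \<Colon> E \<rightarrow> X1" "q \<Colon> X1 \<rightarrow> B" "injX c" "exX c q" "surjX q" "res (Suc 0) E"
    using res_SucE[OF 1(7) BO] .
  have EO: "E \<in> Obj T" using 2(2) by simp
  obtain X2 F e k where 3: "X2 \<in> X" "e \<Colon> F \<rightarrow> X2" "k \<Colon> X2 \<rightarrow> E" "injX e" "exX e k" "surjX k" "res 0 F"
    using res_SucE[OF 2(7) EO] .
  have XO: "X0 \<in> Obj T" "X1 \<in> Obj T" "X2 \<in> Obj T" using 1 2 3 by simp_all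
  \<comment> \<open>The last syzygy \<open>F\<close> lies in \<open>Pp\<close>, so maps from
    \<open>X\<close> into it vanish and \<open>k\<close> is injective on maps out of
    \<open>X\<close>.\<close>
  have kinj: "injX k"
  proof (rule injXI[OF 3(3)])
    fix Z z assume z: "Z \<in> X" "z \<Colon> Z \<rightarrow> X2" "k \<cdot> z = nul Z E"
    obtain y where y: "y \<Colon> Z \<rightarrow> F" "e \<cdot> y = z" using exXD[OF 3(5,2,3) z] .
    have "hom_null Z F" using 3(7) Pp_iff z(1) by simp
    then have "y = nul Z F" using hom_nullD y(1) by blast
    then show "z = nul Z X2" unfolding y(2)[symmetric] using y(1) 3(2) by simp
  qed
  define m where "m = c \<cdot> k"
  define l where "l = b \<cdot> q"
  have m: "m \<Colon> X2 \<rightarrow> X1" unfolding m_def using 2(2) 3(3) by simp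
  have l: "l \<Colon> X1 \<rightarrow> X0" unfolding l_def using 1(2) 2(3) by simp
  have minj: "injX m"
  proof (rule injXI[OF m])
    fix Z z assume z: "Z \<in> X" "z \<Colon> Z \<rightarrow> X2" "m \<cdot> z = nul Z X1"
    have kz: "k \<cdot> z \<Colon> Z \<rightarrow> E" using z 3(3) by simp
    have "c \<cdot> (k \<cdot> z) = nul Z X1" using z(2,3) 2(2) 3(3) unfolding m_def by simp
    from injXD[OF 2(4,2) z(1) kz this] show "z = nul Z X2" by (rule injXD[OF kinj 3(3) z(1,2)])
  qed
  have qker: "\<exists>y. y \<Colon> Z \<rightarrow> X2 \<and> m \<cdot> y = z" if z: "Z \<in> X" "z \<Colon> Z \<rightarrow> X1" "q \<cdot> z = nul Z B" for Z z
  proof -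
    obtain y where y: "y \<Colon> Z \<rightarrow> E" "c \<cdot> y = z" using exXD[OF 2(5,2,3) z] .
    obtain y' where y': "y' \<Colon> Z \<rightarrow> X2" "k \<cdot> y' = y" using surjXD[OF 3(6,3) z(1) y(1)] .
    have "m \<cdot> y' = z" unfolding m_def using y'(1) 2(2) 3(3) unfolding y(2)[symmetric] y'(2)[symmetric] by simp
    then show ?thesis using y'(1) by blast
  qed
  have qm: "q \<cdot> m = nul X2 B" using exX_zero[OF 2(5,2,3) 3(1,3)] unfolding m_def .
  have lex: "exX m l"
  proof (rule exXI[OF m l])
    fix Z z assume z: "Z \<in> X" "z \<Colon> Z \<rightarrow> X2"
    show "l \<cdot> (m \<cdot> z) = nul Z X0"
      unfolding l_def using Cmp_eq_Cmp[OF qm, of z] z(2) m 1(2) 2(3) by simp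
  next
    fix Z z assume z: "Z \<in> X" "z \<Colon> Z \<rightarrow> X1" "l \<cdot> z = nul Z X0"
    have qz: "q \<cdot> z \<Colon> Z \<rightarrow> B" using z(2) 2(3) by simp
    have "b \<cdot> (q \<cdot> z) = nul Z X0" using z(2,3) 1(2) 2(3) unfolding l_def by simp
    from injXD[OF 1(4,2) z(1) qz this] show "\<exists>y. y \<Colon> Z \<rightarrow> X2 \<and> m \<cdot> y = z" by (rule qker[OF z(1,2)])
  qed
  obtain s where s: "s \<Colon> X1 \<rightarrow> X2" "s \<cdot> m = Idt T X2" using split_mono[OF 3(1) 2(1) 1(1) m l minj lex] .
  \<comment> \<open>The idempotent onto the complement of \<open>X2\<close> in \<open>X1\<close>;
    its image lies in \<open>X\<close>, which is closed under summands.\<close>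
  define \<epsilon> where "\<epsilon> = Idt T X1 \<boxminus> m \<cdot> s"
  have ep: "\<epsilon> \<Colon> X1 \<rightarrow> X1" unfolding \<epsilon>_def using s m by simp
  have em: "\<epsilon> \<cdot> m = nul X2 X1" unfolding \<epsilon>_def using s m by (simp add: Cmp_distrib)
  have "\<epsilon> \<cdot> \<epsilon> = \<epsilon> \<cdot> Idt T X1 \<boxminus> (\<epsilon> \<cdot> m) \<cdot> s" using ep s m by (subst (2) \<epsilon>_def) (simp add: Cmp_distrib)
  then have "\<epsilon> \<cdot> \<epsilon> = \<epsilon>" unfolding em using ep s m by simp
  then obtain X' t i where "X' \<in> Obj T" "t \<in> Arr T X1 X'" "i \<in> Arr T X' X1" and it: "i \<cdot> t = \<epsilon>" "t \<cdot> i = Idt T X'"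
    using split XO(2) ArrI[OF ep] unfolding split_idempotents_def by blast
  then have t: "t \<Colon> X1 \<rightarrow> X'" "i \<Colon> X' \<rightarrow> X1" using ArrD XO(2) by blast+
  have X': "X' \<in> X" by (rule X_summand[OF t(2,1) it(2) 2(1)])
  have "t \<cdot> m = (t \<cdot> i) \<cdot> (t \<cdot> m)" unfolding it(2) using t m by simp
  also have "\<dots> = t \<cdot> (\<epsilon> \<cdot> m)" unfolding it(1)[symmetric] using t m by simp
  finally have tm: "t \<cdot> m = nul X2 X'" unfolding em using t m by simp
  obtain Z0 where Z0: "Z0 \<in> Obj T" "is_zero_obj T Z0" using obtain_zero .
  have ZP: "res 0 Z0"
  proof -
    have "hom_null V Z0" for V unfolding hom_null_def using zero_obj_to[OF Z0(2)] by blast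
    then show ?thesis using Z0(1) Pp_iff by simp
  qed
  have n: "nul Z0 X' \<Colon> Z0 \<rightarrow> X'" using Z0 X' by simp
  have qi: "q \<cdot> i \<Colon> X' \<rightarrow> B" using t 2(3) by simp
  have "res (Suc 0) B"
  proof (rule res_SucI[OF X' n qi _ _ _ ZP])
    show "injX (nul Z0 X')"
    proof (rule injXI[OF n])
      fix V z assume "V \<in> X" "z \<Colon> V \<rightarrow> Z0"
      then show "z = nul V Z0" using zero_obj_to[OF Z0(2)] by blast
    qed
    show "exX (nul Z0 X') (q \<cdot> i)"
    proof (rule exXI[OF n qi])
      fix Z z assume z: "Z \<in> X" "z \<Colon> Z \<rightarrow> Z0"
      show "(q \<cdot> i) \<cdot> (nul Z0 X' \<cdot> z) = nul Z B" using z(2) n qi by simp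
    next
      fix Z z assume z: "Z \<in> X" "z \<Colon> Z \<rightarrow> X'" "(q \<cdot> i) \<cdot> z = nul Z B"
      have iz: "i \<cdot> z \<Colon> Z \<rightarrow> X1" "q \<cdot> (i \<cdot> z) = nul Z B" using z(2,3) t 2(3) by simp_all
      obtain y where y: "y \<Colon> Z \<rightarrow> X2" "m \<cdot> y = i \<cdot> z" using qker[OF z(1) iz] by blast
      have "z = t \<cdot> (i \<cdot> z)" using Cmp_eq_Cmp[OF it(2), of z] z(2) t by simp
      also have "\<dots> = nul Z X'" unfolding y(2)[symmetric] using Cmp_eq_Cmp[OF tm, of y] y(1) t m by simp
      finally show "\<exists>y. y \<Colon> Z \<rightarrow> Z0 \<and> nul Z0 X' \<cdot> y = z" using z(2) Z0 by (intro exI[of _ "nul Z Z0"]) simp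
    qed
    show "surjX (q \<cdot> i)"
    proof (rule surjXI[OF qi])
      fix Z z assume z: "Z \<in> X" "z \<Colon> Z \<rightarrow> B"
      obtain y where y: "y \<Colon> Z \<rightarrow> X1" "q \<cdot> y = z" using surjXD[OF 2(6,3) z] .
      have "q \<cdot> (\<epsilon> \<cdot> y) = q \<cdot> y \<boxminus> q \<cdot> (m \<cdot> (s \<cdot> y))" unfolding \<epsilon>_def using y(1) s m 2(3) by (simp add: Cmp_distrib)
      also have "q \<cdot> (m \<cdot> (s \<cdot> y)) = nul Z B" using Cmp_eq_Cmp[OF qm, of "s \<cdot> y"] y(1) s m 2(3) by simp
      also have "q \<cdot> y \<boxminus> nul Z B = z" unfolding y(2) using z(2) by simp
      finally have "(q \<cdot> i) \<cdot> (t \<cdot> y) = z" unfolding it(1)[symmetric] using y(1) t 2(3) by simp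
      then show "\<exists>y. y \<Colon> Z \<rightarrow> X' \<and> (q \<cdot> i) \<cdot> y = z" using y(1) t by (intro exI[of _ "t \<cdot> y"]) simp
    qed
  qed
  then show ?thesis by (rule res_SucI[OF 1(1-6)])
qed

text \<open>Shortening starts at the far end: by induction the syzygy \<open>B\<close> has a
  resolution with two terms, which gives one with three terms for \<open>A\<close>, and
  \<open>res_drop\<close> removes one of them.\<close>

lemma res_two:
  assumes "A \<in> Obj T" "res (Suc n) A"
  shows "res (Suc (Suc 0)) A"
  using assms
proof (induction n arbitrary: A)
  case 0
  then show ?case using res_mono by blast
next
  case (Suc n)
  obtain X0 B b p where *: "X0 \<in> X" "b \<Colon> B \<rightarrow> X0" "p \<Colon> X0 \<rightarrow> A" "injX b" "exX b p" "surjX p" "res (Suc n) B"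
    using res_SucE[OF Suc.prems(2,1)] .
  have "B \<in> Obj T" using *(2) by simp
  from Suc.IH[OF this *(7)] have "res (Suc (Suc (Suc 0))) A" by (rule res_SucI[OF *(1-6)])
  then show ?case by (rule res_drop[OF Suc.prems(1)])
qed

text \<open>Carries one step of a projective resolution from \<open>D\<close> to \<open>T\<close>:
  the projective is identified with some \<open>H X0\<close>, and a lift \<open>B\<close> of the
  kernel becomes the next syzygy. Equations between maps out of \<open>X\<close> hold exactly
  because \<open>H\<close> is faithful on them.\<close>

lemma kernel_res:
  assumes e: "epi D P F e" "e \<Colon>\<^sub>D P \<rightarrow> F" and P: "projective D P" and k: "is_kernel D I P F k e" and I: "I \<in> Obj D"
    and B: "B \<in> Obj T" "isomorphic D (fob H B) I" "res n B"
  shows "\<exists>A\<in>Obj T. isomorphic D (fob H A) F \<and> res (Suc n) A"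
proof -
  have O: "P \<in> Obj D" "F \<in> Obj D" using e by simp_all
  note K = H.D.kernelD[OF k I O]
  obtain A a a' where A: "A \<in> Obj T" "a \<Colon>\<^sub>D fob H A \<rightarrow> F" "a' \<Colon>\<^sub>D F \<rightarrow> fob H A"
    "a' \<cdot>\<^sub>D a = Idt D (fob H A)" "a \<cdot>\<^sub>D a' = Idt D F" using H_obj[OF O(2)] .
  obtain X0 where X0: "X0 \<in> X" "isomorphic D (fob H X0) P" using projective_in_X[OF P] by blast
  have X0O: "X0 \<in> Obj T" "fob H X0 \<in> Obj D" "fob H B \<in> Obj D" using X0 B by simp_all
  obtain c c' where c: "c \<Colon>\<^sub>D fob H X0 \<rightarrow> P" "c' \<Colon>\<^sub>D P \<rightarrow> fob H X0"
    "c' \<cdot>\<^sub>D c = Idt D (fob H X0)" "c \<cdot>\<^sub>D c' = Idt D P" using H.D.isomorphicE[OF X0(2) X0O(2) O(1)] .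
  obtain v v' where v: "v \<Colon>\<^sub>D fob H B \<rightarrow> I" "v' \<Colon>\<^sub>D I \<rightarrow> fob H B"
    "v' \<cdot>\<^sub>D v = Idt D (fob H B)" "v \<cdot>\<^sub>D v' = Idt D I" using H.D.isomorphicE[OF B(2) X0O(3) I] .
  have "a' \<cdot>\<^sub>D (e \<cdot>\<^sub>D c) \<Colon>\<^sub>D fob H X0 \<rightarrow> fob H A" using A(3) e(2) c(1) by simp
  then obtain p where p: "p \<Colon> X0 \<rightarrow> A" "far H p = a' \<cdot>\<^sub>D (e \<cdot>\<^sub>D c)" using H_lift[OF X0O(1) A(1)] by blast
  have "c' \<cdot>\<^sub>D (k \<cdot>\<^sub>D v) \<Colon>\<^sub>D fob H B \<rightarrow> fob H X0" using c(2) K(1) v(1) by simp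
  then obtain b where b: "b \<Colon> B \<rightarrow> X0" "far H b = c' \<cdot>\<^sub>D (k \<cdot>\<^sub>D v)" using H_lift[OF B(1) X0O(1)] by blast
  have sp: "surjX p" by (rule epi_surjX[OF p(1)]) (unfold p(2), rule H.D.epi_iso[OF e c(1,2,4) A(3,2,4)])
  have cb: "c \<cdot>\<^sub>D far H b = k \<cdot>\<^sub>D v" unfolding b(2) using c(1,2) K(1) v(1) by (simp add: H.D.Cmp_eq_Cmp[OF c(4)])
  have ap: "a \<cdot>\<^sub>D far H p = e \<cdot>\<^sub>D c" unfolding p(2) using A(2,3) e(2) c(1) by (simp add: H.D.Cmp_eq_Cmp[OF A(5)])
  have ib: "injX b"
  proof (rule injXI[OF b(1)])
    fix Z z assume z: "Z \<in> X" "z \<Colon> Z \<rightarrow> B" "b \<cdot> z = nul Z X0"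
    have ZO: "fob H Z \<in> Obj D" using z by simp
    have hz: "far H z \<Colon>\<^sub>D fob H Z \<rightarrow> fob H B" using z(2) by simp
    have bz0: "far H b \<cdot>\<^sub>D far H z = nul\<^sub>D (fob H Z) (fob H X0)"
      using H.far_Cmp[of z b] z b(1) by simp
    have "k \<cdot>\<^sub>D (v \<cdot>\<^sub>D far H z) = c \<cdot>\<^sub>D (far H b \<cdot>\<^sub>D far H z)"
      using H.D.Cmp_eq_Cmp[OF cb, of "far H z"] hz b(1) c(1) K(1) v(1) by simp
    also have "\<dots> = k \<cdot>\<^sub>D nul\<^sub>D (fob H Z) I" unfolding bz0 using c(1) ZO K(1) by simp
    finally have "v \<cdot>\<^sub>D far H z = nul\<^sub>D (fob H Z) I"
      by (rule K(5)[of "v \<cdot>\<^sub>D far H z" "fob H Z" "nul\<^sub>D (fob H Z) I", rotated 2]) (use hz v(1) ZO I in simp_all)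
    then have "v' \<cdot>\<^sub>D (v \<cdot>\<^sub>D far H z) = nul\<^sub>D (fob H Z) (fob H B)" using v(2) ZO by simp
    then have "far H z = far H (nul Z B)" using H.D.Cmp_eq_Cmp[OF v(3), of "far H z"] hz v(1,2) z(2) by simp
    then show "z = nul Z B" by (rule H_eq_X[of _ _ Z B]) (use z in simp_all)
  qed
  have ex: "exX b p"
  proof (rule exXI[OF b(1) p(1)])
    fix Z z assume z: "Z \<in> X" "z \<Colon> Z \<rightarrow> B"
    have "a \<cdot>\<^sub>D (far H p \<cdot>\<^sub>D far H b) = e \<cdot>\<^sub>D (k \<cdot>\<^sub>D v)"
      using H.D.Cmp_eq_Cmp[OF ap, of "far H b"] A(2) p(1) b(1) e(2) c(1) cb by simp
    also have "\<dots> = nul\<^sub>D (fob H B) F" using H.D.Cmp_eq_Cmp[OF K(3), of v] K(1,2) v(1) by simp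
    finally have "a' \<cdot>\<^sub>D (a \<cdot>\<^sub>D (far H p \<cdot>\<^sub>D far H b)) = nul\<^sub>D (fob H B) (fob H A)" using A(3) B(1) by simp
    then have "far H (p \<cdot> b) = nul\<^sub>D (fob H B) (fob H A)"
      using H.D.Cmp_eq_Cmp[OF A(4), of "far H p \<cdot>\<^sub>D far H b"] A(2,3) p(1) b(1) by simp
    moreover have pb: "p \<cdot> b \<Colon> B \<rightarrow> A" using p(1) b(1) by simp
    ultimately have "ghost (p \<cdot> b)" using H_nul_iff by blast
    from ghostD[OF this pb z] show "p \<cdot> (b \<cdot> z) = nul Z A" using p(1) b(1) z(2) by simp
  next
    fix Z z assume z: "Z \<in> X" "z \<Colon> Z \<rightarrow> X0" "p \<cdot> z = nul Z A"
    have ZO: "fob H Z \<in> Obj D" "Z \<in> Obj T" using z by simp_all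
    have hz: "far H z \<Colon>\<^sub>D fob H Z \<rightarrow> fob H X0" using z(2) by simp
    have 0: "far H p \<cdot>\<^sub>D far H z = nul\<^sub>D (fob H Z) (fob H A)" using H.far_Cmp[of z p] z p(1) by simp
    have cz: "c \<cdot>\<^sub>D far H z \<Colon>\<^sub>D fob H Z \<rightarrow> P" using c(1) hz by simp
    have "e \<cdot>\<^sub>D (c \<cdot>\<^sub>D far H z) = a \<cdot>\<^sub>D (far H p \<cdot>\<^sub>D far H z)"
      using H.D.Cmp_eq_Cmp[OF ap, of "far H z"] hz p(1) A(2) e(2) c(1) by simp
    also have "\<dots> = nul\<^sub>D (fob H Z) F" unfolding 0 using A(2) ZO by simp
    finally obtain g where g: "g \<Colon>\<^sub>D fob H Z \<rightarrow> I" "k \<cdot>\<^sub>D g = c \<cdot>\<^sub>D far H z" using K(4)[OF cz] by blast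
    have "v' \<cdot>\<^sub>D g \<Colon>\<^sub>D fob H Z \<rightarrow> fob H B" using v(2) g(1) by simp
    then obtain y where y: "y \<Colon> Z \<rightarrow> B" "far H y = v' \<cdot>\<^sub>D g" using H_lift[OF ZO(2) B(1)] by blast
    have "far H (b \<cdot> y) = c' \<cdot>\<^sub>D (k \<cdot>\<^sub>D (v \<cdot>\<^sub>D (v' \<cdot>\<^sub>D g)))"
      using H.far_Cmp[of y b] y b(1) unfolding b(2) y(2) using c(2) K(1) v(1,2) g(1) by simp
    also have "\<dots> = c' \<cdot>\<^sub>D (c \<cdot>\<^sub>D far H z)" using H.D.Cmp_eq_Cmp[OF v(4), of g] v(1,2) g by simp
    also have "\<dots> = far H z" using H.D.Cmp_eq_Cmp[OF c(3), of "far H z"] c(1,2) hz by simp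
    finally have "b \<cdot> y = z" by (rule H_eq_X[of _ _ Z X0]) (use y(1) b(1) z in simp_all)
    then show "\<exists>y. y \<Colon> Z \<rightarrow> B \<and> b \<cdot> y = z" using y(1) by blast
  qed
  have "res (Suc n) A" by (rule res_SucI[OF X0(1) b(1) p(1) ib ex sp B(3)])
  then show ?thesis using A(1) H.D.isomorphicI[OF A(2-5)] by blast
qed

text \<open>Here \<open>J\<close> is the image of \<open>d i\<close> and \<open>m\<close> counts the
  steps left before the resolution stops. At \<open>i = n\<close> the object \<open>J\<close> is a
  quotient of a zero object, so its lift lies in \<open>Pp\<close>; from there
  \<open>kernel_res\<close> goes back one step at a time.\<close>

lemma resolution_syzygy:
  assumes P: "\<forall>i. projective D (P i)" and z: "\<forall>i>n. is_zero_obj D (P i)"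
    and ex: "\<forall>i. exact_at D (P (Suc (Suc i))) (P (Suc i)) (P i) (d (Suc i)) (d i)"
  shows "i + m = n \<Longrightarrow> J \<in> Obj D \<Longrightarrow> epi D (P (Suc i)) J \<epsilon> \<Longrightarrow> is_kernel D J (P i) G \<iota> g \<Longrightarrow> G \<in> Obj D \<Longrightarrow>
    d i = \<iota> \<cdot>\<^sub>D \<epsilon> \<Longrightarrow> \<exists>A\<in>Obj T. isomorphic D (fob H A) J \<and> res m A"
proof (induction m arbitrary: i J \<epsilon> G \<iota> g)
  case 0
  have PO: "P j \<in> Obj D" for j using P unfolding projective_def by blast
  have e: "\<epsilon> \<Colon>\<^sub>D P (Suc i) \<rightarrow> J" using 0(3) H.D.ArrD[OF _ PO 0(2)] unfolding epi_def by blast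
  have "is_zero_obj D (P (Suc i))" using z 0(1) by simp
  then have e0: "\<epsilon> = nul\<^sub>D (P (Suc i)) J" using H.D.zero_obj_from[OF _ e] by blast
  have "Idt D J \<cdot>\<^sub>D \<epsilon> = nul\<^sub>D (P (Suc i)) J" unfolding e0 using PO 0(2) by simp
  from H.D.epiD[OF 0(3) e _ this] have idJ: "Idt D J = nul\<^sub>D J J" using 0(2) by simp
  obtain A a a' where A: "A \<in> Obj T" "a \<Colon>\<^sub>D fob H A \<rightarrow> J" "a' \<Colon>\<^sub>D J \<rightarrow> fob H A"
    "a' \<cdot>\<^sub>D a = Idt D (fob H A)" "a \<cdot>\<^sub>D a' = Idt D J" using H_obj[OF 0(2)] .
  have "Idt D (fob H A) = a' \<cdot>\<^sub>D (Idt D J \<cdot>\<^sub>D a)" using A by simp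
  also have "\<dots> = nul\<^sub>D (fob H A) (fob H A)" unfolding idJ using A(1,2,3) by simp
  finally have idA: "Idt D (fob H A) = nul\<^sub>D (fob H A) (fob H A)" .
  have "ghost (Idt T A)" using H_nul_iff[of "Idt T A" A A] idA A(1) by simp
  then have "z = nul Z A" if "Z \<in> X" "z \<Colon> Z \<rightarrow> A" for Z z
    using ghostD[of "Idt T A" A A Z z] that A(1) by simp
  then have "A \<in> Pp" unfolding Pp_iff hom_null_def using A(1) by blast
  then show ?case using A(1) H.D.isomorphicI[OF A(2-5)] by auto
next
  case (Suc m)
  have PO: "P j \<in> Obj D" for j using P unfolding projective_def by blast
  have e: "\<epsilon> \<Colon>\<^sub>D P (Suc i) \<rightarrow> J" using Suc.prems(3) H.D.ArrD[OF _ PO Suc.prems(2)] unfolding epi_def by blast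
  note K = H.D.kernelD[OF Suc.prems(4,2) PO Suc.prems(5)]
  have "exact_at D (P (Suc (Suc i))) (P (Suc i)) (P i) (d (Suc i)) (d i)" using ex by blast
  then obtain J' \<epsilon>' \<iota>' where J': "J' \<in> Obj D" "epi D (P (Suc (Suc i))) J' \<epsilon>'"
    "is_kernel D J' (P (Suc i)) (P i) \<iota>' (d i)" "d (Suc i) = \<iota>' \<cdot>\<^sub>D \<epsilon>'" unfolding exact_at_def by blast
  have "Suc i + m = n" using Suc.prems(1) by simp
  from Suc.IH[OF this J'(1,2,3) PO J'(4)] obtain A where A: "A \<in> Obj T" "isomorphic D (fob H A) J'" "res m A" by blast
  note K' = H.D.kernelD[OF J'(3,1) PO PO]
  have nulJ: "nul\<^sub>D E (P i) = \<iota> \<cdot>\<^sub>D nul\<^sub>D E J" if "E \<in> Obj D" for E using K(1) that by simp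
  have ei: "\<epsilon> \<cdot>\<^sub>D f = nul\<^sub>D E J" if f: "f \<Colon>\<^sub>D E \<rightarrow> P (Suc i)" "d i \<cdot>\<^sub>D f = nul\<^sub>D E (P i)" for f E
  proof (rule K(5)[of _ E])
    have EO: "E \<in> Obj D" using f by simp
    have "\<iota> \<cdot>\<^sub>D (\<epsilon> \<cdot>\<^sub>D f) = d i \<cdot>\<^sub>D f" unfolding Suc.prems(6) using f(1) e K(1) by simp
    also have "\<dots> = \<iota> \<cdot>\<^sub>D nul\<^sub>D E J" unfolding f(2) by (rule nulJ[OF EO])
    finally show "\<iota> \<cdot>\<^sub>D (\<epsilon> \<cdot>\<^sub>D f) = \<iota> \<cdot>\<^sub>D nul\<^sub>D E J" .
  qed (use f e Suc.prems(2) in simp_all)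
  \<comment> \<open>Since \<open>\<iota>\<close> is monic, a kernel of \<open>d i\<close> is also a
    kernel of its epimorphic part \<open>\<epsilon>\<close>.\<close>
  have "is_kernel D J' (P (Suc i)) J \<iota>' \<epsilon>"
  proof (rule H.D.is_kernelI[OF K'(1) e ei[OF K'(1,3)]])
    fix E f assume f: "f \<Colon>\<^sub>D E \<rightarrow> P (Suc i)" "\<epsilon> \<cdot>\<^sub>D f = nul\<^sub>D E J"
    have "d i \<cdot>\<^sub>D f = \<iota> \<cdot>\<^sub>D (\<epsilon> \<cdot>\<^sub>D f)" unfolding Suc.prems(6) using f(1) e K(1) by simp
    also have "\<dots> = nul\<^sub>D E (P i)" unfolding f(2) using f(1) K(1) by simp
    finally show "\<exists>g. g \<Colon>\<^sub>D E \<rightarrow> J' \<and> \<iota>' \<cdot>\<^sub>D g = f" by (rule K'(4)[OF f(1)])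
  qed (rule K'(5))
  from kernel_res[OF Suc.prems(3) e _ this J'(1) A] show ?case using P by blast
qed

section \<open>Two-term resolutions and normal forms\<close>

lemma exists_res:
  assumes F: "F \<in> Obj D"
  obtains A where "A \<in> Obj T" "isomorphic D (fob H A) F" "res (Suc (Suc 0)) A"
proof -
  obtain n where "has_projective_resolution D F n" using finite_res[OF F] by blast
  then obtain P d e where R: "\<forall>i. projective D (P i)" "\<forall>i>n. is_zero_obj D (P i)"
      "epi D (P 0) F e" "exact_at D (P 1) (P 0) F (d 0) e"
      "\<forall>i. exact_at D (P (Suc (Suc i))) (P (Suc i)) (P i) (d (Suc i)) (d i)"
    unfolding has_projective_resolution_def by blast
  have PO: "P j \<in> Obj D" for j using R(1) unfolding projective_def by blast
  have e: "e \<Colon>\<^sub>D P 0 \<rightarrow> F" using R(3) H.D.ArrD[OF _ PO F] unfolding epi_def by blast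
  obtain J \<epsilon> \<iota> where J: "J \<in> Obj D" "epi D (P (Suc 0)) J \<epsilon>" "is_kernel D J (P 0) F \<iota> e" "d 0 = \<iota> \<cdot>\<^sub>D \<epsilon>"
    using R(4) unfolding exact_at_def by auto
  obtain B where B: "B \<in> Obj T" "isomorphic D (fob H B) J" "res n B"
    using resolution_syzygy[OF R(1,2,5) _ J(1,2,3) F J(4), of n] by auto
  obtain A where "A \<in> Obj T" "isomorphic D (fob H A) F" "res (Suc n) A"
    using kernel_res[OF R(3) e _ J(3,1) B] R(1) by blast
  then show thesis using that res_two by blast
qed

text \<open>The inverse comes from a presentation of \<open>A\<close>: the approximation
  \<open>p\<close> lifts through \<open>g\<close> to \<open>k\<close>, injectivity of
  \<open>g\<close> makes \<open>k \<cdot> b\<close> vanish, and so \<open>k\<close> descends to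
  \<open>A\<close>. The two maps are inverse modulo ghosts.\<close>

lemma bijX_iso:
  assumes g: "g \<Colon> E \<rightarrow> A" and inj: "injX g" and sur: "surjX g"
  shows "isomorphic D (fob H E) (fob H A)"
proof -
  have O: "E \<in> Obj T" "A \<in> Obj T" using g by simp_all
  obtain X0 X1 b p d where P: "X0 \<in> X" "X1 \<in> X" "(X1, X0, A, b, p, d) \<in> Tri T" "surjX p" using presentation[OF O(2)] .
  note t = triD[OF P(3)]
  obtain k where k: "k \<Colon> X0 \<rightarrow> E" "g \<cdot> k = p" using surjXD[OF sur g P(1) t(2)] .
  have kb: "k \<cdot> b \<Colon> X1 \<rightarrow> E" using k t by simp
  have "g \<cdot> (k \<cdot> b) = nul X1 A" using Cmp_eq_Cmp[OF k(2), of b] k(1) g t tri_zero1[OF P(3)] by simp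
  from injXD[OF inj g P(2) kb this] obtain k' where k': "k' \<Colon> A \<rightarrow> E" "k' \<cdot> p = k" using tri_co1[OF P(3) k(1)] by blast
  have gk: "g \<cdot> k' \<Colon> A \<rightarrow> A" and kg: "k' \<cdot> g \<Colon> E \<rightarrow> E" using g k' by simp_all
  have *: "(g \<cdot> k') \<cdot> z = z" if z: "Z \<in> X" "z \<Colon> Z \<rightarrow> A" for Z z
  proof -
    obtain y where y: "y \<Colon> Z \<rightarrow> X0" "p \<cdot> y = z" using surjXD[OF P(4) t(2) z] .
    have "(g \<cdot> k') \<cdot> (p \<cdot> y) = g \<cdot> ((k' \<cdot> p) \<cdot> y)" using y(1) g k'(1) t by simp
    also have "\<dots> = p \<cdot> y" unfolding k'(2) using Cmp_eq_Cmp[OF k(2), of y] y(1) g k(1) by simp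
    finally show ?thesis unfolding y(2) .
  qed
  have idA: "Idt T A \<Colon> A \<rightarrow> A" and idE: "Idt T E \<Colon> E \<rightarrow> E" using O by simp_all
  have "far H (g \<cdot> k') = far H (Idt T A)"
  proof (rule H_eqI[OF gk idA])
    fix Z z assume z: "Z \<in> X" "z \<Colon> Z \<rightarrow> A"
    show "(g \<cdot> k') \<cdot> z = Idt T A \<cdot> z" using *[OF z] z(2) by simp
  qed
  moreover have "far H (k' \<cdot> g) = far H (Idt T E)"
  proof (rule H_eqI[OF kg idE])
    fix Z z assume z: "Z \<in> X" "z \<Colon> Z \<rightarrow> E"
    have gz: "g \<cdot> z \<Colon> Z \<rightarrow> A" and kgz: "(k' \<cdot> g) \<cdot> z \<Colon> Z \<rightarrow> E" using z(2) g k'(1) by simp_all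
    have "g \<cdot> ((k' \<cdot> g) \<cdot> z) = g \<cdot> z" using *[OF z(1) gz] z(2) g k'(1) by simp
    from injX_eq[OF inj g z(1) kgz z(2) this] show "(k' \<cdot> g) \<cdot> z = Idt T E \<cdot> z" using z(2) by simp
  qed
  ultimately show ?thesis using g k'(1) by (intro H.D.isomorphicI[of "far H g" _ _ "far H k'"]) simp_all
qed

text \<open>A two-term resolution contains a map \<open>b\<close> in \<open>X\<close> that
  \<open>H\<close> sends to a monomorphism, and \<open>E\<close> is its cone. Rigidity makes
  \<open>H c\<close> an epimorphism, and the induced map from \<open>E\<close> to \<open>A\<close>
  is bijective on maps out of \<open>X\<close>. That \<open>b\<close> is monic is what excludes
  summands of \<open>E\<close> in \<open>Pp\<close>.\<close>

lemma normal_form: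
  assumes F: "F \<in> Obj D"
  obtains E X0 X1 b c d where "E \<in> Tp" "isomorphic D (fob H E) F" "X0 \<in> X" "X1 \<in> X" "(X1, X0, E, b, c, d) \<in> Tri T"
    "injX b" "surjX c"
proof -
  obtain A where A: "A \<in> Obj T" "isomorphic D (fob H A) F" "res (Suc (Suc 0)) A" using exists_res[OF F] .
  obtain X0 B b0 p where 1: "X0 \<in> X" "b0 \<Colon> B \<rightarrow> X0" "p \<Colon> X0 \<rightarrow> A" "injX b0" "exX b0 p" "surjX p" "res (Suc 0) B"
    using res_SucE[OF A(3,1)] .
  have BO: "B \<in> Obj T" using 1(2) by simp
  obtain X1 B1 b1 q where 2: "X1 \<in> X" "b1 \<Colon> B1 \<rightarrow> X1" "q \<Colon> X1 \<rightarrow> B" "injX b1" "exX b1 q" "surjX q" "res 0 B1"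
    using res_SucE[OF 1(7) BO] .
  define b where "b = b0 \<cdot> q"
  have b: "b \<Colon> X1 \<rightarrow> X0" unfolding b_def using 1 2 by simp
  have binj: "injX b"
  proof (rule injXI[OF b])
    fix Z z assume z: "Z \<in> X" "z \<Colon> Z \<rightarrow> X1" "b \<cdot> z = nul Z X0"
    have qz: "q \<cdot> z \<Colon> Z \<rightarrow> B" using z(2) 2(3) by simp
    have "b0 \<cdot> (q \<cdot> z) = nul Z X0" using z(2,3) 1(2) 2(3) unfolding b_def by simp
    from injXD[OF 1(4,2) z(1) qz this] obtain y where y: "y \<Colon> Z \<rightarrow> B1" "b1 \<cdot> y = z" using exXD[OF 2(5,2,3) z(1,2)] by blast
    have "hom_null Z B1" using 2(7) Pp_iff z(1) by simp
    then have "y = nul Z B1" using hom_nullD y(1) by blast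
    then show "z = nul Z X1" unfolding y(2)[symmetric] using y(1) 2(2) by simp
  qed
  have pb: "p \<cdot> b = nul X1 A" using exX_zero[OF 1(5,2,3) 2(1,3)] unfolding b_def .
  obtain E c d where tr: "(X1, X0, E, b, c, d) \<in> Tri T" using tri_cone[OF b] .
  note t = triD[OF tr]
  have EO: "E \<in> Obj T" using t by simp
  have sc: "surjX c"
  proof (rule surjXI[OF t(2)])
    fix Z z assume z: "Z \<in> X" "z \<Colon> Z \<rightarrow> E"
    have "d \<cdot> z \<Colon> Z \<rightarrow> shob T X1" using z(2) t by simp
    from tri_ex2[OF tr z(2) X_null[OF z(1) 2(1) this]] show "\<exists>y. y \<Colon> Z \<rightarrow> X0 \<and> c \<cdot> y = z" by metis
  qed
  obtain g where g: "g \<Colon> E \<rightarrow> A" "g \<cdot> c = p" using tri_co1[OF tr 1(3) pb] .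
  have "surjX g"
  proof (rule surjXI[OF g(1)])
    fix Z z assume z: "Z \<in> X" "z \<Colon> Z \<rightarrow> A"
    obtain y where y: "y \<Colon> Z \<rightarrow> X0" "p \<cdot> y = z" using surjXD[OF 1(6,3) z] .
    have "g \<cdot> (c \<cdot> y) = z" using Cmp_eq_Cmp[OF g(2), of y] y g(1) t by simp
    then show "\<exists>y. y \<Colon> Z \<rightarrow> E \<and> g \<cdot> y = z" using y(1) t by (intro exI[of _ "c \<cdot> y"]) simp
  qed
  moreover have "injX g"
  proof (rule injXI[OF g(1)])
    fix Z z assume z: "Z \<in> X" "z \<Colon> Z \<rightarrow> E" "g \<cdot> z = nul Z A"
    obtain y where y: "y \<Colon> Z \<rightarrow> X0" "c \<cdot> y = z" using surjXD[OF sc t(2) z(1,2)] .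
    have "p \<cdot> y = g \<cdot> (c \<cdot> y)" using Cmp_eq_Cmp[OF g(2), of y] y(1) g(1) t by simp
    also have "\<dots> = nul Z A" unfolding y(2) z(3) ..
    finally obtain y1 where y1: "y1 \<Colon> Z \<rightarrow> B" "b0 \<cdot> y1 = y" using exXD[OF 1(5,2,3) z(1) y(1)] by blast
    obtain y2 where y2: "y2 \<Colon> Z \<rightarrow> X1" "q \<cdot> y2 = y1" using surjXD[OF 2(6,3) z(1) y1(1)] .
    have "b \<cdot> y2 = y" unfolding b_def using y2(1) 1(2) 2(3) unfolding y1(2)[symmetric] y2(2)[symmetric] by simp
    then have "c \<cdot> (b \<cdot> y2) = z" using y(2) by simp
    then show "z = nul Z E" using Cmp_eq_Cmp[OF tri_zero1[OF tr], of y2] y2(1) t by simp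
  qed
  ultimately have "isomorphic D (fob H E) (fob H A)" by (intro bijX_iso[OF g(1)])
  then have iso: "isomorphic D (fob H E) F" using H.D.isomorphic_trans[OF _ A(2)] EO A(1) F by simp
  have "E \<in> Tp"
  proof (rule TpI[OF EO])
    fix G i r assume *: "i \<Colon> G \<rightarrow> E" "r \<Colon> E \<rightarrow> G" "r \<cdot> i = Idt T G" "G \<in> Pp"
    have GO: "G \<in> Obj T" using *(1) by simp
    obtain V where V: "V \<in> X" "isomorphic T (shob T V) G" using Pp_shift[OF *(4)] .
    have sV: "V \<in> Obj T" "shob T V \<in> Obj T" using V(1) by simp_all
    obtain v v' where v: "v \<Colon> shob T V \<rightarrow> G" "v' \<Colon> G \<rightarrow> shob T V" "v' \<cdot> v = Idt T (shob T V)" "v \<cdot> v' = Idt T G"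
      using isomorphicE[OF V(2) sV(2) GO] .
    \<comment> \<open>A summand in \<open>Pp\<close> has the form V[1] with \<open>V\<close> in
      \<open>X\<close>. Its map to X1[1] is the shift of a map \<open>k\<close> that
      \<open>b\<close> annihilates, so it is zero because \<open>b\<close> is monic.\<close>
    have "d \<cdot> (i \<cdot> v) \<Colon> shob T V \<rightarrow> shob T X1" using t * v by simp
    then obtain k where k: "k \<Colon> V \<rightarrow> X1" "shar T k = d \<cdot> (i \<cdot> v)" using shift_lift[OF sV(1) X_Obj[OF 2(1)]] by blast
    have "shar T b \<cdot> shar T k = nul (shob T V) (shob T X0)"
      unfolding k(2) using Cmp_eq_Cmp[OF tri_zero3[OF tr], of "i \<cdot> v"] t * v by simp
    then have "b \<cdot> k = nul V X0" using k(1) b by (intro shift_eq_nul[of "b \<cdot> k" V X0]) simp_all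
    from injXD[OF binj b V(1) k(1) this] have "d \<cdot> (i \<cdot> v) = nul (shob T V) (shob T X1)" unfolding k(2)[symmetric] using k(1) by simp
    then have "(d \<cdot> (i \<cdot> v)) \<cdot> v' = nul G (shob T X1)" using v t by simp
    then have di: "d \<cdot> i = nul G (shob T X1)" using t *(1) v by simp
    \<comment> \<open>The projection \<open>r\<close> vanishes on \<open>X0\<close>, so it factors
      through \<open>d\<close>. As \<open>d \<cdot> i\<close> is zero, so is
      \<open>r \<cdot> i\<close>, the identity of \<open>G\<close>.\<close>
    have "hom_null X0 G" using *(4) Pp_iff 1(1) by blast
    moreover have "r \<cdot> c \<Colon> X0 \<rightarrow> G" using *(2) t by simp
    ultimately have "r \<cdot> c = nul X0 G" using hom_nullD by blast
    from tri_co2[OF tr *(2) this] obtain r' where r': "r' \<Colon> shob T X1 \<rightarrow> G" "r' \<cdot> d = r" .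
    have "Idt T G = r' \<cdot> (d \<cdot> i)" using Cmp_eq_Cmp[OF r'(2), of i] *(1,2,3) r'(1) t by simp
    then show "Idt T G = nul G G" unfolding di using r'(1) GO by simp
  qed
  then show thesis using that iso 1(1) 2(1) tr binj sc by blast
qed

text \<open>By \<open>Tp_reflect\<close> an object of \<open>Tp\<close> is isomorphic to the normal
  form of its own image, and the triangle is transported along this isomorphism.\<close>

lemma Tp_presentation:
  assumes Y: "Y \<in> Tp"
  obtains X0 X1 b p d where "X0 \<in> X" "X1 \<in> X" "(X1, X0, Y, b, p, d) \<in> Tri T" "injX b" "surjX p"
proof -
  have YO: "Y \<in> Obj T" using Y by simp
  then have "fob H Y \<in> Obj D" by simp
  from normal_form[OF this] obtain E X0 X1 b c d where E: "E \<in> Tp" "isomorphic D (fob H E) (fob H Y)" and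
    X: "X0 \<in> X" "X1 \<in> X" and tr: "(X1, X0, E, b, c, d) \<in> Tri T" and b: "injX b" and c: "surjX c" .
  note t = triD[OF tr]
  have EO: "E \<in> Obj T" using t by simp
  obtain u v where u: "u \<Colon> E \<rightarrow> Y" "v \<Colon> Y \<rightarrow> E" "v \<cdot> u = Idt T E" "u \<cdot> v = Idt T Y"
    using isomorphicE[OF Tp_reflect[OF E(1) Y E(2)] EO YO] .
  have iso_id: "is_iso T Q Q (Idt T Q)" if "Q \<in> Obj T" for Q
    by (rule is_isoI[of _ _ _ "Idt T Q"]) (use that in simp_all)
  have tr': "(X1, X0, Y, b, u \<cdot> c, d \<cdot> v) \<in> Tri T"
  proof (rule TR1_iso[OF tr _ iso_id iso_id is_isoI[OF u]])
    show "(X1, X0, Y, b, u \<cdot> c, d \<cdot> v) \<in> candidate_triangles T" using u t by (intro candI) simp_all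
  qed (use u t in simp_all)
  have uc: "u \<cdot> c \<Colon> X0 \<rightarrow> Y" using u t by simp
  have "surjX (u \<cdot> c)"
  proof (rule surjXI[OF uc])
    fix Z z assume z: "Z \<in> X" "z \<Colon> Z \<rightarrow> Y"
    have "v \<cdot> z \<Colon> Z \<rightarrow> E" using z(2) u by simp
    then obtain y where y: "y \<Colon> Z \<rightarrow> X0" "c \<cdot> y = v \<cdot> z" using surjXD[OF c t(2) z(1)] by blast
    have "(u \<cdot> c) \<cdot> y = u \<cdot> (v \<cdot> z)" unfolding y(2)[symmetric] using u t y(1) by simp
    also have "\<dots> = z" using Cmp_eq_Cmp[OF u(4), of z] u z(2) by simp
    finally show "\<exists>y. y \<Colon> Z \<rightarrow> X0 \<and> (u \<cdot> c) \<cdot> y = z" using y(1) by blast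
  qed
  then show thesis using that X tr' b by blast
qed

end

section \<open>The correspondence\<close>

context ct_setting begin

text \<open>By \<open>ghost_factor\<close>, \<open>factor_ghost\<close> and fullness of the shift,
  the composites in question are exactly the ghosts from \<open>Y\<close> to A[1]. Their vanishing
  is the form that the vanishing of Ext^1(H Y, H A) takes in \<open>T\<close>.\<close>

definition gh0 :: "'o \<Rightarrow> 'o \<Rightarrow> bool"
  where "gh0 Y A \<longleftrightarrow> (\<forall>Z\<in>X. \<forall>u\<in>Arr T Y (shob T Z). \<forall>v\<in>Arr T Z A. shar T v \<cdot> u = nul Y (shob T A))"

lemma gh0D: "gh0 Y A \<Longrightarrow> Z \<in> X \<Longrightarrow> u \<Colon> Y \<rightarrow> shob T Z \<Longrightarrow> v \<Colon> Z \<rightarrow> A \<Longrightarrow> shar T v \<cdot> u = nul Y (shob T A)"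
  unfolding gh0_def using ArrI[of u Y "shob T Z"] ArrI[of v Z A] by blast

lemma gh0I:
  assumes "Y \<in> Obj T" "A \<in> Obj T"
    and "\<And>Z u v. Z \<in> X \<Longrightarrow> u \<Colon> Y \<rightarrow> shob T Z \<Longrightarrow> v \<Colon> Z \<rightarrow> A \<Longrightarrow> shar T v \<cdot> u = nul Y (shob T A)"
  shows "gh0 Y A"
  unfolding gh0_def
proof (intro ballI)
  fix Z u v assume Z: "Z \<in> X" and u: "u \<in> Arr T Y (shob T Z)" and v: "v \<in> Arr T Z A"
  have ZO: "Z \<in> Obj T" "shob T Z \<in> Obj T" using Z by simp_all
  show "shar T v \<cdot> u = nul Y (shob T A)" by (rule assms(3)[OF Z ArrD[OF u assms(1) ZO(2)] ArrD[OF v ZO(1) assms(2)]])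
qed

text \<open>In \<open>T\<close> the map \<open>p\<close> is only a weak cokernel of
  \<open>b\<close>. A lift of \<open>f\<close> annihilates \<open>b\<close> exactly, and not just
  modulo ghosts, because \<open>X1\<close> lies in \<open>X\<close>; hence it descends to
  \<open>Y\<close>.\<close>

lemma H_cokernel:
  assumes P: "X0 \<in> X" "X1 \<in> X" "(X1, X0, Y, b, p, d) \<in> Tri T" "surjX p"
    and f: "f \<Colon>\<^sub>D fob H X0 \<rightarrow> E" "f \<cdot>\<^sub>D far H b = nul\<^sub>D (fob H X1) E"
  obtains g where "g \<Colon>\<^sub>D fob H Y \<rightarrow> E" "g \<cdot>\<^sub>D far H p = f"
proof -
  note t = triD[OF P(3)]
  have EO: "E \<in> Obj D" using f by simp
  obtain W w w' where W: "W \<in> Obj T" "w \<Colon>\<^sub>D fob H W \<rightarrow> E" "w' \<Colon>\<^sub>D E \<rightarrow> fob H W"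
    "w' \<cdot>\<^sub>D w = Idt D (fob H W)" "w \<cdot>\<^sub>D w' = Idt D E" using H_obj[OF EO] .
  have XO: "X0 \<in> Obj T" "X1 \<in> Obj T" using P by simp_all
  have "w' \<cdot>\<^sub>D f \<Colon>\<^sub>D fob H X0 \<rightarrow> fob H W" using W f by simp
  then obtain m where m: "m \<Colon> X0 \<rightarrow> W" "far H m = w' \<cdot>\<^sub>D f" using H_lift[OF XO(1) W(1)] by blast
  have "far H (m \<cdot> b) = w' \<cdot>\<^sub>D (f \<cdot>\<^sub>D far H b)" using m t W(3) f(1) by simp
  also have "\<dots> = far H (nul X1 W)" unfolding f(2) using W XO by simp
  finally have "m \<cdot> b = nul X1 W" by (rule H_eq_X[of _ _ X1 W]) (use m(1) t W XO P(2) in simp_all)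
  from tri_co1[OF P(3) m(1) this] obtain n where n: "n \<Colon> Y \<rightarrow> W" "n \<cdot> p = m" .
  have "far H n \<cdot>\<^sub>D far H p = w' \<cdot>\<^sub>D f" using H.far_Cmp[of p n] n t m(2) by simp
  then have "w \<cdot>\<^sub>D (far H n \<cdot>\<^sub>D far H p) = f" using H.D.Cmp_eq_Cmp[OF W(5), of f] W(2,3) f(1) by simp
  then show thesis using that[of "w \<cdot>\<^sub>D far H n"] W(2) n(1) t by simp
qed

text \<open>Lifting \<open>H p\<close> through \<open>q\<close> and restricting along
  \<open>H b\<close> gives a map \<open>a\<close> from \<open>X1\<close> to \<open>A\<close> that
  represents the extension. The hypothesis annihilates the composite of its shift with the
  connecting map, so \<open>a\<close> extends to \<open>X0\<close>; subtracting this extension from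
  the lift makes it descend to a section of \<open>q\<close>.\<close>

lemma gh0_ext_split:
  assumes Y: "Y \<in> Obj T" and A: "A \<in> Obj T" and g: "gh0 Y A"
  shows "H.D.ext_split (fob H Y) (fob H A)"
  unfolding H.D.ext_split_def
proof (intro ballI allI impI)
  fix E i q assume E: "E \<in> Obj D" and se: "short_exact D (fob H A) E (fob H Y) i q"
  have O: "fob H A \<in> Obj D" "fob H Y \<in> Obj D" using A Y by simp_all
  have k: "is_kernel D (fob H A) E (fob H Y) i q" "is_cokernel D (fob H A) E (fob H Y) i q"
    using se unfolding short_exact_def by simp_all
  note K = H.D.kernelD[OF k(1) O(1) E O(2)] and ep = H.D.cokernelD(2)[OF k(2) O(1) E O(2)]
  obtain X0 X1 b p d where P: "X0 \<in> X" "X1 \<in> X" "(X1, X0, Y, b, p, d) \<in> Tri T" "surjX p" using presentation[OF Y] .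
  note t = triD[OF P(3)]
  have XO: "X0 \<in> Obj T" "X1 \<in> Obj T" using P by simp_all
  have hp: "far H p \<Colon>\<^sub>D fob H X0 \<rightarrow> fob H Y" and hb: "far H b \<Colon>\<^sub>D fob H X1 \<rightarrow> fob H X0" using t by simp_all
  have pb: "far H p \<cdot>\<^sub>D far H b = nul\<^sub>D (fob H X1) (fob H Y)"
    using H.far_Cmp[of b p] t tri_zero1[OF P(3)] by simp
  obtain l where l: "l \<Colon>\<^sub>D fob H X0 \<rightarrow> E" "q \<cdot>\<^sub>D l = far H p" using projective_lift[OF ep K(2) P(1) hp] .
  have lb: "l \<cdot>\<^sub>D far H b \<Colon>\<^sub>D fob H X1 \<rightarrow> E" using l(1) hb by simp
  have "q \<cdot>\<^sub>D (l \<cdot>\<^sub>D far H b) = nul\<^sub>D (fob H X1) (fob H Y)"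
    using H.D.Cmp_eq_Cmp[OF l(2), of "far H b"] l(1) hb K(2) pb by simp
  then obtain \<alpha> where al: "\<alpha> \<Colon>\<^sub>D fob H X1 \<rightarrow> fob H A" "i \<cdot>\<^sub>D \<alpha> = l \<cdot>\<^sub>D far H b" using K(4)[OF lb] by blast
  obtain a where a: "a \<Colon> X1 \<rightarrow> A" "far H a = \<alpha>" using H_lift[OF XO(2) A al(1)] .
  have "shar T a \<cdot> d = nul Y (shob T A)" by (rule gh0D[OF g P(2) t(3) a(1)])
  from tri_co3[OF P(3) a(1) this] obtain a' where a': "a' \<Colon> X0 \<rightarrow> A" "a' \<cdot> b = a" .
  have ia: "i \<cdot>\<^sub>D far H a' \<Colon>\<^sub>D fob H X0 \<rightarrow> E" using K(1) a'(1) by simp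
  define l' where "l' = l \<boxminus>\<^sub>D i \<cdot>\<^sub>D far H a'"
  have l': "l' \<Colon>\<^sub>D fob H X0 \<rightarrow> E" unfolding l'_def using l(1) ia by simp
  have "far H a' \<cdot>\<^sub>D far H b = \<alpha>" using H.far_Cmp[of b a'] a' t a(2) by simp
  then have "l' \<cdot>\<^sub>D far H b = l \<cdot>\<^sub>D far H b \<boxminus>\<^sub>D i \<cdot>\<^sub>D \<alpha>"
    unfolding l'_def using l(1) ia hb K(1) a'(1) by (simp add: H.D.Cmp_distrib)
  also have "\<dots> = nul\<^sub>D (fob H X1) E" unfolding al(2) using lb by simp
  finally obtain s where s: "s \<Colon>\<^sub>D fob H Y \<rightarrow> E" "s \<cdot>\<^sub>D far H p = l'" using H_cokernel[OF P l'] by blast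
  have qs: "q \<cdot>\<^sub>D s \<Colon>\<^sub>D fob H Y \<rightarrow> fob H Y" "Idt D (fob H Y) \<Colon>\<^sub>D fob H Y \<rightarrow> fob H Y" using s(1) K(2) O by simp_all
  have "(q \<cdot>\<^sub>D s) \<cdot>\<^sub>D far H p = q \<cdot>\<^sub>D l'" using s hp K(2) by simp
  also have "\<dots> = q \<cdot>\<^sub>D l \<boxminus>\<^sub>D q \<cdot>\<^sub>D (i \<cdot>\<^sub>D far H a')" unfolding l'_def using K(2) l(1) ia by (simp add: H.D.Cmp_distrib)
  also have "\<dots> = Idt D (fob H Y) \<cdot>\<^sub>D far H p"
    unfolding l(2) using H.D.Cmp_eq_Cmp[OF K(3), of "far H a'"] K(1,2) a'(1) hp Y by simp
  finally have "q \<cdot>\<^sub>D s = Idt D (fob H Y)" by (rule H.D.epi_cancel[OF surjX_epi[OF t(2) P(4)] qs])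
  then show "\<exists>s\<in>Arr D (fob H Y) E. q \<cdot>\<^sub>D s = Idt D (fob H Y)" using H.D.ArrI[OF s(1)] by blast
qed

text \<open>Both factorizations are built on a presentation of the object at which they start. On
  its terms, which lie in \<open>X\<close>, the hypotheses provide lifts, and these descend along
  the presentation triangle; the result is correct modulo ghosts, which is all that \<open>D\<close>
  sees.\<close>

lemma short_exact_H:
  assumes i: "i \<Colon> A \<rightarrow> E" and q: "q \<Colon> E \<rightarrow> Y" and inj: "injX i" and ex: "exX i q" and sur: "surjX q"
  shows "short_exact D (fob H A) (fob H E) (fob H Y) (far H i) (far H q)"
  unfolding short_exact_def
proof
  have O: "A \<in> Obj T" "E \<in> Obj T" "Y \<in> Obj T" using i q by simp_all
  have hi: "far H i \<Colon>\<^sub>D fob H A \<rightarrow> fob H E" and hq: "far H q \<Colon>\<^sub>D fob H E \<rightarrow> fob H Y" using i q by simp_all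
  have qi: "q \<cdot> i \<Colon> A \<rightarrow> Y" using i q by simp
  have "ghost (q \<cdot> i)" using ex unfolding exX_def by blast
  then have z: "far H q \<cdot>\<^sub>D far H i = nul\<^sub>D (fob H A) (fob H Y)" using H_nul_iff[OF qi] i q by simp
  show "is_kernel D (fob H A) (fob H E) (fob H Y) (far H i) (far H q)"
  proof (rule H.D.is_kernelI[OF hi hq z])
    fix F f assume f: "f \<Colon>\<^sub>D F \<rightarrow> fob H E" "far H q \<cdot>\<^sub>D f = nul\<^sub>D F (fob H Y)"
    obtain W w w' where W: "W \<in> Obj T" "w \<Colon>\<^sub>D fob H W \<rightarrow> F" "w' \<Colon>\<^sub>D F \<rightarrow> fob H W"
      "w' \<cdot>\<^sub>D w = Idt D (fob H W)" "w \<cdot>\<^sub>D w' = Idt D F" using H_obj[of F] f by blast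
    have "f \<cdot>\<^sub>D w \<Colon>\<^sub>D fob H W \<rightarrow> fob H E" using f W by simp
    then obtain m where m: "m \<Colon> W \<rightarrow> E" "far H m = f \<cdot>\<^sub>D w" using H_lift[OF W(1) O(2)] by blast
    have qm: "q \<cdot> m \<Colon> W \<rightarrow> Y" using q m by simp
    have "far H (q \<cdot> m) = (far H q \<cdot>\<^sub>D f) \<cdot>\<^sub>D w" using q m f(1) W(2) by simp
    also have "\<dots> = nul\<^sub>D (fob H W) (fob H Y)" unfolding f(2) using W(2) O by simp
    finally have gqm: "ghost (q \<cdot> m)" using H_nul_iff[OF qm] by simp
    obtain X0 X1 b p d where P: "X0 \<in> X" "X1 \<in> X" "(X1, X0, W, b, p, d) \<in> Tri T" "surjX p" using presentation[OF W(1)] .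
    note t = triD[OF P(3)]
    have mp: "m \<cdot> p \<Colon> X0 \<rightarrow> E" using m t by simp
    have "q \<cdot> (m \<cdot> p) = nul X0 Y" using ghostD[OF gqm qm P(1) t(2)] q m(1) t by simp
    from exXD[OF ex i q P(1) mp this] obtain k where k: "k \<Colon> X0 \<rightarrow> A" "i \<cdot> k = m \<cdot> p" .
    have kb: "k \<cdot> b \<Colon> X1 \<rightarrow> A" using k t by simp
    have "i \<cdot> (k \<cdot> b) = m \<cdot> (p \<cdot> b)" using Cmp_eq_Cmp[OF k(2), of b] k(1) i m(1) t by simp
    also have "\<dots> = nul X1 E" unfolding tri_zero1[OF P(3)] using m(1) t by simp
    finally have "k \<cdot> b = nul X1 A" by (rule injXD[OF inj i P(2) kb])
    from tri_co1[OF P(3) k(1) this] obtain n where n: "n \<Colon> W \<rightarrow> A" "n \<cdot> p = k" .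
    have in_t: "i \<cdot> n \<Colon> W \<rightarrow> E" using i n by simp
    have "far H (i \<cdot> n) = far H m"
    proof (rule H_eqI[OF in_t m(1)])
      fix Z z assume zz: "Z \<in> X" "z \<Colon> Z \<rightarrow> W"
      obtain y where y: "y \<Colon> Z \<rightarrow> X0" "p \<cdot> y = z" using surjXD[OF P(4) t(2) zz] .
      have "(i \<cdot> n) \<cdot> (p \<cdot> y) = i \<cdot> ((n \<cdot> p) \<cdot> y)" using y(1) i n(1) t by simp
      also have "\<dots> = m \<cdot> (p \<cdot> y)" unfolding n(2) using Cmp_eq_Cmp[OF k(2), of y] y(1) i k(1) m(1) t by simp
      finally show "(i \<cdot> n) \<cdot> z = m \<cdot> z" unfolding y(2) .
    qed
    then have "far H i \<cdot>\<^sub>D far H n = f \<cdot>\<^sub>D w" using i n(1) m(2) by simp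
    then have "far H i \<cdot>\<^sub>D (far H n \<cdot>\<^sub>D w') = f"
      using H.D.Cmp_eq_Cmp[of "far H i" "far H n" "f \<cdot>\<^sub>D w" w'] i n(1) W(2,3,5) f(1) by simp
    then show "\<exists>g. g \<Colon>\<^sub>D F \<rightarrow> fob H A \<and> far H i \<cdot>\<^sub>D g = f"
      using n(1) W(3) by (intro exI[of _ "far H n \<cdot>\<^sub>D w'"]) simp
  next
    fix F g g' assume g: "g \<Colon>\<^sub>D F \<rightarrow> fob H A" "g' \<Colon>\<^sub>D F \<rightarrow> fob H A" "far H i \<cdot>\<^sub>D g = far H i \<cdot>\<^sub>D g'"
    obtain W w w' where W: "W \<in> Obj T" "w \<Colon>\<^sub>D fob H W \<rightarrow> F" "w' \<Colon>\<^sub>D F \<rightarrow> fob H W"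
      "w' \<cdot>\<^sub>D w = Idt D (fob H W)" "w \<cdot>\<^sub>D w' = Idt D F" using H_obj[of F] g by blast
    have "g \<cdot>\<^sub>D w \<Colon>\<^sub>D fob H W \<rightarrow> fob H A" "g' \<cdot>\<^sub>D w \<Colon>\<^sub>D fob H W \<rightarrow> fob H A" using g W by simp_all
    then obtain m m' where m: "m \<Colon> W \<rightarrow> A" "far H m = g \<cdot>\<^sub>D w" and m': "m' \<Colon> W \<rightarrow> A" "far H m' = g' \<cdot>\<^sub>D w"
      using H_lift[OF W(1) O(1)] by metis
    have "far H (i \<cdot> m) = (far H i \<cdot>\<^sub>D g) \<cdot>\<^sub>D w" using i m g(1) W(2) by simp
    also have "\<dots> = far H (i \<cdot> m')" unfolding g(3) using i m' g(2) W(2) by simp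
    finally have e: "far H (i \<cdot> m) = far H (i \<cdot> m')" .
    have it: "i \<cdot> m \<Colon> W \<rightarrow> E" "i \<cdot> m' \<Colon> W \<rightarrow> E" using i m m' by simp_all
    have "far H m = far H m'"
    proof (rule H_eqI[OF m(1) m'(1)])
      fix Z z assume zz: "Z \<in> X" "z \<Colon> Z \<rightarrow> W"
      have mz: "m \<cdot> z \<Colon> Z \<rightarrow> A" "m' \<cdot> z \<Colon> Z \<rightarrow> A" using m(1) m'(1) zz by simp_all
      have "i \<cdot> (m \<cdot> z) = i \<cdot> (m' \<cdot> z)" using H_eqD[OF e it zz] i m(1) m'(1) zz by simp
      then show "m \<cdot> z = m' \<cdot> z" by (rule injX_eq[OF inj i zz(1) mz])
    qed
    then have "(g \<cdot>\<^sub>D w) \<cdot>\<^sub>D w' = (g' \<cdot>\<^sub>D w) \<cdot>\<^sub>D w'" unfolding m(2) m'(2) by simp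
    moreover have "(g \<cdot>\<^sub>D w) \<cdot>\<^sub>D w' = g" "(g' \<cdot>\<^sub>D w) \<cdot>\<^sub>D w' = g'" using g(1,2) W(2,3,5) by simp_all
    ultimately show "g = g'" by metis
  qed
  show "is_cokernel D (fob H A) (fob H E) (fob H Y) (far H i) (far H q)"
  proof (rule H.D.is_cokernelI[OF hi hq z])
    fix F f assume f: "f \<Colon>\<^sub>D fob H E \<rightarrow> F" "f \<cdot>\<^sub>D far H i = nul\<^sub>D (fob H A) F"
    obtain W w w' where W: "W \<in> Obj T" "w \<Colon>\<^sub>D fob H W \<rightarrow> F" "w' \<Colon>\<^sub>D F \<rightarrow> fob H W"
      "w' \<cdot>\<^sub>D w = Idt D (fob H W)" "w \<cdot>\<^sub>D w' = Idt D F" using H_obj[of F] f by blast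
    have "w' \<cdot>\<^sub>D f \<Colon>\<^sub>D fob H E \<rightarrow> fob H W" using f W by simp
    then obtain m where m: "m \<Colon> E \<rightarrow> W" "far H m = w' \<cdot>\<^sub>D f" using H_lift[OF O(2) W(1)] by blast
    have mi: "m \<cdot> i \<Colon> A \<rightarrow> W" using i m by simp
    have "far H (m \<cdot> i) = w' \<cdot>\<^sub>D (f \<cdot>\<^sub>D far H i)" using i m f(1) W(3) by simp
    also have "\<dots> = nul\<^sub>D (fob H A) (fob H W)" unfolding f(2) using W(3) O by simp
    finally have gmi: "ghost (m \<cdot> i)" using H_nul_iff[OF mi] by simp
    have mi0: "m \<cdot> (i \<cdot> x) = nul Z W" if "Z \<in> X" "x \<Colon> Z \<rightarrow> A" for Z x
      using ghostD[OF gmi mi that] m(1) i that(2) by simp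
    obtain X0 X1 b p d where P: "X0 \<in> X" "X1 \<in> X" "(X1, X0, Y, b, p, d) \<in> Tri T" "surjX p" using presentation[OF O(3)] .
    note t = triD[OF P(3)]
    obtain k where k: "k \<Colon> X0 \<rightarrow> E" "q \<cdot> k = p" using surjXD[OF sur q P(1) t(2)] .
    have kb: "k \<cdot> b \<Colon> X1 \<rightarrow> E" using k t by simp
    have "q \<cdot> (k \<cdot> b) = nul X1 Y" using Cmp_eq_Cmp[OF k(2), of b] k(1) q t tri_zero1[OF P(3)] by simp
    from exXD[OF ex i q P(2) kb this] obtain k2 where k2: "k2 \<Colon> X1 \<rightarrow> A" "i \<cdot> k2 = k \<cdot> b" .
    have mk: "m \<cdot> k \<Colon> X0 \<rightarrow> W" using m k by simp
    have "(m \<cdot> k) \<cdot> b = m \<cdot> (i \<cdot> k2)" unfolding k2(2) using m(1) k(1) t by simp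
    also have "\<dots> = nul X1 W" by (rule mi0[OF P(2) k2(1)])
    finally obtain g where g: "g \<Colon> Y \<rightarrow> W" "g \<cdot> p = m \<cdot> k" using tri_co1[OF P(3) mk] by blast
    have gq: "g \<cdot> q \<Colon> E \<rightarrow> W" using g q by simp
    have "far H (g \<cdot> q) = far H m"
    proof (rule H_eqI[OF gq m(1)])
      fix Z z assume zz: "Z \<in> X" "z \<Colon> Z \<rightarrow> E"
      have qz: "q \<cdot> z \<Colon> Z \<rightarrow> Y" using q zz by simp
      obtain y where y: "y \<Colon> Z \<rightarrow> X0" "p \<cdot> y = q \<cdot> z" using surjXD[OF P(4) t(2) zz(1) qz] .
      have ky: "k \<cdot> y \<Colon> Z \<rightarrow> E" using k y by simp
      have dz: "z \<boxminus> k \<cdot> y \<Colon> Z \<rightarrow> E" using zz ky by simp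
      have "q \<cdot> (z \<boxminus> k \<cdot> y) = q \<cdot> z \<boxminus> p \<cdot> y" using Cmp_eq_Cmp[OF k(2), of y] q zz ky k(1) y(1) by (simp add: Cmp_distrib)
      also have "\<dots> = nul Z Y" unfolding y(2) using qz by simp
      finally obtain x where x: "x \<Colon> Z \<rightarrow> A" "i \<cdot> x = z \<boxminus> k \<cdot> y" using exXD[OF ex i q zz(1) dz] by blast
      have "m \<cdot> z \<boxminus> m \<cdot> (k \<cdot> y) = m \<cdot> (i \<cdot> x)" unfolding x(2) using m(1) zz ky by (simp add: Cmp_distrib)
      also have "\<dots> = nul Z W" by (rule mi0[OF zz(1) x(1)])
      finally have "m \<cdot> z = m \<cdot> (k \<cdot> y)" using minus_eq_nul[of "m \<cdot> z" Z W "m \<cdot> (k \<cdot> y)"] m(1) zz ky by simp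
      also have "\<dots> = g \<cdot> (p \<cdot> y)" using Cmp_eq_Cmp[OF g(2), of y] g(1) t y(1) m(1) k(1) by simp
      finally show "(g \<cdot> q) \<cdot> z = m \<cdot> z" unfolding y(2) using g(1) q zz by simp
    qed
    then have "far H g \<cdot>\<^sub>D far H q = w' \<cdot>\<^sub>D f" using g(1) q m(2) by simp
    then have "(w \<cdot>\<^sub>D far H g) \<cdot>\<^sub>D far H q = f"
      using H.D.Cmp_eq_Cmp[OF W(5), of f] g(1) q W(2,3) f(1) by simp
    then show "\<exists>g. g \<Colon>\<^sub>D fob H Y \<rightarrow> F \<and> g \<cdot>\<^sub>D far H q = f"
      using g(1) W(2) by (intro exI[of _ "w \<cdot>\<^sub>D far H g"]) simp
  next
    fix F g g' assume g: "g \<Colon>\<^sub>D fob H Y \<rightarrow> F" "g' \<Colon>\<^sub>D fob H Y \<rightarrow> F" "g \<cdot>\<^sub>D far H q = g' \<cdot>\<^sub>D far H q"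
    show "g = g'" by (rule H.D.epi_cancel[OF surjX_epi[OF q sur] g])
  qed
qed

text \<open>The map \<open>v[1] u\<close> is the connecting map of a triangle that \<open>H\<close> turns into a short exact sequence.\<close>

lemma ext_split_gh0:
  assumes Y: "Y \<in> Tp" and A: "A \<in> Obj T" and s: "H.D.ext_split (fob H Y) (fob H A)"
  shows "gh0 Y A"
proof (rule gh0I)
  show YO: "Y \<in> Obj T" "A \<in> Obj T" using Y A by simp_all
  fix Z u v assume Z: "Z \<in> X" and u: "u \<Colon> Y \<rightarrow> shob T Z" and v: "v \<Colon> Z \<rightarrow> A"
  obtain X0 X1 b p d where P: "X0 \<in> X" "X1 \<in> X" "(X1, X0, Y, b, p, d) \<in> Tri T" "injX b" "surjX p"
    using Tp_presentation[OF Y] .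
  note t = triD[OF P(3)]
  have "u \<cdot> p \<Colon> X0 \<rightarrow> shob T Z" using u t by simp
  \<comment> \<open>The composite of \<open>u\<close> with \<open>p\<close> is a map from
    \<open>X0\<close> to Z[1], which is zero, so \<open>u\<close> factors through the connecting map
    \<open>d\<close>.\<close>
  from tri_co2[OF P(3) u X_null[OF P(1) Z this]] obtain u' where u': "u' \<Colon> shob T X1 \<rightarrow> shob T Z" "u' \<cdot> d = u" .
  define \<omega> where "\<omega> = shar T v \<cdot> u"
  have w: "\<omega> \<Colon> Y \<rightarrow> shob T A" unfolding \<omega>_def using u v by simp
  obtain E i q where tr: "(A, E, Y, i, q, \<omega>) \<in> Tri T" using tri_complete_last[OF w A] .
  note r = triD[OF tr]
  have w0: "\<omega> \<cdot> z = nul V (shob T A)" if z: "V \<in> X" "z \<Colon> V \<rightarrow> Y" for V z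
  proof -
    have "u \<cdot> z \<Colon> V \<rightarrow> shob T Z" using u z by simp
    from X_null[OF z(1) Z this] show ?thesis unfolding \<omega>_def using u v z by simp
  qed
  \<comment> \<open>This is where the monic presentation of \<open>Y\<close> is used. A map from
    \<open>V\<close> that \<open>i\<close> annihilates comes from a map V[1] -> Y, whose composite
    with \<open>d\<close> is the shift of a map annihilated by \<open>b\<close> and therefore zero;
    hence \<open>u\<close> and with it the connecting map vanish on it.\<close>
  have "injX i"
  proof (rule injXI[OF r(1)])
    fix V z assume z: "V \<in> X" "z \<Colon> V \<rightarrow> A" "i \<cdot> z = nul V E"
    obtain y where y: "y \<Colon> shob T V \<rightarrow> Y" "\<omega> \<cdot> y = shar T z" using tri_ex3[OF tr z(2,3)] .
    have dy: "d \<cdot> y \<Colon> shob T V \<rightarrow> shob T X1" using y t by simp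
    obtain k where k: "k \<Colon> V \<rightarrow> X1" "shar T k = d \<cdot> y" using shift_lift[OF X_Obj[OF z(1)] X_Obj[OF P(2)] dy] .
    have "shar T b \<cdot> shar T k = nul (shob T V) (shob T X0)"
      unfolding k(2) using Cmp_eq_Cmp[OF tri_zero3[OF P(3)], of y] y(1) t by simp
    then have "b \<cdot> k = nul V X0" using k(1) t by (intro shift_eq_nul[of "b \<cdot> k" V X0]) simp_all
    from injXD[OF P(4) t(1) z(1) k(1) this] have dy0: "d \<cdot> y = nul (shob T V) (shob T X1)"
      unfolding k(2)[symmetric] using k(1) by simp
    have "u \<cdot> y = u' \<cdot> (d \<cdot> y)" using Cmp_eq_Cmp[OF u'(2), of y] u'(1) y(1) t by simp
    also have "\<dots> = nul (shob T V) (shob T Z)" unfolding dy0 using u'(1) y(1) by simp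
    finally have "shar T z = nul (shob T V) (shob T A)" unfolding y(2)[symmetric] \<omega>_def using u v y(1) by simp
    then show "z = nul V A" by (rule shift_eq_nul[OF z(2)])
  qed
  moreover have "exX i q"
  proof (rule exXI[OF r(1,2)])
    fix V z assume z: "V \<in> X" "z \<Colon> V \<rightarrow> A"
    show "q \<cdot> (i \<cdot> z) = nul V Y" using Cmp_eq_Cmp[OF tri_zero1[OF tr], of z] z(2) r by simp
  next
    fix V z assume z: "V \<in> X" "z \<Colon> V \<rightarrow> E" "q \<cdot> z = nul V Y"
    show "\<exists>y. y \<Colon> V \<rightarrow> A \<and> i \<cdot> y = z" using tri_ex1[OF tr z(2,3)] by blast
  qed
  moreover have "surjX q"
  proof (rule surjXI[OF r(2)])
    fix V z assume z: "V \<in> X" "z \<Colon> V \<rightarrow> Y"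
    show "\<exists>y. y \<Colon> V \<rightarrow> E \<and> q \<cdot> y = z" using tri_ex2[OF tr z(2) w0[OF z]] by blast
  qed
  ultimately have "short_exact D (fob H A) (fob H E) (fob H Y) (far H i) (far H q)" by (rule short_exact_H[OF r(1,2)])
  moreover have EO: "E \<in> Obj T" "fob H E \<in> Obj D" using r by simp_all
  ultimately obtain \<sigma> where sg: "\<sigma> \<in> Arr D (fob H Y) (fob H E)" "far H q \<cdot>\<^sub>D \<sigma> = Idt D (fob H Y)"
    using s unfolding H.D.ext_split_def by blast
  have "\<sigma> \<Colon>\<^sub>D fob H Y \<rightarrow> fob H E" using H.D.ArrD[OF sg(1)] YO EO by simp
  then obtain s' where s': "s' \<Colon> Y \<rightarrow> E" "far H s' = \<sigma>" using H_lift[OF YO(1) EO(1)] by blast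
  have "far H q \<cdot>\<^sub>D far H s' = Idt D (fob H Y)" unfolding s'(2) by (rule sg(2))
  from Tp_retract[OF Y s'(1) r(2) this] obtain g where g: "g \<Colon> Y \<rightarrow> Y" "(q \<cdot> s') \<cdot> g = Idt T Y" by blast
  \<comment> \<open>The section of \<open>H q\<close> lifts to \<open>s'\<close>, and
    \<open>q \<cdot> s'\<close> becomes the identity after the correction \<open>g\<close>. So the
    connecting map factors through its composite with \<open>q\<close>, which is zero.\<close>
  have "\<omega> = \<omega> \<cdot> ((q \<cdot> s') \<cdot> g)" unfolding g(2) using w by simp
  also have "\<dots> = (\<omega> \<cdot> q) \<cdot> (s' \<cdot> g)" using w r(2) s'(1) g(1) by simp
  also have "\<dots> = nul Y (shob T A)" unfolding tri_zero2[OF tr] using s'(1) g(1) A EO by simp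
  finally show "shar T v \<cdot> u = nul Y (shob T A)" unfolding \<omega>_def .
qed

section \<open>Cluster tilting subcategories of \<open>T\<close> versus tilting subcategories of
  mod-X\<close>

lemma approx_by:
  assumes "contravariantly_finite T Y" "Y \<subseteq> Obj T" "A \<in> Obj T"
  obtains B y where "B \<in> Y" "y \<Colon> B \<rightarrow> A" "\<And>V v. V \<in> Y \<Longrightarrow> v \<Colon> V \<rightarrow> A \<Longrightarrow> \<exists>x. x \<Colon> V \<rightarrow> B \<and> y \<cdot> x = v"
proof -
  obtain B y where B: "B \<in> Y" "y \<in> Arr T B A" and ap: "\<forall>Y'\<in>Y. (\<lambda>h. y \<cdot> h) ` Arr T Y' B = Arr T Y' A"
    using assms(1,3) unfolding contravariantly_finite_def by blast
  have BO: "B \<in> Obj T" using B assms(2) by blast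
  show thesis
  proof (rule that[OF B(1) ArrD[OF B(2) BO assms(3)]])
    fix V v assume v: "V \<in> Y" "v \<Colon> V \<rightarrow> A"
    have "v \<in> (\<lambda>h. y \<cdot> h) ` Arr T V B" using ap v(1) ArrI[OF v(2)] by simp
    then obtain x where x: "x \<in> Arr T V B" "v = y \<cdot> x" by blast
    have "V \<in> Obj T" using v by simp
    from ArrD[OF x(1) this BO] show "\<exists>x. x \<Colon> V \<rightarrow> B \<and> y \<cdot> x = v" using x(2) by blast
  qed
qed

lemma ghost_of_serre:
  assumes f: "f \<Colon> A \<rightarrow> shob T B" and B: "B \<in> Obj T" "B' \<in> Obj T" "isomorphic T (fob S B') (shob T (shob T B))"
    and g: "gh0 B' A"
  shows "ghost f"
proof (rule ghostI[OF f])
  fix Z z assume z: "Z \<in> X" "z \<Colon> Z \<rightarrow> A"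
  show "f \<cdot> z = nul Z (shob T B)"
    by (rule serre_ghost[OF f z(2) B]) (rule gh0D[OF g z(1) _ z(2)])
qed

text \<open>If \<open>H A\<close> is a quotient of \<open>H B\<close> with \<open>B\<close> in
  \<open>Y\<close>, every map from \<open>X\<close> to \<open>A\<close> lifts to \<open>B\<close>,
  and the composites in \<open>gh0 Y0 A\<close> factor through T(Y0, B[1]) = 0. Conversely, the
  cocone \<open>W\<close> of a \<open>Y\<close>-approximation of \<open>A\<close> lies in
  \<open>Y\<close>; the vanishing of \<open>gh0 B' A\<close>, where S B' = W[2], makes the
  connecting map A -> W[1] a ghost, and then the approximation is onto on maps from
  \<open>X\<close>.\<close>

lemma ct_tilting:
  assumes Y: "two_cluster_tilting T Y" and YT: "Y \<subseteq> Tp"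
  shows "tilting_subcategory D (H_img Y)"
proof -
  note c = ctD[OF Y]
  have sr: "\<forall>A\<in>Y. \<exists>B\<in>Y. isomorphic T (fob S B) (shob T (shob T A))"
    using ct_serre[OF Y] unfolding serre_shift_eq_iff[OF c(4)] by blast
  have 1: "subcategory D (H_img Y)"
  proof (rule H_img_subcategory[OF c(1)])
    fix F A s r assume A: "A \<in> Y" and s: "s \<Colon>\<^sub>D F \<rightarrow> fob H A" "r \<Colon>\<^sub>D fob H A \<rightarrow> F" "r \<cdot>\<^sub>D s = Idt D F"
    have FO: "F \<in> Obj D" using s by simp
    \<comment> \<open>The retract is lifted to \<open>Tp\<close>, since there
      \<open>Tp_retract\<close> turns a retraction modulo ghosts into a true one and
      \<open>E\<close> becomes a summand of \<open>A\<close> in \<open>T\<close>.\<close>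
    obtain E where E: "E \<in> Tp" "isomorphic D (fob H E) F" using normal_form[OF FO] by blast
    have O: "E \<in> Obj T" "fob H E \<in> Obj D" "A \<in> Obj T" using E A c(4) by auto
    obtain a a' where a: "a \<Colon>\<^sub>D fob H E \<rightarrow> F" "a' \<Colon>\<^sub>D F \<rightarrow> fob H E" "a' \<cdot>\<^sub>D a = Idt D (fob H E)"
      using H.D.isomorphicE[OF E(2) O(2) FO] by blast
    have "s \<cdot>\<^sub>D a \<Colon>\<^sub>D fob H E \<rightarrow> fob H A" "a' \<cdot>\<^sub>D r \<Colon>\<^sub>D fob H A \<rightarrow> fob H E" using s a by simp_all
    then obtain u v where u: "u \<Colon> E \<rightarrow> A" "far H u = s \<cdot>\<^sub>D a" and v: "v \<Colon> A \<rightarrow> E" "far H v = a' \<cdot>\<^sub>D r"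
      using H_lift[OF O(1,3)] H_lift[OF O(3,1)] by metis
    have "far H v \<cdot>\<^sub>D far H u = Idt D (fob H E)"
      unfolding u(2) v(2) using H.D.Cmp_eq_Cmp[OF s(3), of a] s(1,2) a by simp
    from Tp_retract[OF E(1) u(1) v(1) this] obtain v' where "v' \<Colon> A \<rightarrow> E" "v' \<cdot> u = Idt T E" by blast
    from direct_summandI[OF split u(1) this] have "E \<in> Y" using c(1) A unfolding subcategory_def by blast
    then show "\<exists>A'\<in>Y. isomorphic D (fob H A') F" using E(2) by blast
  qed
  have 2: "contravariantly_finite D (H_img Y)" by (rule H_img_contravariantly_finite[OF c(2,4)])
  show ?thesis unfolding tilting_iff[OF c(4) 1 2]
  proof (intro ballI iffI)
    fix A Y0 assume A: "A \<in> Obj T" and "\<exists>B\<in>Y. \<exists>y. y \<Colon> B \<rightarrow> A \<and> surjX y" and Y0: "Y0 \<in> Y"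
    then obtain B y where B: "B \<in> Y" "y \<Colon> B \<rightarrow> A" "surjX y" by blast
    have YO: "Y0 \<in> Obj T" using Y0 c(4) by blast
    have "gh0 Y0 A"
    proof (rule gh0I[OF YO A])
      fix Z u v assume Z: "Z \<in> X" "u \<Colon> Y0 \<rightarrow> shob T Z" "v \<Colon> Z \<rightarrow> A"
      obtain x where x: "x \<Colon> Z \<rightarrow> B" "y \<cdot> x = v" using surjXD[OF B(3,2) Z(1,3)] .
      have xu: "shar T x \<cdot> u \<Colon> Y0 \<rightarrow> shob T B" using x Z by simp
      have "shar T v \<cdot> u = shar T y \<cdot> (shar T x \<cdot> u)" unfolding x(2)[symmetric] using x(1) B(2) Z(2) by simp
      also have "\<dots> = nul Y0 (shob T A)" unfolding hom_nullD[OF c(5)[OF Y0 B(1)] xu] using B(2) YO by simp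
      finally show "shar T v \<cdot> u = nul Y0 (shob T A)" .
    qed
    then show "H.D.ext_split (fob H Y0) (fob H A)" by (rule gh0_ext_split[OF YO A])
  next
    fix A assume A: "A \<in> Obj T" and s: "\<forall>B\<in>Y. H.D.ext_split (fob H B) (fob H A)"
    have g: "gh0 B A" if "B \<in> Y" for B using ext_split_gh0[OF _ A] s that YT by blast
    obtain B y where B: "B \<in> Y" "y \<Colon> B \<rightarrow> A" and ap: "\<And>V v. V \<in> Y \<Longrightarrow> v \<Colon> V \<rightarrow> A \<Longrightarrow> \<exists>x. x \<Colon> V \<rightarrow> B \<and> y \<cdot> x = v"
      using approx_by[OF c(2,4) A] by blast
    obtain W b w where tr: "(W, B, A, b, y, w) \<in> Tri T" using tri_complete_mid[OF B(2)] .
    note t = triD[OF tr]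
    have WO: "W \<in> Obj T" using t by simp
    have "W \<in> Y" by (rule c(6)[OF WO]) (rule approx_kernel_null[OF tr c(5)[OF _ B(1)] ap])
    then obtain B' where B': "B' \<in> Y" "isomorphic T (fob S B') (shob T (shob T W))" using sr by blast
    have B'O: "B' \<in> Obj T" using B' c(4) by blast
    have gw: "ghost w" by (rule ghost_of_serre[OF t(3) WO B'O B'(2) g[OF B'(1)]])
    have "surjX y"
    proof (rule surjXI[OF B(2)])
      fix Z z assume z: "Z \<in> X" "z \<Colon> Z \<rightarrow> A"
      show "\<exists>x. x \<Colon> Z \<rightarrow> B \<and> y \<cdot> x = z" using tri_ex2[OF tr z(2) ghostD[OF gw t(3) z]] by blast
    qed
    then show "\<exists>B\<in>Y. \<exists>y. y \<Colon> B \<rightarrow> A \<and> surjX y" using B by blast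
  qed
qed

text \<open>The non-trivial inclusion rests on \<open>normal_form\<close>, which lifts every
  coherent functor to an object of \<open>Tp\<close>.\<close>

lemma H_img_pre:
  assumes U: "subcategory D U"
  shows "H_img (H_pre U) = U"
proof
  have UO: "U \<subseteq> Obj D" and iso: "\<And>F G. F \<in> U \<Longrightarrow> G \<in> Obj D \<Longrightarrow> isomorphic D F G \<Longrightarrow> G \<in> U"
    using U unfolding subcategory_def by blast+
  show "H_img (H_pre U) \<subseteq> U" unfolding ess_image_def H_pre_def using iso by blast
  show "U \<subseteq> H_img (H_pre U)"
  proof
    fix F assume F: "F \<in> U"
    then have FO: "F \<in> Obj D" using UO by blast
    obtain E where E: "E \<in> Tp" "isomorphic D (fob H E) F" using normal_form[OF FO] by blast
    have HE: "fob H E \<in> Obj D" using E by simp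
    have "fob H E \<in> U" using iso[OF F HE] H.D.isomorphic_sym[OF E(2) HE FO] by blast
    then show "F \<in> H_img (H_pre U)" unfolding ess_image_def H_pre_def using E FO by blast
  qed
qed

lemma H_pre_subcategory:
  assumes U: "subcategory D U"
  shows "subcategory T (H_pre U)"
proof -
  have u: "\<And>Z. is_zero_obj D Z \<Longrightarrow> Z \<in> U" "\<And>F G W. F \<in> U \<Longrightarrow> G \<in> U \<Longrightarrow> is_direct_sum D F G W \<Longrightarrow> W \<in> U"
    "\<And>F G. F \<in> U \<Longrightarrow> G \<in> Obj D \<Longrightarrow> isomorphic D F G \<Longrightarrow> G \<in> U" "\<And>F G. F \<in> U \<Longrightarrow> direct_summand D G F \<Longrightarrow> G \<in> U"
    using U unfolding subcategory_def by blast+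
  have 1: "H_pre U \<subseteq> Obj T" unfolding H_pre_def using Tp_Obj by blast
  have 2: "Z \<in> H_pre U" if Z: "is_zero_obj T Z" for Z
    unfolding H_pre_def using Tp_zero[OF Z] u(1)[OF H.is_zero_obj_fob[OF Z]] by blast
  have 3: "W \<in> H_pre U" if A: "A \<in> H_pre U" "B \<in> H_pre U" and W: "is_direct_sum T A B W" for A B W
    using A Tp_direct_sum[OF _ _ W] u(2)[OF _ _ H.is_direct_sum_fob[OF W]] unfolding H_pre_def by blast
  have 4: "B \<in> H_pre U" if A: "A \<in> H_pre U" and B: "B \<in> Obj T" "isomorphic T A B" for A B
  proof -
    have "A \<in> Tp" "fob H A \<in> U" "A \<in> Obj T" using A 1 unfolding H_pre_def by blast+
    then show ?thesis using Tp_isomorphic[OF _ B(2,1)] u(3)[OF _ _ H.isomorphic_fob[OF B(2)]] B(1) unfolding H_pre_def by simp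
  qed
  have 5: "B \<in> H_pre U" if A: "A \<in> H_pre U" and B: "direct_summand T B A" for A B
  proof -
    have A': "A \<in> Tp" "fob H A \<in> U" using A unfolding H_pre_def by blast+
    obtain i p where "i \<Colon> B \<rightarrow> A" "p \<Colon> A \<rightarrow> B" "p \<cdot> i = Idt T B" using direct_summandE[OF B] .
    then have "B \<in> Tp" by (rule Tp_summand[OF A'(1)])
    moreover obtain E where "is_direct_sum T B E A" using B unfolding direct_summand_def by blast
    then have "direct_summand D (fob H B) (fob H A)" unfolding direct_summand_def using H.is_direct_sum_fob by blast
    ultimately show ?thesis using u(4)[OF A'(2)] unfolding H_pre_def by blast
  qed
  show ?thesis unfolding subcategory_def using 1 2 3 4 5 by blast
qed

text \<open>The tilting condition controls only ghosts. Serre duality with condition (b) shows that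
  the maps in question are ghosts, after which vanishing of Ext applies a second time. Covariant
  finiteness, which the tilting side does not mention, is recovered from contravariant finiteness by
  completing triangles.\<close>

lemma tilting_ct:
  assumes U: "tilting_subcategory D U" and cf: "contravariantly_finite T (H_pre U)"
    and sh: "ess_image T S (H_pre U) = shift_subcategory T (shift_subcategory T (H_pre U))"
  shows "two_cluster_tilting T (H_pre U)"
proof -
  define Y where "Y = H_pre U"
  have subU: "subcategory D U" "contravariantly_finite D U" using U unfolding tilting_subcategory_def by blast+
  have HY: "H_img Y = U" unfolding Y_def by (rule H_img_pre[OF subU(1)])
  have subY: "subcategory T Y" unfolding Y_def by (rule H_pre_subcategory[OF subU(1)])
  have YO: "Y \<subseteq> Obj T" using subY unfolding subcategory_def by (rule conjunct1)
  have YT: "Y \<subseteq> Tp" unfolding Y_def H_pre_def by blast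
  have cfY: "contravariantly_finite T Y" using cf unfolding Y_def .
  have sr: "\<forall>A\<in>Y. \<exists>B\<in>Y. isomorphic T (fob S A) (shob T (shob T B))"
    "\<forall>A\<in>Y. \<exists>B\<in>Y. isomorphic T (fob S B) (shob T (shob T A))"
    using sh[folded Y_def] unfolding serre_shift_eq_iff[OF YO] by blast+
  have tilt: "\<forall>A\<in>Obj T. (\<exists>B\<in>Y. \<exists>y. y \<Colon> B \<rightarrow> A \<and> surjX y) \<longleftrightarrow> (\<forall>B\<in>Y. H.D.ext_split (fob H B) (fob H A))"
    using tilting_iff[OF YO, THEN iffD1] U subU unfolding HY by blast
  \<comment> \<open>An object of \<open>Y\<close> is a quotient of itself under \<open>H\<close>, so
    the tilting equation gives vanishing Ext between images of objects of \<open>Y\<close>.\<close>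
  have Y_gh0: "gh0 A B" if A: "A \<in> Y" and B: "B \<in> Y" for A B
  proof -
    have BO: "B \<in> Obj T" using B YO by blast
    have i: "Idt T B \<Colon> B \<rightarrow> B" using BO by simp
    have "surjX (Idt T B)"
    proof (rule surjXI[OF i])
      fix Z z assume "Z \<in> X" "z \<Colon> Z \<rightarrow> B"
      then show "\<exists>y. y \<Colon> Z \<rightarrow> B \<and> Idt T B \<cdot> y = z" by (intro exI[of _ z]) simp
    qed
    then have "\<forall>E\<in>Y. H.D.ext_split (fob H E) (fob H B)" using bspec[OF tilt BO, THEN iffD1] B i by blast
    then show ?thesis using ext_split_gh0[OF _ BO] A YT by blast
  qed
  \<comment> \<open>The preceding fact is used twice: for the pair \<open>B'\<close>,
    \<open>A\<close> it makes \<open>f\<close> a ghost through Serre duality, and for the pair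
    \<open>A\<close>, \<open>B\<close> it annihilates that ghost.\<close>
  have rig: "hom_null A (shob T B)" if A: "A \<in> Y" and B: "B \<in> Y" for A B
    unfolding hom_null_def
  proof (intro allI impI)
    fix f assume f: "f \<Colon> A \<rightarrow> shob T B"
    have O: "A \<in> Obj T" "B \<in> Obj T" using A B YO by blast+
    obtain B' where B': "B' \<in> Y" "isomorphic T (fob S B') (shob T (shob T B))" using sr(2) B by blast
    have B'O: "B' \<in> Obj T" using B' YO by blast
    have "ghost f" by (rule ghost_of_serre[OF f O(2) B'O B'(2) Y_gh0[OF B'(1) A]])
    from ghost_factor[OF f this] obtain Z u v where Z: "Z \<in> X" "u \<Colon> A \<rightarrow> shob T Z" "v \<Colon> shob T Z \<rightarrow> shob T B" "f = v \<cdot> u" .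
    obtain v' where v': "v' \<Colon> Z \<rightarrow> B" "shar T v' = v" using shift_lift[OF X_Obj[OF Z(1)] O(2) Z(3)] .
    show "f = nul A (shob T B)" unfolding Z(4) v'(2)[symmetric] by (rule gh0D[OF Y_gh0[OF A B] Z(1,2) v'(1)])
  qed
  \<comment> \<open>The vanishing of T(Y, A[1]) contains the vanishing of the composites in
    \<open>gh0\<close>, so \<open>H A\<close> is orthogonal to the tilting subcategory and hence one
    of its quotients.\<close>
  have cover: "\<exists>B\<in>Y. \<exists>y. y \<Colon> B \<rightarrow> A \<and> surjX y" if A: "A \<in> Obj T" and n: "\<And>B. B \<in> Y \<Longrightarrow> hom_null B (shob T A)" for A
  proof -
    have "H.D.ext_split (fob H B) (fob H A)" if B: "B \<in> Y" for B
    proof -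
      have BO: "B \<in> Obj T" using B YO by blast
      have "gh0 B A"
      proof (rule gh0I[OF BO A])
        fix Z u v assume "Z \<in> X" "u \<Colon> B \<rightarrow> shob T Z" "v \<Colon> Z \<rightarrow> A"
        then have "shar T v \<cdot> u \<Colon> B \<rightarrow> shob T A" by simp
        then show "shar T v \<cdot> u = nul B (shob T A)" by (rule hom_nullD[OF n[OF B]])
      qed
      then show ?thesis by (rule gh0_ext_split[OF BO A])
    qed
    then show ?thesis using bspec[OF tilt A] by blast
  qed
  \<comment> \<open>The aim is to split a \<open>Y\<close>-approximation of \<open>A\<close>, that
    is, to show that its connecting map \<open>w\<close> is zero.\<close>
  have closed: "A \<in> Y" if A: "A \<in> Obj T" and n: "\<And>B. B \<in> Y \<Longrightarrow> hom_null B (shob T A)" for A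
  proof -
    obtain Y0 y where Y0: "Y0 \<in> Y" "y \<Colon> Y0 \<rightarrow> A" and ap: "\<And>V v. V \<in> Y \<Longrightarrow> v \<Colon> V \<rightarrow> A \<Longrightarrow> \<exists>x. x \<Colon> V \<rightarrow> Y0 \<and> y \<cdot> x = v"
      using approx_by[OF cfY YO A] by blast
    obtain B c where B: "B \<in> Y" "c \<Colon> B \<rightarrow> A" "surjX c" using cover[OF A n] by blast
    obtain c' where c': "c' \<Colon> B \<rightarrow> Y0" "y \<cdot> c' = c" using ap[OF B(1,2)] by blast
    obtain W b w where tr: "(W, Y0, A, b, y, w) \<in> Tri T" using tri_complete_mid[OF Y0(2)] .
    note t = triD[OF tr]
    have WO: "W \<in> Obj T" using t by simp
    \<comment> \<open>The covering map \<open>c\<close> factors through the approximation, so the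
      approximation is onto on maps from \<open>X\<close> as well.\<close>
    have gw: "ghost w"
    proof (rule ghostI[OF t(3)])
      fix Z z assume z: "Z \<in> X" "z \<Colon> Z \<rightarrow> A"
      obtain x where x: "x \<Colon> Z \<rightarrow> B" "c \<cdot> x = z" using surjXD[OF B(3,2) z] .
      have z': "z = y \<cdot> (c' \<cdot> x)" using Cmp_eq_Cmp[OF c'(2), of x] x c'(1) Y0(2) by simp
      show "w \<cdot> z = nul Z (shob T W)" unfolding z'
        using Cmp_eq_Cmp[OF tri_zero2[OF tr], of "c' \<cdot> x"] x(1) c'(1) t by simp
    qed
    obtain Z u v where Z: "Z \<in> X" "u \<Colon> A \<rightarrow> shob T Z" "v \<Colon> shob T Z \<rightarrow> shob T W" "w = v \<cdot> u" using ghost_factor[OF t(3) gw] .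
    obtain v' where v': "v' \<Colon> Z \<rightarrow> W" "shar T v' = v" using shift_lift[OF X_Obj[OF Z(1)] WO Z(3)] .
    \<comment> \<open>The cocone satisfies the same orthogonality as \<open>A\<close>, so it too is
      covered by some \<open>Y1\<close> in \<open>Y\<close>. The second factor of the ghost
      \<open>w\<close> lifts to \<open>Y1\<close>, and then \<open>w\<close> passes through a map
      from \<open>A\<close> to Y1[1], which Serre duality excludes.\<close>
    have nW: "hom_null V (shob T W)" if "V \<in> Y" for V by (rule approx_kernel_null[OF tr rig[OF that Y0(1)] ap[OF that]])
    obtain Y1 y1 where Y1: "Y1 \<in> Y" "y1 \<Colon> Y1 \<rightarrow> W" "surjX y1" using cover[OF WO nW] by blast
    obtain k where k: "k \<Colon> Z \<rightarrow> Y1" "y1 \<cdot> k = v'" using surjXD[OF Y1(3,2) Z(1) v'(1)] .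
    obtain B' where B': "B' \<in> Y" "isomorphic T (fob S B') (shob T (shob T Y1))" using sr(2) Y1(1) by blast
    have O: "B' \<in> Obj T" "Y1 \<in> Obj T" using B' Y1 YO by blast+
    have "hom_null A (shob T Y1)" using serre_shift_null[OF A O(2,1) B'(2)] n[OF B'(1)] by blast
    moreover have "shar T k \<cdot> u \<Colon> A \<rightarrow> shob T Y1" using k(1) Z(2) by simp
    ultimately have ku: "shar T k \<cdot> u = nul A (shob T Y1)" using hom_nullD by blast
    have "w = shar T y1 \<cdot> (shar T k \<cdot> u)" unfolding Z(4) v'(2)[symmetric] k(2)[symmetric] using k(1) Y1(2) Z(2) by simp
    also have "\<dots> = nul A (shob T W)" unfolding ku using Y1(2) A by simp
    finally have "w \<cdot> Idt T A = nul A (shob T W)" using t by simp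
    moreover have "Idt T A \<Colon> A \<rightarrow> A" using A by simp
    ultimately obtain s where s: "s \<Colon> A \<rightarrow> Y0" "y \<cdot> s = Idt T A" using tri_ex2[OF tr] by blast
    have "direct_summand T A Y0" by (rule direct_summandI[OF split s(1) Y0(2) s(2)])
    then show ?thesis using subY Y0(1) unfolding subcategory_def by blast
  qed
  \<comment> \<open>The other half of the equation S Y = Y[2] turns orthogonality on this side into
    the one already treated.\<close>
  have closed': "A \<in> Y" if A: "A \<in> Obj T" and n: "\<And>B. B \<in> Y \<Longrightarrow> hom_null A (shob T B)" for A
  proof (rule closed[OF A])
    fix V assume V: "V \<in> Y"
    obtain B where B: "B \<in> Y" "isomorphic T (fob S V) (shob T (shob T B))" using sr(1) V by blast
    have O: "B \<in> Obj T" "V \<in> Obj T" using B V YO by blast+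
    show "hom_null V (shob T A)" using serre_shift_null[OF A O B(2)] n[OF B(1)] by blast
  qed
  \<comment> \<open>A right approximation of A[1] is completed backwards to a triangle A -> M -> Y1
    -> A[1]. The middle term lies in \<open>Y\<close> by \<open>approx_kernel_null\<close> and
    \<open>closed\<close>, and maps from \<open>A\<close> to \<open>Y\<close> extend to
    \<open>M\<close> because T(Y1, Y[1]) vanishes.\<close>
  have cov: "covariantly_finite T Y"
    unfolding covariantly_finite_def
  proof (intro ballI)
    fix A assume A: "A \<in> Obj T"
    have sA: "shob T A \<in> Obj T" using A by simp
    obtain Y1 y where Y1: "Y1 \<in> Y" "y \<Colon> Y1 \<rightarrow> shob T A" and ap: "\<And>V v. V \<in> Y \<Longrightarrow> v \<Colon> V \<rightarrow> shob T A \<Longrightarrow> \<exists>x. x \<Colon> V \<rightarrow> Y1 \<and> y \<cdot> x = v"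
      using approx_by[OF cfY YO sA] by blast
    obtain M f g where tr: "(A, M, Y1, f, g, y) \<in> Tri T" using tri_complete_last[OF Y1(2) A] .
    note t = triD[OF tr]
    have MO: "M \<in> Obj T" using t by simp
    have M: "M \<in> Y" by (rule closed[OF MO]) (rule approx_kernel_null[OF tri_rot[OF tr] rig[OF _ Y1(1)] ap])
    have "(\<lambda>h. h \<cdot> f) ` Arr T M Y' = Arr T A Y'" if Y': "Y' \<in> Y" for Y'
    proof
      have Y'O: "Y' \<in> Obj T" using Y' YO by blast
      show "(\<lambda>h. h \<cdot> f) ` Arr T M Y' \<subseteq> Arr T A Y'" using Cmp_closed[OF A MO Y'O ArrI[OF t(1)]] by blast
      show "Arr T A Y' \<subseteq> (\<lambda>h. h \<cdot> f) ` Arr T M Y'"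
      proof
        fix h assume "h \<in> Arr T A Y'"
        then have h: "h \<Colon> A \<rightarrow> Y'" using ArrD A Y'O by blast
        have hy: "shar T h \<cdot> y \<Colon> Y1 \<rightarrow> shob T Y'" using h t by simp
        from tri_co3[OF tr h hom_nullD[OF rig[OF Y1(1) Y'] hy]] obtain k where "k \<Colon> M \<rightarrow> Y'" "k \<cdot> f = h" .
        then show "h \<in> (\<lambda>h. h \<cdot> f) ` Arr T M Y'" using ArrI[of k M Y'] by blast
      qed
    qed
    then show "\<exists>XA\<in>Y. \<exists>f\<in>Arr T A XA. \<forall>X'\<in>Y. (\<lambda>h. h \<cdot> f) ` Arr T XA X' = Arr T A X'"
      by (intro bexI[OF _ M] bexI[OF _ ArrI[OF t(1)]] ballI) blast
  qed
  show ?thesis unfolding two_cluster_tilting_iff Y_def[symmetric] functorially_finite_def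
  proof (intro conjI ballI iffI subY cfY cov)
    fix A B assume "A \<in> Y" "B \<in> Y"
    then show "hom_null B (shob T A)" by (intro rig)
  next
    fix A assume "A \<in> Obj T" "\<forall>B\<in>Y. hom_null B (shob T A)"
    then show "A \<in> Y" using closed by blast
  next
    fix A B assume "A \<in> Y" "B \<in> Y"
    then show "hom_null A (shob T B)" by (intro rig)
  next
    fix A assume "A \<in> Obj T" "\<forall>B\<in>Y. hom_null A (shob T B)"
    then show "A \<in> Y" using closed' by blast
  qed
qed

lemma correspondence:
  "bij_betw H_img {Y. two_cluster_tilting T Y \<and> Y \<subseteq> Tp}
    {U. tilting_subcategory D U \<and> contravariantly_finite T (H_pre U) \<and>
      ess_image T S (H_pre U) = shift_subcategory T (shift_subcategory T (H_pre U))}"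
proof (rule bij_betw_byWitness[where f' = H_pre])
  have pre: "H_pre (H_img Y) = Y" if Y: "two_cluster_tilting T Y" "Y \<subseteq> Tp" for Y
  proof (rule H_pre_img[OF Y(2)])
    fix A B assume "A \<in> Y" "B \<in> Obj T" "isomorphic T A B"
    then show "B \<in> Y" using ctD(1)[OF Y(1)] unfolding subcategory_def by blast
  qed
  then show "\<forall>Y\<in>{Y. two_cluster_tilting T Y \<and> Y \<subseteq> Tp}. H_pre (H_img Y) = Y" by blast
  show "\<forall>U\<in>{U. tilting_subcategory D U \<and> contravariantly_finite T (H_pre U) \<and>
      ess_image T S (H_pre U) = shift_subcategory T (shift_subcategory T (H_pre U))}. H_img (H_pre U) = U"
    using H_img_pre unfolding tilting_subcategory_def by blast
  show "H_img ` {Y. two_cluster_tilting T Y \<and> Y \<subseteq> Tp} \<subseteq>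
    {U. tilting_subcategory D U \<and> contravariantly_finite T (H_pre U) \<and>
      ess_image T S (H_pre U) = shift_subcategory T (shift_subcategory T (H_pre U))}"
  proof (rule image_subsetI, rule CollectI)
    fix Y assume "Y \<in> {Y. two_cluster_tilting T Y \<and> Y \<subseteq> Tp}"
    then have Y: "two_cluster_tilting T Y" "Y \<subseteq> Tp" by simp_all
    show "tilting_subcategory D (H_img Y) \<and> contravariantly_finite T (H_pre (H_img Y)) \<and>
      ess_image T S (H_pre (H_img Y)) = shift_subcategory T (shift_subcategory T (H_pre (H_img Y)))"
      unfolding pre[OF Y] using ct_tilting[OF Y] ctD(2)[OF Y(1)] ct_serre[OF Y(1)] by blast
  qed
  show "H_pre ` {U. tilting_subcategory D U \<and> contravariantly_finite T (H_pre U) \<and>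
      ess_image T S (H_pre U) = shift_subcategory T (shift_subcategory T (H_pre U))} \<subseteq> {Y. two_cluster_tilting T Y \<and> Y \<subseteq> Tp}"
    using tilting_ct unfolding H_pre_def by blast
qed

end

section \<open>The category of coherent functors\<close>

lemma truncate_simps [simp]:
  "carrier (ring.truncate R) = carrier R" "x \<oplus>\<^bsub>ring.truncate R\<^esub> y = x \<oplus>\<^bsub>R\<^esub> y" "\<zero>\<^bsub>ring.truncate R\<^esub> = \<zero>\<^bsub>R\<^esub>"
  by (simp_all add: ring.truncate_def)

lemma abelian_group_truncate:
  assumes "abelian_group R"
  shows "abelian_group (ring.truncate R)"
proof -
  interpret abelian_group R by fact
  show ?thesis by (rule abelian_groupI) (auto simp: add.m_ac intro: l_neg bexI[of _ "\<ominus>\<^bsub>R\<^esub> _"])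
qed

lemma hom_presheaf_simps [simp]:
  "carrier (fob (hom_presheaf C A) B) = Arr C B A" "\<zero>\<^bsub>fob (hom_presheaf C A) B\<^esub> = nul\<^bsub>C\<^esub> B A"
  "x \<oplus>\<^bsub>fob (hom_presheaf C A) B\<^esub> y = x \<oplus>\<^bsub>Hom C B A\<^esub> y" "far (hom_presheaf C A) f x = x \<cdot>\<^bsub>C\<^esub> f"
  by (simp_all add: hom_presheaf_def)

lemma hom_add_iff:
  "h \<in> hom (add_monoid R) (add_monoid R') \<longleftrightarrow> (\<forall>x\<in>carrier R. h x \<in> carrier R') \<and>
    (\<forall>x\<in>carrier R. \<forall>y\<in>carrier R. h (x \<oplus>\<^bsub>R\<^esub> y) = h x \<oplus>\<^bsub>R'\<^esub> h y)"
  unfolding hom_def by auto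

lemma mod_category_simps [simp]:
  "Obj (mod_category C X) = {F. coherent C X F}"
  "Src (mod_category C X) (F, G, \<eta>) = F" "Tgt (mod_category C X) (F, G, \<eta>) = G"
  "carrier (Hom (mod_category C X) F G) = {(F, G, \<eta>) | \<eta>. \<eta> \<in> nat_transformations C X F G}"
  "\<zero>\<^bsub>Hom (mod_category C X) F G\<^esub> = (F, G, \<lambda>A\<in>X. \<lambda>x\<in>carrier (fob F A). \<zero>\<^bsub>fob G A\<^esub>)"
  "(F1, G1, \<eta>) \<oplus>\<^bsub>Hom (mod_category C X) F G\<^esub> (F2, G2, \<theta>) =
    (F, G, \<lambda>A\<in>X. \<lambda>x\<in>carrier (fob F A). \<eta> A x \<oplus>\<^bsub>fob G A\<^esub> \<theta> A x)"
  "c \<odot>\<^bsub>Hom (mod_category C X) F G\<^esub> (F1, G1, \<eta>) =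
    (F, G, \<lambda>A\<in>X. \<lambda>x\<in>carrier (fob F A). far G (c \<odot>\<^bsub>Hom C A A\<^esub> Idt C A) (\<eta> A x))"
  "Idt (mod_category C X) F = (F, F, \<lambda>A\<in>X. \<lambda>x\<in>carrier (fob F A). x)"
  "(G1, G2, \<theta>) \<cdot>\<^bsub>mod_category C X\<^esub> (F1, F2, \<eta>) = (F1, G2, \<lambda>A\<in>X. \<lambda>x\<in>carrier (fob F1 A). \<theta> A (\<eta> A x))"
  by (simp_all add: mod_category_def)

locale presheaf_setting = lincat K C
  for K :: "('k, 'r) ring_scheme" and C :: "('k, 'o, 'm, 'z) lcat_scheme" (structure) +
  fixes X :: "'o set"
  assumes X_Obj': "X \<subseteq> Obj C"
begin

abbreviation NT :: "('o, 'm) presheaf \<Rightarrow> ('o, 'm) presheaf \<Rightarrow> ('o \<Rightarrow> 'm \<Rightarrow> 'm) set"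
  where "NT F G \<equiv> nat_transformations C X F G"

abbreviation M :: "('k, ('o, 'm) presheaf, ('o, 'm) presheaf \<times> ('o, 'm) presheaf \<times> ('o \<Rightarrow> 'm \<Rightarrow> 'm)) lcat"
  where "M \<equiv> mod_category C X"

abbreviation el :: "('o, 'm) presheaf \<Rightarrow> 'o \<Rightarrow> 'm set"
  where "el F A \<equiv> carrier (fob F A)"

lemma XO [simp]: "A \<in> X \<Longrightarrow> A \<in> Obj C"
  using X_Obj' by blast

lemma presheafD:
  assumes "is_presheaf C X F"
  shows "A \<in> X \<Longrightarrow> abelian_group (fob F A)"
    and "f \<Colon> A \<rightarrow> B \<Longrightarrow> A \<in> X \<Longrightarrow> B \<in> X \<Longrightarrow> x \<in> el F B \<Longrightarrow> far F f x \<in> el F A"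
    and "f \<Colon> A \<rightarrow> B \<Longrightarrow> A \<in> X \<Longrightarrow> B \<in> X \<Longrightarrow> x \<in> el F B \<Longrightarrow> y \<in> el F B \<Longrightarrow>
      far F f (x \<oplus>\<^bsub>fob F B\<^esub> y) = far F f x \<oplus>\<^bsub>fob F A\<^esub> far F f y"
    and "A \<in> X \<Longrightarrow> x \<in> el F A \<Longrightarrow> far F (Idt C A) x = x"
    and "f \<Colon> A \<rightarrow> B \<Longrightarrow> g \<Colon> B \<rightarrow> E \<Longrightarrow> A \<in> X \<Longrightarrow> B \<in> X \<Longrightarrow> E \<in> X \<Longrightarrow> x \<in> el F E \<Longrightarrow>
      far F (g \<cdot> f) x = far F f (far F g x)"
proof -
  show "A \<in> X \<Longrightarrow> abelian_group (fob F A)" "A \<in> X \<Longrightarrow> x \<in> el F A \<Longrightarrow> far F (Idt C A) x = x"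
    using assms unfolding is_presheaf_def by blast+
  have h: "far F f \<in> hom (add_monoid (fob F B)) (add_monoid (fob F A))"
    if "f \<Colon> A \<rightarrow> B" "A \<in> X" "B \<in> X" for f A B
    using assms that(2,3) ArrI[OF that(1)] unfolding is_presheaf_def by blast
  show "f \<Colon> A \<rightarrow> B \<Longrightarrow> A \<in> X \<Longrightarrow> B \<in> X \<Longrightarrow> x \<in> el F B \<Longrightarrow> far F f x \<in> el F A"
    using h[of f A B] unfolding hom_add_iff by blast
  show "f \<Colon> A \<rightarrow> B \<Longrightarrow> A \<in> X \<Longrightarrow> B \<in> X \<Longrightarrow> x \<in> el F B \<Longrightarrow> y \<in> el F B \<Longrightarrow>
      far F f (x \<oplus>\<^bsub>fob F B\<^esub> y) = far F f x \<oplus>\<^bsub>fob F A\<^esub> far F f y"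
    using h[of f A B] unfolding hom_add_iff by blast
  show "far F (g \<cdot> f) x = far F f (far F g x)"
    if "f \<Colon> A \<rightarrow> B" "g \<Colon> B \<rightarrow> E" "A \<in> X" "B \<in> X" "E \<in> X" "x \<in> el F E"
    using assms that(3-6) ArrI[OF that(1)] ArrI[OF that(2)] unfolding is_presheaf_def by blast
qed

text \<open>Arrows of \<open>mod_category\<close> are extensional in both arguments. Writing every
  constructed transformation in this form lets equations be checked on elements by
  \<open>NT_eqI\<close>.\<close>

definition ntf :: "('o, 'm) presheaf \<Rightarrow> ('o \<Rightarrow> 'm \<Rightarrow> 'm) \<Rightarrow> 'o \<Rightarrow> 'm \<Rightarrow> 'm"
  where "ntf F h = (\<lambda>A\<in>X. \<lambda>x\<in>el F A. h A x)"

lemma ntf_apply [simp]: "A \<in> X \<Longrightarrow> x \<in> el F A \<Longrightarrow> ntf F h A x = h A x"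
  unfolding ntf_def by simp

lemma NT_I:
  assumes "\<And>A x. A \<in> X \<Longrightarrow> x \<in> el F A \<Longrightarrow> h A x \<in> el G A"
    and "\<And>A x y. A \<in> X \<Longrightarrow> x \<in> el F A \<Longrightarrow> y \<in> el F A \<Longrightarrow> h A (x \<oplus>\<^bsub>fob F A\<^esub> y) = h A x \<oplus>\<^bsub>fob G A\<^esub> h A y"
    and "\<And>A B f x. A \<in> X \<Longrightarrow> B \<in> X \<Longrightarrow> f \<Colon> A \<rightarrow> B \<Longrightarrow> x \<in> el F B \<Longrightarrow> h A (far F f x) = far G f (h B x)"
    and F: "is_presheaf C X F"
  shows "ntf F h \<in> NT F G"
  unfolding nat_transformations_def
proof (intro CollectI conjI ballI PiE_I IntI)
  fix A assume A: "A \<in> X"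
  interpret abelian_group "fob F A" by (rule presheafD(1)[OF F A])
  show "ntf F h A \<in> hom (add_monoid (fob F A)) (add_monoid (fob G A))"
    unfolding hom_add_iff using A assms(1,2) by simp
  show "ntf F h A \<in> extensional (el F A)" unfolding ntf_def using A by simp
  fix B f x assume B: "B \<in> X" and "f \<in> Arr C A B" and x: "x \<in> el F B"
  then have f: "f \<Colon> A \<rightarrow> B" using ArrD A by simp
  show "ntf F h A (far F f x) = far G f (ntf F h B x)"
    using presheafD(2)[OF F f A B x] assms(3)[OF A B f x] A B x by simp
next
  fix A assume "A \<notin> X"
  then show "ntf F h A = undefined" unfolding ntf_def by simp
qed

lemma NT_D:
  assumes "\<eta> \<in> NT F G" "A \<in> X"
  shows "x \<in> el F A \<Longrightarrow> \<eta> A x \<in> el G A"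
    and "x \<in> el F A \<Longrightarrow> y \<in> el F A \<Longrightarrow> \<eta> A (x \<oplus>\<^bsub>fob F A\<^esub> y) = \<eta> A x \<oplus>\<^bsub>fob G A\<^esub> \<eta> A y"
    and "B \<in> X \<Longrightarrow> f \<Colon> A \<rightarrow> B \<Longrightarrow> x \<in> el F B \<Longrightarrow> \<eta> A (far F f x) = far G f (\<eta> B x)"
proof -
  have h: "\<eta> A \<in> hom (add_monoid (fob F A)) (add_monoid (fob G A))"
    using assms unfolding nat_transformations_def by blast
  show "x \<in> el F A \<Longrightarrow> \<eta> A x \<in> el G A"
    "x \<in> el F A \<Longrightarrow> y \<in> el F A \<Longrightarrow> \<eta> A (x \<oplus>\<^bsub>fob F A\<^esub> y) = \<eta> A x \<oplus>\<^bsub>fob G A\<^esub> \<eta> A y"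
    using h unfolding hom_add_iff by blast+
  show "B \<in> X \<Longrightarrow> f \<Colon> A \<rightarrow> B \<Longrightarrow> x \<in> el F B \<Longrightarrow> \<eta> A (far F f x) = far G f (\<eta> B x)"
    using assms ArrI[of f A B] unfolding nat_transformations_def by blast
qed

lemma NT_eqI:
  assumes "\<eta> \<in> NT F G" "\<theta> \<in> NT F G" "\<And>A x. A \<in> X \<Longrightarrow> x \<in> el F A \<Longrightarrow> \<eta> A x = \<theta> A x"
  shows "\<eta> = \<theta>"
proof (rule ext)
  fix A
  show "\<eta> A = \<theta> A"
  proof (cases "A \<in> X")
    case True
    have "\<eta> A \<in> extensional (el F A)" "\<theta> A \<in> extensional (el F A)"
      using assms(1,2) True unfolding nat_transformations_def by blast+
    then show ?thesis using assms(3)[OF True] by (rule extensionalityI)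
  next
    case False
    then show ?thesis using assms(1,2) unfolding nat_transformations_def by (auto simp: PiE_def extensional_def)
  qed
qed

lemma NT_zero:
  assumes \<eta>: "\<eta> \<in> NT F G" and A: "A \<in> X" and F: "is_presheaf C X F" and G: "is_presheaf C X G"
  shows "\<eta> A \<zero>\<^bsub>fob F A\<^esub> = \<zero>\<^bsub>fob G A\<^esub>"
proof -
  interpret F: abelian_group "fob F A" by (rule presheafD(1)[OF F A])
  interpret G: abelian_group "fob G A" by (rule presheafD(1)[OF G A])
  show ?thesis using NT_D(2)[OF \<eta> A F.zero_closed F.zero_closed] NT_D(1)[OF \<eta> A F.zero_closed]
    by (metis F.l_zero F.zero_closed G.add.l_cancel_one')
qed

lemma far_zero:
  assumes F: "is_presheaf C X F" and f: "f \<Colon> A \<rightarrow> B" "A \<in> X" "B \<in> X"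
  shows "far F f \<zero>\<^bsub>fob F B\<^esub> = \<zero>\<^bsub>fob F A\<^esub>"
proof -
  interpret A: abelian_group "fob F A" by (rule presheafD(1)[OF F f(2)])
  interpret B: abelian_group "fob F B" by (rule presheafD(1)[OF F f(3)])
  show ?thesis using presheafD(3)[OF F f B.zero_closed B.zero_closed] presheafD(2)[OF F f B.zero_closed]
    by (metis B.l_zero B.zero_closed A.add.l_cancel_one')
qed

lemma coherent_presheaf: "coherent C X F \<Longrightarrow> is_presheaf C X F"
  unfolding coherent_def by blast

lemma coherentE:
  assumes "coherent C X F"
  obtains X1 X0 \<alpha> \<beta> where "X1 \<in> X" "X0 \<in> X" "\<alpha> \<in> NT (hom_presheaf C X1) (hom_presheaf C X0)"
    "\<beta> \<in> NT (hom_presheaf C X0) F"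
    "\<And>A. A \<in> X \<Longrightarrow> \<alpha> A ` Arr C A X1 = {x \<in> Arr C A X0. \<beta> A x = \<zero>\<^bsub>fob F A\<^esub>}"
    "\<And>A. A \<in> X \<Longrightarrow> \<beta> A ` Arr C A X0 = el F A"
proof -
  obtain X1 X0 \<alpha> \<beta> where *: "X1 \<in> X" "X0 \<in> X" "\<alpha> \<in> NT (hom_presheaf C X1) (hom_presheaf C X0)"
    "\<beta> \<in> NT (hom_presheaf C X0) F"
    "\<forall>A\<in>X. \<alpha> A ` Arr C A X1 = a_kernel (Hom C A X0) (fob F A) (\<beta> A) \<and> \<beta> A ` Arr C A X0 = el F A"
    using assms unfolding coherent_def by blast
  show thesis
  proof (rule that[OF *(1-4)])
    fix A assume "A \<in> X"
    with *(5) show "\<alpha> A ` Arr C A X1 = {x \<in> Arr C A X0. \<beta> A x = \<zero>\<^bsub>fob F A\<^esub>}" "\<beta> A ` Arr C A X0 = el F A"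
      unfolding a_kernel_def' by simp_all
  qed
qed

text \<open>Presheaves of groups need not be additive, but quotients of representable ones are.\<close>

lemma coherent_additive:
  assumes F: "coherent C X F" and f: "f \<Colon> A \<rightarrow> B" "g \<Colon> A \<rightarrow> B" "A \<in> X" "B \<in> X" and y: "y \<in> el F B"
  shows "far F (f \<boxplus> g) y = far F f y \<oplus>\<^bsub>fob F A\<^esub> far F g y"
proof -
  obtain X1 X0 \<alpha> \<beta> where c: "X0 \<in> X" "\<beta> \<in> NT (hom_presheaf C X0) F" "\<And>A. A \<in> X \<Longrightarrow> \<beta> A ` Arr C A X0 = el F A"
    using coherentE[OF F] by metis
  obtain x where x: "x \<in> Arr C B X0" "y = \<beta> B x" using y c(3)[OF f(4)] by blast
  have x': "x \<Colon> B \<rightarrow> X0" using ArrD[OF x(1)] f c(1) by simp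
  have nat: "far F h y = \<beta> A (x \<cdot> h)" if h: "h \<Colon> A \<rightarrow> B" for h
    using NT_D(3)[OF c(2) f(3,4) h, of x] x by simp
  have fg: "f \<boxplus> g \<Colon> A \<rightarrow> B" using f by simp
  have xf: "x \<cdot> f \<Colon> A \<rightarrow> X0" "x \<cdot> g \<Colon> A \<rightarrow> X0" using x' f by simp_all
  have "x \<cdot> (f \<boxplus> g) = x \<cdot> f \<oplus>\<^bsub>Hom C A X0\<^esub> x \<cdot> g"
    unfolding plus_Hom[OF xf(1)] using x' f by (simp add: Cmp_distrib)
  then show ?thesis unfolding nat[OF fg] nat[OF f(1)] nat[OF f(2)]
    using NT_D(2)[OF c(2) f(3), of "x \<cdot> f" "x \<cdot> g"] ArrI[OF xf(1)] ArrI[OF xf(2)] by simp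
qed

abbreviation sId :: "'k \<Rightarrow> 'o \<Rightarrow> 'm"
  where "sId c A \<equiv> c \<odot>\<^bsub>Hom C A A\<^esub> Idt C A"

lemma sId:
  assumes "A \<in> Obj C" "c \<in> carrier K"
  shows "sId c A = c \<star> Idt C A" "sId c A \<Colon> A \<rightarrow> A"
proof -
  show 1: "sId c A = c \<star> Idt C A" using smult_Hom[of "Idt C A" A A c] assms by simp
  show "sId c A \<Colon> A \<rightarrow> A" unfolding 1 using assms by simp
qed

lemma sId_Cmp:
  assumes "f \<Colon> A \<rightarrow> B" "c \<in> carrier K"
  shows "f \<cdot> sId c A = c \<star> f" "sId c B \<cdot> f = c \<star> f"
  using assms sId(1)[of A c] sId(1)[of B c] by (simp_all add: Cmp_smult_right Cmp_smult_left)

text \<open>The product is stated with its factors reversed, the order that a contravariant functor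
  turns back into the order of the scalars.\<close>

lemma sId_laws:
  assumes A: "A \<in> Obj C" and c: "c \<in> carrier K" "d \<in> carrier K"
  shows "sId (c \<oplus>\<^bsub>K\<^esub> d) A = sId c A \<boxplus> sId d A" "sId (c \<otimes>\<^bsub>K\<^esub> d) A = sId d A \<cdot> sId c A" "sId \<one>\<^bsub>K\<^esub> A = Idt C A"
proof -
  interpret V: vector_space_over K "Hom C A A" by (rule Hom_vector_space[OF A A])
  have i: "Idt C A \<in> Arr C A A" by (rule Idt_closed[OF A])
  have "sId (c \<oplus>\<^bsub>K\<^esub> d) A = sId c A \<oplus>\<^bsub>Hom C A A\<^esub> sId d A" using V.smult_l_distr[OF c i] .
  then show "sId (c \<oplus>\<^bsub>K\<^esub> d) A = sId c A \<boxplus> sId d A" using plus_Hom[OF sId(2)[OF A c(1)]] by simp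
  show "sId \<one>\<^bsub>K\<^esub> A = Idt C A" using V.smult_one[OF i] .
  have "sId (c \<otimes>\<^bsub>K\<^esub> d) A = c \<odot>\<^bsub>Hom C A A\<^esub> sId d A" using V.smult_assoc1[OF c i] .
  also have "\<dots> = c \<star> sId d A" using smult_Hom[OF sId(2)[OF A c(2)]] .
  also have "\<dots> = sId d A \<cdot> sId c A" using sId_Cmp(1)[OF sId(2)[OF A c(2)] c(1)] by simp
  finally show "sId (c \<otimes>\<^bsub>K\<^esub> d) A = sId d A \<cdot> sId c A" .
qed

lemma NT_plus:
  assumes F: "is_presheaf C X F" and G: "is_presheaf C X G" and e: "\<eta> \<in> NT F G" "\<theta> \<in> NT F G"
  shows "ntf F (\<lambda>A x. \<eta> A x \<oplus>\<^bsub>fob G A\<^esub> \<theta> A x) \<in> NT F G"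
proof (rule NT_I[OF _ _ _ F])
  fix A x y assume A: "A \<in> X" and x: "x \<in> el F A"
  interpret G: abelian_group "fob G A" by (rule presheafD(1)[OF G A])
  note n = NT_D[OF e(1) A] NT_D[OF e(2) A]
  show "\<eta> A x \<oplus>\<^bsub>fob G A\<^esub> \<theta> A x \<in> el G A" using n x by simp
  assume y: "y \<in> el F A"
  show "\<eta> A (x \<oplus>\<^bsub>fob F A\<^esub> y) \<oplus>\<^bsub>fob G A\<^esub> \<theta> A (x \<oplus>\<^bsub>fob F A\<^esub> y) =
    (\<eta> A x \<oplus>\<^bsub>fob G A\<^esub> \<theta> A x) \<oplus>\<^bsub>fob G A\<^esub> (\<eta> A y \<oplus>\<^bsub>fob G A\<^esub> \<theta> A y)"
    using n x y by (simp add: G.add.m_ac)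
next
  fix A B f x assume *: "A \<in> X" "B \<in> X" "f \<Colon> A \<rightarrow> B" "x \<in> el F B"
  show "\<eta> A (far F f x) \<oplus>\<^bsub>fob G A\<^esub> \<theta> A (far F f x) = far G f (\<eta> B x \<oplus>\<^bsub>fob G B\<^esub> \<theta> B x)"
    using NT_D(3)[OF e(1) *] NT_D(3)[OF e(2) *] NT_D(1)[OF e(1) *(2,4)] NT_D(1)[OF e(2) *(2,4)] presheafD(3)[OF G *(3,1,2)] by metis
qed

lemma NT_null:
  assumes F: "is_presheaf C X F" and G: "is_presheaf C X G"
  shows "ntf F (\<lambda>A x. \<zero>\<^bsub>fob G A\<^esub>) \<in> NT F G"
proof (rule NT_I[OF _ _ _ F])
  fix A x y assume A: "A \<in> X"
  interpret G: abelian_group "fob G A" by (rule presheafD(1)[OF G A])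
  show "\<zero>\<^bsub>fob G A\<^esub> \<in> el G A" "\<zero>\<^bsub>fob G A\<^esub> = \<zero>\<^bsub>fob G A\<^esub> \<oplus>\<^bsub>fob G A\<^esub> \<zero>\<^bsub>fob G A\<^esub>" by simp_all
next
  fix A B f x assume *: "A \<in> X" "B \<in> X" "f \<Colon> A \<rightarrow> B"
  show "\<zero>\<^bsub>fob G A\<^esub> = far G f \<zero>\<^bsub>fob G B\<^esub>" using far_zero[OF G *(3,1,2)] by simp
qed

lemma NT_neg:
  assumes F: "is_presheaf C X F" and G: "is_presheaf C X G" and e: "\<eta> \<in> NT F G"
  shows "ntf F (\<lambda>A x. \<ominus>\<^bsub>fob G A\<^esub> \<eta> A x) \<in> NT F G"
proof (rule NT_I[OF _ _ _ F])
  fix A x y assume A: "A \<in> X" and x: "x \<in> el F A"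
  interpret G: abelian_group "fob G A" by (rule presheafD(1)[OF G A])
  note n = NT_D[OF e(1) A]
  show "\<ominus>\<^bsub>fob G A\<^esub> \<eta> A x \<in> el G A" using n x by simp
  assume y: "y \<in> el F A"
  show "\<ominus>\<^bsub>fob G A\<^esub> \<eta> A (x \<oplus>\<^bsub>fob F A\<^esub> y) = \<ominus>\<^bsub>fob G A\<^esub> \<eta> A x \<oplus>\<^bsub>fob G A\<^esub> \<ominus>\<^bsub>fob G A\<^esub> \<eta> A y"
    using n x y by (simp add: G.minus_add)
next
  fix A B f x assume *: "A \<in> X" "B \<in> X" "f \<Colon> A \<rightarrow> B" "x \<in> el F B"
  interpret GA: abelian_group "fob G A" by (rule presheafD(1)[OF G *(1)])
  interpret GB: abelian_group "fob G B" by (rule presheafD(1)[OF G *(2)])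
  have c: "\<eta> B x \<in> el G B" by (rule NT_D(1)[OF e *(2,4)])
  have c': "\<ominus>\<^bsub>fob G B\<^esub> \<eta> B x \<in> el G B" using c by simp
  have "far G f (\<ominus>\<^bsub>fob G B\<^esub> \<eta> B x) \<oplus>\<^bsub>fob G A\<^esub> far G f (\<eta> B x) = \<zero>\<^bsub>fob G A\<^esub>"
    using presheafD(3)[OF G *(3,1,2) c' c] far_zero[OF G *(3,1,2)] c by (simp add: GB.l_neg)
  then have "\<ominus>\<^bsub>fob G A\<^esub> far G f (\<eta> B x) = far G f (\<ominus>\<^bsub>fob G B\<^esub> \<eta> B x)"
    by (rule GA.minus_equality) (use presheafD(2)[OF G *(3,1,2)] c c' in simp_all)
  then show "\<ominus>\<^bsub>fob G A\<^esub> \<eta> A (far F f x) = far G f (\<ominus>\<^bsub>fob G B\<^esub> \<eta> B x)" using NT_D(3)[OF e *] by simp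
qed

text \<open>Naturality holds because scalar multiples of identities commute with every
  arrow.\<close>

lemma NT_smult:
  assumes F: "is_presheaf C X F" and G: "is_presheaf C X G" and e: "\<eta> \<in> NT F G" and c: "c \<in> carrier K"
  shows "ntf F (\<lambda>A x. far G (sId c A) (\<eta> A x)) \<in> NT F G"
proof (rule NT_I[OF _ _ _ F])
  fix A x y assume A: "A \<in> X" and x: "x \<in> el F A"
  note n = NT_D[OF e(1) A] and s = sId(2)[OF XO[OF A] c]
  show "far G (sId c A) (\<eta> A x) \<in> el G A" by (rule presheafD(2)[OF G s A A n(1)[OF x]])
  assume y: "y \<in> el F A"
  show "far G (sId c A) (\<eta> A (x \<oplus>\<^bsub>fob F A\<^esub> y)) = far G (sId c A) (\<eta> A x) \<oplus>\<^bsub>fob G A\<^esub> far G (sId c A) (\<eta> A y)"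
    unfolding n(2)[OF x y] by (rule presheafD(3)[OF G s A A n(1)[OF x] n(1)[OF y]])
next
  fix A B f x assume *: "A \<in> X" "B \<in> X" "f \<Colon> A \<rightarrow> B" "x \<in> el F B"
  note sA = sId(2)[OF XO[OF *(1)] c] and sB = sId(2)[OF XO[OF *(2)] c]
  have b: "\<eta> B x \<in> el G B" by (rule NT_D(1)[OF e *(2,4)])
  have "far G (sId c A) (\<eta> A (far F f x)) = far G (f \<cdot> sId c A) (\<eta> B x)"
    unfolding NT_D(3)[OF e *] by (rule presheafD(5)[OF G sA *(3,1,1,2) b, symmetric])
  also have "\<dots> = far G (sId c B \<cdot> f) (\<eta> B x)" using sId_Cmp[OF *(3) c] by simp
  also have "\<dots> = far G f (far G (sId c B) (\<eta> B x))" by (rule presheafD(5)[OF G *(3) sB *(1,2,2) b])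
  finally show "far G (sId c A) (\<eta> A (far F f x)) = far G f (far G (sId c B) (\<eta> B x))" .
qed

lemma NT_comp:
  assumes F: "is_presheaf C X F" and e: "\<eta> \<in> NT F G" "\<theta> \<in> NT G L"
  shows "ntf F (\<lambda>A x. \<theta> A (\<eta> A x)) \<in> NT F L"
proof (rule NT_I[OF _ _ _ F])
  fix A x y assume A: "A \<in> X" and x: "x \<in> el F A"
  note n = NT_D[OF e(1) A] NT_D[OF e(2) A]
  show "\<theta> A (\<eta> A x) \<in> el L A" using n x by simp
  assume y: "y \<in> el F A"
  show "\<theta> A (\<eta> A (x \<oplus>\<^bsub>fob F A\<^esub> y)) = \<theta> A (\<eta> A x) \<oplus>\<^bsub>fob L A\<^esub> \<theta> A (\<eta> A y)" using n x y by simp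
next
  fix A B f x assume *: "A \<in> X" "B \<in> X" "f \<Colon> A \<rightarrow> B" "x \<in> el F B"
  show "\<theta> A (\<eta> A (far F f x)) = far L f (\<theta> B (\<eta> B x))"
    unfolding NT_D(3)[OF e(1) *] by (rule NT_D(3)[OF e(2) *(1,2,3) NT_D(1)[OF e(1) *(2,4)]])
qed

lemma NT_id:
  assumes F: "is_presheaf C X F"
  shows "ntf F (\<lambda>A x. x) \<in> NT F F"
  by (rule NT_I[OF _ _ _ F]) simp_all

section \<open>mod-X as a linear category\<close>

lemma Hom_M_group:
  assumes F: "is_presheaf C X F" and G: "is_presheaf C X G"
  shows "abelian_group (Hom M F G)"
proof (rule abelian_groupI)
  have ca: "ntf F (\<lambda>A x. \<eta> A x \<oplus>\<^bsub>fob G A\<^esub> \<theta> A x) \<in> NT F G" if "\<eta> \<in> NT F G" "\<theta> \<in> NT F G" for \<eta> \<theta>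
    by (rule NT_plus[OF F G that])
  have z: "ntf F (\<lambda>A x. \<zero>\<^bsub>fob G A\<^esub>) \<in> NT F G" by (rule NT_null[OF F G])
  show "x \<oplus>\<^bsub>Hom M F G\<^esub> y \<in> carrier (Hom M F G)" if "x \<in> carrier (Hom M F G)" "y \<in> carrier (Hom M F G)" for x y
    using that ca by (auto simp flip: ntf_def)
  show "\<zero>\<^bsub>Hom M F G\<^esub> \<in> carrier (Hom M F G)" using z by (simp flip: ntf_def)
  fix x assume "x \<in> carrier (Hom M F G)"
  then obtain \<eta> where x: "x = (F, G, \<eta>)" "\<eta> \<in> NT F G" by auto
  note n = NT_D(1)[OF x(2)]
  have "ntf F (\<lambda>A x. ntf F (\<lambda>A x. \<zero>\<^bsub>fob G A\<^esub>) A x \<oplus>\<^bsub>fob G A\<^esub> \<eta> A x) = \<eta>"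
  proof (rule NT_eqI[OF ca[OF z x(2)] x(2)])
    fix A x assume *: "A \<in> X" "x \<in> el F A"
    interpret G: abelian_group "fob G A" by (rule presheafD(1)[OF G *(1)])
    show "ntf F (\<lambda>A x. ntf F (\<lambda>A x. \<zero>\<^bsub>fob G A\<^esub>) A x \<oplus>\<^bsub>fob G A\<^esub> \<eta> A x) A x = \<eta> A x" using * n by simp
  qed
  then show "\<zero>\<^bsub>Hom M F G\<^esub> \<oplus>\<^bsub>Hom M F G\<^esub> x = x" unfolding x by (simp flip: ntf_def)
  have "ntf F (\<lambda>A x. ntf F (\<lambda>A x. \<ominus>\<^bsub>fob G A\<^esub> \<eta> A x) A x \<oplus>\<^bsub>fob G A\<^esub> \<eta> A x) = ntf F (\<lambda>A x. \<zero>\<^bsub>fob G A\<^esub>)"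
  proof (rule NT_eqI[OF ca[OF NT_neg[OF F G x(2)] x(2)] z])
    fix A x assume *: "A \<in> X" "x \<in> el F A"
    interpret G: abelian_group "fob G A" by (rule presheafD(1)[OF G *(1)])
    show "ntf F (\<lambda>A x. ntf F (\<lambda>A x. \<ominus>\<^bsub>fob G A\<^esub> \<eta> A x) A x \<oplus>\<^bsub>fob G A\<^esub> \<eta> A x) A x = ntf F (\<lambda>A x. \<zero>\<^bsub>fob G A\<^esub>) A x"
      using * n by (simp add: G.l_neg)
  qed
  then show "\<exists>y\<in>carrier (Hom M F G). y \<oplus>\<^bsub>Hom M F G\<^esub> x = \<zero>\<^bsub>Hom M F G\<^esub>"
    using NT_neg[OF F G x(2)] unfolding x
    by (intro bexI[of _ "(F, G, ntf F (\<lambda>A x. \<ominus>\<^bsub>fob G A\<^esub> \<eta> A x))"]) (simp_all flip: ntf_def)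
  fix y assume "y \<in> carrier (Hom M F G)"
  then obtain \<theta> where y: "y = (F, G, \<theta>)" "\<theta> \<in> NT F G" by auto
  note n' = NT_D(1)[OF y(2)]
  have "ntf F (\<lambda>A x. \<eta> A x \<oplus>\<^bsub>fob G A\<^esub> \<theta> A x) = ntf F (\<lambda>A x. \<theta> A x \<oplus>\<^bsub>fob G A\<^esub> \<eta> A x)"
  proof (rule NT_eqI[OF ca[OF x(2) y(2)] ca[OF y(2) x(2)]])
    fix A x assume *: "A \<in> X" "x \<in> el F A"
    interpret G: abelian_group "fob G A" by (rule presheafD(1)[OF G *(1)])
    show "ntf F (\<lambda>A x. \<eta> A x \<oplus>\<^bsub>fob G A\<^esub> \<theta> A x) A x = ntf F (\<lambda>A x. \<theta> A x \<oplus>\<^bsub>fob G A\<^esub> \<eta> A x) A x"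
      using * n n' by (simp add: G.add.m_comm)
  qed
  then show "x \<oplus>\<^bsub>Hom M F G\<^esub> y = y \<oplus>\<^bsub>Hom M F G\<^esub> x" unfolding x y by (simp flip: ntf_def)
  fix w assume "w \<in> carrier (Hom M F G)"
  then obtain \<zeta> where w: "w = (F, G, \<zeta>)" "\<zeta> \<in> NT F G" by auto
  note n'' = NT_D(1)[OF w(2)]
  have "ntf F (\<lambda>A x. ntf F (\<lambda>A x. \<eta> A x \<oplus>\<^bsub>fob G A\<^esub> \<theta> A x) A x \<oplus>\<^bsub>fob G A\<^esub> \<zeta> A x) =
    ntf F (\<lambda>A x. \<eta> A x \<oplus>\<^bsub>fob G A\<^esub> ntf F (\<lambda>A x. \<theta> A x \<oplus>\<^bsub>fob G A\<^esub> \<zeta> A x) A x)"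
  proof (rule NT_eqI[OF ca[OF ca[OF x(2) y(2)] w(2)] ca[OF x(2) ca[OF y(2) w(2)]]])
    fix A x assume *: "A \<in> X" "x \<in> el F A"
    interpret G: abelian_group "fob G A" by (rule presheafD(1)[OF G *(1)])
    show "ntf F (\<lambda>A x. ntf F (\<lambda>A x. \<eta> A x \<oplus>\<^bsub>fob G A\<^esub> \<theta> A x) A x \<oplus>\<^bsub>fob G A\<^esub> \<zeta> A x) A x =
      ntf F (\<lambda>A x. \<eta> A x \<oplus>\<^bsub>fob G A\<^esub> ntf F (\<lambda>A x. \<theta> A x \<oplus>\<^bsub>fob G A\<^esub> \<zeta> A x) A x) A x"
      using * n n' n'' by (simp add: G.add.m_assoc)
  qed
  then show "(x \<oplus>\<^bsub>Hom M F G\<^esub> y) \<oplus>\<^bsub>Hom M F G\<^esub> w = x \<oplus>\<^bsub>Hom M F G\<^esub> (y \<oplus>\<^bsub>Hom M F G\<^esub> w)"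
    unfolding x y w by (simp flip: ntf_def)
qed

lemma Hom_M_module:
  assumes F: "coherent C X F" and G: "coherent C X G"
  shows "Module.module K (Hom M F G)"
proof (rule moduleI)
  note F' = coherent_presheaf[OF F] and G' = coherent_presheaf[OF G]
  show "cring K" by unfold_locales
  show "abelian_group (Hom M F G)" by (rule Hom_M_group[OF F' G'])
  have sm: "ntf F (\<lambda>A x. far G (sId c A) (\<eta> A x)) \<in> NT F G" if "\<eta> \<in> NT F G" "c \<in> carrier K" for \<eta> c
    by (rule NT_smult[OF F' G' that])
  have pl: "ntf F (\<lambda>A x. \<eta> A x \<oplus>\<^bsub>fob G A\<^esub> \<theta> A x) \<in> NT F G" if "\<eta> \<in> NT F G" "\<theta> \<in> NT F G" for \<eta> \<theta>
    by (rule NT_plus[OF F' G' that])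
  fix x assume "x \<in> carrier (Hom M F G)"
  then obtain \<eta> where x: "x = (F, G, \<eta>)" "\<eta> \<in> NT F G" by auto
  note n = NT_D(1)[OF x(2)]
  have "ntf F (\<lambda>A x. far G (sId \<one>\<^bsub>K\<^esub> A) (\<eta> A x)) = \<eta>"
  proof (rule NT_eqI[OF sm[OF x(2) one_closed] x(2)])
    fix A x assume *: "A \<in> X" "x \<in> el F A"
    show "ntf F (\<lambda>A x. far G (sId \<one>\<^bsub>K\<^esub> A) (\<eta> A x)) A x = \<eta> A x"
      using * n sId_laws(3)[OF XO[OF *(1)] one_closed one_closed] presheafD(4)[OF G' *(1)] by simp
  qed
  then show "\<one>\<^bsub>K\<^esub> \<odot>\<^bsub>Hom M F G\<^esub> x = x" unfolding x by (simp flip: ntf_def)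
  fix a assume a: "a \<in> carrier K"
  show "a \<odot>\<^bsub>Hom M F G\<^esub> x \<in> carrier (Hom M F G)" unfolding x using sm[OF x(2) a] by (simp flip: ntf_def)
  {
    fix b assume b: "b \<in> carrier K"
    have ab: "a \<oplus>\<^bsub>K\<^esub> b \<in> carrier K" "a \<otimes>\<^bsub>K\<^esub> b \<in> carrier K" using a b by simp_all
    \<comment> \<open>Distributivity over a sum of scalars asks \<open>G\<close> to be additive on
      arrows; coherence of \<open>G\<close> enters at this point.\<close>
    have "ntf F (\<lambda>A x. far G (sId (a \<oplus>\<^bsub>K\<^esub> b) A) (\<eta> A x)) =
      ntf F (\<lambda>A x. ntf F (\<lambda>A x. far G (sId a A) (\<eta> A x)) A x \<oplus>\<^bsub>fob G A\<^esub> ntf F (\<lambda>A x. far G (sId b A) (\<eta> A x)) A x)"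
    proof (rule NT_eqI[OF sm[OF x(2) ab(1)] pl[OF sm[OF x(2) a] sm[OF x(2) b]]])
      fix A x assume *: "A \<in> X" "x \<in> el F A"
      show "ntf F (\<lambda>A x. far G (sId (a \<oplus>\<^bsub>K\<^esub> b) A) (\<eta> A x)) A x =
        ntf F (\<lambda>A x. ntf F (\<lambda>A x. far G (sId a A) (\<eta> A x)) A x \<oplus>\<^bsub>fob G A\<^esub> ntf F (\<lambda>A x. far G (sId b A) (\<eta> A x)) A x) A x"
        using * sId_laws(1)[OF XO[OF *(1)] a b]
          coherent_additive[OF G sId(2)[OF XO[OF *(1)] a] sId(2)[OF XO[OF *(1)] b] *(1,1) n[OF *]] by simp
    qed
    then show "(a \<oplus>\<^bsub>K\<^esub> b) \<odot>\<^bsub>Hom M F G\<^esub> x = a \<odot>\<^bsub>Hom M F G\<^esub> x \<oplus>\<^bsub>Hom M F G\<^esub> b \<odot>\<^bsub>Hom M F G\<^esub> x"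
      unfolding x by (simp flip: ntf_def)
    have "ntf F (\<lambda>A x. far G (sId (a \<otimes>\<^bsub>K\<^esub> b) A) (\<eta> A x)) =
      ntf F (\<lambda>A x. far G (sId a A) (ntf F (\<lambda>A x. far G (sId b A) (\<eta> A x)) A x))"
    proof (rule NT_eqI[OF sm[OF x(2) ab(2)] sm[OF sm[OF x(2) b] a]])
      fix A x assume *: "A \<in> X" "x \<in> el F A"
      show "ntf F (\<lambda>A x. far G (sId (a \<otimes>\<^bsub>K\<^esub> b) A) (\<eta> A x)) A x =
        ntf F (\<lambda>A x. far G (sId a A) (ntf F (\<lambda>A x. far G (sId b A) (\<eta> A x)) A x)) A x"
        using * sId_laws(2)[OF XO[OF *(1)] a b]
          presheafD(5)[OF G' sId(2)[OF XO[OF *(1)] a] sId(2)[OF XO[OF *(1)] b] *(1,1,1) n[OF *]] by simp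
    qed
    then show "(a \<otimes>\<^bsub>K\<^esub> b) \<odot>\<^bsub>Hom M F G\<^esub> x = a \<odot>\<^bsub>Hom M F G\<^esub> (b \<odot>\<^bsub>Hom M F G\<^esub> x)"
      unfolding x by (simp flip: ntf_def)
  }
  fix y assume "y \<in> carrier (Hom M F G)"
  then obtain \<theta> where y: "y = (F, G, \<theta>)" "\<theta> \<in> NT F G" by auto
  note n' = NT_D(1)[OF y(2)]
  have "ntf F (\<lambda>A x. far G (sId a A) (ntf F (\<lambda>A x. \<eta> A x \<oplus>\<^bsub>fob G A\<^esub> \<theta> A x) A x)) =
    ntf F (\<lambda>A x. ntf F (\<lambda>A x. far G (sId a A) (\<eta> A x)) A x \<oplus>\<^bsub>fob G A\<^esub> ntf F (\<lambda>A x. far G (sId a A) (\<theta> A x)) A x)"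
  proof (rule NT_eqI[OF sm[OF pl[OF x(2) y(2)] a] pl[OF sm[OF x(2) a] sm[OF y(2) a]]])
    fix A x assume *: "A \<in> X" "x \<in> el F A"
    show "ntf F (\<lambda>A x. far G (sId a A) (ntf F (\<lambda>A x. \<eta> A x \<oplus>\<^bsub>fob G A\<^esub> \<theta> A x) A x)) A x =
      ntf F (\<lambda>A x. ntf F (\<lambda>A x. far G (sId a A) (\<eta> A x)) A x \<oplus>\<^bsub>fob G A\<^esub> ntf F (\<lambda>A x. far G (sId a A) (\<theta> A x)) A x) A x"
      using * presheafD(3)[OF G' sId(2)[OF XO[OF *(1)] a] *(1,1) n[OF *] n'[OF *]] by simp
  qed
  then show "a \<odot>\<^bsub>Hom M F G\<^esub> (x \<oplus>\<^bsub>Hom M F G\<^esub> y) = a \<odot>\<^bsub>Hom M F G\<^esub> x \<oplus>\<^bsub>Hom M F G\<^esub> a \<odot>\<^bsub>Hom M F G\<^esub> y"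
    unfolding x y by (simp flip: ntf_def)
qed

lemma M_linear: "linear_category K M"
proof (intro linear_category.intro linear_category_axioms.intro)
  show "field K" by unfold_locales
next
  fix A B assume "A \<in> Obj M" "B \<in> Obj M"
  then show "Module.module K (Hom M A B)" by (intro Hom_M_module) simp_all
next
  fix A B f assume "A \<in> Obj M" "B \<in> Obj M" "f \<in> Arr M A B"
  then show "Src M f = A \<and> Tgt M f = B" by auto
next
  fix A assume "A \<in> Obj M"
  then have "is_presheaf C X A" using coherent_presheaf by simp
  from NT_id[OF this] show "Idt M A \<in> Arr M A A" by (simp flip: ntf_def)
next
  fix F G L f g assume "F \<in> Obj M" "G \<in> Obj M" "L \<in> Obj M" "f \<in> Arr M F G" "g \<in> Arr M G L"
  then obtain \<eta> \<theta> where *: "f = (F, G, \<eta>)" "\<eta> \<in> NT F G" "g = (G, L, \<theta>)" "\<theta> \<in> NT G L" "is_presheaf C X F"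
    using coherent_presheaf by auto
  show "g \<cdot>\<^bsub>M\<^esub> f \<in> Arr M F L" unfolding * using NT_comp[OF *(5,2,4)] by (simp flip: ntf_def)
next
  fix F G f assume "F \<in> Obj M" "G \<in> Obj M" "f \<in> Arr M F G"
  then obtain \<eta> where *: "f = (F, G, \<eta>)" "\<eta> \<in> NT F G" "is_presheaf C X F" "is_presheaf C X G"
    using coherent_presheaf by auto
  have "ntf F (\<lambda>A x. \<eta> A (ntf F (\<lambda>A x. x) A x)) = \<eta>"
    by (rule NT_eqI[OF NT_comp[OF *(3) NT_id[OF *(3)] *(2)] *(2)]) simp
  then show "f \<cdot>\<^bsub>M\<^esub> Idt M F = f" unfolding * by (simp flip: ntf_def)
  have "ntf F (\<lambda>A x. ntf G (\<lambda>A x. x) A (\<eta> A x)) = \<eta>"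
    by (rule NT_eqI[OF NT_comp[OF *(3) *(2) NT_id[OF *(4)]] *(2)]) (simp add: NT_D(1)[OF *(2)])
  then show "Idt M G \<cdot>\<^bsub>M\<^esub> f = f" unfolding * by (simp flip: ntf_def)
next
  fix F G L N f g h assume "F \<in> Obj M" "G \<in> Obj M" "L \<in> Obj M" "N \<in> Obj M" "f \<in> Arr M F G" "g \<in> Arr M G L" "h \<in> Arr M L N"
  then obtain \<eta> \<theta> \<zeta> where *: "f = (F, G, \<eta>)" "\<eta> \<in> NT F G" "g = (G, L, \<theta>)" "\<theta> \<in> NT G L" "h = (L, N, \<zeta>)" "\<zeta> \<in> NT L N"
    and F: "is_presheaf C X F" and G: "is_presheaf C X G" using coherent_presheaf by auto
  have "ntf F (\<lambda>A x. ntf G (\<lambda>A x. \<zeta> A (\<theta> A x)) A (\<eta> A x)) = ntf F (\<lambda>A x. \<zeta> A (ntf F (\<lambda>A x. \<theta> A (\<eta> A x)) A x))"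
    by (rule NT_eqI[OF NT_comp[OF F *(2) NT_comp[OF G *(4,6)]] NT_comp[OF F NT_comp[OF F *(2,4)] *(6)]])
      (simp add: NT_D(1)[OF *(2)])
  then show "(h \<cdot>\<^bsub>M\<^esub> g) \<cdot>\<^bsub>M\<^esub> f = h \<cdot>\<^bsub>M\<^esub> (g \<cdot>\<^bsub>M\<^esub> f)" unfolding * by (simp flip: ntf_def)
next
  fix F G L g assume O: "F \<in> Obj M" "G \<in> Obj M" "L \<in> Obj M" and g: "g \<in> Arr M G L"
  then obtain \<theta> where g: "g = (G, L, \<theta>)" "\<theta> \<in> NT G L" by auto
  have F: "is_presheaf C X F" and G: "is_presheaf C X G" and L: "is_presheaf C X L" using O coherent_presheaf by simp_all
  show "(\<lambda>f. g \<cdot>\<^bsub>M\<^esub> f) \<in> linear_maps K (Hom M F G) (Hom M F L)"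
    unfolding linear_maps_def
  proof (intro CollectI conjI ballI Pi_I)
    fix x assume "x \<in> Arr M F G"
    then obtain \<eta> where x: "x = (F, G, \<eta>)" "\<eta> \<in> NT F G" by auto
    note n = NT_D(1)[OF x(2)]
    show "g \<cdot>\<^bsub>M\<^esub> x \<in> Arr M F L" unfolding g x using NT_comp[OF F x(2) g(2)] by (simp flip: ntf_def)
    {
      fix y assume "y \<in> Arr M F G"
      then obtain \<zeta> where y: "y = (F, G, \<zeta>)" "\<zeta> \<in> NT F G" by auto
      note n' = NT_D(1)[OF y(2)]
      have "ntf F (\<lambda>A x. \<theta> A (ntf F (\<lambda>A x. \<eta> A x \<oplus>\<^bsub>fob G A\<^esub> \<zeta> A x) A x)) =
        ntf F (\<lambda>A x. ntf F (\<lambda>A x. \<theta> A (\<eta> A x)) A x \<oplus>\<^bsub>fob L A\<^esub> ntf F (\<lambda>A x. \<theta> A (\<zeta> A x)) A x)"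
        by (rule NT_eqI[OF NT_comp[OF F NT_plus[OF F G x(2) y(2)] g(2)] NT_plus[OF F L NT_comp[OF F x(2) g(2)] NT_comp[OF F y(2) g(2)]]])
          (simp add: NT_D(2)[OF g(2)] n n')
      then show "g \<cdot>\<^bsub>M\<^esub> (x \<oplus>\<^bsub>Hom M F G\<^esub> y) = g \<cdot>\<^bsub>M\<^esub> x \<oplus>\<^bsub>Hom M F L\<^esub> g \<cdot>\<^bsub>M\<^esub> y" unfolding g x y by (simp flip: ntf_def)
    }
    fix c assume c: "c \<in> carrier K"
    have "ntf F (\<lambda>A x. \<theta> A (ntf F (\<lambda>A x. far G (sId c A) (\<eta> A x)) A x)) =
      ntf F (\<lambda>A x. far L (sId c A) (ntf F (\<lambda>A x. \<theta> A (\<eta> A x)) A x))"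
    proof (rule NT_eqI[OF NT_comp[OF F NT_smult[OF F G x(2) c] g(2)] NT_smult[OF F L NT_comp[OF F x(2) g(2)] c]])
      fix A x assume *: "A \<in> X" "x \<in> el F A"
      show "ntf F (\<lambda>A x. \<theta> A (ntf F (\<lambda>A x. far G (sId c A) (\<eta> A x)) A x)) A x =
        ntf F (\<lambda>A x. far L (sId c A) (ntf F (\<lambda>A x. \<theta> A (\<eta> A x)) A x)) A x"
        using * NT_D(3)[OF g(2) *(1,1) sId(2)[OF XO[OF *(1)] c] n[OF *]] by simp
    qed
    then show "g \<cdot>\<^bsub>M\<^esub> (c \<odot>\<^bsub>Hom M F G\<^esub> x) = c \<odot>\<^bsub>Hom M F L\<^esub> (g \<cdot>\<^bsub>M\<^esub> x)" unfolding g x by (simp flip: ntf_def)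
  qed
next
  fix F G L f assume O: "F \<in> Obj M" "G \<in> Obj M" "L \<in> Obj M" and f: "f \<in> Arr M F G"
  then obtain \<eta> where f: "f = (F, G, \<eta>)" "\<eta> \<in> NT F G" by auto
  have F: "is_presheaf C X F" and G: "is_presheaf C X G" and L: "is_presheaf C X L" using O coherent_presheaf by simp_all
  note n = NT_D(1)[OF f(2)]
  show "(\<lambda>g. g \<cdot>\<^bsub>M\<^esub> f) \<in> linear_maps K (Hom M G L) (Hom M F L)"
    unfolding linear_maps_def
  proof (intro CollectI conjI ballI Pi_I)
    fix x assume "x \<in> Arr M G L"
    then obtain \<theta> where x: "x = (G, L, \<theta>)" "\<theta> \<in> NT G L" by auto
    show "x \<cdot>\<^bsub>M\<^esub> f \<in> Arr M F L" unfolding f x using NT_comp[OF F f(2) x(2)] by (simp flip: ntf_def)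
    {
      fix y assume "y \<in> Arr M G L"
      then obtain \<zeta> where y: "y = (G, L, \<zeta>)" "\<zeta> \<in> NT G L" by auto
      have "ntf F (\<lambda>A x. ntf G (\<lambda>A x. \<theta> A x \<oplus>\<^bsub>fob L A\<^esub> \<zeta> A x) A (\<eta> A x)) =
        ntf F (\<lambda>A x. ntf F (\<lambda>A x. \<theta> A (\<eta> A x)) A x \<oplus>\<^bsub>fob L A\<^esub> ntf F (\<lambda>A x. \<zeta> A (\<eta> A x)) A x)"
        by (rule NT_eqI[OF NT_comp[OF F f(2) NT_plus[OF G L x(2) y(2)]] NT_plus[OF F L NT_comp[OF F f(2) x(2)] NT_comp[OF F f(2) y(2)]]])
          (simp add: n)
      then show "(x \<oplus>\<^bsub>Hom M G L\<^esub> y) \<cdot>\<^bsub>M\<^esub> f = x \<cdot>\<^bsub>M\<^esub> f \<oplus>\<^bsub>Hom M F L\<^esub> y \<cdot>\<^bsub>M\<^esub> f" unfolding f x y by (simp flip: ntf_def)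
    }
    fix c assume c: "c \<in> carrier K"
    have "ntf F (\<lambda>A x. ntf G (\<lambda>A x. far L (sId c A) (\<theta> A x)) A (\<eta> A x)) =
      ntf F (\<lambda>A x. far L (sId c A) (ntf F (\<lambda>A x. \<theta> A (\<eta> A x)) A x))"
      by (rule NT_eqI[OF NT_comp[OF F f(2) NT_smult[OF G L x(2) c]] NT_smult[OF F L NT_comp[OF F f(2) x(2)] c]])
        (simp add: n)
    then show "(c \<odot>\<^bsub>Hom M G L\<^esub> x) \<cdot>\<^bsub>M\<^esub> f = c \<odot>\<^bsub>Hom M F L\<^esub> (x \<cdot>\<^bsub>M\<^esub> f)" unfolding f x by (simp flip: ntf_def)
  qed
qed

end

section \<open>The restricted Yoneda functor\<close>

context presheaf_setting begin

abbreviation hp :: "'o \<Rightarrow> ('o, 'm) presheaf"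
  where "hp A \<equiv> hom_presheaf C A"

abbreviation HF :: "('o, 'm, ('o, 'm) presheaf, ('o, 'm) presheaf \<times> ('o, 'm) presheaf \<times> ('o \<Rightarrow> 'm \<Rightarrow> 'm)) funct"
  where "HF \<equiv> H_functor C X"

definition Hn :: "'m \<Rightarrow> 'o \<Rightarrow> 'm \<Rightarrow> 'm"
  where "Hn f = ntf (hp (Src C f)) (\<lambda>A x. f \<cdot> x)"

lemma HF_simps [simp]: "fob HF A = hp A" "far HF f = (hp (Src C f), hp (Tgt C f), Hn f)"
  by (simp_all add: H_functor_def Hn_def ntf_def)

lemma far_HF: "f \<Colon> A \<rightarrow> B \<Longrightarrow> far HF f = (hp A, hp B, Hn f)"
  by simp

lemma M_ops:
  "nul\<^bsub>M\<^esub> F G = (F, G, ntf F (\<lambda>A x. \<zero>\<^bsub>fob G A\<^esub>))"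
  "(F1, G1, \<eta>) \<oplus>\<^bsub>Hom M F G\<^esub> (F2, G2, \<theta>) = (F, G, ntf F (\<lambda>A x. \<eta> A x \<oplus>\<^bsub>fob G A\<^esub> \<theta> A x))"
  "c \<odot>\<^bsub>Hom M F G\<^esub> (F1, G1, \<eta>) = (F, G, ntf F (\<lambda>A x. far G (sId c A) (\<eta> A x)))"
  "Idt M F = (F, F, ntf F (\<lambda>A x. x))"
  "(G1, G2, \<theta>) \<cdot>\<^bsub>M\<^esub> (F1, F2, \<eta>) = (F1, G2, ntf F1 (\<lambda>A x. \<theta> A (\<eta> A x)))"
  by (simp_all add: ntf_def)

lemma Hn_apply: "f \<Colon> A \<rightarrow> B \<Longrightarrow> E \<in> X \<Longrightarrow> x \<Colon> E \<rightarrow> A \<Longrightarrow> Hn f E x = f \<cdot> x"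
  unfolding Hn_def using ArrI[of x E A] by simp

lemma hp_presheaf:
  assumes A: "A \<in> Obj C"
  shows "is_presheaf C X (hp A)"
  unfolding is_presheaf_def
proof (intro conjI ballI)
  fix B assume B: "B \<in> X"
  show "abelian_group (fob (hp A) B)"
    unfolding hom_presheaf_def using abelian_group_truncate[OF Hom_group[of B A]] A B by simp
  fix x assume "x \<in> el (hp A) B"
  then have "x \<Colon> B \<rightarrow> A" using ArrD[of x B A] A B by simp
  then show "far (hp A) (Idt C B) x = x" by simp
next
  fix B E f assume B: "B \<in> X" "E \<in> X" and f: "f \<in> Arr C B E"
  have O: "B \<in> Obj C" "E \<in> Obj C" using B by simp_all
  show "far (hp A) f \<in> hom (add_monoid (fob (hp A) E)) (add_monoid (fob (hp A) B))"
    unfolding hom_add_iff using Cmp_linear_left[OF O A f] unfolding linear_maps_def by auto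
next
  fix B E G f g x assume B: "B \<in> X" "E \<in> X" "G \<in> X" "f \<in> Arr C B E" "g \<in> Arr C E G" "x \<in> el (hp A) G"
  then have "f \<Colon> B \<rightarrow> E" "g \<Colon> E \<rightarrow> G" "x \<Colon> G \<rightarrow> A" using ArrD A XO by simp_all
  then show "far (hp A) (g \<cdot> f) x = far (hp A) f (far (hp A) g x)" by simp
qed

lemma Hn_NT:
  assumes f: "f \<Colon> A \<rightarrow> B"
  shows "Hn f \<in> NT (hp A) (hp B)"
proof -
  have S: "Src C f = A" and O: "A \<in> Obj C" "B \<in> Obj C" using f by simp_all
  show ?thesis unfolding Hn_def S
  proof (rule NT_I[OF _ _ _ hp_presheaf[OF O(1)]])
    fix E x y assume E: "E \<in> X" and x: "x \<in> el (hp A) E"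
    have l: "(\<lambda>x. f \<cdot> x) \<in> linear_maps K (Hom C E A) (Hom C E B)"
      by (rule Cmp_linear_right[OF XO[OF E] O ArrI[OF f]])
    then show "f \<cdot> x \<in> el (hp B) E" using x unfolding linear_maps_def by auto
    assume "y \<in> el (hp A) E"
    then show "f \<cdot> (x \<oplus>\<^bsub>fob (hp A) E\<^esub> y) = f \<cdot> x \<oplus>\<^bsub>fob (hp B) E\<^esub> f \<cdot> y"
      using l x unfolding linear_maps_def by simp
  next
    fix E G g x assume *: "E \<in> X" "G \<in> X" "g \<Colon> E \<rightarrow> G" "x \<in> el (hp A) G"
    then have "x \<Colon> G \<rightarrow> A" using ArrD[of x G A] O by simp
    then show "f \<cdot> far (hp A) g x = far (hp B) g (f \<cdot> x)" using *(3) f by simp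
  qed
qed

lemma NT_hp_eqI:
  assumes "\<eta> \<in> NT (hp A) G" "\<theta> \<in> NT (hp A) G" "A \<in> Obj C"
    and "\<And>E x. E \<in> X \<Longrightarrow> x \<Colon> E \<rightarrow> A \<Longrightarrow> \<eta> E x = \<theta> E x"
  shows "\<eta> = \<theta>"
proof (rule NT_eqI[OF assms(1,2)])
  fix E x assume E: "E \<in> X" "x \<in> el (hp A) E"
  then have "x \<Colon> E \<rightarrow> A" using ArrD[of x E A] assms(3) by simp
  then show "\<eta> E x = \<theta> E x" by (rule assms(4)[OF E(1)])
qed

lemma HF_linear:
  assumes co: "\<And>A. A \<in> Obj C \<Longrightarrow> coherent C X (hp A)"
  shows "linear_functor K C M HF"
  unfolding linear_functor_def
proof (intro conjI ballI)
  fix A assume "A \<in> Obj C"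
  then show "fob HF A \<in> Obj M" using co by simp
next
  fix A B assume O: "A \<in> Obj C" "B \<in> Obj C"
  note pA = hp_presheaf[OF O(1)] and pB = hp_presheaf[OF O(2)]
  show "far HF \<in> linear_maps K (Hom C A B) (Hom M (fob HF A) (fob HF B))"
    unfolding linear_maps_def
  proof (intro CollectI conjI ballI Pi_I)
    fix f assume "f \<in> Arr C A B"
    then have f: "f \<Colon> A \<rightarrow> B" using ArrD O by blast
    show "far HF f \<in> Arr M (fob HF A) (fob HF B)" using Hn_NT[OF f] f by simp
    {
      fix g assume "g \<in> Arr C A B"
      then have g: "g \<Colon> A \<rightarrow> B" using ArrD O by blast
      have fg: "f \<boxplus> g \<Colon> A \<rightarrow> B" using f g by simp
      have "Hn (f \<boxplus> g) = ntf (hp A) (\<lambda>E x. Hn f E x \<oplus>\<^bsub>fob (hp B) E\<^esub> Hn g E x)"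
      proof (rule NT_hp_eqI[OF Hn_NT[OF fg] NT_plus[OF pA pB Hn_NT[OF f] Hn_NT[OF g]] O(1)])
        fix E x assume E: "E \<in> X" and x: "x \<Colon> E \<rightarrow> A"
        have fx: "f \<cdot> x \<Colon> E \<rightarrow> B" using f x by simp
        have "Hn (f \<boxplus> g) E x = f \<cdot> x \<boxplus> g \<cdot> x" unfolding Hn_apply[OF fg E x] using f g x by (simp add: Cmp_distrib)
        then show "Hn (f \<boxplus> g) E x = ntf (hp A) (\<lambda>E x. Hn f E x \<oplus>\<^bsub>fob (hp B) E\<^esub> Hn g E x) E x"
          using E ArrI[OF x] by (simp add: Hn_apply[OF f E x] Hn_apply[OF g E x] plus_Hom[OF fx])
      qed
      then show "far HF (f \<oplus>\<^bsub>Hom C A B\<^esub> g) = far HF f \<oplus>\<^bsub>Hom M (fob HF A) (fob HF B)\<^esub> far HF g"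
        unfolding plus_Hom[OF f] by (simp only: far_HF[OF fg] far_HF[OF f] far_HF[OF g] HF_simps(1) M_ops)
    }
    fix c assume c: "c \<in> carrier K"
    have cf: "c \<star> f \<Colon> A \<rightarrow> B" using f c by simp
    have "Hn (c \<star> f) = ntf (hp A) (\<lambda>E x. far (hp B) (sId c E) (Hn f E x))"
    proof (rule NT_hp_eqI[OF Hn_NT[OF cf] NT_smult[OF pA pB Hn_NT[OF f] c] O(1)])
      fix E x assume E: "E \<in> X" and x: "x \<Colon> E \<rightarrow> A"
      have fx: "f \<cdot> x \<Colon> E \<rightarrow> B" using f x by simp
      have "Hn (c \<star> f) E x = c \<star> (f \<cdot> x)" unfolding Hn_apply[OF cf E x] using f x c by (simp add: Cmp_smult_left)
      then show "Hn (c \<star> f) E x = ntf (hp A) (\<lambda>E x. far (hp B) (sId c E) (Hn f E x)) E x"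
        using E ArrI[OF x] sId_Cmp(1)[OF fx c] by (simp add: Hn_apply[OF f E x])
    qed
    then show "far HF (c \<odot>\<^bsub>Hom C A B\<^esub> f) = c \<odot>\<^bsub>Hom M (fob HF A) (fob HF B)\<^esub> far HF f"
      unfolding smult_Hom[OF f] by (simp only: far_HF[OF cf] far_HF[OF f] HF_simps(1) M_ops)
  qed
next
  fix A assume O: "A \<in> Obj C"
  have i: "Idt C A \<Colon> A \<rightarrow> A" using O by simp
  have "Hn (Idt C A) = ntf (hp A) (\<lambda>E x. x)"
  proof (rule NT_hp_eqI[OF Hn_NT[OF i] NT_id[OF hp_presheaf[OF O]] O])
    fix E x assume E: "E \<in> X" and x: "x \<Colon> E \<rightarrow> A"
    show "Hn (Idt C A) E x = ntf (hp A) (\<lambda>E x. x) E x" unfolding Hn_apply[OF i E x] using E x ArrI[OF x] by simp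
  qed
  then show "far HF (Idt C A) = Idt M (fob HF A)" by (simp only: far_HF[OF i] HF_simps(1) M_ops)
next
  fix A B E f g assume O: "A \<in> Obj C" "B \<in> Obj C" "E \<in> Obj C" and "f \<in> Arr C A B" "g \<in> Arr C B E"
  then have t: "f \<Colon> A \<rightarrow> B" "g \<Colon> B \<rightarrow> E" using ArrD by blast+
  have gf: "g \<cdot> f \<Colon> A \<rightarrow> E" using t by simp
  have "Hn (g \<cdot> f) = ntf (hp A) (\<lambda>G x. Hn g G (Hn f G x))"
  proof (rule NT_hp_eqI[OF Hn_NT[OF gf] NT_comp[OF hp_presheaf[OF O(1)] Hn_NT[OF t(1)] Hn_NT[OF t(2)]] O(1)])
    fix G x assume G: "G \<in> X" and x: "x \<Colon> G \<rightarrow> A"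
    have fx: "f \<cdot> x \<Colon> G \<rightarrow> B" using t x by simp
    show "Hn (g \<cdot> f) G x = ntf (hp A) (\<lambda>G x. Hn g G (Hn f G x)) G x"
      using G t x ArrI[OF x] by (simp add: Hn_apply[OF gf G x] Hn_apply[OF t(1) G x] Hn_apply[OF t(2) G fx])
  qed
  then show "far HF (g \<cdot> f) = far HF g \<cdot>\<^bsub>M\<^esub> far HF f" by (simp only: far_HF[OF gf] far_HF[OF t(1)] far_HF[OF t(2)] M_ops)
qed

lemma yoneda:
  assumes Z: "Z \<in> X" and B: "B \<in> Obj C" and e: "\<eta> \<in> NT (hp Z) (hp B)"
  obtains f where "f \<Colon> Z \<rightarrow> B" "\<eta> = Hn f"
proof -
  have i: "Idt C Z \<in> el (hp Z) Z" unfolding hom_presheaf_simps by (rule Idt_closed[OF XO[OF Z]])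
  define f where "f = \<eta> Z (Idt C Z)"
  have "f \<in> Arr C Z B" unfolding f_def using NT_D(1)[OF e Z i] by simp
  then have f: "f \<Colon> Z \<rightarrow> B" using ArrD Z B XO by blast
  have "\<eta> = Hn f"
  proof (rule NT_hp_eqI[OF e Hn_NT[OF f] XO[OF Z]])
    fix E x assume E: "E \<in> X" and x: "x \<Colon> E \<rightarrow> Z"
    show "\<eta> E x = Hn f E x"
      unfolding Hn_apply[OF f E x] using NT_D(3)[OF e E Z x i] x unfolding f_def by simp
  qed
  then show thesis using that f by blast
qed

lemma NT_bij_iso:
  assumes F: "is_presheaf C X F" and G: "is_presheaf C X G" and e: "\<eta> \<in> NT F G"
    and b: "\<And>A. A \<in> X \<Longrightarrow> bij_betw (\<eta> A) (el F A) (el G A)"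
  shows "is_iso M F G (F, G, \<eta>)"
proof -
  define h where "h A = inv_into (el F A) (\<eta> A)" for A
  have h: "h A x \<in> el F A" "\<eta> A (h A x) = x" if "A \<in> X" "x \<in> el G A" for A x
    using b[OF that(1)] that(2) unfolding h_def bij_betw_def by (metis inv_into_into, metis f_inv_into_f)
  have h': "h A (\<eta> A x) = x" if "A \<in> X" "x \<in> el F A" for A x
    using b[OF that(1)] that(2) unfolding h_def bij_betw_def by (metis inv_into_f_f)
  have inj: "x = y" if "A \<in> X" "x \<in> el F A" "y \<in> el F A" "\<eta> A x = \<eta> A y" for A x y
    using b[OF that(1)] that unfolding bij_betw_def inj_on_def by blast
  have t: "ntf G h \<in> NT G F"
  proof (rule NT_I[OF _ _ _ G])
    fix A x y assume A: "A \<in> X" and x: "x \<in> el G A"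
    show "h A x \<in> el F A" using h A x by blast
    assume y: "y \<in> el G A"
    interpret F: abelian_group "fob F A" by (rule presheafD(1)[OF F A])
    interpret G: abelian_group "fob G A" by (rule presheafD(1)[OF G A])
    show "h A (x \<oplus>\<^bsub>fob G A\<^esub> y) = h A x \<oplus>\<^bsub>fob F A\<^esub> h A y"
      by (rule inj[OF A]) (use h[OF A] x y NT_D(2)[OF e A] in simp_all)
  next
    fix A B f x assume *: "A \<in> X" "B \<in> X" "f \<Colon> A \<rightarrow> B" "x \<in> el G B"
    show "h A (far G f x) = far F f (h B x)"
    proof (rule inj[OF *(1)])
      have c: "far G f x \<in> el G A" by (rule presheafD(2)[OF G *(3,1,2,4)])
      show "h A (far G f x) \<in> el F A" by (rule h(1)[OF *(1) c])
      show "far F f (h B x) \<in> el F A" by (rule presheafD(2)[OF F *(3,1,2) h(1)[OF *(2,4)]])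
      show "\<eta> A (h A (far G f x)) = \<eta> A (far F f (h B x))"
        using h(2)[OF *(1) c] NT_D(3)[OF e *(1,2,3) h(1)[OF *(2,4)]] h(2)[OF *(2,4)] by simp
    qed
  qed
  have 1: "ntf F (\<lambda>A x. ntf G h A (\<eta> A x)) = ntf F (\<lambda>A x. x)"
    by (rule NT_eqI[OF NT_comp[OF F e t] NT_id[OF F]]) (use h' NT_D(1)[OF e] in simp)
  have 2: "ntf G (\<lambda>A x. \<eta> A (ntf G h A x)) = ntf G (\<lambda>A x. x)"
    by (rule NT_eqI[OF NT_comp[OF G t e] NT_id[OF G]]) (use h in simp)
  show ?thesis unfolding is_iso_def
    by (intro conjI bexI[of _ "(G, F, ntf G h)"]) (use e t 1 2 in \<open>simp_all flip: ntf_def\<close>)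
qed

end

section \<open>Coherence, density and fullness of the restricted Yoneda functor\<close>

locale rigid_setting = triang K T
  for K :: "('k, 'r) ring_scheme" and T :: "('k, 'o, 'm, 'z) tcat_scheme" (structure) +
  fixes X :: "'o set"
  assumes X_sub: "subcategory T X" and X_cfin: "contravariantly_finite T X" and X_rig: "rigid T X"
begin

sublocale presheaf_setting K T X
  by unfold_locales (use X_sub in \<open>simp only: subcategory_def\<close>)

lemma rigid_null: "Z \<in> X \<Longrightarrow> Z' \<in> X \<Longrightarrow> hom_null Z (shob T Z')"
  using X_rig Arr_null_iff[of Z "shob T Z'", folded hom_null_def] unfolding rigid_def by simp

lemma X_approx:
  assumes A: "A \<in> Obj T"
  obtains X0 p where "X0 \<in> X" "p \<Colon> X0 \<rightarrow> A" "\<And>Z z. Z \<in> X \<Longrightarrow> z \<Colon> Z \<rightarrow> A \<Longrightarrow> \<exists>y. y \<Colon> Z \<rightarrow> X0 \<and> p \<cdot> y = z"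
proof -
  obtain X0 p where p: "X0 \<in> X" "p \<in> Arr T X0 A" "\<forall>X'\<in>X. (\<lambda>h. p \<cdot> h) ` Arr T X' X0 = Arr T X' A"
    using X_cfin assms unfolding contravariantly_finite_def by blast
  show thesis
  proof (rule that[OF p(1) ArrD[OF p(2) XO[OF p(1)] A]])
    fix Z z assume z: "Z \<in> X" "z \<Colon> Z \<rightarrow> A"
    have "z \<in> (\<lambda>h. p \<cdot> h) ` Arr T Z X0" using p(3) z(1) ArrI[OF z(2)] by simp
    then obtain y where y: "y \<in> Arr T Z X0" "z = p \<cdot> y" by blast
    from ArrD[OF y(1) XO[OF z(1)] XO[OF p(1)]] show "\<exists>y. y \<Colon> Z \<rightarrow> X0 \<and> p \<cdot> y = z" using y(2) by blast
  qed
qed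

text \<open>An approximation of \<open>A\<close> gives the generators, and an approximation of its
  cocone the relations.\<close>

lemma hp_coherent:
  assumes A: "A \<in> Obj T"
  shows "coherent T X (hp A)"
proof -
  obtain X0 p where p: "X0 \<in> X" "p \<Colon> X0 \<rightarrow> A" "\<And>Z z. Z \<in> X \<Longrightarrow> z \<Colon> Z \<rightarrow> A \<Longrightarrow> \<exists>y. y \<Colon> Z \<rightarrow> X0 \<and> p \<cdot> y = z"
    using X_approx[OF A] by blast
  obtain W b d where tr: "(W, X0, A, b, p, d) \<in> Tri T" using tri_complete_mid[OF p(2)] .
  note t = triD[OF tr]
  have WO: "W \<in> Obj T" using t by simp
  obtain X1 q where q: "X1 \<in> X" "q \<Colon> X1 \<rightarrow> W" "\<And>Z z. Z \<in> X \<Longrightarrow> z \<Colon> Z \<rightarrow> W \<Longrightarrow> \<exists>y. y \<Colon> Z \<rightarrow> X1 \<and> q \<cdot> y = z"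
    using X_approx[OF WO] by blast
  have bq: "b \<cdot> q \<Colon> X1 \<rightarrow> X0" using t q by simp
  have 1: "Hn (b \<cdot> q) E ` Arr T E X1 = a_kernel (Hom T E X0) (fob (hp A) E) (Hn p E)" if E: "E \<in> X" for E
    unfolding a_kernel_def'
  proof (intro equalityI subsetI)
    fix y assume "y \<in> Hn (b \<cdot> q) E ` Arr T E X1"
    then obtain x where x: "x \<in> Arr T E X1" "y = Hn (b \<cdot> q) E x" by blast
    have x': "x \<Colon> E \<rightarrow> X1" using ArrD[OF x(1)] E q(1) by simp
    have y: "y = b \<cdot> (q \<cdot> x)" unfolding x(2) Hn_apply[OF bq E x'] using x' q t by simp
    have y': "y \<Colon> E \<rightarrow> X0" unfolding y using x' q(2) t by simp
    have "p \<cdot> y = nul E A" unfolding y using Cmp_eq_Cmp[OF tri_zero1[OF tr], of "q \<cdot> x"] x' q(2) t by simp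
    then show "y \<in> {x \<in> carrier (Hom T E X0). Hn p E x = \<zero>\<^bsub>fob (hp A) E\<^esub>}"
      using ArrI[OF y'] Hn_apply[OF p(2) E y'] by simp
  next
    fix y assume "y \<in> {x \<in> carrier (Hom T E X0). Hn p E x = \<zero>\<^bsub>fob (hp A) E\<^esub>}"
    then have y: "y \<in> Arr T E X0" "Hn p E y = nul E A" by simp_all
    have y': "y \<Colon> E \<rightarrow> X0" using ArrD[OF y(1)] E p(1) by simp
    have "p \<cdot> y = nul E A" using y(2) Hn_apply[OF p(2) E y'] by simp
    from tri_ex1[OF tr y' this] obtain w where w: "w \<Colon> E \<rightarrow> W" "b \<cdot> w = y" .
    obtain x where x: "x \<Colon> E \<rightarrow> X1" "q \<cdot> x = w" using q(3)[OF E w(1)] by blast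
    have "Hn (b \<cdot> q) E x = b \<cdot> (q \<cdot> x)" unfolding Hn_apply[OF bq E x(1)] using x(1) q(2) t by simp
    then have "y = Hn (b \<cdot> q) E x" unfolding x(2) w(2) by simp
    then show "y \<in> Hn (b \<cdot> q) E ` Arr T E X1" using ArrI[OF x(1)] by blast
  qed
  have 2: "Hn p E ` Arr T E X0 = el (hp A) E" if E: "E \<in> X" for E
  proof (intro equalityI subsetI)
    fix y assume "y \<in> Hn p E ` Arr T E X0"
    then show "y \<in> el (hp A) E" using NT_D(1)[OF Hn_NT[OF p(2)] E] by auto
  next
    fix y assume "y \<in> el (hp A) E"
    then have y: "y \<Colon> E \<rightarrow> A" using ArrD[of y E A] A E by simp
    obtain x where x: "x \<Colon> E \<rightarrow> X0" "p \<cdot> x = y" using p(3)[OF E y] by blast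
    then have "y = Hn p E x" using Hn_apply[OF p(2) E x(1)] by simp
    then show "y \<in> Hn p E ` Arr T E X0" using ArrI[OF x(1)] by blast
  qed
  show ?thesis unfolding coherent_def
    using hp_presheaf[OF A] p(1) q(1) Hn_NT[OF bq] Hn_NT[OF p(2)] 1 2 by blast
qed

lemma HF_functor: "linear_functor K T M HF"
  by (rule HF_linear[OF hp_coherent])

lemma HF_ghost:
  assumes f: "f \<Colon> A \<rightarrow> B"
  shows "far HF f = nul\<^bsub>M\<^esub> (fob HF A) (fob HF B) \<longleftrightarrow> f \<in> ghosts T X A B"
proof -
  have O: "A \<in> Obj T" "B \<in> Obj T" using f by simp_all
  have z: "ntf (hp A) (\<lambda>E x. \<zero>\<^bsub>fob (hp B) E\<^esub>) \<in> NT (hp A) (hp B)" by (rule NT_null[OF hp_presheaf hp_presheaf]) (use O in simp_all)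
  have "far HF f = nul\<^bsub>M\<^esub> (fob HF A) (fob HF B) \<longleftrightarrow> Hn f = ntf (hp A) (\<lambda>E x. \<zero>\<^bsub>fob (hp B) E\<^esub>)"
    by (simp only: far_HF[OF f] HF_simps(1) M_ops prod.inject simp_thms)
  also have "\<dots> \<longleftrightarrow> f \<in> ghosts T X A B"
  proof
    assume l: "Hn f = ntf (hp A) (\<lambda>E x. \<zero>\<^bsub>fob (hp B) E\<^esub>)"
    show "f \<in> ghosts T X A B" unfolding ghosts_def
    proof (intro CollectI conjI ballI ArrI[OF f])
      fix E x assume E: "E \<in> X" "x \<in> Arr T E A"
      have x: "x \<Colon> E \<rightarrow> A" using ArrD[OF E(2)] E(1) O by simp
      show "f \<cdot> x = nul E B" using Hn_apply[OF f E(1) x] unfolding l using E by simp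
    qed
  next
    assume r: "f \<in> ghosts T X A B"
    show "Hn f = ntf (hp A) (\<lambda>E x. \<zero>\<^bsub>fob (hp B) E\<^esub>)"
    proof (rule NT_hp_eqI[OF Hn_NT[OF f] z O(1)])
      fix E x assume E: "E \<in> X" and x: "x \<Colon> E \<rightarrow> A"
      have "f \<cdot> x = nul E B" using r E ArrI[OF x] unfolding ghosts_def by blast
      then show "Hn f E x = ntf (hp A) (\<lambda>E x. \<zero>\<^bsub>fob (hp B) E\<^esub>) E x"
        using Hn_apply[OF f E x] E ArrI[OF x] by simp
    qed
  qed
  finally show ?thesis .
qed

text \<open>By Yoneda a presentation of \<open>F\<close> is induced by a map \<open>a\<close> in
  \<open>X\<close>, and its cone \<open>A\<close> is a lift of \<open>F\<close>: rigidity lifts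
  every map from \<open>X\<close> to \<open>A\<close> to \<open>X0\<close>, and two such lifts
  become equal in \<open>A\<close> precisely when \<open>\<beta>\<close> identifies them.\<close>

lemma HF_ess_surj: "ess_image M HF (Obj T) = Obj M"
proof
  show "ess_image M HF (Obj T) \<subseteq> Obj M" unfolding ess_image_def by blast
  show "Obj M \<subseteq> ess_image M HF (Obj T)"
  proof
    fix F assume FM: "F \<in> Obj M"
    then have F: "coherent T X F" by simp
    note F' = coherent_presheaf[OF F]
    obtain X1 X0 \<alpha> \<beta> where c: "X1 \<in> X" "X0 \<in> X" "\<alpha> \<in> NT (hp X1) (hp X0)" "\<beta> \<in> NT (hp X0) F"
      and ex: "\<forall>A\<in>X. \<alpha> A ` Arr T A X1 = a_kernel (Hom T A X0) (fob F A) (\<beta> A) \<and> \<beta> A ` Arr T A X0 = el F A"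
      using F unfolding coherent_def by blast
    have ker: "\<alpha> A ` Arr T A X1 = {x \<in> Arr T A X0. \<beta> A x = \<zero>\<^bsub>fob F A\<^esub>}" if "A \<in> X" for A
      using ex that unfolding a_kernel_def' by simp
    have sur: "\<beta> A ` Arr T A X0 = el F A" if "A \<in> X" for A
      using ex that by simp
    obtain a where a: "a \<Colon> X1 \<rightarrow> X0" "\<alpha> = Hn a" using yoneda[OF c(1) XO[OF c(2)] c(3)] .
    obtain A p d where tr: "(X1, X0, A, a, p, d) \<in> Tri T" using tri_cone[OF a(1)] .
    note t = triD[OF tr]
    have AO: "A \<in> Obj T" using t by simp
    have lift: "\<exists>y. y \<Colon> E \<rightarrow> X0 \<and> p \<cdot> y = z" if E: "E \<in> X" and z: "z \<Colon> E \<rightarrow> A" for E z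
    proof -
      have "d \<cdot> z \<Colon> E \<rightarrow> shob T X1" using z t by simp
      from tri_ex2[OF tr z hom_nullD[OF rigid_null[OF E c(1)] this]] show ?thesis by blast
    qed
    have iff: "p \<cdot> y = p \<cdot> y' \<longleftrightarrow> \<beta> E y = \<beta> E y'" if E: "E \<in> X" and y: "y \<Colon> E \<rightarrow> X0" "y' \<Colon> E \<rightarrow> X0" for E y y'
    proof -
      interpret F: abelian_group "fob F E" by (rule presheafD(1)[OF F' E])
      have d: "y \<boxminus> y' \<Colon> E \<rightarrow> X0" using y by simp
      have el: "\<beta> E (y \<boxminus> y') \<in> el F E" "\<beta> E y' \<in> el F E" using NT_D(1)[OF c(4) E] ArrI[OF d] ArrI[OF y(2)] by simp_all
      have "\<beta> E y = \<beta> E ((y \<boxminus> y') \<oplus>\<^bsub>Hom T E X0\<^esub> y')" using minus_plus_cancel[OF y] plus_Hom[OF d] by simp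
      also have "\<dots> = \<beta> E (y \<boxminus> y') \<oplus>\<^bsub>fob F E\<^esub> \<beta> E y'"
        using NT_D(2)[OF c(4) E, of "y \<boxminus> y'" y'] ArrI[OF d] ArrI[OF y(2)] by simp
      finally have "\<beta> E y = \<beta> E y' \<longleftrightarrow> \<beta> E (y \<boxminus> y') \<oplus>\<^bsub>fob F E\<^esub> \<beta> E y' = \<beta> E y'" by simp
      also have "\<dots> \<longleftrightarrow> \<beta> E (y \<boxminus> y') = \<zero>\<^bsub>fob F E\<^esub>" using el by simp
      also have "\<dots> \<longleftrightarrow> y \<boxminus> y' \<in> \<alpha> E ` Arr T E X1" using ker[OF E] ArrI[OF d] by blast
      also have "\<dots> \<longleftrightarrow> p \<cdot> (y \<boxminus> y') = nul E A"
      proof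
        assume "y \<boxminus> y' \<in> \<alpha> E ` Arr T E X1"
        then obtain w where w: "w \<in> Arr T E X1" "y \<boxminus> y' = \<alpha> E w" by blast
        have w': "w \<Colon> E \<rightarrow> X1" using ArrD[OF w(1)] E c(1) by simp
        have "y \<boxminus> y' = a \<cdot> w" unfolding w(2) a(2) by (rule Hn_apply[OF a(1) E w'])
        then show "p \<cdot> (y \<boxminus> y') = nul E A" using Cmp_eq_Cmp[OF tri_zero1[OF tr], of w] w' t by simp
      next
        assume "p \<cdot> (y \<boxminus> y') = nul E A"
        from tri_ex1[OF tr d this] obtain w where w: "w \<Colon> E \<rightarrow> X1" "a \<cdot> w = y \<boxminus> y'" .
        then have "y \<boxminus> y' = \<alpha> E w" unfolding a(2) using Hn_apply[OF a(1) E w(1)] by simp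
        then show "y \<boxminus> y' \<in> \<alpha> E ` Arr T E X1" using ArrI[OF w(1)] by blast
      qed
      also have "\<dots> \<longleftrightarrow> p \<cdot> y \<boxminus> p \<cdot> y' = nul E A" using y t by (simp add: Cmp_distrib)
      also have "\<dots> \<longleftrightarrow> p \<cdot> y = p \<cdot> y'" using minus_eq_nul[of "p \<cdot> y" E A "p \<cdot> y'"] y t by simp
      finally show ?thesis by blast
    qed
    \<comment> \<open>The isomorphism sends \<open>p \<cdot> y\<close> to
      \<open>\<beta> E y\<close>; by the equivalence just proved the choice of \<open>y\<close> does
      not matter.\<close>
    define h where "h E z = \<beta> E (SOME y. y \<in> Arr T E X0 \<and> p \<cdot> y = z)" for E z
    have h: "h E (p \<cdot> y) = \<beta> E y" if E: "E \<in> X" and y: "y \<Colon> E \<rightarrow> X0" for E y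
    proof -
      have "(SOME y'. y' \<in> Arr T E X0 \<and> p \<cdot> y' = p \<cdot> y) \<in> Arr T E X0 \<and> p \<cdot> (SOME y'. y' \<in> Arr T E X0 \<and> p \<cdot> y' = p \<cdot> y) = p \<cdot> y"
        by (rule someI[of "\<lambda>y'. y' \<in> Arr T E X0 \<and> p \<cdot> y' = p \<cdot> y" y]) (use ArrI[OF y] in simp)
      then have s: "(SOME y'. y' \<in> Arr T E X0 \<and> p \<cdot> y' = p \<cdot> y) \<Colon> E \<rightarrow> X0" "p \<cdot> (SOME y'. y' \<in> Arr T E X0 \<and> p \<cdot> y' = p \<cdot> y) = p \<cdot> y"
        using ArrD[OF _ XO[OF E] XO[OF c(2)]] by blast+
      show ?thesis unfolding h_def using iff[OF E s(1) y] s(2) by blast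
    qed
    have rep: "\<exists>y. y \<Colon> E \<rightarrow> X0 \<and> z = p \<cdot> y" if "E \<in> X" "z \<in> el (hp A) E" for E z
    proof -
      have "z \<in> Arr T E A" using that(2) by simp
      from ArrD[OF this XO[OF that(1)] AO] have "z \<Colon> E \<rightarrow> A" .
      from lift[OF that(1) this] show ?thesis by blast
    qed
    have e: "ntf (hp A) h \<in> NT (hp A) F"
    proof (rule NT_I[OF _ _ _ hp_presheaf[OF AO]])
      fix E z z' assume E: "E \<in> X" and z: "z \<in> el (hp A) E"
      obtain y where y: "y \<Colon> E \<rightarrow> X0" "z = p \<cdot> y" using rep[OF E z] by blast
      show "h E z \<in> el F E" unfolding y(2) h[OF E y(1)] using NT_D(1)[OF c(4) E] ArrI[OF y(1)] by simp
      assume z': "z' \<in> el (hp A) E"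
      obtain y' where y': "y' \<Colon> E \<rightarrow> X0" "z' = p \<cdot> y'" using rep[OF E z'] by blast
      have yy: "y \<boxplus> y' \<Colon> E \<rightarrow> X0" and py: "p \<cdot> y \<Colon> E \<rightarrow> A" using y(1) y'(1) t by simp_all
      have "z \<oplus>\<^bsub>fob (hp A) E\<^esub> z' = p \<cdot> y \<boxplus> p \<cdot> y'" unfolding y(2) y'(2) by (simp add: plus_Hom[OF py])
      also have "\<dots> = p \<cdot> (y \<boxplus> y')" using y(1) y'(1) t by (simp add: Cmp_distrib)
      finally have "h E (z \<oplus>\<^bsub>fob (hp A) E\<^esub> z') = \<beta> E (y \<boxplus> y')" using h[OF E yy] by simp
      also have "\<dots> = \<beta> E y \<oplus>\<^bsub>fob F E\<^esub> \<beta> E y'"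
        using NT_D(2)[OF c(4) E, of y y'] ArrI[OF y(1)] ArrI[OF y'(1)] plus_Hom[OF y(1)] by simp
      finally show "h E (z \<oplus>\<^bsub>fob (hp A) E\<^esub> z') = h E z \<oplus>\<^bsub>fob F E\<^esub> h E z'"
        unfolding y(2) y'(2) h[OF E y(1)] h[OF E y'(1)] .
    next
      fix E G f z assume E: "E \<in> X" "G \<in> X" "f \<Colon> E \<rightarrow> G" and z: "z \<in> el (hp A) G"
      obtain y where y: "y \<Colon> G \<rightarrow> X0" "z = p \<cdot> y" using rep[OF E(2) z] by blast
      have yf: "y \<cdot> f \<Colon> E \<rightarrow> X0" using y(1) E(3) by simp
      have "far (hp A) f z = p \<cdot> (y \<cdot> f)" unfolding y(2) using y(1) E(3) t by simp
      then have "h E (far (hp A) f z) = \<beta> E (y \<cdot> f)" using h[OF E(1) yf] by simp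
      also have "\<dots> = far F f (\<beta> G y)" using NT_D(3)[OF c(4) E, of y] ArrI[OF y(1)] by simp
      finally show "h E (far (hp A) f z) = far F f (h G z)" unfolding y(2) h[OF E(2) y(1)] .
    qed
    have "bij_betw (ntf (hp A) h E) (el (hp A) E) (el F E)" if E: "E \<in> X" for E
      unfolding bij_betw_def
    proof (intro conjI inj_onI equalityI subsetI)
      fix z z' assume z: "z \<in> el (hp A) E" "z' \<in> el (hp A) E" "ntf (hp A) h E z = ntf (hp A) h E z'"
      obtain y where y: "y \<Colon> E \<rightarrow> X0" "z = p \<cdot> y" using rep[OF E z(1)] by blast
      obtain y' where y': "y' \<Colon> E \<rightarrow> X0" "z' = p \<cdot> y'" using rep[OF E z(2)] by blast
      have "h E z = h E z'" using z E by simp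
      then have "\<beta> E y = \<beta> E y'" unfolding y(2) y'(2) h[OF E y(1)] h[OF E y'(1)] .
      then show "z = z'" unfolding y(2) y'(2) using iff[OF E y(1) y'(1)] by blast
    next
      fix x assume "x \<in> ntf (hp A) h E ` el (hp A) E"
      then show "x \<in> el F E" using NT_D(1)[OF e E] by blast
    next
      fix x assume "x \<in> el F E"
      then obtain y where y: "y \<in> Arr T E X0" "x = \<beta> E y" using sur[OF E] by blast
      have y': "y \<Colon> E \<rightarrow> X0" using ArrD[OF y(1)] E c(2) by simp
      have py: "p \<cdot> y \<Colon> E \<rightarrow> A" using y' t by simp
      have "x = ntf (hp A) h E (p \<cdot> y)" using h[OF E y'] y(2) E ArrI[OF py] by simp
      then show "x \<in> ntf (hp A) h E ` el (hp A) E" using ArrI[OF py] by simp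
    qed
    from NT_bij_iso[OF hp_presheaf[OF AO] F' e this]
    have "isomorphic M (fob HF A) F" unfolding isomorphic_def by auto
    then show "F \<in> ess_image M HF (Obj T)" unfolding ess_image_def using AO FM by blast
  qed
qed

text \<open>Composed with the approximation \<open>p\<close>, the transformation starts at a
  representable of \<open>X\<close> and is induced by some \<open>b0\<close>. Because
  \<open>X1\<close> also lies in \<open>X\<close>, the transformation can be evaluated at
  \<open>p \<cdot> b = 0\<close>; this gives \<open>b0 \<cdot> b = 0\<close>, and \<open>b0\<close>
  descends to \<open>A\<close>.\<close>

lemma HF_full_ct:
  assumes ct: "two_cluster_tilting T X"
  shows "full_functor T M HF"
  unfolding full_functor_def
proof (intro ballI equalityI subsetI)
  fix A B \<phi> assume O: "A \<in> Obj T" "B \<in> Obj T"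
  {
    assume "\<phi> \<in> far HF ` Arr T A B"
    then show "\<phi> \<in> Arr M (fob HF A) (fob HF B)" using HF_functor O unfolding linear_functor_def linear_maps_def by blast
  }
  assume "\<phi> \<in> Arr M (fob HF A) (fob HF B)"
  then obtain \<eta> where e: "\<phi> = (hp A, hp B, \<eta>)" "\<eta> \<in> NT (hp A) (hp B)" by auto
  obtain X0 p where p: "X0 \<in> X" "p \<Colon> X0 \<rightarrow> A" "\<And>Z z. Z \<in> X \<Longrightarrow> z \<Colon> Z \<rightarrow> A \<Longrightarrow> \<exists>y. y \<Colon> Z \<rightarrow> X0 \<and> p \<cdot> y = z"
    using X_approx[OF O(1)] by blast
  obtain X1 b d where tr: "(X1, X0, A, b, p, d) \<in> Tri T" using tri_complete_mid[OF p(2)] .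
  note t = triD[OF tr]
  have "X1 \<in> Obj T" using t by simp
  then have X1: "X1 \<in> X"
    by (rule ctD(6)[OF ct]) (rule approx_kernel_null[OF tr rigid_null[OF _ p(1)] p(3)])
  have c: "ntf (hp X0) (\<lambda>E x. \<eta> E (Hn p E x)) \<in> NT (hp X0) (hp B)"
    by (rule NT_comp[OF hp_presheaf[OF XO[OF p(1)]] Hn_NT[OF p(2)] e(2)])
  obtain b0 where b0: "b0 \<Colon> X0 \<rightarrow> B" "ntf (hp X0) (\<lambda>E x. \<eta> E (Hn p E x)) = Hn b0" using yoneda[OF p(1) O(2) c] .
  have ev: "\<eta> E (p \<cdot> y) = b0 \<cdot> y" if E: "E \<in> X" and y: "y \<Colon> E \<rightarrow> X0" for E y
    using arg_cong[OF b0(2), of "\<lambda>f. f E y"] E ArrI[OF y] by (simp add: Hn_apply[OF p(2) E y] Hn_apply[OF b0(1) E y])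
  have "b0 \<cdot> b = \<eta> X1 (p \<cdot> b)" using ev[OF X1 t(1)] by simp
  also have "\<dots> = nul X1 B"
    unfolding tri_zero1[OF tr] using NT_zero[OF e(2) X1 hp_presheaf[OF O(1)] hp_presheaf[OF O(2)]] by simp
  finally obtain g where g: "g \<Colon> A \<rightarrow> B" "g \<cdot> p = b0" using tri_co1[OF tr b0(1)] by blast
  have "\<eta> = Hn g"
  proof (rule NT_hp_eqI[OF e(2) Hn_NT[OF g(1)] O(1)])
    fix E x assume E: "E \<in> X" and x: "x \<Colon> E \<rightarrow> A"
    obtain y where y: "y \<Colon> E \<rightarrow> X0" "p \<cdot> y = x" using p(3)[OF E x] by blast
    have "b0 \<cdot> y = g \<cdot> (p \<cdot> y)" using Cmp_eq_Cmp[OF g(2), of y] y(1) g(1) t by simp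
    then show "\<eta> E x = Hn g E x" unfolding Hn_apply[OF g(1) E x] using ev[OF E y(1)] unfolding y(2) by simp
  qed
  then have "\<phi> = far HF g" unfolding e(1) using g(1) by simp
  then show "\<phi> \<in> far HF ` Arr T A B" using ArrI[OF g(1)] by blast
qed

end

section \<open>Quotients by ghosts\<close>

lemma quotient_algebra_simps:
  "carrier (quotient_algebra A I) = (\<lambda>x. I +>\<^bsub>A\<^esub> x) ` carrier A"
  "V \<oplus>\<^bsub>quotient_algebra A I\<^esub> W = (\<Union>x\<in>V. \<Union>y\<in>W. {x \<oplus>\<^bsub>A\<^esub> y})"
  "c \<odot>\<^bsub>quotient_algebra A I\<^esub> W = (\<Union>x\<in>W. I +>\<^bsub>A\<^esub> (c \<odot>\<^bsub>A\<^esub> x))"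
  "V \<otimes>\<^bsub>quotient_algebra A I\<^esub> W = (\<Union>x\<in>V. \<Union>y\<in>W. I +>\<^bsub>A\<^esub> (x \<otimes>\<^bsub>A\<^esub> y))"
  "\<one>\<^bsub>quotient_algebra A I\<^esub> = I +>\<^bsub>A\<^esub> \<one>\<^bsub>A\<^esub>"
  unfolding quotient_algebra_def FactRing_def A_RCOSETS_def' set_add_def' rcoset_mult_def
  by (auto simp: ring.extend_def module.fields_def)

lemma End_algebra_simps [simp]:
  "carrier (End_algebra C A) = Arr C A A" "add (End_algebra C A) = add (Hom C A A)" "\<zero>\<^bsub>End_algebra C A\<^esub> = nul\<^bsub>C\<^esub> A A"
  "x \<otimes>\<^bsub>End_algebra C A\<^esub> y = x \<cdot>\<^bsub>C\<^esub> y" "\<one>\<^bsub>End_algebra C A\<^esub> = Idt C A" "c \<odot>\<^bsub>End_algebra C A\<^esub> x = c \<odot>\<^bsub>Hom C A A\<^esub> x"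
  by (simp_all add: End_algebra_def)

lemma End_algebra_coset: "I +>\<^bsub>End_algebra C A\<^esub> x = I +>\<^bsub>Hom C A A\<^esub> x"
  unfolding a_r_coset_def' by simp

lemma full_subcategory_simps [simp]:
  "Obj (full_subcategory C U) = U" "Hom (full_subcategory C U) = Hom C" "Cmp (full_subcategory C U) = Cmp C"
  "Idt (full_subcategory C U) = Idt C"
  by (simp_all add: full_subcategory_def)

lemma ghost_quotient_simps:
  "Obj (ghost_quotient T X Y) = Y" "Hom (ghost_quotient T X Y) A B = quotient_algebra (Hom T A B) (ghosts T X A B)"
  "Idt (ghost_quotient T X Y) A = ghosts T X A A +>\<^bsub>Hom T A A\<^esub> Idt T A"
  "V \<cdot>\<^bsub>ghost_quotient T X Y\<^esub> W = (\<Union>g\<in>V. \<Union>f\<in>W.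
    ghosts T X (Src T f) (Tgt T g) +>\<^bsub>Hom T (Src T f) (Tgt T g)\<^esub> (g \<cdot>\<^bsub>T\<^esub> f))"
  by (simp_all add: ghost_quotient_def)

context lincat begin

lemma ring_End:
  assumes A: "A \<in> Obj C"
  shows "ring (End_algebra C A)"
proof (rule ringI)
  have "comm_group (add_monoid (End_algebra C A))"
    using abelian_group.a_comm_group[OF Hom_group[OF A A]] by simp
  then show "abelian_group (End_algebra C A)" by (rule comm_group_abelian_groupI)
  have m: "x \<Colon> A \<rightarrow> A" if "x \<in> carrier (End_algebra C A)" for x
    using ArrD[of x A A] that A by simp
  show "monoid (End_algebra C A)"
  proof (rule monoidI)
    fix x y assume "x \<in> carrier (End_algebra C A)" "y \<in> carrier (End_algebra C A)"
    then have t: "x \<Colon> A \<rightarrow> A" "y \<Colon> A \<rightarrow> A" using m by blast+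
    have "x \<cdot> y \<Colon> A \<rightarrow> A" using t by simp
    then show "x \<otimes>\<^bsub>End_algebra C A\<^esub> y \<in> carrier (End_algebra C A)" using ArrI[of "x \<cdot> y" A A] by simp
    fix z assume "z \<in> carrier (End_algebra C A)"
    then have "z \<Colon> A \<rightarrow> A" using m by blast
    then show "x \<otimes>\<^bsub>End_algebra C A\<^esub> y \<otimes>\<^bsub>End_algebra C A\<^esub> z = x \<otimes>\<^bsub>End_algebra C A\<^esub> (y \<otimes>\<^bsub>End_algebra C A\<^esub> z)"
      using t by simp
  next
    show "\<one>\<^bsub>End_algebra C A\<^esub> \<in> carrier (End_algebra C A)" using Idt_closed[OF A] by simp
  next
    fix x assume "x \<in> carrier (End_algebra C A)"
    then have "x \<Colon> A \<rightarrow> A" using m by blast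
    then show "\<one>\<^bsub>End_algebra C A\<^esub> \<otimes>\<^bsub>End_algebra C A\<^esub> x = x" "x \<otimes>\<^bsub>End_algebra C A\<^esub> \<one>\<^bsub>End_algebra C A\<^esub> = x" by simp_all
  qed
  fix x y z assume "x \<in> carrier (End_algebra C A)" "y \<in> carrier (End_algebra C A)" "z \<in> carrier (End_algebra C A)"
  then have t: "x \<Colon> A \<rightarrow> A" "y \<Colon> A \<rightarrow> A" "z \<Colon> A \<rightarrow> A" using m by blast+
  have tt: "x \<cdot> z \<Colon> A \<rightarrow> A" "z \<cdot> x \<Colon> A \<rightarrow> A" using t by simp_all
  show "(x \<oplus>\<^bsub>End_algebra C A\<^esub> y) \<otimes>\<^bsub>End_algebra C A\<^esub> z = x \<otimes>\<^bsub>End_algebra C A\<^esub> z \<oplus>\<^bsub>End_algebra C A\<^esub> y \<otimes>\<^bsub>End_algebra C A\<^esub> z"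
    unfolding End_algebra_simps plus_Hom[OF t(1)] plus_Hom[OF tt(1)] using t by (simp add: Cmp_distrib)
  show "z \<otimes>\<^bsub>End_algebra C A\<^esub> (x \<oplus>\<^bsub>End_algebra C A\<^esub> y) = z \<otimes>\<^bsub>End_algebra C A\<^esub> x \<oplus>\<^bsub>End_algebra C A\<^esub> z \<otimes>\<^bsub>End_algebra C A\<^esub> y"
    unfolding End_algebra_simps plus_Hom[OF t(1)] plus_Hom[OF tt(2)] using t by (simp add: Cmp_distrib)
qed

lemma is_direct_sum_zero:
  assumes "A \<in> Obj C" "is_zero_obj C Z"
  shows "is_direct_sum C A Z A" and "is_direct_sum C Z A A"
proof -
  have Z: "Z \<in> Obj C" "Idt C Z = nul Z Z" using assms(2) is_zero_obj_iff by simp_all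
  show "is_direct_sum C A Z A"
    by (rule is_direct_sumI[of "Idt C A" _ _ "nul Z A" _ "Idt C A" "nul A Z"]) (use assms(1) Z in simp_all)
  show "is_direct_sum C Z A A"
    by (rule is_direct_sumI[of "nul Z A" _ _ "Idt C A" _ "nul A Z" "Idt C A"]) (use assms(1) Z in simp_all)
qed

end

context ghost_setting begin

abbreviation Qh :: "'o \<Rightarrow> 'o \<Rightarrow> ('k, 'm set) module"
  where "Qh A B \<equiv> quotient_algebra (Hom T A B) (ghosts T X A B)"

text \<open>Cosets of the ghosts are the fibres of \<open>H\<close> on hom-sets. Indexing them by
  arrows of \<open>D\<close> turns operations on cosets into operations in \<open>D\<close>.\<close>

definition cl :: "'o \<Rightarrow> 'o \<Rightarrow> 'n \<Rightarrow> 'm set"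
  where "cl A B \<phi> = {f \<in> Arr T A B. far H f = \<phi>}"

lemma cl_iff: "A \<in> Obj T \<Longrightarrow> B \<in> Obj T \<Longrightarrow> f \<in> cl A B \<phi> \<longleftrightarrow> f \<Colon> A \<rightarrow> B \<and> far H f = \<phi>"
  unfolding cl_def by (simp add: Arr_iff)

lemma cl_lift:
  assumes "A \<in> Obj T" "B \<in> Obj T" "\<phi> \<Colon>\<^sub>D fob H A \<rightarrow> fob H B"
  obtains f where "f \<in> cl A B \<phi>" "f \<Colon> A \<rightarrow> B" "far H f = \<phi>"
proof -
  obtain f where f: "f \<Colon> A \<rightarrow> B" "far H f = \<phi>" using H_lift[OF assms] .
  have "f \<in> cl A B \<phi>" using f cl_iff[OF assms(1,2)] by simp
  then show thesis using that f by blast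
qed

lemma coset_cl:
  assumes f: "f \<Colon> A \<rightarrow> B"
  shows "ghosts T X A B +>\<^bsub>Hom T A B\<^esub> f = cl A B (far H f)"
proof (intro equalityI subsetI)
  have O: "A \<in> Obj T" "B \<in> Obj T" using f by simp_all
  {
    fix g assume "g \<in> ghosts T X A B +>\<^bsub>Hom T A B\<^esub> f"
    then obtain h where h: "h \<in> ghosts T X A B" "g = h \<oplus>\<^bsub>Hom T A B\<^esub> f" unfolding a_r_coset_def' by blast
    have "h \<in> Arr T A B" using h(1) unfolding ghosts_def by blast
    from ArrD[OF this O] have h': "h \<Colon> A \<rightarrow> B" .
    have n: "far H h = nul\<^sub>D (fob H A) (fob H B)" using H_ghost[OF h'] h(1) by simp
    have g: "g = h \<boxplus> f" using h(2) plus_Hom[OF h'] by simp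
    have "far H g = far H f" unfolding g using H.far_plus[of h f] n h' f by simp
    moreover have "g \<Colon> A \<rightarrow> B" unfolding g using h' f by simp
    ultimately show "g \<in> cl A B (far H f)" using cl_iff[OF O] by simp
  }
  fix g assume "g \<in> cl A B (far H f)"
  then have g: "g \<Colon> A \<rightarrow> B" "far H g = far H f" using cl_iff[OF O] by simp_all
  have d: "g \<boxminus> f \<Colon> A \<rightarrow> B" using f g(1) by simp
  have "far H (g \<boxminus> f) = nul\<^sub>D (fob H A) (fob H B)" using H.far_minus[of g f] g f by simp
  then have "g \<boxminus> f \<in> ghosts T X A B" using H_ghost[OF d] by simp
  moreover have "g = (g \<boxminus> f) \<oplus>\<^bsub>Hom T A B\<^esub> f" using minus_plus_cancel[OF g(1) f] plus_Hom[OF d] by simp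
  ultimately show "g \<in> ghosts T X A B +>\<^bsub>Hom T A B\<^esub> f" unfolding a_r_coset_def' by blast
qed

lemma cl_inject:
  assumes "A \<in> Obj T" "B \<in> Obj T" "\<phi> \<Colon>\<^sub>D fob H A \<rightarrow> fob H B" "cl A B \<phi> = cl A B \<psi>"
  shows "\<phi> = \<psi>"
proof -
  obtain f where f: "f \<in> cl A B \<phi>" "far H f = \<phi>" using cl_lift[OF assms(1-3)] by blast
  then show ?thesis using assms(4) unfolding cl_def by blast
qed

lemma quotient_cl:
  assumes O: "A \<in> Obj T" "B \<in> Obj T"
  shows "carrier (Qh A B) = cl A B ` Arr D (fob H A) (fob H B)"
    and "\<phi> \<Colon>\<^sub>D fob H A \<rightarrow> fob H B \<Longrightarrow> \<psi> \<Colon>\<^sub>D fob H A \<rightarrow> fob H B \<Longrightarrow>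
      cl A B \<phi> \<oplus>\<^bsub>Qh A B\<^esub> cl A B \<psi> = cl A B (\<phi> \<boxplus>\<^sub>D \<psi>)"
    and "\<phi> \<Colon>\<^sub>D fob H A \<rightarrow> fob H B \<Longrightarrow> c \<in> carrier K \<Longrightarrow>
      c \<odot>\<^bsub>Qh A B\<^esub> cl A B \<phi> = cl A B (c \<star>\<^sub>D \<phi>)"
proof -
  note HO = H.fob_Obj[OF O(1)] H.fob_Obj[OF O(2)]
  have "(\<lambda>x. ghosts T X A B +>\<^bsub>Hom T A B\<^esub> x) ` Arr T A B = (\<lambda>x. cl A B (far H x)) ` Arr T A B"
    by (rule image_cong[OF refl]) (rule coset_cl[OF ArrD[OF _ O]])
  also have "\<dots> = cl A B ` (far H ` Arr T A B)" by (simp add: image_image)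
  also have "far H ` Arr T A B = Arr D (fob H A) (fob H B)" using H_full O unfolding full_functor_def by blast
  finally show "carrier (Qh A B) = cl A B ` Arr D (fob H A) (fob H B)"
    unfolding quotient_algebra_simps .
next
  assume p: "\<phi> \<Colon>\<^sub>D fob H A \<rightarrow> fob H B" and q: "\<psi> \<Colon>\<^sub>D fob H A \<rightarrow> fob H B"
  show "cl A B \<phi> \<oplus>\<^bsub>Qh A B\<^esub> cl A B \<psi> = cl A B (\<phi> \<boxplus>\<^sub>D \<psi>)"
    unfolding quotient_algebra_simps
  proof (intro equalityI subsetI)
    fix h assume "h \<in> (\<Union>x\<in>cl A B \<phi>. \<Union>y\<in>cl A B \<psi>. {x \<oplus>\<^bsub>Hom T A B\<^esub> y})"
    then obtain x y where x: "x \<in> cl A B \<phi>" and y: "y \<in> cl A B \<psi>" and h: "h = x \<oplus>\<^bsub>Hom T A B\<^esub> y" by blast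
    have t: "x \<Colon> A \<rightarrow> B" "far H x = \<phi>" "y \<Colon> A \<rightarrow> B" "far H y = \<psi>" using x y cl_iff[OF O] by simp_all
    have h': "h = x \<boxplus> y" unfolding h by (rule plus_Hom[OF t(1)])
    have "h \<Colon> A \<rightarrow> B" unfolding h' using t(1,3) by simp
    moreover have "far H h = \<phi> \<boxplus>\<^sub>D \<psi>" unfolding h' using H.far_plus[of x y] t by simp
    ultimately show "h \<in> cl A B (\<phi> \<boxplus>\<^sub>D \<psi>)" using cl_iff[OF O] by simp
  next
    fix h assume "h \<in> cl A B (\<phi> \<boxplus>\<^sub>D \<psi>)"
    then have h: "h \<Colon> A \<rightarrow> B" "far H h = \<phi> \<boxplus>\<^sub>D \<psi>" using cl_iff[OF O] by simp_all
    obtain y where y: "y \<in> cl A B \<psi>" "y \<Colon> A \<rightarrow> B" "far H y = \<psi>" using cl_lift[OF O q] .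
    have d: "h \<boxminus> y \<Colon> A \<rightarrow> B" using h(1) y(2) by simp
    have "far H (h \<boxminus> y) = (\<phi> \<boxplus>\<^sub>D \<psi>) \<boxminus>\<^sub>D \<psi>" using H.far_minus[of h y] h y(2,3) by simp
    also have "\<dots> = \<phi>" by (rule H.D.plus_minus_cancel[OF p q])
    finally have "h \<boxminus> y \<in> cl A B \<phi>" using d cl_iff[OF O] by simp
    moreover have "h = (h \<boxminus> y) \<oplus>\<^bsub>Hom T A B\<^esub> y" using minus_plus_cancel[OF h(1) y(2)] plus_Hom[OF d] by simp
    ultimately show "h \<in> (\<Union>x\<in>cl A B \<phi>. \<Union>y\<in>cl A B \<psi>. {x \<oplus>\<^bsub>Hom T A B\<^esub> y})" using y(1) by blast
  qed
next
  assume p: "\<phi> \<Colon>\<^sub>D fob H A \<rightarrow> fob H B" and c: "c \<in> carrier K"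
  obtain f where f: "f \<in> cl A B \<phi>" using cl_lift[OF O p] by blast
  have "ghosts T X A B +>\<^bsub>Hom T A B\<^esub> (c \<odot>\<^bsub>Hom T A B\<^esub> x) = cl A B (c \<star>\<^sub>D \<phi>)" if x: "x \<in> cl A B \<phi>" for x
  proof -
    have t: "x \<Colon> A \<rightarrow> B" "far H x = \<phi>" using x cl_iff[OF O] by simp_all
    have "c \<star> x \<Colon> A \<rightarrow> B" using t c by simp
    from coset_cl[OF this] show ?thesis unfolding smult_Hom[OF t(1)] using H.far_smult[of x c] t c by simp
  qed
  then have "(\<Union>x\<in>cl A B \<phi>. ghosts T X A B +>\<^bsub>Hom T A B\<^esub> (c \<odot>\<^bsub>Hom T A B\<^esub> x)) = (\<Union>x\<in>cl A B \<phi>. cl A B (c \<star>\<^sub>D \<phi>))"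
    by (intro SUP_cong refl)
  also have "\<dots> = cl A B (c \<star>\<^sub>D \<phi>)" using f by auto
  finally show "c \<odot>\<^bsub>Qh A B\<^esub> cl A B \<phi> = cl A B (c \<star>\<^sub>D \<phi>)"
    unfolding quotient_algebra_simps .
qed

lemma Cmp_cl:
  assumes O: "A \<in> Obj T" "B \<in> Obj T" "E \<in> Obj T" and p: "\<phi> \<Colon>\<^sub>D fob H A \<rightarrow> fob H B" and q: "\<psi> \<Colon>\<^sub>D fob H B \<rightarrow> fob H E"
  shows "(\<Union>g\<in>cl B E \<psi>. \<Union>f\<in>cl A B \<phi>. ghosts T X A E +>\<^bsub>Hom T A E\<^esub> (g \<cdot> f)) = cl A E (\<psi> \<cdot>\<^sub>D \<phi>)"
    and "cl B E \<psi> \<cdot>\<^bsub>ghost_quotient T X Y\<^esub> cl A B \<phi> = cl A E (\<psi> \<cdot>\<^sub>D \<phi>)"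
proof -
  obtain g0 where g0: "g0 \<in> cl B E \<psi>" using cl_lift[OF O(2,3) q] by blast
  obtain f0 where f0: "f0 \<in> cl A B \<phi>" using cl_lift[OF O(1,2) p] by blast
  have t: "ghosts T X A E +>\<^bsub>Hom T A E\<^esub> (g \<cdot> f) = cl A E (\<psi> \<cdot>\<^sub>D \<phi>)" "Src T f = A" "Tgt T g = E"
    if g: "g \<in> cl B E \<psi>" and f: "f \<in> cl A B \<phi>" for f g
  proof -
    have *: "g \<Colon> B \<rightarrow> E" "far H g = \<psi>" "f \<Colon> A \<rightarrow> B" "far H f = \<phi>" using f g cl_iff[OF O(1,2)] cl_iff[OF O(2,3)] by simp_all
    then show "Src T f = A" "Tgt T g = E" by simp_all
    have "g \<cdot> f \<Colon> A \<rightarrow> E" using * by simp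
    from coset_cl[OF this] show "ghosts T X A E +>\<^bsub>Hom T A E\<^esub> (g \<cdot> f) = cl A E (\<psi> \<cdot>\<^sub>D \<phi>)" using * by simp
  qed
  have "(\<Union>g\<in>cl B E \<psi>. \<Union>f\<in>cl A B \<phi>. ghosts T X A E +>\<^bsub>Hom T A E\<^esub> (g \<cdot> f)) = (\<Union>g\<in>cl B E \<psi>. \<Union>f\<in>cl A B \<phi>. cl A E (\<psi> \<cdot>\<^sub>D \<phi>))"
    by (intro SUP_cong refl t(1))
  also have c: "\<dots> = cl A E (\<psi> \<cdot>\<^sub>D \<phi>)" using f0 g0 by auto
  finally show "(\<Union>g\<in>cl B E \<psi>. \<Union>f\<in>cl A B \<phi>. ghosts T X A E +>\<^bsub>Hom T A E\<^esub> (g \<cdot> f)) = cl A E (\<psi> \<cdot>\<^sub>D \<phi>)" .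
  have "cl B E \<psi> \<cdot>\<^bsub>ghost_quotient T X Y\<^esub> cl A B \<phi> = (\<Union>g\<in>cl B E \<psi>. \<Union>f\<in>cl A B \<phi>. cl A E (\<psi> \<cdot>\<^sub>D \<phi>))"
    unfolding ghost_quotient_simps by (intro SUP_cong refl) (use t in simp)
  then show "cl B E \<psi> \<cdot>\<^bsub>ghost_quotient T X Y\<^esub> cl A B \<phi> = cl A E (\<psi> \<cdot>\<^sub>D \<phi>)" unfolding c .
qed

lemma Idt_cl: "A \<in> Obj T \<Longrightarrow> ghosts T X A A +>\<^bsub>Hom T A A\<^esub> Idt T A = cl A A (Idt D (fob H A))"
  using coset_cl[of "Idt T A" A A] by simp

lemma ghosts_iff: "A \<in> Obj T \<Longrightarrow> B \<in> Obj T \<Longrightarrow> f \<in> ghosts T X A B \<longleftrightarrow> f \<Colon> A \<rightarrow> B \<and> far H f = nul\<^sub>D (fob H A) (fob H B)"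
proof -
  assume O: "A \<in> Obj T" "B \<in> Obj T"
  have "f \<in> ghosts T X A B \<Longrightarrow> f \<in> Arr T A B" unfolding ghosts_def by blast
  then show ?thesis using H_ghost[of f A B] O by (auto simp: Arr_iff)
qed

lemma ghosts_ideal:
  assumes A: "A \<in> Obj T"
  shows "ideal (ghosts T X A A) (End_algebra T A)"
proof (rule idealI[OF ring_End[OF A]])
  interpret E: abelian_group "Hom T A A" by (rule Hom_group[OF A A])
  note g = ghosts_iff[OF A A]
  show "subgroup (ghosts T X A A) (add_monoid (End_algebra T A))"
    unfolding End_algebra_simps
  proof (rule E.add.subgroupI)
    show "ghosts T X A A \<subseteq> Arr T A A" unfolding ghosts_def by blast
    have "nul A A \<in> ghosts T X A A" using g A by simp
    then show "ghosts T X A A \<noteq> {}" by blast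
    fix a assume "a \<in> ghosts T X A A"
    then have a: "a \<Colon> A \<rightarrow> A" "far H a = nul\<^sub>D (fob H A) (fob H A)" using g by simp_all
    show "\<ominus>\<^bsub>Hom T A A\<^esub> a \<in> ghosts T X A A" unfolding neg_Hom[OF a(1)] g using a H.far_minus[of "nul A A" a] by simp
    fix b assume "b \<in> ghosts T X A A"
    then have b: "b \<Colon> A \<rightarrow> A" "far H b = nul\<^sub>D (fob H A) (fob H A)" using g by simp_all
    show "a \<oplus>\<^bsub>Hom T A A\<^esub> b \<in> ghosts T X A A" unfolding plus_Hom[OF a(1)] g using a b H.far_plus[of a b] by simp
  qed
  fix a x assume "a \<in> ghosts T X A A" "x \<in> carrier (End_algebra T A)"
  then have "a \<Colon> A \<rightarrow> A" "far H a = nul\<^sub>D (fob H A) (fob H A)" "x \<Colon> A \<rightarrow> A" using g ArrD[of x A A] A by simp_all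
  then show "x \<otimes>\<^bsub>End_algebra T A\<^esub> a \<in> ghosts T X A A" "a \<otimes>\<^bsub>End_algebra T A\<^esub> x \<in> ghosts T X A A" unfolding g by simp_all
qed

lemma End_algebra_iso:
  assumes A: "A \<in> Obj T"
  shows "algebra_isos K (quotient_algebra (End_algebra T A) (ghosts T X A A)) (End_algebra D (fob H A)) \<noteq> {}"
    (is "algebra_isos K ?Q ?E \<noteq> {}")
proof -
  have HA: "fob H A \<in> Obj D" using A by simp
  let ?R = "Qh A A"
  have Q: "carrier ?Q = carrier ?R" "V \<oplus>\<^bsub>?Q\<^esub> W = V \<oplus>\<^bsub>?R\<^esub> W" "c \<odot>\<^bsub>?Q\<^esub> W = c \<odot>\<^bsub>?R\<^esub> W" for V W c
    by (simp_all add: quotient_algebra_simps End_algebra_coset)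
  \<comment> \<open>Any representative serves, because \<open>H\<close> is constant on the
    coset.\<close>
  define h where "h W = far H (SOME f. f \<in> W)" for W
  have h: "h (cl A A \<phi>) = \<phi>" if p: "\<phi> \<Colon>\<^sub>D fob H A \<rightarrow> fob H A" for \<phi>
  proof -
    obtain f where f: "f \<in> cl A A \<phi>" using cl_lift[OF A A p] by blast
    then have "(SOME f. f \<in> cl A A \<phi>) \<in> cl A A \<phi>" by (rule someI)
    then show ?thesis unfolding h_def cl_def by simp
  qed
  have rep: "\<exists>\<phi>. \<phi> \<Colon>\<^sub>D fob H A \<rightarrow> fob H A \<and> W = cl A A \<phi>" if W: "W \<in> carrier ?Q" for W
  proof -
    obtain \<phi> where p: "\<phi> \<in> Arr D (fob H A) (fob H A)" "W = cl A A \<phi>" using W unfolding Q quotient_cl[OF A A] by blast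
    from H.D.ArrD[OF p(1) HA HA] show ?thesis using p(2) by blast
  qed
  have lin: "h \<in> linear_maps K ?Q ?E"
    unfolding linear_maps_def
  proof (intro CollectI conjI ballI Pi_I)
    fix V assume "V \<in> carrier ?Q"
    then obtain \<phi> where p: "\<phi> \<Colon>\<^sub>D fob H A \<rightarrow> fob H A" "V = cl A A \<phi>" using rep by blast
    show "h V \<in> carrier ?E" unfolding p(2) h[OF p(1)] using H.D.ArrI[OF p(1)] by simp
    {
      fix W assume "W \<in> carrier ?Q"
      then obtain \<psi> where q: "\<psi> \<Colon>\<^sub>D fob H A \<rightarrow> fob H A" "W = cl A A \<psi>" using rep by blast
      have pq: "\<phi> \<boxplus>\<^sub>D \<psi> \<Colon>\<^sub>D fob H A \<rightarrow> fob H A" using p(1) q(1) by simp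
      show "h (V \<oplus>\<^bsub>?Q\<^esub> W) = h V \<oplus>\<^bsub>?E\<^esub> h W"
        unfolding p(2) q(2) Q quotient_cl(2)[OF A A p(1) q(1)] h[OF pq] h[OF p(1)] h[OF q(1)] End_algebra_simps H.D.plus_Hom[OF p(1)] ..
    }
    fix c assume c: "c \<in> carrier K"
    have cp: "c \<star>\<^sub>D \<phi> \<Colon>\<^sub>D fob H A \<rightarrow> fob H A" using p(1) c by simp
    show "h (c \<odot>\<^bsub>?Q\<^esub> V) = c \<odot>\<^bsub>?E\<^esub> h V"
      unfolding p(2) Q quotient_cl(3)[OF A A p(1) c] h[OF cp] h[OF p(1)] End_algebra_simps H.D.smult_Hom[OF p(1)] ..
  qed
  have i: "Idt D (fob H A) \<Colon>\<^sub>D fob H A \<rightarrow> fob H A" using HA by simp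
  have "h \<in> ring_hom ?Q ?E"
  proof (rule ring_hom_memI)
    fix V assume V: "V \<in> carrier ?Q"
    then show "h V \<in> carrier ?E" using lin unfolding linear_maps_def by blast
    fix W assume W: "W \<in> carrier ?Q"
    then show "h (V \<oplus>\<^bsub>?Q\<^esub> W) = h V \<oplus>\<^bsub>?E\<^esub> h W" using lin V unfolding linear_maps_def by blast
    obtain \<phi> where p: "\<phi> \<Colon>\<^sub>D fob H A \<rightarrow> fob H A" "V = cl A A \<phi>" using rep[OF V] by blast
    obtain \<psi> where q: "\<psi> \<Colon>\<^sub>D fob H A \<rightarrow> fob H A" "W = cl A A \<psi>" using rep[OF W] by blast
    have pq: "\<phi> \<cdot>\<^sub>D \<psi> \<Colon>\<^sub>D fob H A \<rightarrow> fob H A" using p(1) q(1) by simp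
    have "V \<otimes>\<^bsub>?Q\<^esub> W = cl A A (\<phi> \<cdot>\<^sub>D \<psi>)"
      unfolding p(2) q(2) quotient_algebra_simps End_algebra_coset End_algebra_simps by (rule Cmp_cl(1)[OF A A A q(1) p(1)])
    then show "h (V \<otimes>\<^bsub>?Q\<^esub> W) = h V \<otimes>\<^bsub>?E\<^esub> h W" unfolding p(2) q(2) using h[OF p(1)] h[OF q(1)] h[OF pq] by simp
  next
    have "\<one>\<^bsub>?Q\<^esub> = cl A A (Idt D (fob H A))" unfolding quotient_algebra_simps End_algebra_coset End_algebra_simps by (rule Idt_cl[OF A])
    then show "h \<one>\<^bsub>?Q\<^esub> = \<one>\<^bsub>?E\<^esub>" using h[OF i] by simp
  qed
  moreover have "bij_betw h (carrier ?Q) (carrier ?E)"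
  proof (rule bij_betwI[of _ _ _ "cl A A"])
    show "h \<in> carrier ?Q \<rightarrow> carrier ?E" using lin unfolding linear_maps_def by blast
    show "cl A A \<in> carrier ?E \<rightarrow> carrier ?Q" unfolding Q quotient_cl[OF A A] by simp
    show "cl A A (h V) = V" if V: "V \<in> carrier ?Q" for V
    proof -
      obtain \<phi> where p: "\<phi> \<Colon>\<^sub>D fob H A \<rightarrow> fob H A" "V = cl A A \<phi>" using rep[OF V] by blast
      show ?thesis unfolding p(2) h[OF p(1)] ..
    qed
    show "h (cl A A \<phi>) = \<phi>" if "\<phi> \<in> carrier ?E" for \<phi>
      using h[of \<phi>] H.D.ArrD[of \<phi>, OF _ HA HA] that by simp
  qed
  ultimately have "h \<in> algebra_isos K ?Q ?E" unfolding algebra_isos_def ring_iso_def using lin by simp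
  then show ?thesis by blast
qed

text \<open>The functor preserves powers and summands. Conversely, a summand of a power of
  \<open>H A\<close> is known to come from the additive closure only because the image is closed
  under summands, which is the hypothesis \<open>U\<close>.\<close>

lemma add_closure_H:
  assumes A: "A \<in> Obj T" and U: "subcategory D (H_img (add_closure T A))"
  shows "H_img (add_closure T A) = add_closure D (fob H A)"
proof (intro equalityI subsetI)
  obtain Z where Z: "is_zero_obj T Z" using obtain_zero by blast
  have "is_power T A (Suc 0) A" using is_direct_sum_zero(2)[OF A Z] Z by auto
  moreover have "direct_summand T A A" unfolding direct_summand_def using is_direct_sum_zero(1)[OF A Z] by blast
  ultimately have "A \<in> add_closure T A" unfolding add_closure_def by blast
  from H_imgI[OF this A] have HA: "fob H A \<in> H_img (add_closure T A)" .
  {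
    fix F assume "F \<in> H_img (add_closure T A)"
    then obtain B where B: "B \<in> add_closure T A" "isomorphic D (fob H B) F" and F: "F \<in> Obj D" unfolding ess_image_def by blast
    obtain n S B' where S: "is_power T A n S" "is_direct_sum T B B' S"
      using B(1) unfolding add_closure_def direct_summand_def by blast
    have "is_power D (fob H A) n (fob H S)"
      using S(1) by (induction n arbitrary: S) (auto intro: H.is_zero_obj_fob H.is_direct_sum_fob)
    moreover have "is_direct_sum D F (fob H B') (fob H S)"
    proof -
      have O: "B' \<in> Obj T" "S \<in> Obj T" using S(2) unfolding is_direct_sum_def by simp_all
      show ?thesis by (rule H.D.is_direct_sum_iso[OF H.is_direct_sum_fob[OF S(2)] B(2)]) (use F O in simp_all)
    qed
    ultimately show "F \<in> add_closure D (fob H A)" unfolding add_closure_def direct_summand_def by blast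
  }
  fix F assume "F \<in> add_closure D (fob H A)"
  then obtain n S where S: "is_power D (fob H A) n S" "direct_summand D F S" unfolding add_closure_def by blast
  have "S \<in> H_img (add_closure T A)"
    using S(1)
  proof (induction n arbitrary: S)
    case 0
    then show ?case using U unfolding subcategory_def by auto
  next
    case (Suc n)
    then obtain S' where S': "is_power D (fob H A) n S'" "is_direct_sum D S' (fob H A) S" by auto
    from Suc.IH[OF S'(1)] show ?case using S'(2) HA U unfolding subcategory_def by blast
  qed
  then show "F \<in> H_img (add_closure T A)" using S(2) U unfolding subcategory_def by blast
qed

text \<open>The evident functor goes from the quotient to the image. As the equivalence is asked for
  in the other direction, each \<open>F\<close> is assigned an object of \<open>Y\<close> and an
  isomorphism, and an arrow is conjugated by these and sent to its fibre under
  \<open>H\<close>.\<close>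

lemma ghost_quotient_equivalence:
  assumes Y: "Y \<subseteq> Obj T"
  shows "equivalent_categories K (full_subcategory D (H_img Y)) (ghost_quotient T X Y)"
proof -
  let ?P = "full_subcategory D (H_img Y)" and ?Q = "ghost_quotient T X Y"
  have ex: "\<forall>F\<in>H_img Y. \<exists>w. fst w \<in> Y \<and> fst (snd w) \<Colon>\<^sub>D fob H (fst w) \<rightarrow> F \<and> snd (snd w) \<Colon>\<^sub>D F \<rightarrow> fob H (fst w) \<and>
    snd (snd w) \<cdot>\<^sub>D fst (snd w) = Idt D (fob H (fst w)) \<and> fst (snd w) \<cdot>\<^sub>D snd (snd w) = Idt D F"
  proof
    fix F assume "F \<in> H_img Y"
    then obtain A where A: "A \<in> Y" "isomorphic D (fob H A) F" "F \<in> Obj D" unfolding ess_image_def by blast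
    have "fob H A \<in> Obj D" using A(1) Y by auto
    from H.D.isomorphicE[OF A(2) this A(3)] obtain f g where f: "f \<Colon>\<^sub>D fob H A \<rightarrow> F" "g \<Colon>\<^sub>D F \<rightarrow> fob H A"
      "g \<cdot>\<^sub>D f = Idt D (fob H A)" "f \<cdot>\<^sub>D g = Idt D F" .
    show "\<exists>w. fst w \<in> Y \<and> fst (snd w) \<Colon>\<^sub>D fob H (fst w) \<rightarrow> F \<and> snd (snd w) \<Colon>\<^sub>D F \<rightarrow> fob H (fst w) \<and>
      snd (snd w) \<cdot>\<^sub>D fst (snd w) = Idt D (fob H (fst w)) \<and> fst (snd w) \<cdot>\<^sub>D snd (snd w) = Idt D F"
      by (rule exI[of _ "(A, f, g)"]) (use A f in simp)
  qed
  from bchoice[OF ex] obtain w where w: "\<And>F. F \<in> H_img Y \<Longrightarrow> fst (w F) \<in> Y \<and> fst (snd (w F)) \<Colon>\<^sub>D fob H (fst (w F)) \<rightarrow> F \<and>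
    snd (snd (w F)) \<Colon>\<^sub>D F \<rightarrow> fob H (fst (w F)) \<and>
    snd (snd (w F)) \<cdot>\<^sub>D fst (snd (w F)) = Idt D (fob H (fst (w F))) \<and> fst (snd (w F)) \<cdot>\<^sub>D snd (snd (w F)) = Idt D F"
    by blast
  define r a b where "r F = fst (w F)" and "a F = fst (snd (w F))" and "b F = snd (snd (w F))" for F
  have w: "r F \<in> Y" "a F \<Colon>\<^sub>D fob H (r F) \<rightarrow> F" "b F \<Colon>\<^sub>D F \<rightarrow> fob H (r F)"
    "b F \<cdot>\<^sub>D a F = Idt D (fob H (r F))" "a F \<cdot>\<^sub>D b F = Idt D F" if "F \<in> H_img Y" for F
    using w[OF that] unfolding r_def a_def b_def by blast+
  have rO: "r F \<in> Obj T" if "F \<in> H_img Y" for F using w(1)[OF that] Y by blast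
  have UO: "F \<in> Obj D" if "F \<in> H_img Y" for F using that unfolding ess_image_def by blast
  \<comment> \<open>Conjugation by the chosen isomorphisms. It is a bijection, so fullness and
    faithfulness of the functor follow from the description of cosets as fibres.\<close>
  define c where "c F G \<phi> = b G \<cdot>\<^sub>D (\<phi> \<cdot>\<^sub>D a F)" for F G \<phi>
  have c: "c F G \<phi> \<Colon>\<^sub>D fob H (r F) \<rightarrow> fob H (r G)" if "F \<in> H_img Y" "G \<in> H_img Y" "\<phi> \<Colon>\<^sub>D F \<rightarrow> G" for F G \<phi>
    unfolding c_def using w(2)[OF that(1)] w(3)[OF that(2)] that(3) by simp
  define L where "L = \<lparr>fob = r, far = (\<lambda>\<phi>. cl (r (Src D \<phi>)) (r (Tgt D \<phi>)) (c (Src D \<phi>) (Tgt D \<phi>) \<phi>))\<rparr>"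
  have L: "fob L = r" "\<And>F G \<phi>. \<phi> \<Colon>\<^sub>D F \<rightarrow> G \<Longrightarrow> far L \<phi> = cl (r F) (r G) (c F G \<phi>)"
    unfolding L_def by simp_all
  have c_Cmp: "c F E (\<psi> \<cdot>\<^sub>D \<phi>) = c G E \<psi> \<cdot>\<^sub>D c F G \<phi>"
    if U: "F \<in> H_img Y" "G \<in> H_img Y" "E \<in> H_img Y" and t: "\<phi> \<Colon>\<^sub>D F \<rightarrow> G" "\<psi> \<Colon>\<^sub>D G \<rightarrow> E" for F G E \<phi> \<psi>
  proof -
    note wF = w(2)[OF U(1)] and wG = w(2)[OF U(2)] w(3)[OF U(2)] and wE = w(3)[OF U(3)]
    have "c G E \<psi> \<cdot>\<^sub>D c F G \<phi> = b E \<cdot>\<^sub>D (\<psi> \<cdot>\<^sub>D ((a G \<cdot>\<^sub>D b G) \<cdot>\<^sub>D (\<phi> \<cdot>\<^sub>D a F)))"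
      unfolding c_def using wF wG wE t by simp
    also have "\<dots> = c F E (\<psi> \<cdot>\<^sub>D \<phi>)" unfolding w(5)[OF U(2)] c_def using wF wE t by simp
    finally show ?thesis ..
  qed
  have c_bij: "a G \<cdot>\<^sub>D (c F G \<phi> \<cdot>\<^sub>D b F) = \<phi>" if U: "F \<in> H_img Y" "G \<in> H_img Y" and t: "\<phi> \<Colon>\<^sub>D F \<rightarrow> G" for F G \<phi>
  proof -
    note wF = w(2,3)[OF U(1)] and wG = w(2,3)[OF U(2)]
    have "a G \<cdot>\<^sub>D (c F G \<phi> \<cdot>\<^sub>D b F) = (a G \<cdot>\<^sub>D b G) \<cdot>\<^sub>D (\<phi> \<cdot>\<^sub>D (a F \<cdot>\<^sub>D b F))"
      unfolding c_def using wF wG t by simp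
    then show ?thesis unfolding w(5)[OF U(1)] w(5)[OF U(2)] using t by simp
  qed
  have lin: "linear_functor K ?P ?Q L"
    unfolding linear_functor_def full_subcategory_simps
  proof (intro conjI ballI)
    fix F assume F: "F \<in> H_img Y"
    show "fob L F \<in> Obj ?Q" unfolding L(1) ghost_quotient_simps by (rule w(1)[OF F])
  next
    fix F G assume U: "F \<in> H_img Y" "G \<in> H_img Y"
    note q = quotient_cl[OF rO[OF U(1)] rO[OF U(2)]]
    note wF = w(2,3)[OF U(1)] and wG = w(2,3)[OF U(2)]
    show "far L \<in> linear_maps K (Hom D F G) (Hom ?Q (fob L F) (fob L G))"
      unfolding L(1) ghost_quotient_simps linear_maps_def
    proof (intro CollectI conjI ballI Pi_I)
      fix \<phi> assume "\<phi> \<in> Arr D F G"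
      then have p: "\<phi> \<Colon>\<^sub>D F \<rightarrow> G" by (rule H.D.ArrD[OF _ UO[OF U(1)] UO[OF U(2)]])
      note cp = c[OF U p]
      show "far L \<phi> \<in> carrier (Qh (r F) (r G))"
        unfolding q(1) L(2)[OF p] using H.D.ArrI[OF cp] by simp
      {
        fix \<psi> assume "\<psi> \<in> Arr D F G"
        then have p': "\<psi> \<Colon>\<^sub>D F \<rightarrow> G" by (rule H.D.ArrD[OF _ UO[OF U(1)] UO[OF U(2)]])
        have pp: "\<phi> \<boxplus>\<^sub>D \<psi> \<Colon>\<^sub>D F \<rightarrow> G" using p p' by simp
        have "c F G (\<phi> \<boxplus>\<^sub>D \<psi>) = c F G \<phi> \<boxplus>\<^sub>D c F G \<psi>"
          unfolding c_def using p p' wF wG by (simp add: H.D.Cmp_distrib)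
        then show "far L (\<phi> \<oplus>\<^bsub>Hom D F G\<^esub> \<psi>) = far L \<phi> \<oplus>\<^bsub>Qh (r F) (r G)\<^esub> far L \<psi>"
          unfolding H.D.plus_Hom[OF p] L(2)[OF p] L(2)[OF p'] L(2)[OF pp] q(2)[OF cp c[OF U p']] by simp
      }
      fix k assume k: "k \<in> carrier K"
      have kp: "k \<star>\<^sub>D \<phi> \<Colon>\<^sub>D F \<rightarrow> G" using p k by simp
      have "c F G (k \<star>\<^sub>D \<phi>) = k \<star>\<^sub>D c F G \<phi>"
        unfolding c_def using p k wF wG by (simp add: H.D.Cmp_smult_left H.D.Cmp_smult_right)
      then show "far L (k \<odot>\<^bsub>Hom D F G\<^esub> \<phi>) = k \<odot>\<^bsub>Qh (r F) (r G)\<^esub> far L \<phi>"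
        unfolding H.D.smult_Hom[OF p] L(2)[OF p] L(2)[OF kp] q(3)[OF cp k] by simp
    qed
  next
    fix F assume F: "F \<in> H_img Y"
    have i: "Idt D F \<Colon>\<^sub>D F \<rightarrow> F" using UO[OF F] by simp
    have "c F F (Idt D F) = Idt D (fob H (r F))" unfolding c_def using w(2,3,4)[OF F] by simp
    then show "far L (Idt D F) = Idt ?Q (fob L F)"
      unfolding L(1) L(2)[OF i] ghost_quotient_simps Idt_cl[OF rO[OF F]] by simp
  next
    fix F G E \<phi> \<psi> assume U: "F \<in> H_img Y" "G \<in> H_img Y" "E \<in> H_img Y" and a: "\<phi> \<in> Arr D F G" "\<psi> \<in> Arr D G E"
    have t: "\<phi> \<Colon>\<^sub>D F \<rightarrow> G" "\<psi> \<Colon>\<^sub>D G \<rightarrow> E"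
      using H.D.ArrD[OF a(1) UO[OF U(1)] UO[OF U(2)]] H.D.ArrD[OF a(2) UO[OF U(2)] UO[OF U(3)]] .
    have tt: "\<psi> \<cdot>\<^sub>D \<phi> \<Colon>\<^sub>D F \<rightarrow> E" using t by simp
    show "far L (\<psi> \<cdot>\<^sub>D \<phi>) = far L \<psi> \<cdot>\<^bsub>?Q\<^esub> far L \<phi>"
      unfolding L(2)[OF t(1)] L(2)[OF t(2)] L(2)[OF tt] c_Cmp[OF U t]
      by (rule Cmp_cl(2)[OF rO[OF U(1)] rO[OF U(2)] rO[OF U(3)] c[OF U(1,2) t(1)] c[OF U(2,3) t(2)], symmetric])
  qed
  have ful: "full_functor ?P ?Q L"
    unfolding full_functor_def full_subcategory_simps L(1) ghost_quotient_simps
  proof (intro ballI equalityI subsetI)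
    fix F G W assume U: "F \<in> H_img Y" "G \<in> H_img Y"
    note wF = w(2,3)[OF U(1)] and wG = w(2,3)[OF U(2)]
    have "far L \<in> linear_maps K (Hom D F G) (Qh (r F) (r G))"
      by (rule lin[unfolded linear_functor_def full_subcategory_simps L(1) ghost_quotient_simps,
        THEN conjunct2, THEN conjunct1, THEN bspec, OF U(1), THEN bspec, OF U(2)])
    then have "far L \<in> Arr D F G \<rightarrow> carrier (Qh (r F) (r G))"
      unfolding linear_maps_def by blast
    then show "W \<in> carrier (Qh (r F) (r G))" if "W \<in> far L ` Arr D F G"
      using that by blast
    assume "W \<in> carrier (Qh (r F) (r G))"
    then obtain \<psi> where p: "\<psi> \<in> Arr D (fob H (r F)) (fob H (r G))" "W = cl (r F) (r G) \<psi>"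
      unfolding quotient_cl(1)[OF rO[OF U(1)] rO[OF U(2)]] by blast
    have p': "\<psi> \<Colon>\<^sub>D fob H (r F) \<rightarrow> fob H (r G)" using H.D.ArrD[OF p(1)] rO[OF U(1)] rO[OF U(2)] by simp
    have t: "a G \<cdot>\<^sub>D (\<psi> \<cdot>\<^sub>D b F) \<Colon>\<^sub>D F \<rightarrow> G" using wF wG p' by simp
    have "c F G (a G \<cdot>\<^sub>D (\<psi> \<cdot>\<^sub>D b F)) = (b G \<cdot>\<^sub>D a G) \<cdot>\<^sub>D (\<psi> \<cdot>\<^sub>D (b F \<cdot>\<^sub>D a F))"
      unfolding c_def using wF wG p' by simp
    also have "\<dots> = \<psi>" unfolding w(4)[OF U(1)] w(4)[OF U(2)] using p' by simp
    finally have "W = far L (a G \<cdot>\<^sub>D (\<psi> \<cdot>\<^sub>D b F))" unfolding L(2)[OF t] p(2) by simp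
    then show "W \<in> far L ` Arr D F G" using H.D.ArrI[OF t] by blast
  qed
  have fai: "faithful_functor ?P L"
    unfolding faithful_functor_def full_subcategory_simps
  proof (intro ballI inj_onI)
    fix F G \<phi> \<psi> assume U: "F \<in> H_img Y" "G \<in> H_img Y" and *: "\<phi> \<in> Arr D F G" "\<psi> \<in> Arr D F G" "far L \<phi> = far L \<psi>"
    note t = H.D.ArrD[OF *(1) UO[OF U(1)] UO[OF U(2)]] and t' = H.D.ArrD[OF *(2) UO[OF U(1)] UO[OF U(2)]]
    have "c F G \<phi> = c F G \<psi>"
      by (rule cl_inject[OF rO[OF U(1)] rO[OF U(2)] c[OF U t] *(3)[unfolded L(2)[OF t] L(2)[OF t']]])
    then have "a G \<cdot>\<^sub>D (c F G \<phi> \<cdot>\<^sub>D b F) = a G \<cdot>\<^sub>D (c F G \<psi> \<cdot>\<^sub>D b F)" by (rule arg_cong)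
    then show "\<phi> = \<psi>" unfolding c_bij[OF U t] c_bij[OF U t'] .
  qed
  have "ess_image ?Q L (Obj ?P) = Obj ?Q"
  proof (intro equalityI subsetI)
    fix B assume B: "B \<in> Obj ?Q"
    then have BY: "B \<in> Y" unfolding ghost_quotient_simps .
    then have BO: "B \<in> Obj T" using Y by blast
    have U: "fob H B \<in> H_img Y" by (rule H_imgI[OF BY BO])
    note wB = w(2,3,4,5)[OF U] and R = rO[OF U]
    let ?A = "r (fob H B)"
    have "is_iso ?Q ?A B (cl ?A B (a (fob H B)))"
      unfolding is_iso_def ghost_quotient_simps(1-3)
    proof (intro conjI bexI[of _ "cl B ?A (b (fob H B))"])
      show "cl ?A B (a (fob H B)) \<in> carrier (Qh ?A B)"
        unfolding quotient_cl(1)[OF R BO] using H.D.ArrI[OF wB(1)] by blast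
      show "cl B ?A (b (fob H B)) \<in> carrier (Qh B ?A)"
        unfolding quotient_cl(1)[OF BO R] using H.D.ArrI[OF wB(2)] by blast
      show "cl B ?A (b (fob H B)) \<cdot>\<^bsub>?Q\<^esub> cl ?A B (a (fob H B)) = ghosts T X ?A ?A +>\<^bsub>Hom T ?A ?A\<^esub> Idt T ?A"
        unfolding Cmp_cl(2)[OF R BO R wB(1,2)] Idt_cl[OF R] wB(3) ..
      show "cl ?A B (a (fob H B)) \<cdot>\<^bsub>?Q\<^esub> cl B ?A (b (fob H B)) = ghosts T X B B +>\<^bsub>Hom T B B\<^esub> Idt T B"
        unfolding Cmp_cl(2)[OF BO R BO wB(2,1)] Idt_cl[OF BO] wB(4) ..
    qed
    then have "isomorphic ?Q (fob L (fob H B)) B" unfolding isomorphic_def L(1) by blast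
    then show "B \<in> ess_image ?Q L (Obj ?P)"
      unfolding ess_image_def[of ?Q] full_subcategory_simps by (intro CollectI conjI B) (rule bexI[of _ "fob H B", OF _ U])
  next
    fix B assume "B \<in> ess_image ?Q L (Obj ?P)"
    then show "B \<in> Obj ?Q" unfolding ess_image_def[of ?Q] by simp
  qed
  then have "linear_equivalence K ?P ?Q L" unfolding linear_equivalence_def using lin ful fai by blast
  then show ?thesis unfolding equivalent_categories_def by blast
qed

end

text \<open>One inclusion is rigidity of \<open>X\<close>, the other \<open>ghost_factor\<close>.
  Since \<open>shift_subcategory\<close> is closed under isomorphisms, an intermediate object is
  first identified with an actual shift.\<close>

lemma (in ct_setting) factoring_endos_ghosts:
  assumes A: "A \<in> Obj T"
  shows "factoring_endos T (shift_subcategory T X) A = ghosts T X A A"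
proof (intro equalityI subsetI)
  fix f assume "f \<in> factoring_endos T (shift_subcategory T X) A"
  then obtain W u v where W: "W \<in> shift_subcategory T X" and uv: "u \<in> Arr T A W" "v \<in> Arr T W A" and f: "f = v \<cdot> u"
    unfolding factoring_endos_def by blast
  obtain Z where Z: "Z \<in> X" "isomorphic T (shob T Z) W" and WO: "W \<in> Obj T" using W unfolding shift_subcategory_def ess_image_def by blast
  have "shob T Z \<in> Obj T" using Z(1) by simp
  from isomorphicE[OF Z(2) this WO] obtain a b where ab: "a \<Colon> shob T Z \<rightarrow> W" "b \<Colon> W \<rightarrow> shob T Z"
    "b \<cdot> a = Idt T (shob T Z)" "a \<cdot> b = Idt T W" .
  have t: "u \<Colon> A \<rightarrow> W" "v \<Colon> W \<rightarrow> A" using ArrD[OF uv(1) A WO] ArrD[OF uv(2) WO A] .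
  have "b \<cdot> u \<Colon> A \<rightarrow> shob T Z" "v \<cdot> a \<Colon> shob T Z \<rightarrow> A" using t ab by simp_all
  from factor_ghost[OF Z(1) this] have "ghost ((v \<cdot> a) \<cdot> (b \<cdot> u))" .
  moreover have "(v \<cdot> a) \<cdot> (b \<cdot> u) = v \<cdot> ((a \<cdot> b) \<cdot> u)" using t ab(1,2) by simp
  ultimately have g: "ghost f" unfolding f ab(4) using t by simp
  have ft: "f \<Colon> A \<rightarrow> A" unfolding f using t by simp
  show "f \<in> ghosts T X A A" using H_ghost[OF ft] H_nul_iff[OF ft] g by simp
next
  fix f assume g: "f \<in> ghosts T X A A"
  then have f: "f \<Colon> A \<rightarrow> A" using ghosts_iff[OF A A] by simp
  have "ghost f" using H_ghost[OF f] H_nul_iff[OF f] g by simp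
  from ghost_factor[OF f this] obtain Z u v where Z: "Z \<in> X" and uv: "u \<Colon> A \<rightarrow> shob T Z" "v \<Colon> shob T Z \<rightarrow> A" "f = v \<cdot> u" .
  have "shob T Z \<in> Obj T" using Z by simp
  then have "shob T Z \<in> shift_subcategory T X" unfolding shift_subcategory_def ess_image_def using Z isomorphic_refl by blast
  then show "f \<in> factoring_endos T (shift_subcategory T X) A" unfolding factoring_endos_def
    using ArrI[OF f] ArrI[OF uv(1)] ArrI[OF uv(2)] uv(3) by blast
qed

section \<open>The theorem\<close>

text \<open>In \<open>enat\<close> the infimum of the empty set is infinity, so a finite dimension
  implies that a resolution exists.\<close>

lemma finite_projective_resolution:
  assumes "gl_dim C < \<infinity>" "A \<in> Obj C"
  shows "\<exists>n. has_projective_resolution C A n"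
proof (rule ccontr)
  assume "\<not> ?thesis"
  then have "proj_dim C A = Inf {}" unfolding proj_dim_def by simp
  then have "proj_dim C A = \<infinity>" by (simp add: top_enat_def)
  moreover have "proj_dim C A \<le> gl_dim C" unfolding gl_dim_def by (rule SUP_upper[OF assms(2)])
  ultimately show False using assms(1) by simp
qed

lemma (in rigid_setting) ghost_settingI:
  assumes "split_idempotents T" "hom_finite K T" "full_functor T M HF"
  shows "ghost_setting K T M HF X"
  by (intro ghost_setting.intro linfun.intro lincat.intro linfun_axioms.intro ghost_setting_axioms.intro
      triang_axioms linear_category_axioms M_linear HF_functor HF_ghost HF_ess_surj X_sub X_cfin X_rig assms)

lemma fully_rigid_ghost_setting:
  assumes "triangulated_category K T" "split_idempotents T" "hom_finite K T" "fully_rigid T X"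
  shows "ghost_setting K T (mod_category T X) (H_functor T X) X"
proof -
  have "rigid_setting K T X"
    by (intro rigid_setting.intro rigid_setting_axioms.intro triang.intro) (use assms in \<open>simp_all add: fully_rigid_def\<close>)
  then show ?thesis by (rule rigid_setting.ghost_settingI) (use assms in \<open>simp_all add: fully_rigid_def\<close>)
qed

lemma ct_fully_rigid:
  assumes T: "triangulated_category K T" and ct: "two_cluster_tilting T X"
  shows "fully_rigid T X"
proof -
  interpret triang K T by (rule triang.intro[OF T])
  note X = ctD[OF ct]
  have "rigid T X" unfolding rigid_def
  proof (intro ballI)
    fix A B assume AB: "A \<in> X" "B \<in> X"
    then have O: "A \<in> Obj T" "shob T B \<in> Obj T" using X(4) by auto
    show "Arr T A (shob T B) = {nul\<^bsub>T\<^esub> A (shob T B)}"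
      unfolding Arr_null_iff[OF O] using X(5)[OF AB] unfolding hom_null_def .
  qed
  moreover from this have "rigid_setting K T X"
    by (intro rigid_setting.intro rigid_setting_axioms.intro triang_axioms X(1,2))
  then have "full_functor T (mod_category T X) (H_functor T X)" by (rule rigid_setting.HF_full_ct) (rule ct)
  ultimately show ?thesis unfolding fully_rigid_def using X(1,2) by blast
qed

theorem theorem6p6:
  fixes K :: "'k ring"
    and T :: "('k, 'o, 'm) tcat"
    and S :: "('o, 'm, 'o, 'm) funct"
    and X :: "'o set"
  assumes "triangulated_category K T"
    and "split_idempotents T"
    and "hom_finite K T"
    and "serre_functor K T S"
    and "subcategory T X"
    and "contravariantly_finite T X"
    and "gl_dim (mod_category T X) < \<infinity>"
  defines "cond_i \<equiv> two_cluster_tilting T X"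
    and "cond_ii \<equiv> fully_rigid T X \<and>
      ess_image T S X = shift_subcategory T (shift_subcategory T X) \<and>
      bij_betw (H_image T X) (ct_subcategories_in_TXperp T X) (serre_tilting_subcategories T S X)"
  shows "(cond_i \<longleftrightarrow> cond_ii) \<and>
    (cond_i \<and> cond_ii \<longrightarrow>
      (\<forall>Y\<in>ct_subcategories_in_TXperp T X.
        equivalent_categories K (full_subcategory (mod_category T X) (H_image T X Y))
          (ghost_quotient T X Y) \<and>
        (\<forall>T0\<in>Obj T. Y = add_closure T T0 \<longrightarrow>
          H_image T X Y = add_closure (mod_category T X) (fob (H_functor T X) T0) \<and>
          ideal (factoring_endos T (shift_subcategory T X) T0) (End_algebra T T0) \<and>
          algebra_isos K
            (quotient_algebra (End_algebra T T0) (factoring_endos T (shift_subcategory T X) T0))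
            (End_algebra (mod_category T X) (fob (H_functor T X) T0)) \<noteq> {})))"
proof -
  let ?M = "mod_category T X" and ?H = "H_functor T X"
  have gs: "ghost_setting K T ?M ?H X" if "fully_rigid T X"
    by (rule fully_rigid_ghost_setting[OF assms(1-3) that])
  have sc: "serre_cat K T S"
    by (intro serre_cat.intro serre_cat_axioms.intro triang.intro assms(1,3,4))
  have cs: "ct_setting K T ?M ?H X S" if ct: "two_cluster_tilting T X"
    by (intro ct_setting.intro ct_setting_axioms.intro gs ct_fully_rigid[OF assms(1) ct] sc ct
        finite_projective_resolution[OF assms(7)])
  have pre: "H_preimage T X = ghost_setting.H_pre T ?H X" if "ghost_setting K T ?M ?H X"
    by (rule ext) (simp add: H_preimage_def ghost_setting.H_pre_def[OF that])
  have img: "H_image T X = ess_image ?M ?H"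
    by (rule ext) (simp add: H_image_def)
  have "cond_ii" if i: "cond_i"
  proof -
    have ct: "two_cluster_tilting T X" using i unfolding cond_i_def .
    note fr = ct_fully_rigid[OF assms(1) ct]
    interpret ct_setting K T ?M ?H X S by (rule cs[OF ct])
    show ?thesis
      unfolding cond_ii_def ct_subcategories_in_TXperp_def serre_tilting_subcategories_def img pre[OF gs[OF fr]]
      by (intro conjI fr ct_serre ct correspondence)
  qed
  moreover have "cond_i" if ii: "cond_ii"
  proof -
    have fr: "fully_rigid T X" and se: "ess_image T S X = shift_subcategory T (shift_subcategory T X)"
      and bij: "bij_betw (H_image T X) (ct_subcategories_in_TXperp T X) (serre_tilting_subcategories T S X)"
      using ii unfolding cond_ii_def by blast+
    interpret ghost_setting K T ?M ?H X by (rule gs[OF fr])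
    have iso: "B \<in> Y" if "subcategory T Y" "A \<in> Y" "B \<in> Obj T" "isomorphic T A B" for Y A B
      using that unfolding subcategory_def by blast
    \<comment> \<open>Rigidity puts \<open>X\<close> into \<open>Tp\<close>, so it is recovered from
      its image. Conditions (a) and (b) for the projectives thereby become the contravariant
      finiteness of \<open>X\<close> and the equation S X = X[2].\<close>
    have X: "H_pre (H_img X) = X" by (rule H_pre_img[OF X_Tp iso[OF X_subcat]])
    have "H_img X \<in> serre_tilting_subcategories T S X"
      unfolding serre_tilting_subcategories_def pre[OF gs[OF fr]]
      by (intro CollectI conjI projectives_tilting) (simp_all only: X X_cf se)
    then have "H_img X \<in> H_image T X ` ct_subcategories_in_TXperp T X" using bij unfolding bij_betw_def by simp
    then obtain Y where Y: "two_cluster_tilting T Y" "Y \<subseteq> Tp" "H_img X = H_img Y"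
      unfolding img ct_subcategories_in_TXperp_def by blast
    \<comment> \<open>Both subcategories lie in \<open>Tp\<close> and have the same image, from
      which \<open>H_pre\<close> recovers each of them.\<close>
    have "Y = X" using H_pre_img[OF Y(2) iso[OF ctD(1)[OF Y(1)]]] X unfolding Y(3) by simp
    then show ?thesis unfolding cond_i_def using Y(1) by simp
  qed
  moreover have "equivalent_categories K (full_subcategory ?M (H_image T X Y)) (ghost_quotient T X Y) \<and>
      (\<forall>T0\<in>Obj T. Y = add_closure T T0 \<longrightarrow> H_image T X Y = add_closure ?M (fob ?H T0) \<and>
        ideal (factoring_endos T (shift_subcategory T X) T0) (End_algebra T T0) \<and>
        algebra_isos K (quotient_algebra (End_algebra T T0) (factoring_endos T (shift_subcategory T X) T0))
          (End_algebra ?M (fob ?H T0)) \<noteq> {})"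
    if i: "cond_i" and Y: "Y \<in> ct_subcategories_in_TXperp T X" for Y
  proof -
    have ct: "two_cluster_tilting T X" using i unfolding cond_i_def .
    interpret ct_setting K T ?M ?H X S by (rule cs[OF ct])
    have Y: "two_cluster_tilting T Y" "Y \<subseteq> Tp" using Y unfolding ct_subcategories_in_TXperp_def by simp_all
    have U: "subcategory ?M (H_img Y)" using ct_tilting[OF Y] unfolding tilting_subcategory_def by blast
    show ?thesis unfolding img
    proof (intro conjI ballI impI ghost_quotient_equivalence[OF ctD(4)[OF Y(1)]])
      fix T0 assume T0: "T0 \<in> Obj T" and a: "Y = add_closure T T0"
      show "H_img Y = add_closure ?M (fob ?H T0)" using add_closure_H[OF T0] U unfolding a by blast
      show "ideal (factoring_endos T (shift_subcategory T X) T0) (End_algebra T T0)"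
        unfolding factoring_endos_ghosts[OF T0] by (rule ghosts_ideal[OF T0])
      show "algebra_isos K (quotient_algebra (End_algebra T T0) (factoring_endos T (shift_subcategory T X) T0))
          (End_algebra ?M (fob ?H T0)) \<noteq> {}"
        unfolding factoring_endos_ghosts[OF T0] by (rule End_algebra_iso[OF T0])
    qed
  qed
  ultimately show ?thesis by blast
qed

end
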